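(* Let $u_\varepsilon$ be the weak solution of the mixed boundary-value problem in the thin domain $\Omega_\varepsilon$ described in the context, let $\{\omega_0^{(i)}\}_{i=1}^3$ be the solution of the limit problem on the graph, let $\alpha\in(\tfrac23,1)$ be fixed and $I^{(i)}_{\varepsilon,\alpha}=(3\ell\varepsilon^\alpha,1)$. Assume that $h_i(x_i)\equiv h_i\equiv\mathrm{const}$ for $i=1,2,3$. Put $$ (E_\varepsilon^{(i)}u_\varepsilon)(x_i)=\frac1{\pi\varepsilon^2h_i^2}\int_{\{|\overline x_i|<\varepsilon h_i\}}u_\varepsilon(x)\,d\overline x_i,\qquad i=1,2,3. $$ Then there exist constants $\widetilde C_2,\widetilde C_3>0$ independent of $\varepsilon$ such that for all sufficiently small $\varepsilon>0$ and $i=1,2,3$ $$ \|E_\varepsilon^{(i)}(u_\varepsilon)-\omega_0^{(i)}\|_{H^1(I_{\varepsilon,\alpha}^{(i)})}\le\widetilde C_2\,\varepsilon,\qquad \max_{x_i\in\overline{I_{\varepsilon,\alpha}^{(i)}}}\big|E_\varepsilon^{(i)}(u_\varepsilon)(x_i)-\omega_0^{(i)}(x_i)\big|\le\widetilde C_3\,\varepsilon . $$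
   Context: **Notation.** For $i\in\{1,2,3\}$ and $x\in\mathbb R^3$, $\overline x_i\in\mathbb R^2$ is the pair of coordinates of $x$ other than $x_i$ (similarly $\overline\xi_i$). **Domain.** Fix $\ell\in(0,\frac13)$ and positive constants $h_1,h_2,h_3$. For small $\varepsilon>0$, $\Omega_\varepsilon^{(i)}=\{x\in\mathbb R^3:\varepsilon\ell<x_i<1,\ |\overline x_i|<\varepsilon h_i\}$, $i=1,2,3$. Let $\Xi^{(0)}\subset\mathbb R^3$ be a bounded domain whose boundary contains the three disks $\{\xi:\xi_i=\ell,\ |\overline\xi_i|<h_i\}$, and put $\Omega_\varepsilon^{(0)}=\varepsilon\,\Xi^{(0)}$. $\Omega_\varepsilon$ is the interior of $\bigcup_{k=0}^3\overline{\Omega_\varepsilon^{(k)}}$; the four pieces are pairwise disjoint and $\Omega_\varepsilon$ has Lipschitz boundary. $\Upsilon^{(i)}_\varepsilon(t)=\{x:x_i=t,\ |\overline x_i|<\varepsilon h_i\}$; $\Gamma_\varepsilon^{(i)}=\partial\Omega_\varepsilon^{(i)}\cap\{\varepsilon\ell<x_i<1\}$, $i=1,2,3$; $\Gamma_\varepsilon^{(0)}=\partial\Omega_\varepsilon^{(0)}\setminus\bigcup_{i=1}^3\overline{\Upsilon_\varepsilon^{(i)}(\varepsilon\ell)}$. **Problem.** $f=f(x)$ and $\varphi^{(i)}=\varphi^{(i)}(x_i,\overline\xi_i)$, $i=1,2,3$, are given smooth functions (independent of $\varepsilon$). $u_\varepsilon\in H^1(\Omega_\varepsilon)$ is the unique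 weak solution of $-\Delta u_\varepsilon=f$ in $\Omega_\varepsilon$; $\partial_\nu u_\varepsilon=0$ on $\Gamma^{(0)}_\varepsilon$; $-\partial_\nu u_\varepsilon=\varepsilon\varphi^{(i)}(x_i,\overline x_i/\varepsilon)$ on $\Gamma_\varepsilon^{(i)}$; $u_\varepsilon=0$ on $\Upsilon_\varepsilon^{(i)}(1)$ ($i=1,2,3$), with $\nu$ the outward unit normal. **Limit problem.** $\{\omega_0^{(i)}\}_{i=1}^3$ is the unique solution of $-\pi h_i^2\frac{d^2\omega_0^{(i)}}{dx_i^2}(x_i)=\pi h_i^2f(x)\big|_{\overline x_i=(0,0)}-\int_{|\overline\xi_i|=h_i}\varphi^{(i)}(x_i,\overline\xi_i)\,dl_{\overline\xi_i}$ for $x_i\in(0,1)$, $\omega_0^{(i)}(1)=0$ ($i=1,2,3$), $\omega_0^{(1)}(0)=\omega_0^{(2)}(0)=\omega_0^{(3)}(0)$, $\sum_{i=1}^3\pi h_i^2\frac{d\omega_0^{(i)}}{dx_i}(0)=0$. *)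

theory Defs
  imports "HOL-Analysis.Analysis"
begin

section \<open>Smooth functions and the Sobolev space \<open>H\<^sup>1\<close>\<close>

text \<open>\<open>k\<close>-times continuously differentiable real functions on an open set \<open>S\<close>.\<close>

primrec C_k :: "nat \<Rightarrow> 'a::euclidean_space set \<Rightarrow> ('a \<Rightarrow> real) \<Rightarrow> bool" where
  "C_k 0 S f \<longleftrightarrow> continuous_on S f"
| "C_k (Suc k) S f \<longleftrightarrow>
     (\<forall>x\<in>S. f differentiable (at x)) \<and>
     (\<forall>b\<in>Basis. C_k k S (\<lambda>x. frechet_derivative f (at x) b))"

definition smooth_fun_on :: "'a::euclidean_space set \<Rightarrow> ('a \<Rightarrow> real) \<Rightarrow> bool" where
  "smooth_fun_on S f \<longleftrightarrow> (\<forall>k. C_k k S f)"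

definition test_function :: "'a::euclidean_space set \<Rightarrow> ('a \<Rightarrow> real) \<Rightarrow> bool" where
  "test_function S \<psi> \<longleftrightarrow> smooth_fun_on UNIV \<psi> \<and>
     compact (closure {x. \<psi> x \<noteq> 0}) \<and> closure {x. \<psi> x \<noteq> 0} \<subseteq> S"

definition in_L2 :: "'a measure \<Rightarrow> ('a \<Rightarrow> 'b::euclidean_space) \<Rightarrow> bool" where
  "in_L2 M u \<longleftrightarrow> u \<in> borel_measurable M \<and> integrable M (\<lambda>x. (norm (u x))\<^sup>2)"

definition has_weak_grad ::
  "'a::euclidean_space set \<Rightarrow> ('a \<Rightarrow> real) \<Rightarrow> ('a \<Rightarrow> 'a) \<Rightarrow> bool" where
  "has_weak_grad S u G \<longleftrightarrow> in_L2 (lebesgue_on S) G \<and>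
     (\<forall>\<psi>. test_function S \<psi> \<longrightarrow> (\<forall>b\<in>Basis.
        (\<integral>x. u x * frechet_derivative \<psi> (at x) b \<partial>lebesgue_on S) =
        - (\<integral>x. (G x \<bullet> b) * \<psi> x \<partial>lebesgue_on S)))"

definition in_H1 :: "'a::euclidean_space set \<Rightarrow> ('a \<Rightarrow> real) \<Rightarrow> bool" where
  "in_H1 S u \<longleftrightarrow> in_L2 (lebesgue_on S) u \<and> (\<exists>G. has_weak_grad S u G)"

text \<open>For open \<open>S\<close> and \<open>u\<close> in \<open>H\<^sup>1(S)\<close> the weak gradient is unique up to null sets,
  so everything below is independent of the choice.\<close>

definition weak_grad :: "'a::euclidean_space set \<Rightarrow> ('a \<Rightarrow> real) \<Rightarrow> 'a \<Rightarrow> 'a" where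
  "weak_grad S u = (SOME G. has_weak_grad S u G)"

definition H1_norm :: "'a::euclidean_space set \<Rightarrow> ('a \<Rightarrow> real) \<Rightarrow> real" where
  "H1_norm S u = sqrt ((\<integral>x. (u x)\<^sup>2 \<partial>lebesgue_on S) +
                       (\<integral>x. (norm (weak_grad S u x))\<^sup>2 \<partial>lebesgue_on S))"

text \<open>\<open>\<sigma>\<close> is a surface measure carried by a part of the boundary of \<open>S\<close>.  The trace operator of
  a bounded Lipschitz domain is the continuous extension to \<open>H\<^sup>1(S)\<close> of the restriction map, defined
  on functions that are continuously differentiable up to the boundary (a dense subspace); \<open>g\<close> is the
  value of this extension at \<open>u\<close>.\<close>

definition has_trace ::
  "'a::euclidean_space set \<Rightarrow> 'a measure \<Rightarrow> ('a \<Rightarrow> real) \<Rightarrow> ('a \<Rightarrow> real) \<Rightarrow> bool" where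
  "has_trace S \<sigma> u g \<longleftrightarrow> in_L2 \<sigma> g \<and>
     (\<exists>w::nat \<Rightarrow> 'a \<Rightarrow> real.
        (\<forall>n. C_k 1 UNIV (w n) \<and> in_H1 S (w n) \<and> in_L2 \<sigma> (w n)) \<and>
        (\<lambda>n. H1_norm S (\<lambda>x. w n x - u x)) \<longlonglongrightarrow> 0 \<and>
        (\<lambda>n. \<integral>x. (w n x - g x)\<^sup>2 \<partial>\<sigma>) \<longlonglongrightarrow> 0)"

text \<open>Near each boundary point, \<open>S\<close> is the set below the graph (in some direction \<open>e\<close>) of a
  Lipschitz function on the hyperplane orthogonal to \<open>e\<close>.\<close>

definition lipschitz_boundary :: "'a::euclidean_space set \<Rightarrow> bool" where
  "lipschitz_boundary S \<longleftrightarrow> (\<forall>p\<in>frontier S. \<exists>e \<gamma> r L.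
     norm e = 1 \<and> r > 0 \<and> L-lipschitz_on {y. y \<bullet> e = 0} (\<gamma> :: 'a \<Rightarrow> real) \<and>
     (\<forall>x\<in>ball p r. x \<in> S \<longleftrightarrow> x \<bullet> e < \<gamma> (x - (x \<bullet> e) *\<^sub>R e)))"


section \<open>The thin graph-like domain\<close>

text \<open>\<open>rest i x\<close> are the coordinates of \<open>x\<close> other than \<open>x $ i\<close>, in increasing order of the index;
  \<open>point i t y\<close> is the point \<open>x\<close> with \<open>x $ i = t\<close> and \<open>rest i x = y\<close>.  (The norm on
  \<^typ>\<open>real \<times> real\<close> is Euclidean.)\<close>

definition rest :: "3 \<Rightarrow> real^3 \<Rightarrow> real \<times> real" where
  "rest i x = (if i = 1 then (x $ 2, x $ 3) else if i = 2 then (x $ 1, x $ 3) else (x $ 1, x $ 2))"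

definition point :: "3 \<Rightarrow> real \<Rightarrow> real \<times> real \<Rightarrow> real^3" where
  "point i t y = (if i = 1 then vector [t, fst y, snd y]
                  else if i = 2 then vector [fst y, t, snd y]
                  else vector [fst y, snd y, t])"

definition cylinder :: "real \<Rightarrow> (3 \<Rightarrow> real) \<Rightarrow> real \<Rightarrow> 3 \<Rightarrow> (real^3) set" where
  "cylinder l h \<epsilon> i = {x. \<epsilon> * l < x $ i \<and> x $ i < 1 \<and> norm (rest i x) < \<epsilon> * h i}"

definition node :: "(real^3) set \<Rightarrow> real \<Rightarrow> (real^3) set" where
  "node \<Xi> \<epsilon> = (\<lambda>\<xi>. \<epsilon> *\<^sub>R \<xi>) ` \<Xi>"

definition thin_domain :: "real \<Rightarrow> (3 \<Rightarrow> real) \<Rightarrow> (real^3) set \<Rightarrow> real \<Rightarrow> (real^3) set" where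
  "thin_domain l h \<Xi> \<epsilon> =
     interior (closure (node \<Xi> \<epsilon>) \<union> (\<Union>i. closure (cylinder l h \<epsilon> i)))"

definition cross_section :: "(3 \<Rightarrow> real) \<Rightarrow> real \<Rightarrow> 3 \<Rightarrow> real \<Rightarrow> (real^3) set" where
  "cross_section h \<epsilon> i t = {x. x $ i = t \<and> norm (rest i x) < \<epsilon> * h i}"

definition lateral_surface :: "real \<Rightarrow> (3 \<Rightarrow> real) \<Rightarrow> real \<Rightarrow> 3 \<Rightarrow> (real^3) set" where
  "lateral_surface l h \<epsilon> i = frontier (cylinder l h \<epsilon> i) \<inter> {x. \<epsilon> * l < x $ i \<and> x $ i < 1}"

text \<open>Arc length on a circle and the surface area measures on \<^const>\<open>cross_section\<close> and
  \<^const>\<open>lateral_surface\<close>, as images under the standard parametrisations.\<close>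

definition circle_measure :: "real \<Rightarrow> (real \<times> real) measure" where
  "circle_measure r = scale_measure (ennreal r)
     (distr (restrict_space lborel {0..<2 * pi}) (restrict_space borel (sphere 0 r))
        (\<lambda>\<theta>. (r * cos \<theta>, r * sin \<theta>)))"

definition cross_section_measure ::
  "(3 \<Rightarrow> real) \<Rightarrow> real \<Rightarrow> 3 \<Rightarrow> real \<Rightarrow> (real^3) measure" where
  "cross_section_measure h \<epsilon> i t =
     distr (restrict_space lborel (ball 0 (\<epsilon> * h i)))
       (restrict_space borel (cross_section h \<epsilon> i t)) (point i t)"

definition lateral_measure ::
  "real \<Rightarrow> (3 \<Rightarrow> real) \<Rightarrow> real \<Rightarrow> 3 \<Rightarrow> (real^3) measure" where
  "lateral_measure l h \<epsilon> i =
     distr (restrict_space lborel {\<epsilon> * l<..<1} \<Otimes>\<^sub>M circle_measure (\<epsilon> * h i))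
       (restrict_space borel (lateral_surface l h \<epsilon> i)) (\<lambda>(t, y). point i t y)"


section \<open>The boundary-value problem and the limit problem\<close>

text \<open>Weak form of \<open>- \<Delta> u = f\<close> with \<open>u = 0\<close> on the end discs, \<open>\<partial>\<^sub>\<nu> u = 0\<close> on the boundary of
  the node and \<open>- \<partial>\<^sub>\<nu> u = \<epsilon> \<phi> i (x $ i) (rest i x / \<epsilon>)\<close> on the lateral surfaces.  The test functions
  are the \<open>v\<close> in \<open>H\<^sup>1\<close> vanishing on the end discs; \<open>g i\<close> is the trace of \<open>v\<close> on the
  \<open>i\<close>-th lateral surface.\<close>

definition weak_solution ::
  "real \<Rightarrow> (3 \<Rightarrow> real) \<Rightarrow> (real^3) set \<Rightarrow> (real^3 \<Rightarrow> real) \<Rightarrow>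
   (3 \<Rightarrow> real \<Rightarrow> real \<times> real \<Rightarrow> real) \<Rightarrow> real \<Rightarrow> (real^3 \<Rightarrow> real) \<Rightarrow> bool" where
  "weak_solution l h \<Xi> f \<phi> \<epsilon> u \<longleftrightarrow>
     (let \<Omega> = thin_domain l h \<Xi> \<epsilon> in
      in_H1 \<Omega> u \<and> (\<forall>i. has_trace \<Omega> (cross_section_measure h \<epsilon> i 1) u (\<lambda>_. 0)) \<and>
      (\<forall>v g. in_H1 \<Omega> v \<and>
             (\<forall>i. has_trace \<Omega> (cross_section_measure h \<epsilon> i 1) v (\<lambda>_. 0)) \<and>
             (\<forall>i. has_trace \<Omega> (lateral_measure l h \<epsilon> i) v (g i)) \<longrightarrow>
         (\<integral>x. weak_grad \<Omega> u x \<bullet> weak_grad \<Omega> v x \<partial>lebesgue_on \<Omega>) =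
         (\<integral>x. f x * v x \<partial>lebesgue_on \<Omega>) -
         \<epsilon> * (\<Sum>i\<in>UNIV. \<integral>x. \<phi> i (x $ i) (rest i x /\<^sub>R \<epsilon>) * g i x \<partial>lateral_measure l h \<epsilon> i)))"

definition limit_solution ::
  "(3 \<Rightarrow> real) \<Rightarrow> (real^3 \<Rightarrow> real) \<Rightarrow> (3 \<Rightarrow> real \<Rightarrow> real \<times> real \<Rightarrow> real) \<Rightarrow>
   (3 \<Rightarrow> real \<Rightarrow> real) \<Rightarrow> bool" where
  "limit_solution h f \<phi> \<omega> \<longleftrightarrow>
     (\<exists>D D2 :: 3 \<Rightarrow> real \<Rightarrow> real.
        (\<forall>i. continuous_on {0..1} (D i) \<and>
             (\<forall>t\<in>{0..1}. (\<omega> i has_real_derivative D i t) (at t within {0..1})) \<and>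
             (\<forall>t\<in>{0<..<1}. (D i has_real_derivative D2 i t) (at t) \<and>
                - pi * (h i)\<^sup>2 * D2 i t =
                  pi * (h i)\<^sup>2 * f (point i t 0) - (\<integral>y. \<phi> i t y \<partial>circle_measure (h i))) \<and>
             \<omega> i 1 = 0) \<and>
        \<omega> 1 0 = \<omega> 2 0 \<and> \<omega> 2 0 = \<omega> 3 0 \<and>
        (\<Sum>i\<in>UNIV. pi * (h i)\<^sup>2 * D i 0) = 0)"

definition section_mean :: "(3 \<Rightarrow> real) \<Rightarrow> real \<Rightarrow> 3 \<Rightarrow> (real^3 \<Rightarrow> real) \<Rightarrow> real \<Rightarrow> real" where
  "section_mean h \<epsilon> i u t =
     1 / (pi * \<epsilon>\<^sup>2 * (h i)\<^sup>2) * (\<integral>y. u (point i t y) \<partial>lebesgue_on (ball 0 (\<epsilon> * h i)))"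

end

(* The gradient of u is compared in L2 with that of p(x) = w0 + sum_i chi(x_i / eps) (omega_i(x_i) - w0).
  Testing the weak formulation with u - p, Kirchhoff's law cancels the contribution of the junction up to
  mean oscillations, so a scaled L1 Poincare inequality near the node bounds the squared energy of the
  error by C eps^3 and hence the L1 norm of grad u near the node by C eps^3.
  Testing with functions of x_i alone and the du Bois-Reymond lemma, the mean of d_i u over cross sections
  is omega_i' + kappa_i + O(eps) with constants kappa_i.  Poincare's inequality near the node shows that
  the kappa_i differ by O(eps), and testing with a function equal to 1 near the node shows that
  sum_i h_i^2 kappa_i = O(eps); hence kappa_i = O(eps), and integration from x_i = 1 gives both estimates. *)
theory Submission
 imports Defs "HOL-Real_Asymp.Real_Asymp" "HOL-Computational_Algebra.Polynomial"
begin

text \<open>The energy bound alone is too weak: dividing eps^3 by the section area shows that it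
  controls the derivative of the section means only up to eps^(1/2) in L2. The rate eps comes from
  the exact one-dimensional equation of the means, which leaves one unknown constant per edge; the
  energy bound only has to make these constants comparable, on a core of the junction that is a
  scaled copy of a fixed reference domain. L1 norms suffice there, since grad p is bounded and the
  residual sees v and grad v only through L1 norms, and in L1 the Poincare inequality follows from
  translations and chains of balls. The squared energy is of order eps^3 because Young's inequality
  leaves eps^2 |Om| + |core|, with |Om| of order eps^2 and |core| of order eps^3. Poincare on the
  core costs eps * eps^3, against slabs of section area eps^2 and length eps: the rate eps. Traces
  are defined as limits along C1 functions, so all estimates are made for C1 functions and passed to
  the limit; the lateral trace of u, needed to test with u itself, comes from completeness of
  L2.\<close>

abbreviation nn_lborel :: "('a::euclidean_space => ennreal) => ennreal" (binder "NN " 10) where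
 "nn_lborel q == nn_integral lborel q"

section \<open>Smooth bump functions and weak gradients\<close>

text \<open>The gradient is carried along as an explicit vector field, so that estimates can name it
  without going through \<open>weak_grad\<close>, which is only a choice up to null sets.\<close>

definition C1 :: "('a::euclidean_space => real) => ('a => 'a) => bool" where
 "C1 w g \<longleftrightarrow> (\<forall>x. (w has_derivative (%d. g x \<bullet> d)) (at x)) \<and> continuous_on UNIV g"

section \<open>Algebra of C^k functions on the whole space\<close>

lemma C_k_UNIV_SucI:
 assumes "\<And>x. (f has_derivative f' x) (at x)" "\<And>b. b \<in> Basis ==> C_k k UNIV (%x. f' x b)"
 shows "C_k (Suc k) UNIV f"
proof -
 have "frechet_derivative f (at x) = f' x" for x
  using frechet_derivative_at[OF assms(1)] by simp
 with assms show ?thesis by (auto intro: differentiableI)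
qed

lemma C_k_Suc_imp: "C_k (Suc k) UNIV f ==> C_k k UNIV f"
proof (induction k arbitrary: f)
 case 0
 then show ?case by (auto simp: continuous_on_eq_continuous_at differentiable_imp_continuous_within)
next
 case (Suc k)
 then show ?case using C_k.simps(2) by metis
qed

lemma C_k_const: "C_k k UNIV (%x. c)"
proof (induction k arbitrary: c)
 case (Suc k)
 then show ?case by (intro C_k_UNIV_SucI[of _ "%x d. 0"]) auto
qed simp

lemma C_k_add: "C_k k UNIV f ==> C_k k UNIV g ==> C_k k UNIV (%x. f x + g x)"
proof (induction k arbitrary: f g)
 case 0
 then show ?case by (auto intro: continuous_intros)
next
 case (Suc k)
 show ?case
  by (rule C_k_UNIV_SucI[of _ "%x d. frechet_derivative f (at x) d + frechet_derivative g (at x) d"])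
    (use Suc in \<open>auto intro!: has_derivative_add simp: frechet_derivative_works[symmetric]\<close>)
qed

lemma C_k_mult: "C_k k UNIV f ==> C_k k UNIV g ==> C_k k UNIV (%x. f x * g x)"
proof (induction k arbitrary: f g)
 case 0
 then show ?case by (auto intro: continuous_intros)
next
 case (Suc k)
 show ?case
 proof (rule C_k_UNIV_SucI[of _ "%x d. f x * frechet_derivative g (at x) d
     + frechet_derivative f (at x) d * g x"])
  show "((%x. f x * g x) has_derivative (%d. f x * frechet_derivative g (at x) d
     + frechet_derivative f (at x) d * g x)) (at x)" for x
   using Suc.prems by (intro has_derivative_mult) (auto simp: frechet_derivative_works[symmetric])
  show "C_k k UNIV (%x. f x * frechet_derivative g (at x) b + frechet_derivative f (at x) b * g x)"
   if "b \<in> Basis" for b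
   using Suc.prems that C_k_Suc_imp[OF Suc.prems(1)] C_k_Suc_imp[OF Suc.prems(2)]
   by (intro C_k_add Suc.IH) auto
 qed
qed

lemma C_k_prod: "finite I ==> (\<And>i. i \<in> I ==> C_k k UNIV (f i)) ==> C_k k UNIV (%x. \<Prod>i\<in>I. f i x)"
 by (induction rule: finite_induct) (auto simp: C_k_const C_k_mult)

text \<open>The functions p(1/t) exp(-1/t), extended by zero to t <= 0. Allowing a polynomial factor
  makes the family closed under differentiation, so smoothness follows by induction.\<close>

definition flat :: "real poly => real => real" where
 "flat p t = (if t > 0 then poly p (1 / t) * exp (- (1 / t)) else 0)"

lemma poly_exp_at_top: "((%x::real. poly p x * exp (- x)) \<longlongrightarrow> 0) at_top"
proof -
 have "((%x. \<Sum>i\<le>degree p. coeff p i * (x ^ i / exp x)) \<longlongrightarrow> (\<Sum>i\<le>degree p. coeff p i * 0)) at_top"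
  by (intro tendsto_sum tendsto_mult tendsto_const tendsto_power_div_exp_0)
 then show ?thesis
  by (simp add: poly_altdef exp_minus sum_distrib_right divide_inverse mult.assoc)
qed

text \<open>With s = 1/t one has d/dt = - s^2 d/ds, and differentiating p(s) exp(-s) gives s^2 (p -
  p') exp(-s). At t = 0 the right difference quotient is a function of the same kind with p replaced
  by s p, and it tends to 0 because exp beats every polynomial.\<close>

lemma flat_has_derivative:
 "(flat p has_real_derivative flat (monom 1 2 * (p - pderiv p)) t) (at t)"
proof -
 consider "t > 0" | "t < 0" | "t = 0" by linarith
 then show ?thesis
 proof cases
  case 1
  have "((%t. poly p (1 / t) * exp (- (1 / t))) has_real_derivative
    flat (monom 1 2 * (p - pderiv p)) t) (at t)"
   using 1 by (auto intro!: derivative_eq_intros poly_DERIV[THEN DERIV_chain2]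
     simp: flat_def poly_monom power2_eq_square field_simps)
  then show ?thesis
   by (rule has_field_derivative_transform_within[where d = t])
     (use 1 in \<open>auto simp: flat_def dist_real_def\<close>)
 next
  case 2
  have "((%t. 0) has_real_derivative flat (monom 1 2 * (p - pderiv p)) t) (at t)"
   using 2 by (simp add: flat_def)
  then show ?thesis
   by (rule has_field_derivative_transform_within[where d = "- t"])
     (use 2 in \<open>auto simp: flat_def dist_real_def\<close>)
 next
  case 3
  have "((%h. poly (monom 1 1 * p) (inverse h) * exp (- inverse h)) \<longlongrightarrow> 0) (at_right 0)"
   by (rule filterlim_compose[OF poly_exp_at_top filterlim_inverse_at_top_right])
  then have "((%h. flat p h / h) \<longlongrightarrow> 0) (at_right 0)"
   by (rule Lim_transform_eventually)
     (auto simp: flat_def poly_monom field_simps eventually_at intro!: exI[of _ 1])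
  moreover have "((%h. flat p h / h) \<longlongrightarrow> 0) (at_left 0)"
   by (rule Lim_transform_eventually[OF tendsto_const])
     (auto simp: flat_def eventually_at intro!: exI[of _ 1])
  ultimately have "((%h. flat p h / h) \<longlongrightarrow> 0) (at 0)"
   by (simp add: filterlim_split_at)
  then show ?thesis using 3 by (simp add: DERIV_def flat_def)
 qed
qed

lemma C_k_flat: "C_k k UNIV (%x. flat p (v \<bullet> x + d))"
proof (induction k arbitrary: p)
 case 0
 have "continuous_on UNIV (flat p)"
  using flat_has_derivative DERIV_isCont by (blast intro: continuous_at_imp_continuous_on)
 then show ?case
  by (auto intro!: continuous_on_compose2[of UNIV "flat p"] continuous_intros)
next
 case (Suc k)
 let ?q = "monom 1 2 * (p - pderiv p)"
 show ?case
 proof (rule C_k_UNIV_SucI[of _ "%x b. flat ?q (v \<bullet> x + d) * (v \<bullet> b)"])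
  show "((%x. flat p (v \<bullet> x + d)) has_derivative (%b. flat ?q (v \<bullet> x + d) * (v \<bullet> b))) (at x)" for x
  proof -
   have "((%x. v \<bullet> x + d) has_derivative (%b. v \<bullet> b)) (at x)"
    by (auto intro!: derivative_eq_intros)
   from has_derivative_compose[OF this flat_has_derivative[unfolded has_field_derivative_def]]
   show ?thesis .
  qed
  show "C_k k UNIV (%x. flat ?q (v \<bullet> x + d) * (v \<bullet> b))" for b
   by (intro C_k_mult Suc C_k_const)
 qed
qed

text \<open>The shift by -1 keeps the support in the box shrunk by 1/n, hence compact inside the
  open box. As n grows the arguments of \<open>flat 1\<close> tend to infinity at interior points,
  where \<open>flat 1\<close> tends to 1, so these bumps converge to the indicator of the open box
  with values in [0, 1].\<close>

definition box_bump :: "'a::euclidean_space => 'a => nat => 'a => real" where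
 "box_bump a b n x = (\<Prod>i\<in>Basis. flat 1 (real n * ((x - a) \<bullet> i) - 1) * flat 1 (real n * ((b - x) \<bullet> i) - 1))"

lemma flat_1_bounds: "0 <= flat 1 t" "flat 1 t <= 1" "flat 1 t \<noteq> 0 \<longleftrightarrow> t > 0"
 by (auto simp: flat_def)

lemma box_bump_bounds: "0 <= box_bump a b n x" "box_bump a b n x <= 1"
 unfolding box_bump_def
 by (auto intro!: prod_nonneg prod_le_1 mult_nonneg_nonneg mult_le_one simp: flat_1_bounds)

lemma box_bump_nonzeroD:
 assumes "box_bump a b n x \<noteq> 0" 
 shows "n > 0" "x \<in> cbox (a + (1 / n) *\<^sub>R One) (b - (1 / n) *\<^sub>R One)"
proof -
 have *: "real n * ((x - a) \<bullet> i) > 1" "real n * ((b - x) \<bullet> i) > 1" if "i \<in> Basis" for i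
  using assms that by (auto simp: box_bump_def flat_1_bounds)
 show n: "n > 0" using *[OF SOME_Basis] by (cases n) auto
 show "x \<in> cbox (a + (1 / n) *\<^sub>R One) (b - (1 / n) *\<^sub>R One)"
 proof (unfold mem_box, intro ballI conjI)
  fix i :: 'a assume i: "i \<in> Basis"
  have "(x - a) \<bullet> i > 1 / n" "(b - x) \<bullet> i > 1 / n"
   using *[OF i] n by (auto simp: pos_divide_less_eq mult.commute)
  then show "(a + (1 / n) *\<^sub>R One) \<bullet> i <= x \<bullet> i" "x \<bullet> i <= (b - (1 / n) *\<^sub>R One) \<bullet> i"
   using i by (simp_all add: inner_simps)
 qed
qed

lemma box_bump_tendsto: "(%n. box_bump a b n x) \<longlonglongrightarrow> indicator (box a b) x"
proof -
 have pos: "(%n. flat 1 (real n * s - 1)) \<longlonglongrightarrow> (if s > 0 then 1 else 0)" for s :: real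
 proof (cases "s > 0")
  case True
  have *: "filterlim (%n. real n * s - 1) at_top sequentially"
   using True by real_asymp
  have "((%t::real. exp (- (1 / t))) \<longlongrightarrow> 1) at_top" by real_asymp
  then have "(flat 1 \<longlongrightarrow> 1) at_top"
   by (rule Lim_transform_eventually)
     (auto simp: flat_def eventually_at_top_linorder intro!: exI[of _ 1])
  from filterlim_compose[OF this *] True show ?thesis by simp
 next
  case False
  have "flat 1 (real n * s - 1) = 0" for n
   using False mult_nonneg_nonpos[of "real n" s] by (auto simp: flat_def)
  then show ?thesis using False by simp
 qed
 have "(%n. box_bump a b n x) \<longlonglongrightarrow>
  (\<Prod>i\<in>Basis. (if (x - a) \<bullet> i > 0 then 1 else 0) * (if (b - x) \<bullet> i > 0 then 1 else 0))"
  unfolding box_bump_def by (intro tendsto_prod tendsto_mult pos)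
 also have "(\<Prod>i\<in>Basis. (if (x - a) \<bullet> i > 0 then 1 else 0) * (if (b - x) \<bullet> i > 0 then 1 else 0)) =
  (indicator (box a b) x :: real)"
  by (cases "x \<in> box a b") (auto simp: mem_box inner_simps)
 finally show ?thesis .
qed

lemma test_function_box_bump:
 assumes "box a b \<subseteq> S" shows "test_function S (box_bump a b n)"
proof (cases "n = 0")
 case True
 then have "box_bump a b n = (%x. 0)" using box_bump_nonzeroD by blast
 then show ?thesis by (simp add: test_function_def smooth_fun_on_def C_k_const)
next
 case False
 have "C_k k UNIV (box_bump a b n)" for k
 proof -
  have "C_k k UNIV (%x. \<Prod>i\<in>Basis. flat 1 ((real n *\<^sub>R i) \<bullet> x + (- real n * (a \<bullet> i) - 1)) *
     flat 1 ((- real n *\<^sub>R i) \<bullet> x + (real n * (b \<bullet> i) - 1)))"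
   by (intro C_k_prod C_k_mult C_k_flat) auto
  also have "(%x. \<Prod>i\<in>Basis. flat 1 ((real n *\<^sub>R i) \<bullet> x + (- real n * (a \<bullet> i) - 1)) *
     flat 1 ((- real n *\<^sub>R i) \<bullet> x + (real n * (b \<bullet> i) - 1))) = box_bump a b n"
   by (auto simp: box_bump_def fun_eq_iff algebra_simps inner_commute intro!: prod.cong)
  finally show ?thesis .
 qed
 moreover
 let ?K = "cbox (a + (1 / n) *\<^sub>R One) (b - (1 / n) *\<^sub>R One)"
 have sub: "closure {x. box_bump a b n x \<noteq> 0} \<subseteq> ?K"
  by (rule closure_minimal) (use box_bump_nonzeroD in \<open>auto simp: closed_cbox\<close>)
 moreover have "compact (closure {x. box_bump a b n x \<noteq> 0})"
  using sub by (meson bounded_cbox bounded_subset closed_closure compact_eq_bounded_closed)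
 moreover have "?K \<subseteq> box a b"
 proof
  fix x assume K: "x \<in> ?K"
  show "x \<in> box a b"
  proof (unfold mem_box, intro ballI conjI)
   fix i :: 'a assume i: "i \<in> Basis"
   have "0 < 1 / real n" using False by simp
   moreover have "a \<bullet> i + 1 / n <= x \<bullet> i" "x \<bullet> i <= b \<bullet> i - 1 / n"
    using K i by (auto simp: mem_box inner_simps)
   ultimately show "a \<bullet> i < x \<bullet> i" "x \<bullet> i < b \<bullet> i" by linarith+
  qed
 qed
 ultimately show ?thesis using assms unfolding test_function_def smooth_fun_on_def by blast
qed

text \<open>Inside a fixed box the positive and negative parts of f are densities of two finite
  measures that agree on all boxes, an intersection-stable generator of the Borel sets; equal
  measures have equal densities almost everywhere. An open S is a countable union of boxes with
  rational corners.\<close>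

lemma AE_zero_of_box_integrals:
 fixes f :: "'a::euclidean_space => real"
 assumes f: "integrable lborel f" and S: "open S"
  and zero: "\<And>a b. box a b \<subseteq> S ==> (LBINT x. indicator (box a b) x * f x) = 0"
 shows "AE x in lborel. x \<in> S --> f x = 0"
proof -
 note [measurable] = borel_measurable_integrable[OF f]
 have box0: "AE x in lborel. x \<in> box a b --> f x = 0" if ab: "box a b \<subseteq> S" for a b
 proof -
  let ?k = "%x. indicator (box a b) x * f x"
  let ?p = "%x. ennreal (?k x)" and ?n = "%x. ennreal (- ?k x)"
  have [measurable]: "box c d \<in> sets borel" for c d :: 'a by simp
  have k: "integrable lborel (%x. indicator (box c d) x * f x)" for c d
   using integrable_mult_indicator[OF _ f, of "box c d"] by simp
  have fin: "(NN x. ?p x) \<noteq> \<infinity>" "(NN x. ?n x) \<noteq> \<infinity>"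
   using real_integrable_def[of lborel ?k] k by auto
  have "density lborel ?p = density lborel ?n"
  proof (rule measure_eqI_generator_eq)
   let ?E = "range (%(a, b). box a b::'a set)"
   show "Int_stable ?E"
    by (auto simp: Int_stable_def box_Int_box)
   show "?E \<subseteq> Pow UNIV" "sets (density lborel ?p) = sigma_sets UNIV ?E"
    "sets (density lborel ?n) = sigma_sets UNIV ?E"
    by (simp_all add: borel_eq_box)
   let ?A = "%n::nat. box (- (real n *\<^sub>R One)) (real n *\<^sub>R One) :: 'a set"
   show "range ?A \<subseteq> ?E" "(\<Union>i. ?A i) = UNIV"
    unfolding UN_box_eq_UNIV by auto
   show "emeasure (density lborel ?p) (?A i) \<noteq> \<infinity>" for i
   proof -
    have "emeasure (density lborel ?p) (?A i) <= emeasure (density lborel ?p) (space lborel)"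
     by (intro emeasure_mono) auto
    also have "... = (NN x. ?p x)"
     by (subst emeasure_density) auto
    finally show ?thesis using fin by (auto simp: top_unique)
   qed
   fix X assume "X \<in> ?E"
   then obtain c d where X: "X = box c d" by auto
   obtain c' d' where cd: "box a b \<inter> box c d = box c' d'"
    by (auto simp: box_Int_box)
   have "box c' d' \<subseteq> S" using cd ab by blast
   let ?m = "%x. indicator (box c' d') x * f x"
   have m: "indicator (box c d) x * ?k x = ?m x" for x
    by (auto simp: indicator_def cd[symmetric])
   have "(LBINT x. ?m x) = 0" by (rule zero) fact
   then have "enn2real (NN x. ennreal (?m x)) = enn2real (NN x. ennreal (- ?m x))"
    using real_lebesgue_integral_def[OF k, of c' d'] by simp
   moreover have "(NN x. ennreal (?m x)) < \<infinity>" "(NN x. ennreal (- ?m x)) < \<infinity>"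
    using real_integrable_def[of lborel ?m] k[of c' d'] by (auto simp: top.not_eq_extremum)
   ultimately have "(NN x. ennreal (?m x)) = (NN x. ennreal (- ?m x))"
    by (metis ennreal_enn2real infinity_ennreal_def)
   moreover have "emeasure (density lborel ?p) X = (NN x. ennreal (?m x))"
    unfolding X by (subst emeasure_density)
     (auto intro!: nn_integral_cong simp: m[symmetric] split: split_indicator)
   moreover have "emeasure (density lborel ?n) X = (NN x. ennreal (- ?m x))"
    unfolding X by (subst emeasure_density)
     (auto intro!: nn_integral_cong simp: m[symmetric] split: split_indicator)
   ultimately show "emeasure (density lborel ?p) X = emeasure (density lborel ?n) X" by simp
  qed
  then have "AE x in lborel. ?p x = ?n x"
   using finite_density_unique[of ?p lborel ?n] fin by auto
  then show ?thesis
  proof eventually_elim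
   case (elim x)
   have "r = 0" if "ennreal r = ennreal (- r)" for r
    using that ennreal_neg[of r] ennreal_neg[of "- r"]
    by (cases "r >= 0") (auto simp: ennreal_eq_0_iff eq_commute[of 0])
   from this[of "?k x"] elim show ?case by auto
  qed
 qed
 define a' where "a' f = (\<Sum>i\<in>Basis. fst (f i) *\<^sub>R i)" for f :: "'a => real \<times> real"
 define b' where "b' f = (\<Sum>i\<in>Basis. snd (f i) *\<^sub>R i)" for f :: "'a => real \<times> real"
 define I where "I = {f\<in>Basis \<rightarrow>\<^sub>E \<rat> \<times> \<rat>. box (a' f) (b' f) \<subseteq> S}"
 have "countable (Basis \<rightarrow>\<^sub>E (\<rat> \<times> \<rat>) :: ('a => real \<times> real) set)"
  by (intro countable_PiE) (auto simp: countable_rat)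
 then have "countable I"
  by (rule countable_subset[rotated]) (auto simp: I_def)
 moreover have "S = (\<Union>f\<in>I. box (a' f) (b' f))"
  using open_UNION_box[OF S] unfolding I_def a'_def b'_def .
 moreover have "AE x in lborel. \<forall>k\<in>I. x \<in> box (a' k) (b' k) --> f x = 0"
  using \<open>countable I\<close> box0 by (subst AE_ball_countable) (auto simp: I_def)
 ultimately show ?thesis by (auto elim!: eventually_mono)
qed

text \<open>The definitions integrate over \<open>lebesgue_on S\<close>, whereas Fubini,
  translations and densities are at hand for \<open>lborel\<close>. A Borel representative, extended
  by zero, links the two.\<close>

lemma integrable_lebesgue_on_borel_rep:
 fixes g :: "'a::euclidean_space => real"
 assumes S: "S \<in> sets lebesgue" and g: "g \<in> borel_measurable (lebesgue_on S)"
 obtains g' where "g' \<in> borel_measurable borel" "AE x in lborel. g' x = (if x \<in> S then g x else 0)"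
proof -
 have "(%x. if x \<in> S then g x else 0) \<in> borel_measurable lebesgue"
  using g S borel_measurable_if by blast
 from completion_ex_borel_measurable_real[OF this]
 obtain g' where "g' \<in> borel_measurable lborel" "AE x in lborel. (if x \<in> S then g x else 0) = g' x"
  by blast
 then show ?thesis
  by (intro that[of g']) (simp, auto elim: eventually_mono)
qed

lemma integral_lebesgue_on_borel_rep:
 fixes g :: "'a::euclidean_space => real"
 assumes S: "S \<in> sets lebesgue" and g': "g' \<in> borel_measurable borel"
  and ae: "AE x in lborel. g' x = (if x \<in> S then g x else 0)"
 shows "integrable (lebesgue_on S) g \<longleftrightarrow> integrable lborel g'"
  and "(\<integral>x. g x \<partial>lebesgue_on S) = (LBINT x. g' x)"
proof -
 have m: "g' \<in> borel_measurable lborel" using g' by simp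
 have ae': "AE x in lebesgue. (if x \<in> S then g x else 0) = g' x"
  using AE_completion[OF ae] by eventually_elim auto
 have mg: "(%x. if x \<in> S then g x else 0) \<in> borel_measurable lebesgue"
  using borel_measurable_AE[OF measurable_completion[OF m]] AE_completion[OF ae] by fast
 show "integrable (lebesgue_on S) g \<longleftrightarrow> integrable lborel g'"
  using integrable_cong_AE[OF mg measurable_completion[OF m] ae'] integrable_completion[OF m]
  by (simp add: Lebesgue_Measure.integrable_restrict_UNIV[OF S])
 show "(\<integral>x. g x \<partial>lebesgue_on S) = (LBINT x. g' x)"
  using integral_cong_AE[OF mg measurable_completion[OF m] ae'] integral_completion[OF m]
  by (simp add: Lebesgue_Measure.integral_restrict_UNIV[OF S])
qed

text \<open>The smooth bumps of a box in S are admissible test functions and converge boundedly to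
  its indicator, so all box integrals of g vanish by dominated convergence.\<close>

lemma fundamental_lemma:
 fixes g :: "'a::euclidean_space => real"
 assumes S: "open S" and g: "integrable (lebesgue_on S) g"
  and zero: "\<And>\<psi>. test_function S \<psi> ==> (\<integral>x. g x * \<psi> x \<partial>lebesgue_on S) = 0"
 shows "AE x in lebesgue_on S. g x = 0"
proof -
 have SL: "S \<in> sets lebesgue" using S by auto
 obtain g' where g'[measurable]: "g' \<in> borel_measurable borel"
  and ae: "AE x in lborel. g' x = (if x \<in> S then g x else 0)"
  using integrable_lebesgue_on_borel_rep[OF SL borel_measurable_integrable[OF g]] .
 have ig: "integrable lborel g'"
  using integral_lebesgue_on_borel_rep(1)[OF SL g' ae] g by simp
 have "AE x in lborel. x \<in> S --> g' x = 0"
 proof (rule AE_zero_of_box_integrals[OF ig S])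
  fix a b assume ab: "box a b \<subseteq> S"
  have m: "box_bump a b n \<in> borel_measurable borel" for n
   using test_function_box_bump[OF ab, of n]
   by (auto simp: test_function_def smooth_fun_on_def intro!: borel_measurable_continuous_onI
     dest: spec[of _ 0])
  have "(LBINT x. box_bump a b n x * g' x) = (\<integral>x. g x * box_bump a b n x \<partial>lebesgue_on S)" for n
   using m ae by (intro integral_lebesgue_on_borel_rep(2)[OF SL, symmetric]) auto
  then have z: "(LBINT x. box_bump a b n x * g' x) = 0" for n
   using zero[OF test_function_box_bump[OF ab]] by simp
  have "(%n. LBINT x. box_bump a b n x * g' x) \<longlonglongrightarrow> (LBINT x. indicator (box a b) x * g' x)"
  proof (rule integral_dominated_convergence[where w = "%x. \<bar>g' x\<bar>"])
   show "AE x in lborel. norm (box_bump a b n x * g' x) <= \<bar>g' x\<bar>" for n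
    using box_bump_bounds[of a b n] by (auto simp: abs_mult intro!: mult_left_le_one_le)
  qed (use m ig in \<open>auto intro!: tendsto_mult box_bump_tendsto\<close>)
  then show "(LBINT x. indicator (box a b) x * g' x) = 0"
   using z by (simp add: LIMSEQ_const_iff)
 qed
 with ae have "AE x in lborel. x \<in> S --> g x = 0" by eventually_elim auto
 then show ?thesis
  using SL by (simp add: AE_restrict_space_iff AE_completion)
qed

section \<open>Functions of class C1 and their restriction to lines\<close>

lemma C1_frechet:
 assumes "C1 w g" shows "frechet_derivative w (at x) = (%d. g x \<bullet> d)"
 using assms frechet_derivative_at[of w "%d. g x \<bullet> d" x] by (auto simp: C1_def)

lemma C1_imp_C_k:
 assumes "C1 w g" shows "C_k 1 UNIV w"
proof -
 have "w differentiable (at x)" for x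
  using assms differentiableI unfolding C1_def by blast
 moreover have "continuous_on UNIV (%x. g x \<bullet> b)" for b
  using assms by (auto simp: C1_def intro!: continuous_intros)
 ultimately show ?thesis by (simp add: C1_frechet[OF assms])
qed

lemma C_k_imp_C1:
 assumes "C_k 1 UNIV w" shows "C1 w (%x. \<Sum>b\<in>Basis. frechet_derivative w (at x) b *\<^sub>R b)"
proof -
 have d: "(w has_derivative frechet_derivative w (at x)) (at x)" for x
  using assms by (simp add: frechet_derivative_works[symmetric])
 have "frechet_derivative w (at x) = (%d. (\<Sum>b\<in>Basis. frechet_derivative w (at x) b *\<^sub>R b) \<bullet> d)" for x
 proof
  fix v :: 'a
  interpret bounded_linear "frechet_derivative w (at x)"
   using d has_derivative_bounded_linear by blast
  have "frechet_derivative w (at x) v = frechet_derivative w (at x) (\<Sum>b\<in>Basis. (v \<bullet> b) *\<^sub>R b)"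
   by (simp add: euclidean_representation)
  also have "... = (\<Sum>b\<in>Basis. frechet_derivative w (at x) b *\<^sub>R b) \<bullet> v"
   by (simp add: sum scaleR inner_sum_left inner_commute[of v] mult.commute)
  finally show "frechet_derivative w (at x) v = (\<Sum>b\<in>Basis. frechet_derivative w (at x) b *\<^sub>R b) \<bullet> v" .
 qed
 with d show ?thesis
  using assms by (auto simp: C1_def intro!: continuous_intros)
qed

lemma C1_diff: "C1 v g ==> C1 w k ==> C1 (%x. v x - w x) (%x. g x - k x)"
 by (auto simp: C1_def inner_diff_left intro!: has_derivative_diff continuous_intros)

lemma C1_continuous: "C1 w g ==> continuous_on UNIV w" "C1 w g ==> continuous_on UNIV g"
 by (auto simp: C1_def intro!: continuous_at_imp_continuous_on has_derivative_continuous)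

lemma C1_borel [measurable_dest]: "C1 w g ==> w \<in> borel_measurable borel" "C1 w g ==> g \<in> borel_measurable borel"
 using C1_continuous[of w g] by (auto intro: borel_measurable_continuous_onI)

lemma C1_mult:
 assumes "C1 v g" "C1 w k"
 shows "C1 (%x. v x * w x) (%x. v x *\<^sub>R k x + w x *\<^sub>R g x)"
 unfolding C1_def
proof (intro conjI allI)
 fix x
 have "((%x. v x * w x) has_derivative (%d. v x * (k x \<bullet> d) + (g x \<bullet> d) * w x)) (at x)"
  using assms by (intro has_derivative_mult) (auto simp: C1_def)
 then show "((%x. v x * w x) has_derivative (%d. (v x *\<^sub>R k x + w x *\<^sub>R g x) \<bullet> d)) (at x)"
  by (simp add: inner_add_left mult.commute)
qed (intro continuous_intros C1_continuous[OF assms(1)] C1_continuous[OF assms(2)])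

lemma C1_line:
 assumes "C1 w g"
 shows "((%s. w (x + s *\<^sub>R b)) has_real_derivative (g (x + s *\<^sub>R b) \<bullet> b)) (at s)"
proof -
 have "((%s. x + s *\<^sub>R b) has_derivative (%h. h *\<^sub>R b)) (at s)"
  by (auto intro!: derivative_eq_intros)
 moreover have "(w has_derivative (%d. g (x + s *\<^sub>R b) \<bullet> d)) (at (x + s *\<^sub>R b))"
  using assms by (auto simp: C1_def)
 ultimately have "((%s. w (x + s *\<^sub>R b)) has_derivative (%h. g (x + s *\<^sub>R b) \<bullet> (h *\<^sub>R b))) (at s)"
  by (rule has_derivative_compose)
 then show ?thesis
  unfolding has_field_derivative_def by (simp add: mult_commute_abs)
qed

lemma bounded_continuous_bound:
 fixes g :: "'a::euclidean_space => 'b::real_normed_vector"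
 assumes "bounded S" "continuous_on UNIV g"
 obtains B where "B > 0" "\<And>x. x \<in> S ==> norm (g x) <= B"
proof -
 have "compact (closure S)" using assms by (simp add: compact_closure)
 then have "bounded (g ` closure S)"
  using assms continuous_on_subset by (blast intro: compact_imp_bounded compact_continuous_image)
 then show ?thesis
  using that closure_subset unfolding bounded_pos by (metis image_eqI subsetD)
qed

text \<open>Integrating the derivative along segments from x to x + b gives F (x + b) - F x, whose
  integral over x is zero by translation invariance; by Fubini the same double integral is the
  integral of G . b.\<close>

lemma integral_C1_compact_support:
 fixes b :: "'a::euclidean_space"
 assumes F: "C1 F G" and K: "compact K" "\<And>x. x \<notin> K ==> F x = 0" "\<And>x. x \<notin> K ==> G x = 0"
 shows "(LBINT x. G x \<bullet> b) = 0"
proof -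
 have cF: "continuous_on UNIV F" and cG: "continuous_on UNIV G" using C1_continuous[OF F] by auto
 have [measurable]: "F \<in> borel_measurable borel" "G \<in> borel_measurable borel"
  using C1_borel[OF F] by auto
 obtain M where M: "\<And>x. norm (G x) <= M"
  using bounded_continuous_bound[OF compact_imp_bounded[OF K(1)] cG] K(3)
  by (metis norm_zero less_imp_le)
 let ?k = "%(x, s). indicator {0..1::real} s * (G (x + s *\<^sub>R b) \<bullet> b)"
 obtain R where R: "\<And>x. x \<in> K ==> norm x <= R" using compact_imp_bounded[OF K(1)] by (auto simp: bounded_iff)
 \<comment> \<open>A segment x + s b meets the support of G only if x is within R + |b| of the
   origin, so the integrand lives on a set of finite measure and Fubini applies.\<close>
 let ?A = "cball 0 (R + norm b) \<times> {0..1::real} :: ('a \<times> real) set"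
 have "integrable (lborel \<Otimes>\<^sub>M lborel) (%x. indicator ?A x *\<^sub>R ?k x)"
 proof (rule integrableI_bounded_set_indicator[where B = "M * norm b"])
  show "?A \<in> sets (lborel \<Otimes>\<^sub>M lborel)" by (intro pair_measureI) auto
  show "emeasure (lborel \<Otimes>\<^sub>M lborel) ?A < \<infinity>"
   by (subst lborel.emeasure_pair_measure_Times)
     (use emeasure_lborel_cball_finite in \<open>auto simp: ennreal_mult_less_top\<close>)
  show "AE x in lborel \<Otimes>\<^sub>M lborel. x \<in> ?A --> norm (?k x) <= M * norm b"
  proof (intro AE_I2 impI)
   have "0 <= M * norm b" using M[of 0] norm_ge_zero[of "G 0"] by (intro mult_nonneg_nonneg norm_ge_zero) linarith
   then show "norm (?k z) <= M * norm b" for z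
    using mult_right_mono[OF M norm_ge_zero[of b]] Cauchy_Schwarz_ineq2[of _ b]
    by (auto simp: split_beta indicator_def intro: order_trans)
  qed
 qed measurable
 moreover have "indicator ?A x *\<^sub>R ?k x = ?k x" for x
 proof (cases x)
  case (Pair y s)
  have "y \<in> cball 0 (R + norm b)" if "s \<in> {0..1}" "G (y + s *\<^sub>R b) \<noteq> 0"
  proof -
   have "norm (y + s *\<^sub>R b) <= R" using K(3) R that by blast
   moreover have "norm (s *\<^sub>R b) <= norm b" using that by (auto intro: mult_left_le_one_le)
   ultimately show ?thesis using norm_triangle_ineq4[of "y + s *\<^sub>R b" "s *\<^sub>R b"] by simp
  qed
  then show ?thesis by (cases "G (y + s *\<^sub>R b) = 0") (auto simp: Pair indicator_def)
 qed
 ultimately have int: "integrable (lborel \<Otimes>\<^sub>M lborel) ?k" by (simp only:)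
 have tr: "(LBINT x. k (x + c)) = (LBINT x. k x)"
  if [measurable]: "k \<in> borel_measurable borel" for k :: "'a => real" and c
 proof -
  have "(LBINT x. k x) = (\<integral>x. k x \<partial>distr lborel borel ((+) c))" by (simp add: lborel_distr_plus)
  also have "... = (LBINT x. k (x + c))" by (subst integral_distr) (auto simp: add.commute)
  finally show ?thesis by simp
 qed
 have iF: "integrable lborel F"
 proof -
  obtain MF where "\<And>x. x \<in> K ==> norm (F x) <= MF"
   using bounded_continuous_bound[OF compact_imp_bounded[OF K(1)] cF] by blast
  then have "integrable lborel (%x. indicator K x *\<^sub>R F x)"
   using K by (intro integrableI_bounded_set_indicator[where B = MF])
    (use emeasure_compact_finite[OF K(1)] in \<open>auto simp: compact_imp_closed\<close>)
  moreover have "indicator K x *\<^sub>R F x = F x" for x using K(2) by (auto simp: indicator_def)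
  ultimately show ?thesis by (simp only:)
 qed
 have iFb: "integrable lborel (%x. F (x + b))"
  using lborel_integrable_real_affine
 proof -
  have "integrable (distr lborel borel ((+) b)) F" using iF by (simp add: lborel_distr_plus)
  then show ?thesis by (subst (asm) integrable_distr_eq) (auto simp: add.commute)
 qed
 have "(LBINT x. LBINT s. ?k (x, s)) = (LBINT x. F (x + b) - F x)"
 proof (rule Bochner_Integration.integral_cong[OF refl])
  fix x
  have "(LBINT s. indicator {0..1} s *\<^sub>R (G (x + s *\<^sub>R b) \<bullet> b)) = F (x + 1 *\<^sub>R b) - F (x + 0 *\<^sub>R b)"
   by (rule integral_FTC_atLeastAtMost)
     (auto intro!: continuous_intros continuous_on_compose2[OF cG]
      has_field_derivative_at_within C1_line[OF F] simp: has_real_derivative_iff_has_vector_derivative[symmetric])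
  then show "(LBINT s. ?k (x, s)) = F (x + b) - F x" by simp
 qed
 also have "... = 0" using iF iFb tr[of F b] by simp
 finally have "(LBINT s. LBINT x. ?k (x, s)) = 0"
  using lborel_pair.Fubini_integral[of "%s x. ?k (x, s)"] lborel_pair.integrable_product_swap[OF int]
  by (simp add: split_beta)
 moreover have "(LBINT x. ?k (x, s)) = indicator {0..1} s * (LBINT x. G x \<bullet> b)" for s
  using tr[of "%x. G x \<bullet> b" "s *\<^sub>R b"] by simp
 ultimately have "(\<integral>s. indicator {0..1} s * (LBINT x. G x \<bullet> b) \<partial>(lborel::real measure)) = 0"
  by (simp only:)
 then show ?thesis by simp
qed

section \<open>Square-integrable vector fields\<close>

lemma in_L2_inner:
 fixes u v :: "_ => 'b::euclidean_space"
 assumes "in_L2 M u" "in_L2 M v" shows "integrable M (%x. u x \<bullet> v x)"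
proof (rule Bochner_Integration.integrable_bound)
 show "integrable M (%x. (norm (u x))\<^sup>2 + (norm (v x))\<^sup>2)"
  using assms by (auto simp: in_L2_def)
 show "(%x. u x \<bullet> v x) \<in> borel_measurable M"
  using assms by (auto simp: in_L2_def)
 show "AE x in M. norm (u x \<bullet> v x) <= norm ((norm (u x))\<^sup>2 + (norm (v x))\<^sup>2)"
 proof (rule AE_I2)
  fix x
  have "\<bar>u x \<bullet> v x\<bar> <= norm (u x) * norm (v x)" by (rule Cauchy_Schwarz_ineq2)
  also have "... <= (norm (u x))\<^sup>2 + (norm (v x))\<^sup>2"
   using sum_squares_bound[of "norm (u x)" "norm (v x)"] mult_nonneg_nonneg[OF norm_ge_zero[of "u x"] norm_ge_zero[of "v x"]]
   by linarith
  finally show "norm (u x \<bullet> v x) <= norm ((norm (u x))\<^sup>2 + (norm (v x))\<^sup>2)" by simp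
 qed
qed

lemma in_L2_add:
 assumes "in_L2 M u" "in_L2 M v" shows "in_L2 M (%x. u x + v x)"
proof -
 have "integrable M (%x. (norm (u x))\<^sup>2 + 2 * (u x \<bullet> v x) + (norm (v x))\<^sup>2)"
  using assms in_L2_inner[OF assms] by (auto simp: in_L2_def)
 moreover have "(norm (u x + v x))\<^sup>2 = (norm (u x))\<^sup>2 + 2 * (u x \<bullet> v x) + (norm (v x))\<^sup>2" for x
  by (simp add: power2_norm_eq_inner inner_add_left inner_add_right inner_commute)
 ultimately show ?thesis using assms by (auto simp: in_L2_def)
qed

lemma in_L2_diff:
 assumes "in_L2 M u" "in_L2 M v" shows "in_L2 M (%x. u x - v x)"
 using in_L2_add[of M u "%x. - v x"] assms by (auto simp: in_L2_def)

lemma in_L2_continuous: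
 fixes w :: "'a::euclidean_space => 'b::euclidean_space"
 assumes "bounded S" "S \<in> sets lebesgue" "continuous_on UNIV w"
 shows "in_L2 (lebesgue_on S) w"
proof -
 obtain B where B: "B > 0" "\<And>x. x \<in> S ==> norm (w x) <= B"
  using bounded_continuous_bound[OF assms(1,3)] by blast
 interpret finite_measure "lebesgue_on S"
  using assms bounded_set_imp_lmeasurable by (intro finite_measure_lebesgue_on) blast
 have m: "w \<in> borel_measurable (lebesgue_on S)"
  using assms by (intro continuous_imp_measurable_on_sets_lebesgue) (auto intro: continuous_on_subset)
 have "integrable (lebesgue_on S) (%x. (norm (w x))\<^sup>2)"
  using m B by (intro integrable_const_bound[where B = "B\<^sup>2"]) (auto intro!: AE_I2 power_mono)
 then show ?thesis using m by (simp add: in_L2_def)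
qed

section \<open>Weak gradients: C1 functions, uniqueness, differences\<close>

lemma test_function_imp_C1:
 assumes "test_function S \<psi>" obtains g where "C1 \<psi> g"
 using C_k_imp_C1[of \<psi>] assms unfolding test_function_def smooth_fun_on_def by blast

lemma test_function_C1:
 assumes "test_function S \<psi>"
 obtains g where "C1 \<psi> g" "compact (closure {x. \<psi> x \<noteq> 0})" "closure {x. \<psi> x \<noteq> 0} \<subseteq> S"
  "\<And>x. x \<notin> closure {x. \<psi> x \<noteq> 0} ==> g x = 0"
proof -
 let ?K = "closure {x. \<psi> x \<noteq> 0}"
 obtain g where g: "C1 \<psi> g"
  using assms by (rule test_function_imp_C1)
 have "g x = 0" if x: "x \<notin> ?K" for x
 proof -
  have "((%y. 0) has_derivative (%d. g x \<bullet> d)) (at x)"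
  proof (rule has_derivative_transform_within_open)
   show "(\<psi> has_derivative (%d. g x \<bullet> d)) (at x)" using g by (simp add: C1_def)
   show "open (- ?K)" "x \<in> - ?K" using x by auto
   show "\<psi> y = 0" if "y \<in> - ?K" for y using that closure_subset[of "{x. \<psi> x \<noteq> 0}"] by auto
  qed
  then have "(%d. g x \<bullet> d) = (%d. 0)"
   by (rule has_derivative_unique[OF _ has_derivative_const])
  from fun_cong[OF this, of "g x"] show "g x = 0" by simp
 qed
 then show ?thesis using that[OF g] assms by (auto simp: test_function_def)
qed

text \<open>The product of w with a test function is C1 with compact support in S, so the integral
  of its derivative vanishes; the product rule turns this into the defining identity.\<close>

lemma C1_has_weak_grad:
 assumes S: "open S" "bounded S" and w: "C1 w g"
 shows "has_weak_grad S w g"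
 unfolding has_weak_grad_def
proof (intro conjI allI impI ballI)
 show "in_L2 (lebesgue_on S) g"
  using S C1_continuous[OF w] by (intro in_L2_continuous) auto
 fix \<psi> and b :: 'a assume \<psi>: "test_function S \<psi>" and "b \<in> Basis"
 let ?K = "closure {x. \<psi> x \<noteq> 0}"
 obtain k where k: "C1 \<psi> k" "compact ?K" "?K \<subseteq> S" "\<And>x. x \<notin> ?K ==> k x = 0"
  using test_function_C1[OF \<psi>] by blast
 have \<psi>0: "\<psi> x = 0" if "x \<notin> ?K" for x using that closure_subset[of "{x. \<psi> x \<noteq> 0}"] by auto
 have [measurable]: "w \<in> borel_measurable borel" "g \<in> borel_measurable borel"
   "\<psi> \<in> borel_measurable borel" "k \<in> borel_measurable borel"
  using C1_borel[OF w] C1_borel[OF k(1)] by auto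
 have SL: "S \<in> sets lebesgue" using S by auto
 have rep: "(\<integral>x. q x \<partial>lebesgue_on S) = (LBINT x. q x)" "integrable lborel q"
  if q: "continuous_on UNIV q" "\<And>x. x \<notin> ?K ==> q x = 0" for q :: "'a => real"
 proof -
  have "q \<in> borel_measurable borel" using q by (auto intro: borel_measurable_continuous_onI)
  then show "(\<integral>x. q x \<partial>lebesgue_on S) = (LBINT x. q x)"
   using q k by (intro integral_lebesgue_on_borel_rep(2)[OF SL]) auto
  have "integrable lborel (%x. indicator ?K x *\<^sub>R q x)"
   using borel_integrable_compact[OF k(2) continuous_on_subset[OF q(1)]] by auto
  also have "(%x. indicator ?K x *\<^sub>R q x) = q" using q(2) by (intro ext) (auto split: split_indicator)
  finally show "integrable lborel q" .
 qed
 have "continuous_on UNIV (%x. w x * (k x \<bullet> b))" "continuous_on UNIV (%x. (g x \<bullet> b) * \<psi> x)"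
  by (intro continuous_intros C1_continuous[OF w] C1_continuous[OF k(1)])+
 note r1 = rep[OF this(1)] and r2 = rep[OF this(2)]
 have z1: "w x * (k x \<bullet> b) = 0" if "x \<notin> ?K" for x
  using k(4)[OF that] by simp
 have z2: "(g x \<bullet> b) * \<psi> x = 0" if "x \<notin> ?K" for x
  using \<psi>0[OF that] by simp
 note r1 = r1[OF z1] and r2 = r2[OF z2]
 have "(LBINT x. (w x *\<^sub>R k x + \<psi> x *\<^sub>R g x) \<bullet> b) = 0"
 proof (rule integral_C1_compact_support[OF C1_mult[OF w k(1)] k(2)])
  show "w x * \<psi> x = 0" if "x \<notin> ?K" for x using \<psi>0[OF that] by simp
  show "w x *\<^sub>R k x + \<psi> x *\<^sub>R g x = 0" if "x \<notin> ?K" for x using \<psi>0[OF that] k(4)[OF that] by simp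
 qed
 then have "(LBINT x. w x * (k x \<bullet> b)) + (LBINT x. (g x \<bullet> b) * \<psi> x) = 0"
  using r1 r2 by (simp add: inner_add_left mult.commute)
 then show "(\<integral>x. w x * frechet_derivative \<psi> (at x) b \<partial>lebesgue_on S) =
    - (\<integral>x. (g x \<bullet> b) * \<psi> x \<partial>lebesgue_on S)"
  using r1 r2 by (simp add: C1_frechet[OF k(1)])
qed

lemma has_weak_grad_unique:
 assumes S: "open S" "bounded S" and G: "has_weak_grad S u G" and H: "has_weak_grad S u H"
 shows "AE x in lebesgue_on S. G x = H x"
proof -
 interpret finite_measure "lebesgue_on S"
  using S by (intro finite_measure_lebesgue_on lmeasurable_open) auto
 have L: "in_L2 (lebesgue_on S) G" "in_L2 (lebesgue_on S) H"
  using G H by (auto simp: has_weak_grad_def)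
 have c: "in_L2 (lebesgue_on S) (%x. b)" for b :: 'a
  using S by (intro in_L2_continuous) auto
 have "AE x in lebesgue_on S. (G x - H x) \<bullet> b = 0" if b: "b \<in> Basis" for b
 proof (rule fundamental_lemma[OF S(1)])
  show "integrable (lebesgue_on S) (%x. (G x - H x) \<bullet> b)"
   by (intro in_L2_inner in_L2_diff L c)
  fix \<psi> assume \<psi>: "test_function S \<psi>"
  obtain k where "C1 \<psi> k" using \<psi> by (blast elim: test_function_imp_C1)
  then have p: "in_L2 (lebesgue_on S) (%x. \<psi> x *\<^sub>R b)"
   using S C1_continuous by (intro in_L2_continuous) (auto intro!: continuous_intros)
  have "(\<integral>x. (G x \<bullet> b) * \<psi> x \<partial>lebesgue_on S) = (\<integral>x. (H x \<bullet> b) * \<psi> x \<partial>lebesgue_on S)"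
   using G H \<psi> b by (simp add: has_weak_grad_def)
  moreover have "integrable (lebesgue_on S) (%x. (G x \<bullet> b) * \<psi> x)" "integrable (lebesgue_on S) (%x. (H x \<bullet> b) * \<psi> x)"
   using in_L2_inner[OF L(1) p] in_L2_inner[OF L(2) p] by (simp_all add: mult.commute)
  ultimately show "(\<integral>x. ((G x - H x) \<bullet> b) * \<psi> x \<partial>lebesgue_on S) = 0"
   by (simp add: inner_diff_left left_diff_distrib)
 qed
 then have "AE x in lebesgue_on S. \<forall>b\<in>Basis. (G x - H x) \<bullet> b = 0"
  by (intro AE_finite_allI) auto
 then show ?thesis
  by eventually_elim (metis euclidean_all_zero_iff right_minus_eq)
qed

lemma has_weak_grad_diff:
 assumes S: "open S" "bounded S" and L: "in_L2 (lebesgue_on S) u" "in_L2 (lebesgue_on S) v"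
  and G: "has_weak_grad S u G" and H: "has_weak_grad S v H"
 shows "has_weak_grad S (%x. u x - v x) (%x. G x - H x)"
 unfolding has_weak_grad_def
proof (intro conjI allI impI ballI)
 have LG: "in_L2 (lebesgue_on S) G" "in_L2 (lebesgue_on S) H"
  using G H by (auto simp: has_weak_grad_def)
 then show "in_L2 (lebesgue_on S) (%x. G x - H x)" by (rule in_L2_diff)
 fix \<psi> and b :: 'a assume \<psi>: "test_function S \<psi>" and b: "b \<in> Basis"
 obtain k where k: "C1 \<psi> k" using \<psi> by (blast elim: test_function_imp_C1)
 have p: "in_L2 (lebesgue_on S) (%x. \<psi> x *\<^sub>R b)" and q: "in_L2 (lebesgue_on S) (%x. k x \<bullet> b)"
  using S C1_continuous[OF k] by (auto intro!: in_L2_continuous continuous_intros)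
 have "integrable (lebesgue_on S) (%x. u x * (k x \<bullet> b))" "integrable (lebesgue_on S) (%x. v x * (k x \<bullet> b))"
  using in_L2_inner[OF L(1) q] in_L2_inner[OF L(2) q] by simp_all
 moreover have "integrable (lebesgue_on S) (%x. (G x \<bullet> b) * \<psi> x)" "integrable (lebesgue_on S) (%x. (H x \<bullet> b) * \<psi> x)"
  using in_L2_inner[OF LG(1) p] in_L2_inner[OF LG(2) p] by (simp_all add: mult.commute)
 moreover have "(\<integral>x. u x * frechet_derivative \<psi> (at x) b \<partial>lebesgue_on S) = - (\<integral>x. (G x \<bullet> b) * \<psi> x \<partial>lebesgue_on S)"
   "(\<integral>x. v x * frechet_derivative \<psi> (at x) b \<partial>lebesgue_on S) = - (\<integral>x. (H x \<bullet> b) * \<psi> x \<partial>lebesgue_on S)"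
  using G H \<psi> b by (auto simp: has_weak_grad_def)
 ultimately show "(\<integral>x. (u x - v x) * frechet_derivative \<psi> (at x) b \<partial>lebesgue_on S) =
    - (\<integral>x. ((G x - H x) \<bullet> b) * \<psi> x \<partial>lebesgue_on S)"
  by (simp add: C1_frechet[OF k] inner_diff_left left_diff_distrib)
qed

lemma in_H1_weak_grad: "in_H1 S u ==> has_weak_grad S u (weak_grad S u)"
 unfolding in_H1_def weak_grad_def using someI_ex[of "has_weak_grad S u"] by simp

lemma C1_in_H1:
 assumes "open S" "bounded S" "C1 w g"
 shows "in_H1 S w" "AE x in lebesgue_on S. weak_grad S w x = g x"
proof -
 show "in_H1 S w"
  using assms C1_has_weak_grad[OF assms] C1_continuous[OF assms(3)]
  by (auto simp: in_H1_def intro!: in_L2_continuous)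
 then show "AE x in lebesgue_on S. weak_grad S w x = g x"
  by (rule has_weak_grad_unique[OF assms(1,2) in_H1_weak_grad C1_has_weak_grad[OF assms]])
qed

section \<open>An \<open>L\<^sup>1\<close> Poincare inequality\<close>

lemma nn_integral_lborel_shift:
 fixes c :: "'a::euclidean_space"
 assumes [measurable]: "k \<in> borel_measurable borel"
 shows "(NN x. k (x + c)) = (NN x. k x)"
proof -
 have "(NN x. k x) = (\<integral>\<^sup>+x. k x \<partial>distr lborel borel ((+) c))" by (simp add: lborel_distr_plus)
 also have "... = (NN x. k (x + c))" by (subst nn_integral_distr) (auto simp: add.commute)
 finally show ?thesis by simp
qed

definition gradL1 :: "('a::euclidean_space => 'a) => 'a set => ennreal" where
 "gradL1 g S = (NN x. indicator S x * ennreal (norm (g x)))"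

text \<open>A form of the Poincare left-hand side without a mean value: it is symmetric in the two
  sets, splits over unions and can be chained through a third set. Values in \<open>ennreal\<close>
  make Fubini free of integrability conditions.\<close>

definition osc :: "('a::euclidean_space => real) => 'a set => 'a set => ennreal" where
 "osc W A B = (NN x. NN y. indicator A x * (indicator B y * ennreal \<bar>W x - W y\<bar>))"

text \<open>The increment W (x + z) - W x is the integral of g . z along the segment. Exchanging the
  order of integration and translating back by s z turns every s-slice into at most |z| times the
  integral of |g| over S, because the segments stay in S.\<close>

lemma translation_inequality:
 assumes W: "C1 W g" and [measurable]: "A \<in> sets borel" "S \<in> sets borel"
  and sub: "\<And>x s. x \<in> A ==> 0 <= s ==> s <= 1 ==> x + s *\<^sub>R z \<in> S"
 shows "(NN x. indicator A x * ennreal \<bar>W (x + z) - W x\<bar>) <= ennreal (norm z) * gradL1 g S"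
proof -
 have [measurable]: "W \<in> borel_measurable borel" "g \<in> borel_measurable borel"
  using C1_borel[OF W] by auto
 let ?k = "%x s. indicator {0..1::real} s * (indicator S (x + s *\<^sub>R z) * (ennreal (norm z) * ennreal (norm (g (x + s *\<^sub>R z)))))"
 have le: "indicator A x * ennreal \<bar>W (x + z) - W x\<bar> <= (NN s. ?k x s)" for x
 proof (cases "x \<in> A")
  case True
  have c: "continuous_on {0..1} (%s. g (x + s *\<^sub>R z) \<bullet> z)"
   by (auto intro!: continuous_intros continuous_on_compose2[OF C1_continuous(2)[OF W]])
  have "(LBINT s. indicator {0..1} s *\<^sub>R (g (x + s *\<^sub>R z) \<bullet> z)) = W (x + 1 *\<^sub>R z) - W (x + 0 *\<^sub>R z)"
   by (rule integral_FTC_atLeastAtMost)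
     (auto intro!: c has_field_derivative_at_within C1_line[OF W]
      simp: has_real_derivative_iff_has_vector_derivative[symmetric])
  then have "ennreal \<bar>W (x + z) - W x\<bar> = ennreal (norm (LBINT s. indicator {0..1} s *\<^sub>R (g (x + s *\<^sub>R z) \<bullet> z)))"
   by simp
  also have "... <= (NN s. ennreal (norm (indicator {0..1} s *\<^sub>R (g (x + s *\<^sub>R z) \<bullet> z))))"
   by (intro integral_norm_bound_ennreal borel_integrable_atLeastAtMost'[unfolded set_integrable_def] c)
  also have "... <= (NN s. ?k x s)"
  proof (rule nn_integral_mono)
   fix s :: real
   have "\<bar>g (x + s *\<^sub>R z) \<bullet> z\<bar> <= norm z * norm (g (x + s *\<^sub>R z))"
    using Cauchy_Schwarz_ineq2[of "g (x + s *\<^sub>R z)" z] by (simp add: mult.commute)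
   then show "ennreal (norm (indicator {0..1} s *\<^sub>R (g (x + s *\<^sub>R z) \<bullet> z))) <= ?k x s"
    using sub[OF True, of s] by (auto simp: indicator_def ennreal_mult[symmetric] intro!: ennreal_leI)
  qed
  finally show ?thesis using True by simp
 qed simp
 have "(NN x. indicator A x * ennreal \<bar>W (x + z) - W x\<bar>) <= (NN x. NN s. ?k x s)"
  by (intro nn_integral_mono le)
 also have "... = (NN s. NN x. ?k x s)"
  by (rule lborel_pair.Fubini'[symmetric]) measurable
 also have "... = (NN s. indicator {0..1::real} s * (ennreal (norm z) * gradL1 g S))"
 proof (rule nn_integral_cong)
  fix s :: real
  have "(NN x. ?k x s) = indicator {0..1} s * (NN x. indicator S (x + s *\<^sub>R z) * (ennreal (norm z) * ennreal (norm (g (x + s *\<^sub>R z)))))"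
   by (subst nn_integral_cmult) auto
  also have "(NN x. indicator S (x + s *\<^sub>R z) * (ennreal (norm z) * ennreal (norm (g (x + s *\<^sub>R z)))))
   = (NN x. indicator S x * (ennreal (norm z) * ennreal (norm (g x))))"
   by (rule nn_integral_lborel_shift[of "%x. indicator S x * (ennreal (norm z) * ennreal (norm (g x)))"]) measurable
  also have "... = (NN x. ennreal (norm z) * (indicator S x * ennreal (norm (g x))))"
   by (simp add: ac_simps)
  also have "... = ennreal (norm z) * gradL1 g S"
   unfolding gradL1_def by (rule nn_integral_cmult) measurable
  finally show "(NN x. ?k x s) = indicator {0..1} s * (ennreal (norm z) * gradL1 g S)" .
 qed
 also have "... = ennreal (norm z) * gradL1 g S"
  by (simp add: nn_integral_multc)
 finally show ?thesis .
qed

section \<open>Oscillation integrals and chains of linked sets\<close>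

lemma gradL1_mono: "A \<subseteq> B ==> gradL1 g A <= gradL1 g B"
 unfolding gradL1_def by (intro nn_integral_mono) (auto simp: indicator_def)

lemma osc_mono: "A \<subseteq> A' ==> B \<subseteq> B' ==> osc W A B <= osc W A' B'"
 unfolding osc_def by (intro nn_integral_mono) (auto simp: indicator_def)

text \<open>Put y = x + z. For a pair of points of the ball |z| < 2 r, and by convexity the segment
  between them stays in the ball, so \<open>translation_inequality\<close> bounds each z-slice by 2
  r times the gradient norm; then z ranges over a ball of radius 2 r.\<close>

lemma osc_ball:
 assumes W: "C1 W g"
 shows "osc W (ball c r) (ball c r) <= ennreal (2 * r * measure lborel (ball (0::'a::euclidean_space) (2 * r))) * gradL1 g (ball (c::'a) r)"
proof (cases "r > 0")
 case True
 have [measurable]: "W \<in> borel_measurable borel" "g \<in> borel_measurable borel"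
  using C1_borel[OF W] by auto
 let ?B = "ball c r"
 have [measurable]: "?B \<in> sets borel" by simp
 let ?k = "%x z. indicator ?B x * (indicator ?B (x + z) * ennreal \<bar>W (x + z) - W x\<bar>)"
 have "osc W ?B ?B = (NN x. NN z. ?k x z)"
  unfolding osc_def
 proof (rule nn_integral_cong)
  fix x
  show "(NN y. indicator ?B x * (indicator ?B y * ennreal \<bar>W x - W y\<bar>)) = (NN z. ?k x z)"
  proof -
   have "(NN y. indicator ?B x * (indicator ?B y * ennreal \<bar>W x - W y\<bar>)) =
     (NN z. indicator ?B x * (indicator ?B (z + x) * ennreal \<bar>W x - W (z + x)\<bar>))"
    by (rule nn_integral_lborel_shift[symmetric, of "%y. indicator ?B x * (indicator ?B y * ennreal \<bar>W x - W y\<bar>)"])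
     measurable
   then show ?thesis
    by (simp only: add.commute[of _ x] abs_minus_commute[of "W x"])
  qed
 qed
 also have "... = (NN z. NN x. ?k x z)"
  by (rule lborel_pair.Fubini'[symmetric]) measurable
 also have "... <= (NN z. (ennreal (2 * r) * gradL1 g ?B) * indicator (ball (0::'a) (2 * r)) z)"
 proof (rule nn_integral_mono)
  fix z :: 'a
  let ?A = "{x. x \<in> ?B \<and> x + z \<in> ?B}"
  have [measurable]: "?A \<in> sets borel" by measurable
  have eq: "(NN x. ?k x z) = (NN x. indicator ?A x * ennreal \<bar>W (x + z) - W x\<bar>)"
   by (intro nn_integral_cong) (auto simp: indicator_def)
  show "(NN x. ?k x z) <= (ennreal (2 * r) * gradL1 g ?B) * indicator (ball (0::'a) (2 * r)) z"
  proof (cases "norm z < 2 * r")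
   case True
   have "(NN x. indicator ?A x * ennreal \<bar>W (x + z) - W x\<bar>) <= ennreal (norm z) * gradL1 g ?B"
   proof (rule translation_inequality[OF W])
    fix x s assume x: "x \<in> ?A" and s: "0 <= s" "s <= (1::real)"
    have "(1 - s) *\<^sub>R x + s *\<^sub>R (x + z) \<in> ?B"
     using x s by (intro convexD[OF convex_ball]) auto
    then show "x + s *\<^sub>R z \<in> ?B" by (simp add: algebra_simps)
   qed auto
   also have "... <= ennreal (2 * r) * gradL1 g ?B"
    using True by (intro mult_right_mono ennreal_leI) auto
   finally show ?thesis using True eq by simp
  next
   case False
   have "?A = {}"
   proof -
    have "norm z < 2 * r" if "x \<in> ?B" "x + z \<in> ?B" for x
     using that dist_triangle[of x "x + z" c] by (simp add: dist_norm norm_minus_commute dist_commute)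
    then show ?thesis using False by auto
   qed
   then show ?thesis unfolding eq by simp
  qed
 qed
 also have "... = (ennreal (2 * r) * gradL1 g ?B) * emeasure lborel (ball (0::'a) (2 * r))"
  by (simp add: nn_integral_cmult_indicator)
 also have "emeasure lborel (ball (0::'a) (2 * r)) = ennreal (measure lborel (ball (0::'a) (2 * r)))"
  using emeasure_lborel_ball_finite[of "0::'a" "2 * r"] by (intro emeasure_eq_ennreal_measure) auto
 finally show ?thesis using True by (simp add: ennreal_mult ac_simps)
next
 case False
 then have e: "ball c r = {}" by (simp add: ball_empty)
 show ?thesis unfolding e osc_def by simp
qed

text \<open>Pairs of sets whose mutual oscillation is controlled by the gradient on S, with a
  constant that depends on the sets alone. A Poincare inequality on S is
  \<open>linked S S S\<close>; it is assembled from balls by transitivity and unions.\<close>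

definition linked :: "'a::euclidean_space set => 'a set => 'a set => bool" where
 "linked S A B \<longleftrightarrow> (\<exists>C\<ge>0. \<forall>W g. C1 W g --> osc W A B <= ennreal C * gradL1 g S)"

lemma linked_empty: "linked S {} B"
 unfolding linked_def osc_def by (intro exI[of _ 0]) simp

lemma linked_mono: "linked S A' B' ==> A \<subseteq> A' ==> B \<subseteq> B' ==> linked S A B"
 unfolding linked_def using osc_mono order_trans by meson

lemma linked_ball: "ball c r \<subseteq> S ==> linked S (ball c r) (ball c r)"
proof (cases "r >= 0")
 case True
 assume sub: "ball c r \<subseteq> S"
 show ?thesis
  unfolding linked_def
 proof (intro exI conjI allI impI)
  show "0 <= 2 * r * measure lborel (ball (0::'a) (2 * r))" using True by simp
  show "osc W (ball c r) (ball c r) <= ennreal (2 * r * measure lborel (ball (0::'a) (2 * r))) * gradL1 g S"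
   if "C1 W g" for W g
   using osc_ball[OF that, of c r] gradL1_mono[OF sub, of g]
   by (meson mult_left_mono order_trans zero_le)
 qed
next
 case False
 then have "ball c r = {}" by (simp add: ball_empty)
 then show ?thesis by (simp only: linked_empty)
qed

lemma linked_sym:
 fixes A :: "'a::euclidean_space set"
 assumes "linked S A B" and [measurable]: "A \<in> sets borel" "B \<in> sets borel"
 shows "linked S B A"
proof -
 have "osc W B A = osc W A B" if "C1 W g" for W :: "'a => real" and g
 proof -
  have [measurable]: "W \<in> borel_measurable borel" using C1_borel[OF that] by auto
  have "osc W B A = (NN y. NN x. indicator B x * (indicator A y * ennreal \<bar>W x - W y\<bar>))"
   unfolding osc_def by (rule lborel_pair.Fubini'[symmetric]) measurable
  also have "... = osc W A B"
   unfolding osc_def by (simp add: ac_simps abs_minus_commute)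
  finally show ?thesis .
 qed
 then show ?thesis using assms(1) unfolding linked_def by metis
qed

text \<open>Insert a point y of B in |W x - W z| and integrate over y: |B| osc(A, D) <= |D| osc(A,
  B) + |A| osc(B, D). Dividing needs B of positive measure.\<close>

lemma linked_trans:
 fixes A :: "'a::euclidean_space set"
 assumes AB: "linked S A B" and BD: "linked S B D" and B: "measure lborel B > 0"
  and m[measurable]: "A \<in> sets borel" "B \<in> sets borel" "D \<in> sets borel"
  and bd: "bounded A" "bounded B" "bounded D"
 shows "linked S A D"
proof -
 obtain p q where p: "p >= 0" "\<And>W (g :: 'a => 'a). C1 W g ==> osc W A B <= ennreal p * gradL1 g S"
  and q: "q >= 0" "\<And>W (g :: 'a => 'a). C1 W g ==> osc W B D <= ennreal q * gradL1 g S"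
  using AB BD unfolding linked_def by blast
 have fin: "emeasure lborel X = ennreal (measure lborel X)" if "bounded X" for X :: "'a set"
  using emeasure_bounded_finite[OF that] by (intro emeasure_eq_ennreal_measure) auto
 define a b d where "a = measure lborel A" and "b = measure lborel B" and "d = measure lborel D"
 have abd: "a >= 0" "b > 0" "d >= 0" using B by (auto simp: a_def b_def d_def)
 show ?thesis
  unfolding linked_def
 proof (intro exI conjI allI impI)
  show "0 <= (d * p + a * q) / b" using abd p q by simp
  fix W :: "'a => real" and g assume W: "C1 W g"
  have [measurable]: "W \<in> borel_measurable borel" using C1_borel[OF W] by auto
  have "ennreal b * osc W A D = (NN y. indicator B y * osc W A D)"
   by (subst nn_integral_multc) (auto simp: fin[OF bd(2)] b_def)
  also have "... = (NN y. NN x. NN z. indicator B y * (indicator A x * (indicator D z * ennreal \<bar>W x - W z\<bar>)))"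
   unfolding osc_def by (simp add: nn_integral_cmult[symmetric])
  also have "... <= (NN y. NN x. NN z. indicator D z * (indicator A x * (indicator B y * ennreal \<bar>W x - W y\<bar>)) +
      indicator A x * (indicator B y * (indicator D z * ennreal \<bar>W y - W z\<bar>)))"
   by (intro nn_integral_mono)
     (auto simp: indicator_def ennreal_plus[symmetric] simp del: ennreal_plus intro!: ennreal_leI)
  also have "... = (NN y. NN x. indicator A x * (indicator B y * ennreal \<bar>W x - W y\<bar>) * d)
    + (NN y. NN x. indicator A x * (NN z. indicator B y * (indicator D z * ennreal \<bar>W y - W z\<bar>)))"
   by (simp add: nn_integral_add nn_integral_multc nn_integral_cmult fin[OF bd(3)] d_def mult.commute[of "ennreal (measure lborel D)"])
  also have "(NN y. NN x. indicator A x * (indicator B y * ennreal \<bar>W x - W y\<bar>) * d)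
    = d * osc W A B"
  proof -
   have "(NN y. NN x. indicator A x * (indicator B y * ennreal \<bar>W x - W y\<bar>) * d)
    = (NN x. NN y. indicator A x * (indicator B y * ennreal \<bar>W x - W y\<bar>) * d)"
    by (rule lborel_pair.Fubini') measurable
   then show ?thesis
    unfolding osc_def by (simp add: nn_integral_cmult mult.commute[of _ "ennreal d"])
  qed
  also have "(NN y. NN x. indicator A x * (NN z. indicator B y * (indicator D z * ennreal \<bar>W y - W z\<bar>)))
    = a * osc W B D"
   unfolding osc_def
   by (simp add: nn_integral_multc nn_integral_cmult fin[OF bd(1)] a_def)
  also have "d * osc W A B + a * osc W B D <= d * (ennreal p * gradL1 g S) + a * (ennreal q * gradL1 g S)"
   by (intro add_mono mult_left_mono p q W) auto
  also have "... = ennreal (d * p + a * q) * gradL1 g S"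
   using abd p q by (simp add: ennreal_mult distrib_right mult.assoc)
  finally have *: "ennreal b * osc W A D <= ennreal (d * p + a * q) * gradL1 g S" .
  have "osc W A D = ennreal (1 / b) * (ennreal b * osc W A D)"
   using abd by (simp add: mult.assoc[symmetric] ennreal_mult[symmetric])
  also have "... <= ennreal (1 / b) * (ennreal (d * p + a * q) * gradL1 g S)"
   by (intro mult_left_mono *) auto
  also have "... = ennreal ((d * p + a * q) / b) * gradL1 g S"
   using abd p q by (simp add: mult.assoc[symmetric] ennreal_mult[symmetric] del: ennreal_plus)
  finally show "osc W A D <= ennreal ((d * p + a * q) / b) * gradL1 g S" .
 qed
qed

lemma linked_Un:
 fixes A1 :: "'a::euclidean_space set"
 assumes "linked S A1 B" "linked S A2 B" and [measurable]: "A1 \<in> sets borel" "A2 \<in> sets borel" "B \<in> sets borel"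
 shows "linked S (A1 \<union> A2) B"
proof -
 obtain p q where p: "p >= 0" "\<And>W (g :: 'a => 'a). C1 W g ==> osc W A1 B <= ennreal p * gradL1 g S"
  and q: "q >= 0" "\<And>W (g :: 'a => 'a). C1 W g ==> osc W A2 B <= ennreal q * gradL1 g S"
  using assms unfolding linked_def by blast
 show ?thesis
  unfolding linked_def
 proof (intro exI conjI allI impI)
  show "0 <= p + q" using p q by simp
  fix W :: "'a => real" and g assume W: "C1 W g"
  have [measurable]: "W \<in> borel_measurable borel" using C1_borel[OF W] by auto
  have "osc W (A1 \<union> A2) B <= (NN x. (NN y. indicator A1 x * (indicator B y * ennreal \<bar>W x - W y\<bar>)) +
    (NN y. indicator A2 x * (indicator B y * ennreal \<bar>W x - W y\<bar>)))"
   unfolding osc_def by (intro nn_integral_mono) (auto simp: indicator_def)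
  also have "... = osc W A1 B + osc W A2 B"
   unfolding osc_def by (rule nn_integral_add) measurable
  also have "... <= ennreal p * gradL1 g S + ennreal q * gradL1 g S"
   by (intro add_mono p q W)
  finally show "osc W (A1 \<union> A2) B <= ennreal (p + q) * gradL1 g S"
   using p q by (simp add: distrib_right)
 qed
qed

text \<open>This reaches pieces of S at the boundary, whose points have no ball of fixed size around
  them in S: the piece is moved by a single vector z along segments inside S into an interior ball,
  at the cost of |z| times the gradient norm, and the ball is linked with itself.\<close>

lemma linked_translate:
 fixes A :: "'a::euclidean_space set"
 assumes D: "ball c r \<subseteq> S" and [measurable]: "A \<in> sets borel" "S \<in> sets borel" and r: "r > 0"
  and A: "\<And>x. x \<in> A ==> x + z \<in> ball c r"
   "\<And>x s. x \<in> A ==> 0 <= s ==> s <= 1 ==> x + s *\<^sub>R z \<in> S"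
 shows "linked S A (ball c r)"
proof -
 let ?D = "ball c r"
 have [measurable]: "?D \<in> sets borel" by simp
 obtain p where p: "p >= 0" "\<And>W (g :: 'a => 'a). C1 W g ==> osc W ?D ?D <= ennreal p * gradL1 g S"
  using linked_ball[OF D] unfolding linked_def by blast
 define d where "d = measure lborel ?D"
 have d: "emeasure lborel ?D = ennreal d" "d >= 0"
  using emeasure_lborel_ball_finite[of c r] by (auto simp: d_def intro!: emeasure_eq_ennreal_measure)
 show ?thesis
  unfolding linked_def
 proof (intro exI conjI allI impI)
  show "0 <= d * norm z + p" using p d by simp
  fix W :: "'a => real" and g assume W: "C1 W g"
  have [measurable]: "W \<in> borel_measurable borel" using C1_borel[OF W] by auto
  have "osc W A ?D <= (NN x. NN y. (indicator A x * ennreal \<bar>W (x + z) - W x\<bar>) * indicator ?D y +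
    indicator ?D (x + z) * (indicator ?D y * ennreal \<bar>W (x + z) - W y\<bar>))"
   unfolding osc_def
  proof (intro nn_integral_mono)
   fix x y
   show "indicator A x * (indicator ?D y * ennreal \<bar>W x - W y\<bar>)
     <= (indicator A x * ennreal \<bar>W (x + z) - W x\<bar>) * indicator ?D y +
    indicator ?D (x + z) * (indicator ?D y * ennreal \<bar>W (x + z) - W y\<bar>)"
    using A(1)[of x]
    by (auto simp: indicator_def ennreal_plus[symmetric] simp del: ennreal_plus intro!: ennreal_leI)
  qed
  also have "... = (NN x. (indicator A x * ennreal \<bar>W (x + z) - W x\<bar>) * ennreal d) +
    (NN x. NN y. indicator ?D (x + z) * (indicator ?D y * ennreal \<bar>W (x + z) - W y\<bar>))"
   by (simp add: nn_integral_add nn_integral_cmult d)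
  also have "(NN x. NN y. indicator ?D (x + z) * (indicator ?D y * ennreal \<bar>W (x + z) - W y\<bar>)) = osc W ?D ?D"
   unfolding osc_def
   by (rule nn_integral_lborel_shift[of "%x. NN y. indicator ?D x * (indicator ?D y * ennreal \<bar>W x - W y\<bar>)"]) measurable
  also have "(NN x. (indicator A x * ennreal \<bar>W (x + z) - W x\<bar>) * ennreal d) =
    (NN x. indicator A x * ennreal \<bar>W (x + z) - W x\<bar>) * ennreal d"
   by (rule nn_integral_multc) measurable
  also have "... + osc W ?D ?D <= ennreal (norm z) * gradL1 g S * ennreal d + ennreal p * gradL1 g S"
   by (intro add_mono mult_right_mono translation_inequality[OF W] p W A) auto
  also have "... = ennreal (d * norm z + p) * gradL1 g S"
   using d p by (simp add: distrib_right distrib_left ennreal_mult ac_simps)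
  finally show "osc W A ?D <= ennreal (d * norm z + p) * gradL1 g S" .
 qed
qed

text \<open>In the chart S lies below a graph in direction e, so moving by a negative multiple of e
  never leaves S as long as the chart ball is not left, and it takes a boundary point to positive
  depth below the graph.\<close>

lemma lipschitz_boundary_local:
 fixes S :: "'a::euclidean_space set"
 assumes S: "open S" "lipschitz_boundary S" and p: "p \<in> frontier S"
 obtains r z where "r > 0" "ball (p + z) r \<subseteq> S"
  "\<And>x s. x \<in> S \<inter> ball p r ==> 0 <= s ==> s <= 1 ==> x + s *\<^sub>R z \<in> S"
proof -
 obtain e \<gamma> R L where e: "norm e = 1" and R: "R > 0" and L: "L-lipschitz_on {y. y \<bullet> e = 0} (\<gamma> :: 'a => real)"
  and g: "\<And>x. x \<in> ball p R ==> x \<in> S \<longleftrightarrow> x \<bullet> e < \<gamma> (x - (x \<bullet> e) *\<^sub>R e)"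
  using S(2) p unfolding lipschitz_boundary_def by blast
 define \<pi> where "\<pi> x = x - (x \<bullet> e) *\<^sub>R e" for x
 have ee: "e \<bullet> e = 1" using e by (simp add: norm_eq_1)
 have \<pi>0: "\<pi> x \<in> {y. y \<bullet> e = 0}" for x by (simp add: \<pi>_def inner_diff_left ee)
 have L0: "L >= 0" using L by (rule lipschitz_on_nonneg)
 have \<pi>n: "norm (\<pi> x - \<pi> y) <= norm (x - y)" for x y
 proof -
  have "(norm (\<pi> x - \<pi> y))\<^sup>2 = (norm (x - y))\<^sup>2 - ((x - y) \<bullet> e)\<^sup>2"
   unfolding power2_norm_eq_inner
   by (simp add: \<pi>_def inner_diff_left inner_diff_right inner_commute ee power2_eq_square algebra_simps)
  then have "(norm (\<pi> x - \<pi> y))\<^sup>2 <= (norm (x - y))\<^sup>2" by simp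
  then show ?thesis by (rule power2_le_imp_le) simp
 qed
 have Lg: "\<bar>\<gamma> (\<pi> x) - \<gamma> (\<pi> y)\<bar> <= L * norm (x - y)" for x y
 proof -
  have "\<bar>\<gamma> (\<pi> x) - \<gamma> (\<pi> y)\<bar> <= L * norm (\<pi> x - \<pi> y)"
   using lipschitz_onD[OF L \<pi>0 \<pi>0, of x y] by (simp add: dist_norm dist_real_def)
  also have "... <= L * norm (x - y)" using \<pi>n L0 by (intro mult_left_mono)
  finally show ?thesis .
 qed
 have xe: "\<bar>x \<bullet> e - y \<bullet> e\<bar> <= norm (x - y)" for x y
  using Cauchy_Schwarz_ineq2[of "x - y" e] e by (simp add: inner_diff_left)
 have pS: "p \<notin> S" using p S(1) by (simp add: frontier_def interior_open)
 then have pe1: "\<gamma> (\<pi> p) <= p \<bullet> e" using g[of p] R by (auto simp: \<pi>_def)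
 \<comment> \<open>The boundary point lies exactly on the graph: points of S near p are strictly
   below it, and height and graph together vary by at most 1 + L times the distance.\<close>
 have pe2: "p \<bullet> e <= \<gamma> (\<pi> p)"
 proof (rule field_le_epsilon)
  fix \<eta> :: real assume \<eta>: "\<eta> > 0"
  have "p \<in> closure S" using p by (simp add: frontier_def)
  moreover have "min R (\<eta> / (1 + L)) > 0" using R \<eta> L0 by simp
  ultimately obtain x where x: "x \<in> S" "dist x p < min R (\<eta> / (1 + L))"
   using closure_approachable by blast
  then have "x \<bullet> e < \<gamma> (\<pi> x)" using g[of x] by (auto simp: dist_commute \<pi>_def)
  then have "p \<bullet> e <= \<gamma> (\<pi> p) + (1 + L) * norm (x - p)"
   using xe[of x p] Lg[of x p] by (simp add: distrib_right)
  moreover have "(1 + L) * norm (x - p) <= \<eta>"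
   using x(2) L0 by (simp add: dist_norm pos_less_divide_eq mult.commute)
  ultimately show "p \<bullet> e <= \<gamma> (\<pi> p) + \<eta>" by simp
 qed
 \<comment> \<open>The depth is half the chart radius R. Requiring (1 + L) \<delta> < s keeps the
   whole \<delta>-ball about p + z below the graph, and \<delta> <= R/4 keeps all points and their
   translates inside the chart.\<close>
 define s where "s = R / 2"
 define \<delta> where "\<delta> = min (R / 4) (s / (2 * (1 + L)))"
 define z where "z = - s *\<^sub>R e"
 have \<delta>: "\<delta> > 0" using R L0 by (simp add: \<delta>_def s_def)
 have \<delta>4: "\<delta> <= R / 4" unfolding \<delta>_def by (rule min.cobounded1)
 have "\<delta> <= s / (2 * (1 + L))" unfolding \<delta>_def by (rule min.cobounded2)
 moreover have "2 * (1 + L) > 0" using L0 by simp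
 ultimately have "\<delta> * (2 * (1 + L)) <= s" by (metis pos_le_divide_eq)
 then have "2 * ((1 + L) * \<delta>) <= s" by (simp add: algebra_simps)
 moreover have "(1 + L) * \<delta> > 0" using L0 \<delta> by simp
 ultimately have \<delta>s: "(1 + L) * \<delta> < s" by linarith
 have nz: "norm z = s" using e R by (simp add: z_def s_def)
 show ?thesis
 proof (rule that[OF \<delta>])
  show "ball (p + z) \<delta> \<subseteq> S"
  proof
   fix x assume "x \<in> ball (p + z) \<delta>"
   then have d: "norm (x - (p + z)) < \<delta>" by (simp add: dist_norm norm_minus_commute)
   have "norm (x - p) <= norm (x - (p + z)) + norm z"
    using norm_triangle_ineq[of "x - (p + z)" z] by (simp add: algebra_simps)
   then have "x \<in> ball p R" using d \<delta>4 R nz by (simp add: dist_norm norm_minus_commute s_def)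
   moreover have "\<pi> (p + z) = \<pi> p"
    by (simp add: \<pi>_def z_def inner_add_left inner_diff_left ee algebra_simps)
   then have "\<bar>\<gamma> (\<pi> x) - \<gamma> (\<pi> p)\<bar> <= L * norm (x - (p + z))"
    using Lg[of x "p + z"] by simp
   moreover have "L * norm (x - (p + z)) <= L * \<delta>" using d L0 by (intro mult_left_mono) auto
   moreover have "x \<bullet> e <= p \<bullet> e - s + norm (x - (p + z))"
    using xe[of x "p + z"] by (simp add: z_def inner_add_left inner_diff_left ee)
   ultimately show "x \<in> S"
    using g[of x] pe1 pe2 d \<delta>s by (simp add: \<pi>_def[symmetric] distrib_right)
  qed
  fix x t assume x: "x \<in> S \<inter> ball p \<delta>" and t: "0 <= t" "t <= (1::real)"
  have "norm (x - p) < R" using x \<delta>4 R by (simp add: dist_norm norm_minus_commute)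
  then have x1: "x \<bullet> e < \<gamma> (\<pi> x)" using x g[of x] by (simp add: dist_norm norm_minus_commute \<pi>_def)
  have "norm (x + t *\<^sub>R z - p) <= norm (x - p) + t * s"
   using norm_triangle_ineq[of "x - p" "t *\<^sub>R z"] t nz by (simp add: algebra_simps)
  also have "... <= norm (x - p) + s" using t R by (simp add: s_def mult_left_le_one_le)
  also have "... < R" using x \<delta>4 R by (simp add: s_def dist_norm norm_minus_commute)
  finally have "x + t *\<^sub>R z \<in> ball p R" by (simp add: dist_norm norm_minus_commute)
  moreover have "\<pi> (x + t *\<^sub>R z) = \<pi> x"
   by (simp add: \<pi>_def z_def inner_add_left inner_diff_left ee algebra_simps)
  moreover have "(x + t *\<^sub>R z) \<bullet> e <= x \<bullet> e"
   using t R by (simp add: z_def inner_add_left inner_diff_left ee s_def)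
  ultimately show "x + t *\<^sub>R z \<in> S" using g[of "x + t *\<^sub>R z"] x1 by (simp add: \<pi>_def[symmetric])
 qed
qed

text \<open>The centres of balls that are linked to a fixed ball form an open and relatively closed
  set, hence all of S by connectedness. Near a boundary point a translation into S does the rest,
  and compactness of the closure leaves finitely many pieces.\<close>

theorem linked_lipschitz_domain:
 fixes S :: "'a::euclidean_space set"
 assumes S: "open S" "bounded S" "connected S" "lipschitz_boundary S"
 shows "linked S S S"
proof (cases "S = {}")
 case True then show ?thesis by (simp add: linked_empty)
next
 case False
 then obtain x0 where x0: "x0 \<in> S" by blast
 obtain r0 where r0: "r0 > 0" "ball x0 r0 \<subseteq> S" using S(1) x0 openE by blast
 let ?B0 = "ball x0 r0"
 have [measurable]: "S \<in> sets borel" using S by auto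
 have pos: "measure lborel (ball x r) > 0" if "r > 0" for x :: 'a and r
  using content_ball_pos[OF that, of x] by simp
 have lt: "linked S A D" if "linked S A (ball x r)" "linked S (ball x r) D" "r > 0"
  "A \<in> sets borel" "D \<in> sets borel" "bounded A" "bounded D" for A D and x :: 'a and r
  by (rule linked_trans[OF that(1,2)]) (use that pos in auto)
 define T where "T = {x\<in>S. \<exists>r>0. ball x r \<subseteq> S \<and> linked S ?B0 (ball x r)}"
 have oT: "open T"
 proof (subst open_contains_ball, intro ballI)
  fix x assume "x \<in> T"
  then obtain r where r: "r > 0" "ball x r \<subseteq> S" "linked S ?B0 (ball x r)" by (auto simp: T_def)
  have "ball x r \<subseteq> T"
  proof
   fix y assume y: "y \<in> ball x r"
   obtain r' where r': "r' > 0" "ball y r' \<subseteq> ball x r" using y open_ball openE by blast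
   then have "linked S ?B0 (ball y r')" using linked_mono[OF r(3)] by blast
   with r' y r show "y \<in> T" by (auto simp: T_def)
  qed
  with r show "\<exists>e>0. ball x e \<subseteq> T" by blast
 qed
 have oC: "open (S - T)"
 proof (subst open_contains_ball, intro ballI)
  fix x assume x: "x \<in> S - T"
  obtain r where r: "r > 0" "ball x r \<subseteq> S" using S(1) x openE by blast
  \<comment> \<open>A point y of T in the ball would link it to the fixed ball through a small ball
    about y, and then x would lie in T.\<close>
  have "ball x r \<inter> T = {}"
  proof (rule ccontr)
   assume "ball x r \<inter> T \<noteq> {}"
   then obtain y where y: "y \<in> ball x r" "y \<in> T" by blast
   then obtain r1 where r1: "r1 > 0" "linked S ?B0 (ball y r1)" by (auto simp: T_def)
   obtain r2 where r2: "r2 > 0" "ball y r2 \<subseteq> ball x r" using y open_ball openE by blast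
   let ?r = "min r1 r2"
   have "linked S ?B0 (ball y ?r)" by (rule linked_mono[OF r1(2)]) auto
   moreover have "linked S (ball y ?r) (ball x r)"
    by (rule linked_mono[OF linked_ball[OF r(2)]]) (use r2 in \<open>auto simp: subset_iff\<close>)
   ultimately have "linked S ?B0 (ball x r)"
    by (rule lt) (use r1 r2 in auto)
   then show False using x r by (auto simp: T_def)
  qed
  then have "ball x r \<subseteq> S - T" using r by blast
  with r show "\<exists>e>0. ball x e \<subseteq> S - T" by blast
 qed
 have "x0 \<in> T" using x0 r0 linked_ball[OF r0(2)] by (auto simp: T_def)
 have TS: "T = S"
 proof (rule ccontr)
  assume ne: "T \<noteq> S"
  have "T \<subseteq> S" by (auto simp: T_def)
  then have "S \<subseteq> T \<union> (S - T)" "T \<inter> (S - T) \<inter> S = {}" "T \<inter> S \<noteq> {}" "(S - T) \<inter> S \<noteq> {}"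
   using \<open>x0 \<in> T\<close> x0 ne by auto
  with connectedD[OF S(3) oT oC] show False by blast
 qed
 have loc: "\<exists>N. open N \<and> p \<in> N \<and> linked S (S \<inter> N) ?B0" if p: "p \<in> closure S" for p
 proof (cases "p \<in> S")
  case True
  then obtain r where r: "r > 0" "ball p r \<subseteq> S" "linked S ?B0 (ball p r)"
   using TS by (auto simp: T_def)
  have "linked S (S \<inter> ball p r) ?B0"
   by (rule linked_mono[OF linked_sym[OF r(3)]]) auto
  with r show ?thesis by (intro exI[of _ "ball p r"]) auto
 next
  case False
  then have "p \<in> frontier S" using p S(1) by (simp add: frontier_def interior_open)
  then obtain r z where rz: "r > 0" "ball (p + z) r \<subseteq> S"
   "\<And>x s. x \<in> S \<inter> ball p r ==> 0 <= s ==> s <= 1 ==> x + s *\<^sub>R z \<in> S"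
   using lipschitz_boundary_local[OF S(1,4)] by blast
  have 1: "linked S (S \<inter> ball p r) (ball (p + z) r)"
   by (rule linked_translate[OF rz(2), where z = z]) (use rz in \<open>auto simp: dist_norm\<close>)
  have "p + z \<in> T" using rz TS by auto
  then obtain r1 where r1: "r1 > 0" "ball (p + z) r1 \<subseteq> S" "linked S ?B0 (ball (p + z) r1)"
   by (auto simp: T_def)
  have "linked S ?B0 (ball (p + z) (min r r1))" by (rule linked_mono[OF r1(3)]) auto
  moreover have "linked S (ball (p + z) (min r r1)) (ball (p + z) r)"
   by (rule linked_mono[OF linked_ball[OF rz(2)]]) auto
  ultimately have "linked S ?B0 (ball (p + z) r)" by (rule lt) (use rz r1 in auto)
  then have "linked S (ball (p + z) r) ?B0" by (rule linked_sym) auto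
  with 1 have "linked S (S \<inter> ball p r) ?B0"
   by (rule lt) (use rz S(2) in \<open>auto intro: bounded_subset\<close>)
  with rz show ?thesis by (intro exI[of _ "ball p r"]) auto
 qed
 then obtain N where N: "\<And>p. p \<in> closure S ==> open (N p) \<and> p \<in> N p \<and> linked S (S \<inter> N p) ?B0"
  by metis
 have comp: "compact (closure S)" using S by simp
 have cov: "closure S \<subseteq> (\<Union>p\<in>closure S. N p)" using N by auto
 obtain F where F: "F \<subseteq> closure S" "finite F" "closure S \<subseteq> (\<Union>p\<in>F. N p)"
  by (rule compactE_image[OF comp _ cov]) (use N in auto)
 have "linked S (\<Union>p\<in>F. S \<inter> N p) ?B0" using F(2,1)
 proof (induction F rule: finite_induct)
  case empty show ?case by (simp add: linked_empty)
 next
  case (insert p F)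
  have "open (\<Union>p\<in>F. S \<inter> N p)" using insert.prems N S(1) by (intro open_UN ballI open_Int) auto
  with insert N S(1) show ?case by (auto intro!: linked_Un)
 qed
 then have SB: "linked S S ?B0"
  by (rule linked_mono) (use F(3) closure_subset[of S] in auto)
 then have "linked S ?B0 S" by (rule linked_sym) auto
 with SB show ?thesis by (rule lt) (use r0 S(2) in auto)
qed

text \<open>For the mean value c of W over S, |W x - c| is at most the average of |W x - W y| over
  y, so the integral is at most \<open>osc W S S\<close> divided by the volume.\<close>

theorem poincare_lipschitz_domain:
 fixes S :: "'a::euclidean_space set"
 assumes S: "open S" "bounded S" "connected S" "lipschitz_boundary S" "S \<noteq> {}"
 obtains C where "C >= 0" "\<And>W (g :: 'a => 'a). C1 W g ==> \<exists>c.
  (NN x. indicator S x * ennreal \<bar>W x - c\<bar>) <= ennreal C * gradL1 g S"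
proof -
 obtain C where C: "C >= 0" "\<And>W (g :: 'a => 'a). C1 W g ==> osc W S S <= ennreal C * gradL1 g S"
  using linked_lipschitz_domain[OF S(1-4)] unfolding linked_def by blast
 have [measurable]: "S \<in> sets borel" using S by auto
 define m where "m = measure lborel S"
 have em: "emeasure lborel S = ennreal m"
  unfolding m_def using emeasure_bounded_finite[OF S(2)] by (intro emeasure_eq_ennreal_measure) auto
 have "emeasure lborel S \<noteq> 0"
  using open_not_negligible[OF S(1,5)] by (auto simp: negligible_iff_null_sets null_sets_def)
 then have m: "m > 0" using em by (auto simp: m_def zero_less_measure_iff)
 show ?thesis
 proof (rule that)
  show "C / m >= 0" using C m by simp
  fix W :: "'a => real" and g assume W: "C1 W g"
  have [measurable]: "W \<in> borel_measurable borel" using C1_borel[OF W] by auto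
  obtain B where B: "\<And>x. x \<in> S ==> norm (W x) <= B"
   using bounded_continuous_bound[OF S(2) C1_continuous(1)[OF W]] by blast
  have iW: "integrable lborel (%y. indicator S y *\<^sub>R W y)"
   using B em by (intro integrableI_bounded_set_indicator[where B = B]) auto
  have i1: "integrable lborel (%y. indicator S y *\<^sub>R c)" for c :: real
   using em by (intro integrableI_bounded_set_indicator[where B = "\<bar>c\<bar>"]) auto
  define c where "c = (LBINT y. indicator S y *\<^sub>R W y) / m"
  have le: "ennreal \<bar>W x - c\<bar> <= ennreal (1 / m) * (NN y. indicator S y * ennreal \<bar>W x - W y\<bar>)" for x
  proof -
   have "(LBINT y. indicator S y *\<^sub>R (W x - W y)) = m * W x - m * c"
    using iW i1[of "W x"] m by (simp add: right_diff_distrib c_def m_def)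
   then have "W x - c = (1 / m) * (LBINT y. indicator S y *\<^sub>R (W x - W y))"
    using m by (simp add: field_simps)
   then have "\<bar>W x - c\<bar> = (1 / m) * norm (LBINT y. indicator S y *\<^sub>R (W x - W y))"
    using m by (simp add: abs_mult)
   also have "ennreal ... = ennreal (1 / m) * ennreal (norm (LBINT y. indicator S y *\<^sub>R (W x - W y)))"
    using m by (intro ennreal_mult) auto
   also have "... <= ennreal (1 / m) * (NN y. ennreal (norm (indicator S y *\<^sub>R (W x - W y))))"
    using iW i1[of "W x"] by (intro mult_left_mono integral_norm_bound_ennreal) (auto simp: right_diff_distrib)
   also have "(NN y. ennreal (norm (indicator S y *\<^sub>R (W x - W y)))) = (NN y. indicator S y * ennreal \<bar>W x - W y\<bar>)"
    by (intro nn_integral_cong) (auto simp: indicator_def)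
   finally show ?thesis .
  qed
  have "(NN x. indicator S x * ennreal \<bar>W x - c\<bar>) <=
    (NN x. ennreal (1 / m) * (NN y. indicator S x * (indicator S y * ennreal \<bar>W x - W y\<bar>)))"
  proof (rule nn_integral_mono)
   fix x
   show "indicator S x * ennreal \<bar>W x - c\<bar> <= ennreal (1 / m) * (NN y. indicator S x * (indicator S y * ennreal \<bar>W x - W y\<bar>))"
    using le[of x] by (auto simp: indicator_def)
  qed
  also have "... = ennreal (1 / m) * osc W S S"
   unfolding osc_def by (rule nn_integral_cmult) measurable
  also have "... <= ennreal (1 / m) * (ennreal C * gradL1 g S)"
   by (intro mult_left_mono C W) auto
  also have "... = ennreal (C / m) * gradL1 g S"
   using C m by (simp add: mult.assoc[symmetric] ennreal_mult[symmetric])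
  finally show "\<exists>c. (NN x. indicator S x * ennreal \<bar>W x - c\<bar>) <= ennreal (C / m) * gradL1 g S"
   by blast
 qed
qed

section \<open>Traces on circles\<close>

lemma C1_segment_bound:
 assumes W: "C1 W g" and ab: "a <= b"
 shows "ennreal \<bar>W (p + b *\<^sub>R z) - W (p + a *\<^sub>R z)\<bar> <= (NN s. indicator {a..b} s * ennreal (norm z * norm (g (p + s *\<^sub>R z))))"
proof -
 have c: "continuous_on {a..b} (%s. g (p + s *\<^sub>R z) \<bullet> z)"
  by (auto intro!: continuous_intros continuous_on_compose2[OF C1_continuous(2)[OF W]])
 have "(LBINT s. indicator {a..b} s *\<^sub>R (g (p + s *\<^sub>R z) \<bullet> z)) = W (p + b *\<^sub>R z) - W (p + a *\<^sub>R z)"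
  by (rule integral_FTC_atLeastAtMost[OF ab])
    (auto intro!: c has_field_derivative_at_within C1_line[OF W]
     simp: has_real_derivative_iff_has_vector_derivative[symmetric])
 then have "ennreal \<bar>W (p + b *\<^sub>R z) - W (p + a *\<^sub>R z)\<bar> = ennreal (norm (LBINT s. indicator {a..b} s *\<^sub>R (g (p + s *\<^sub>R z) \<bullet> z)))"
  by simp
 also have "... <= (NN s. ennreal (norm (indicator {a..b} s *\<^sub>R (g (p + s *\<^sub>R z) \<bullet> z))))"
  by (intro integral_norm_bound_ennreal borel_integrable_atLeastAtMost'[unfolded set_integrable_def] c)
 also have "... <= (NN s. indicator {a..b} s * ennreal (norm z * norm (g (p + s *\<^sub>R z))))"
 proof (rule nn_integral_mono)
  fix s :: real
  have "\<bar>g (p + s *\<^sub>R z) \<bullet> z\<bar> <= norm z * norm (g (p + s *\<^sub>R z))"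
   using Cauchy_Schwarz_ineq2[of "g (p + s *\<^sub>R z)" z] by (simp add: mult.commute)
  then show "ennreal (norm (indicator {a..b} s *\<^sub>R (g (p + s *\<^sub>R z) \<bullet> z))) <= indicator {a..b} s * ennreal (norm z * norm (g (p + s *\<^sub>R z)))"
   by (auto simp: indicator_def intro!: ennreal_leI)
 qed
 finally show ?thesis .
qed

definition L1 :: "('a::euclidean_space => real) => 'a set => ennreal" where
 "L1 k S = (NN x. indicator S x * ennreal \<bar>k x\<bar>)"

definition polar :: "real => real => real \<times> real" where
 "polar ro th = (ro * cos th, ro * sin th)"

lemma continuous_polar: "continuous_on UNIV (polar ro)"
 unfolding polar_def by (intro continuous_intros)

lemma polar_borel [measurable]: "polar ro \<in> borel_measurable borel"
 using continuous_polar by (rule borel_measurable_continuous_onI)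

lemma norm_polar: "norm (polar ro th) = \<bar>ro\<bar>"
 unfolding polar_def norm_Pair
 by (simp add: power_mult_distrib distrib_left[symmetric] sin_cos_squared_add2 real_sqrt_mult)

text \<open>On the arc |\<theta>| <= pi/4 the point at angle \<theta> has first coordinate ro cos
  \<theta> > ro/2. Its value differs from k at (x, ro sin \<theta>), 0 <= x <= ro/2, by the integral
  of |g| along a horizontal chord in the disc. Averaging over x and substituting y = ro sin \<theta>
  gives integrals over the disc; 4/ro^2 is the product of 2/ro from the averaging and 2/ro from the
  Jacobian.\<close>

lemma trace_sector:
 assumes k: "C1 k g" and ro: "ro > 0"
 shows "(NN th. indicator {-pi/4..pi/4} th * ennreal \<bar>k (polar ro th)\<bar>)
  <= ennreal (4 / ro\<^sup>2) * (L1 k (ball 0 ro) + ennreal (ro / 2) * gradL1 g (ball 0 ro))"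
proof -
 have [measurable]: "k \<in> borel_measurable borel" "g \<in> borel_measurable borel"
  using C1_borel[OF k] by auto
 let ?B = "ball (0 :: real \<times> real) ro"
 have [measurable]: "?B \<in> sets borel" by simp
 define d where "d = ro / 2"
 have d: "d > 0" using ro by (simp add: d_def)
 define h where "h x y = indicator ?B (x, y) * ennreal \<bar>k (x, y)\<bar> + ennreal d * (indicator ?B (x, y) * ennreal (norm (g (x, y))))" for x y
 have [measurable]: "(%(x, y). h x y) \<in> borel_measurable (borel \<Otimes>\<^sub>M borel)"
  unfolding h_def by measurable
 define H where "H y = (NN x. h x y)" for y
 have [measurable]: "H \<in> borel_measurable borel" unfolding H_def by measurable
 have inB: "(x, y) \<in> ?B \<longleftrightarrow> x\<^sup>2 + y\<^sup>2 < ro\<^sup>2" for x y :: real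
 proof -
  have "norm (x, y) < ro \<longleftrightarrow> sqrt (x\<^sup>2 + y\<^sup>2) < sqrt (ro\<^sup>2)"
   using ro by (simp add: norm_Pair)
  then show ?thesis by (simp only: real_sqrt_less_iff mem_ball_0)
 qed
 have cos_ge: "cos th >= 1 / sqrt 2" if "th \<in> {-pi/4..pi/4}" for th
 proof -
  have "cos (pi / 4) <= cos \<bar>th\<bar>" using that by (intro cos_monotone_0_pi_le) auto
  moreover have "1 / sqrt 2 = sqrt 2 / (2::real)" by (simp add: field_simps)
  ultimately show ?thesis by (simp add: cos_45)
 qed
 have half: "1 / sqrt 2 > (1::real) / 2"
 proof -
  have "sqrt 2 < sqrt 4" by (subst real_sqrt_less_iff) simp
  then show ?thesis by (simp add: field_simps)
 qed
 have pt: "ennreal d * ennreal \<bar>k (polar ro th)\<bar> <= H (ro * sin th)" if th: "th \<in> {-pi/4..pi/4}" for th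
 proof -
  define X where "X = ro * cos th"
  define y where "y = ro * sin th"
  have XY: "X\<^sup>2 + y\<^sup>2 = ro\<^sup>2"
   by (simp add: X_def y_def power_mult_distrib distrib_left[symmetric])
  have dX: "d < X"
  proof -
   have "cos th > 1 / 2" using less_le_trans[OF half cos_ge[OF th]] .
   then have "ro * (1 / 2) < ro * cos th" using ro by (intro mult_strict_left_mono)
   then show ?thesis by (simp add: d_def X_def)
  qed
  have B: "(x, y) \<in> ?B" if "0 <= x" "x < X" for x
  proof -
   have "x\<^sup>2 < X\<^sup>2" using that by (intro power_strict_mono) auto
   then show ?thesis unfolding inB using XY by linarith
  qed
  let ?c = "NN s. indicator ?B (s, y) * ennreal (norm (g (s, y)))"
  have le: "ennreal \<bar>k (X, y)\<bar> <= ennreal \<bar>k (x, y)\<bar> + ?c" if x: "0 <= x" "x <= d" for x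
  proof -
   have "ennreal \<bar>k (X, y) - k (x, y)\<bar> = ennreal \<bar>k ((0, y) + X *\<^sub>R (1, 0)) - k ((0, y) + x *\<^sub>R (1, 0))\<bar>"
    by simp
   also have "... <= (NN s. indicator {x..X} s * ennreal (norm (1::real, 0::real) * norm (g ((0, y) + s *\<^sub>R (1, 0)))))"
    using x dX by (intro C1_segment_bound[OF k]) auto
   also have "... <= ?c"
   proof (rule nn_integral_mono_AE)
    show "AE s in lborel. indicator {x..X} s * ennreal (norm (1::real, 0::real) * norm (g ((0, y) + s *\<^sub>R (1, 0)))) <= indicator ?B (s, y) * ennreal (norm (g (s, y)))"
     using AE_lborel_singleton[of X]
    proof eventually_elim
     case (elim s)
     then show ?case using B[of s] x by (auto simp: indicator_def norm_Pair)
    qed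
   qed
   finally have "ennreal \<bar>k (x, y)\<bar> + ennreal \<bar>k (X, y) - k (x, y)\<bar> <= ennreal \<bar>k (x, y)\<bar> + ?c"
    by (rule add_left_mono)
   moreover have "ennreal \<bar>k (X, y)\<bar> <= ennreal \<bar>k (x, y)\<bar> + ennreal \<bar>k (X, y) - k (x, y)\<bar>"
    by (auto simp: ennreal_plus[symmetric] simp del: ennreal_plus intro!: ennreal_leI)
   ultimately show ?thesis by (rule order_trans[rotated])
  qed
  have "ennreal d * ennreal \<bar>k (X, y)\<bar> = (NN x. indicator {0..d} x * ennreal \<bar>k (X, y)\<bar>)"
   using d by (simp add: nn_integral_multc)
  also have "... <= (NN x. indicator ?B (x, y) * ennreal \<bar>k (x, y)\<bar> + indicator {0..d} x * ?c)"
  proof (rule nn_integral_mono)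
   fix x show "indicator {0..d} x * ennreal \<bar>k (X, y)\<bar> <= indicator ?B (x, y) * ennreal \<bar>k (x, y)\<bar> + indicator {0..d} x * ?c"
    using le[of x] B[of x] dX by (auto simp: indicator_def)
  qed
  also have "... = (NN x. indicator ?B (x, y) * ennreal \<bar>k (x, y)\<bar>) + ennreal d * ?c"
   using d by (simp add: nn_integral_add nn_integral_multc)
  also have "... = H y"
   unfolding H_def h_def by (simp add: nn_integral_add nn_integral_cmult)
  finally show ?thesis by (simp add: X_def y_def polar_def)
 qed
 have "ennreal d * (NN th. indicator {-pi/4..pi/4} th * ennreal \<bar>k (polar ro th)\<bar>)
   = (NN th. indicator {-pi/4..pi/4} th * (ennreal d * ennreal \<bar>k (polar ro th)\<bar>))"
  by (simp add: nn_integral_cmult[symmetric] ac_simps)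
 \<comment> \<open>The Jacobian ro cos \<theta> of the substitution is inserted by hand: on the arc
   2 cos \<theta> >= 1.\<close>
 also have "... <= (NN th. ennreal (2 / ro) * (H (ro * sin th) * ennreal (ro * cos th) * indicator {-pi/4..pi/4} th))"
 proof (rule nn_integral_mono)
  fix th :: real
  show "indicator {-pi/4..pi/4} th * (ennreal d * ennreal \<bar>k (polar ro th)\<bar>) <= ennreal (2 / ro) * (H (ro * sin th) * ennreal (ro * cos th) * indicator {-pi/4..pi/4} th)"
  proof (cases "th \<in> {-pi/4..pi/4}")
   case True
   have "1 <= 2 * cos th" using less_le_trans[OF half cos_ge[OF True]] by simp
   then have "1 <= ennreal (2 / ro) * ennreal (ro * cos th)"
    using ro by (simp add: ennreal_mult[symmetric] ennreal_1[symmetric] del: ennreal_1)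
   then have "H (ro * sin th) * 1 <= H (ro * sin th) * (ennreal (2 / ro) * ennreal (ro * cos th))"
    by (intro mult_left_mono) auto
   with pt[OF True] show ?thesis using True by (simp add: ac_simps)
  qed simp
 qed
 also have "... = ennreal (2 / ro) * (NN th. H (ro * sin th) * ennreal (ro * cos th) * indicator {-pi/4..pi/4} th)"
  by (rule nn_integral_cmult) measurable
 also have "(NN th. H (ro * sin th) * ennreal (ro * cos th) * indicator {-pi/4..pi/4} th)
   = (NN y. H y * indicator {ro * sin (-pi/4)..ro * sin (pi/4)} y)"
 proof (rule nn_integral_substitution_aux[symmetric])
  show "((%th. ro * sin th) has_real_derivative ro * cos th) (at th)" for th
   by (auto intro!: derivative_eq_intros)
  show "0 <= ro * cos th" if "th \<in> {-pi/4..pi/4}" for th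
   using less_le_trans[OF half cos_ge[OF that]] ro by (intro mult_nonneg_nonneg) auto
 qed (auto intro!: continuous_intros)
 also have "... <= (NN y. H y)"
  by (intro nn_integral_mono) (auto simp: indicator_def)
 also have "... = (NN x. NN y. h x y)"
  unfolding H_def by (rule lborel_pair.Fubini') measurable
 also have "... = (\<integral>\<^sup>+p. h (fst p) (snd p) \<partial>(lborel \<Otimes>\<^sub>M lborel))"
  using lborel.nn_integral_fst[of "%p. h (fst p) (snd p)" "lborel :: real measure"] by (simp add: split_beta')
 also have "... = L1 k ?B + ennreal d * gradL1 g ?B"
  unfolding L1_def gradL1_def h_def lborel_prod by (simp add: nn_integral_add nn_integral_cmult)
 finally have *: "ennreal d * (NN th. indicator {-pi/4..pi/4} th * ennreal \<bar>k (polar ro th)\<bar>)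
   <= ennreal (2 / ro) * (L1 k ?B + ennreal d * gradL1 g ?B)"
  by (simp add: mult_left_mono)
 have "(NN th. indicator {-pi/4..pi/4} th * ennreal \<bar>k (polar ro th)\<bar>)
   = ennreal (1 / d) * (ennreal d * (NN th. indicator {-pi/4..pi/4} th * ennreal \<bar>k (polar ro th)\<bar>))"
  using d by (simp add: mult.assoc[symmetric] ennreal_mult[symmetric])
 also have "... <= ennreal (1 / d) * (ennreal (2 / ro) * (L1 k ?B + ennreal d * gradL1 g ?B))"
  by (intro mult_left_mono *) auto
 also have "... = ennreal (4 / ro\<^sup>2) * (L1 k ?B + ennreal d * gradL1 g ?B)"
  using ro by (simp add: mult.assoc[symmetric] ennreal_mult[symmetric] d_def power2_eq_square)
 finally show ?thesis by (simp add: d_def)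
qed

text \<open>Rotation by a right angle. It permutes the coordinates up to sign, so invariance of
  \<open>lborel\<close> can be checked on boxes, and repeated turns carry one sector around the
  circle.\<close>

definition quarter :: "real \<times> real => real \<times> real" where "quarter p = (- snd p, fst p)"

lemma quarter_polar: "quarter (polar ro th) = polar ro (th + pi / 2)"
 by (simp add: quarter_def polar_def sin_add cos_add)

lemma norm_quarter: "norm (quarter p) = norm p"
 by (cases p) (simp add: quarter_def norm_Pair add.commute)

lemma quarter_borel [measurable]: "quarter \<in> borel_measurable borel"
 unfolding quarter_def by (intro borel_measurable_continuous_onI continuous_intros)

lemma lborel_distr_quarter: "distr lborel borel quarter = lborel"
proof (rule lborel_eqI[symmetric])
 fix l u :: "real \<times> real" assume le: "\<And>b. b \<in> Basis ==> l \<bullet> b <= u \<bullet> b"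
 have "quarter -` box l u = box (snd l, - fst u) (snd u, - fst l)"
  by (auto simp: quarter_def box_def Basis_prod_def inner_prod_def)
 moreover have "fst l <= fst u" "snd l <= snd u"
  using le[of "(1, 0)"] le[of "(0, 1)"] by (auto simp: Basis_prod_def inner_prod_def)
 ultimately show "emeasure (distr lborel borel quarter) (box l u) = (\<Prod>b\<in>Basis. (u - l) \<bullet> b)"
  by (simp add: emeasure_distr emeasure_lborel_box_eq Basis_prod_def prod.union_disjoint prod.insert
    inj_on_def prod.reindex ball_Un mult.commute inner_prod_def)
qed simp

lemma nn_integral_quarter:
 assumes [measurable]: "k \<in> borel_measurable borel"
 shows "(NN x. k (quarter x)) = (NN x. k x)"
 by (subst (2) lborel_distr_quarter[symmetric]) (simp add: nn_integral_distr)

lemma C1_quarter: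
 assumes k: "C1 k g" shows "C1 (%p. k (quarter p)) (%p. (snd (g (quarter p)), - fst (g (quarter p))))"
 unfolding C1_def
proof (intro conjI allI)
 fix p
 have "(quarter has_derivative quarter) (at p)"
  unfolding quarter_def by (auto intro!: derivative_eq_intros)
 moreover have "(k has_derivative (%d. g (quarter p) \<bullet> d)) (at (quarter p))"
  using k unfolding C1_def by blast
 ultimately have "((%p. k (quarter p)) has_derivative (%d. g (quarter p) \<bullet> quarter d)) (at p)"
  by (rule has_derivative_compose)
 then show "((%p. k (quarter p)) has_derivative (%d. (snd (g (quarter p)), - fst (g (quarter p))) \<bullet> d)) (at p)"
  by (simp add: quarter_def inner_prod_def algebra_simps)
next
 have "continuous_on UNIV (%p. g (quarter p))"
  unfolding quarter_def by (intro continuous_on_compose2[OF C1_continuous(2)[OF k]] continuous_intros) auto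
 then show "continuous_on UNIV (%p. (snd (g (quarter p)), - fst (g (quarter p))))"
  by (intro continuous_intros)
qed

lemma trace_sector_rotated:
 assumes "C1 k g" and ro: "ro > 0"
 shows "(NN th. indicator {real j * (pi / 2) - pi/4..real j * (pi / 2) + pi/4} th * ennreal \<bar>k (polar ro th)\<bar>)
  <= ennreal (4 / ro\<^sup>2) * (L1 k (ball 0 ro) + ennreal (ro / 2) * gradL1 g (ball 0 ro))"
 using assms(1)
proof (induction j arbitrary: k g)
 case 0
 then show ?case using trace_sector[OF 0 ro] by simp
next
 case (Suc j)
 have [measurable]: "k \<in> borel_measurable borel" "g \<in> borel_measurable borel"
  using C1_borel[OF Suc.prems] by auto
 let ?g = "%p. (snd (g (quarter p)), - fst (g (quarter p)))"
 have [measurable]: "ball (0::real\<times>real) ro \<in> sets borel" by simp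
 have "(NN th. indicator {real (Suc j) * (pi / 2) - pi/4..real (Suc j) * (pi / 2) + pi/4} th * ennreal \<bar>k (polar ro th)\<bar>)
  = (NN th. indicator {real (Suc j) * (pi / 2) - pi/4..real (Suc j) * (pi / 2) + pi/4} (th + pi / 2) * ennreal \<bar>k (polar ro (th + pi / 2))\<bar>)"
  by (rule nn_integral_lborel_shift[symmetric]) measurable
 also have "... = (NN th. indicator {real j * (pi / 2) - pi/4..real j * (pi / 2) + pi/4} th * ennreal \<bar>k (quarter (polar ro th))\<bar>)"
 proof (intro nn_integral_cong)
  fix th :: real
  have "real (Suc j) * (pi / 2) = real j * (pi / 2) + pi / 2" by (simp add: distrib_right)
  then have "th + pi / 2 \<in> {real (Suc j) * (pi / 2) - pi/4..real (Suc j) * (pi / 2) + pi/4} \<longleftrightarrow>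
    th \<in> {real j * (pi / 2) - pi/4..real j * (pi / 2) + pi/4}"
   unfolding atLeastAtMost_iff by linarith
  then show "indicator {real (Suc j) * (pi / 2) - pi/4..real (Suc j) * (pi / 2) + pi/4} (th + pi / 2) * ennreal \<bar>k (polar ro (th + pi / 2))\<bar> =
    indicator {real j * (pi / 2) - pi/4..real j * (pi / 2) + pi/4} th * ennreal \<bar>k (quarter (polar ro th))\<bar>"
   unfolding quarter_polar indicator_def by simp
 qed
 also have "... <= ennreal (4 / ro\<^sup>2) * (L1 (%p. k (quarter p)) (ball 0 ro) + ennreal (ro / 2) * gradL1 ?g (ball 0 ro))"
  by (rule Suc.IH[OF C1_quarter[OF Suc.prems]])
 also have "L1 (%p. k (quarter p)) (ball 0 ro) = L1 k (ball 0 ro)"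
 proof -
  have "L1 (%p. k (quarter p)) (ball 0 ro) = (NN x. indicator (ball 0 ro) (quarter x) * ennreal \<bar>k (quarter x)\<bar>)"
   unfolding L1_def by (intro nn_integral_cong) (simp add: indicator_def norm_quarter)
  also have "... = L1 k (ball 0 ro)"
   unfolding L1_def by (rule nn_integral_quarter[of "%x. indicator (ball 0 ro) x * ennreal \<bar>k x\<bar>"]) measurable
  finally show ?thesis .
 qed
 also have "gradL1 ?g (ball 0 ro) = gradL1 g (ball 0 ro)"
 proof -
  have "norm (?g x) = norm (g (quarter x))" for x
   by (cases "g (quarter x)") (simp add: norm_Pair add.commute)
  then have "gradL1 ?g (ball 0 ro) = (NN x. indicator (ball 0 ro) (quarter x) * ennreal (norm (g (quarter x))))"
   unfolding gradL1_def by (intro nn_integral_cong) (simp add: indicator_def norm_quarter)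
  also have "... = gradL1 g (ball 0 ro)"
   unfolding gradL1_def by (rule nn_integral_quarter[of "%x. indicator (ball 0 ro) x * ennreal (norm (g x))"]) measurable
  finally show ?thesis .
 qed
 finally show ?case .
qed

text \<open>Five sectors of opening pi/2 centred at j pi/2 cover the half-open parameter interval.
  The constants are 5 * 4/ro^2 * ro = 20/ro and 20/ro * ro/2 = 10.\<close>

lemma trace_circle:
 assumes k: "C1 k g" and ro: "ro > 0"
 shows "ennreal ro * (NN th. indicator {0..<2 * pi} th * ennreal \<bar>k (polar ro th)\<bar>)
  <= ennreal (20 / ro) * L1 k (ball 0 ro) + ennreal 10 * gradL1 g (ball 0 ro)"
proof -
 have [measurable]: "k \<in> borel_measurable borel" using C1_borel[OF k] by auto
 let ?S = "%j::nat. {real j * (pi / 2) - pi/4..real j * (pi / 2) + pi/4}"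
 let ?b = "ennreal (4 / ro\<^sup>2) * (L1 k (ball 0 ro) + ennreal (ro / 2) * gradL1 g (ball 0 ro))"
 \<comment> \<open>The sector j = 0 starts at -pi/4, so four sectors end at 7 pi/4; the fifth,
   around 2 pi, covers the remaining eighth of the circle.\<close>
 have cover: "indicator {0..<2 * pi} th * e <= (\<Sum>j<5. indicator (?S j) th * e)" for th :: real and e :: ennreal
 proof (cases "th \<in> {0..<2 * pi}")
  case True
  then have "th \<in> ?S 0 \<or> th \<in> ?S 1 \<or> th \<in> ?S 2 \<or> th \<in> ?S 3 \<or> th \<in> ?S 4"
   by (simp add: algebra_simps) linarith
  then have "\<exists>j\<in>{0, 1, 2, 3, 4}. th \<in> ?S j" by blast
  then obtain j where j: "j \<in> {0, 1, 2, 3, 4}" "th \<in> ?S j" by blast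
  then have "j < 5" by auto
  note j = this j(2)
  have "indicator {0..<2 * pi} th * e = indicator (?S j) th * e" using True j by simp
  also have "... <= (\<Sum>j<5. indicator (?S j) th * e)"
   using j by (intro member_le_sum) auto
  finally show ?thesis .
 qed simp
 have "(NN th. indicator {0..<2 * pi} th * ennreal \<bar>k (polar ro th)\<bar>)
   <= (NN th. (\<Sum>j<5. indicator (?S j) th * ennreal \<bar>k (polar ro th)\<bar>))"
  by (intro nn_integral_mono cover)
 also have "... = (\<Sum>j<5. NN th. indicator (?S j) th * ennreal \<bar>k (polar ro th)\<bar>)"
  by (rule nn_integral_sum) measurable
 also have "... <= (\<Sum>j<(5::nat). ?b)"
  by (intro sum_mono trace_sector_rotated[OF k ro])
 also have "... = ennreal 5 * ?b" by simp
 finally have "ennreal ro * (NN th. indicator {0..<2 * pi} th * ennreal \<bar>k (polar ro th)\<bar>) <= ennreal ro * (ennreal 5 * ?b)"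
  by (intro mult_left_mono) auto
 also have "... = (ennreal ro * ennreal 5 * ennreal (4 / ro\<^sup>2)) * L1 k (ball 0 ro) +
   (ennreal ro * ennreal 5 * ennreal (4 / ro\<^sup>2) * ennreal (ro / 2)) * gradL1 g (ball 0 ro)"
  by (simp only: distrib_left mult.assoc)
 also have "ennreal ro * ennreal 5 * ennreal (4 / ro\<^sup>2) = ennreal (20 / ro)"
  using ro by (simp add: ennreal_mult[symmetric] power2_eq_square del: ennreal_numeral)
 also have "ennreal (20 / ro) * ennreal (ro / 2) = ennreal 10"
  using ro by (simp add: ennreal_mult[symmetric] del: ennreal_numeral)
 finally show ?thesis .
qed

lemma measure_disc: "ro >= 0 ==> measure lborel (ball (x :: real \<times> real) ro) = pi * ro\<^sup>2"
 using content_ball[of ro x] by (simp add: unit_ball_vol_2 power2_eq_square)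

text \<open>Replacing k by k - k y for a fixed y in the disc turns the left-hand side, averaged over
  y, into traces of functions that vanish at y. \<open>trace_circle\<close> bounds them by L1 norms
  of k - k y, whose integral over y is an oscillation integral, controlled by
  \<open>osc_ball\<close>.\<close>

lemma circle_mean:
 assumes k: "C1 k g" and ro: "ro > 0" and a: "continuous_on UNIV a" "\<And>th. th \<in> {0..<2 * pi} ==> \<bar>a th\<bar> <= M"
 shows "ennreal \<bar>ro * (LBINT th. indicator {0..<2 * pi} th * (a th * k (polar ro th)))
   - ro * (LBINT th. indicator {0..<2 * pi} th * a th) / (pi * ro\<^sup>2) * (LBINT y. indicator (ball 0 ro) y * k y)\<bar>
  <= ennreal (170 * M) * gradL1 g (ball 0 ro)"
proof -
 have M: "M >= 0" using a(2)[of 0] by (simp add: order_trans[OF abs_ge_zero])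
 let ?B = "ball (0 :: real \<times> real) ro"
 let ?I = "{0..<2 * pi}"
 have [measurable]: "?B \<in> sets borel" by simp
 have [measurable]: "k \<in> borel_measurable borel" "a \<in> borel_measurable borel"
  using C1_borel[OF k] a(1) by (auto intro: borel_measurable_continuous_onI)
 have mB: "emeasure lborel ?B = ennreal (pi * ro\<^sup>2)"
  using emeasure_lborel_ball_finite[of 0 ro] measure_disc[of ro 0] ro
  by (metis emeasure_eq_ennreal_measure infinity_ennreal_def less_imp_le less_irrefl)
 have P: "pi * ro\<^sup>2 > 0" using ro by simp
 have ck: "continuous_on UNIV k" using C1_continuous[OF k] by simp
 have c2: "continuous_on UNIV (%th. a th * k (polar ro th))"
  by (intro continuous_intros a continuous_on_compose2[OF ck continuous_polar]) auto
 have iI: "integrable lborel (%th. indicator ?I th *\<^sub>R q th)" if cq: "continuous_on UNIV q" for q :: "real => real"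
 proof -
  have bI: "bounded ?I" by simp
  obtain B where B: "\<And>x. x \<in> ?I ==> norm (q x) <= B"
   using bounded_continuous_bound[OF bI cq] by blast
  show ?thesis
   using B cq by (intro integrableI_bounded_set_indicator[where B = B])
    (auto intro: borel_measurable_continuous_onI)
 qed
 obtain Bk where Bk: "\<And>x. x \<in> ?B ==> norm (k x) <= Bk"
  using bounded_continuous_bound[OF bounded_ball ck] by blast
 have iB: "integrable lborel (%y. indicator ?B y *\<^sub>R k y)"
  using Bk mB by (intro integrableI_bounded_set_indicator[where B = Bk]) auto
 have iBc: "integrable lborel (%y. indicator ?B y *\<^sub>R c)" for c :: real
  using mB by (intro integrableI_bounded_set_indicator[where B = "\<bar>c\<bar>"]) auto
 define A where "A = (LBINT th. indicator ?I th * a th)"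
 define Z where "Z = (LBINT th. indicator ?I th * (a th * k (polar ro th)))"
 define K where "K = (LBINT y. indicator ?B y * k y)"
 have 1: "Z - A * k y = (LBINT th. indicator ?I th * (a th * (k (polar ro th) - k y)))" for y
 proof -
  have "(LBINT th. indicator ?I th * (a th * (k (polar ro th) - k y)))
    = (LBINT th. indicator ?I th * (a th * k (polar ro th)) - (indicator ?I th * a th) * k y)"
   by (simp add: algebra_simps)
  also have "... = Z - A * k y"
   unfolding Z_def A_def using iI[OF c2] iI[OF a(1)]
   by (subst Bochner_Integration.integral_diff) auto
  finally show ?thesis by simp
 qed
 have 2: "ennreal \<bar>ro * (Z - A * k y)\<bar> <= ennreal M * (ennreal (20 / ro) * L1 (%x. k x - k y) ?B + ennreal 10 * gradL1 g ?B)" for y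
 proof -
  have c: "continuous_on UNIV (%th. a th * (k (polar ro th) - k y))"
   by (intro continuous_intros a continuous_on_compose2[OF ck continuous_polar]) auto
  have "ennreal \<bar>ro * (Z - A * k y)\<bar> = ennreal ro * ennreal (norm (LBINT th. indicator ?I th * (a th * (k (polar ro th) - k y))))"
   using ro by (simp add: 1 abs_mult ennreal_mult)
  also have "... <= ennreal ro * (NN th. ennreal (norm (indicator ?I th * (a th * (k (polar ro th) - k y)))))"
   using iI[OF c] by (intro mult_left_mono integral_norm_bound_ennreal) auto
  also have "... <= ennreal ro * (NN th. ennreal M * (indicator ?I th * ennreal \<bar>k (polar ro th) - k y\<bar>))"
  proof (intro mult_left_mono nn_integral_mono)
   fix th :: real
   show "ennreal (norm (indicator ?I th * (a th * (k (polar ro th) - k y)))) <= ennreal M * (indicator ?I th * ennreal \<bar>k (polar ro th) - k y\<bar>)"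
    using a(2)[of th] M
    by (auto simp: indicator_def abs_mult ennreal_mult[symmetric] intro!: ennreal_leI mult_right_mono)
  qed simp
  also have "... = ennreal M * (ennreal ro * (NN th. indicator ?I th * ennreal \<bar>k (polar ro th) - k y\<bar>))"
   by (subst nn_integral_cmult) (auto simp: ac_simps)
  also have "... <= ennreal M * (ennreal (20 / ro) * L1 (%x. k x - k y) ?B + ennreal 10 * gradL1 g ?B)"
  proof (intro mult_left_mono)
   have "C1 (%x. k x - k y) (%x. g x - 0)"
    by (intro C1_diff k) (auto simp: C1_def)
   then have "C1 (%x. k x - k y) g" by simp
   from trace_circle[OF this ro]
   show "ennreal ro * (NN th. indicator ?I th * ennreal \<bar>k (polar ro th) - k y\<bar>)
    <= ennreal (20 / ro) * L1 (%x. k x - k y) ?B + ennreal 10 * gradL1 g ?B" .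
  qed simp
  finally show ?thesis .
 qed
 let ?d = "ro * Z - ro * A / (pi * ro\<^sup>2) * K"
 have "(LBINT y. indicator ?B y * (ro * (Z - A * k y))) = (LBINT y. indicator ?B y *\<^sub>R (ro * Z) - (ro * A) * (indicator ?B y *\<^sub>R k y))"
  by (simp add: algebra_simps)
 also have "... = (pi * ro\<^sup>2) * (ro * Z) - (ro * A) * K"
  using iB iBc[of "ro * Z"] ro measure_disc[of ro 0] by (simp add: K_def)
 also have "... = (pi * ro\<^sup>2) * ?d" using ro by (simp add: field_simps)
 finally have 3: "(pi * ro\<^sup>2) * ?d = (LBINT y. indicator ?B y * (ro * (Z - A * k y)))" by simp
 have int3: "integrable lborel (%y. indicator ?B y * (ro * (Z - A * k y)))"
 proof -
  have "integrable lborel (%y. indicator ?B y *\<^sub>R (ro * Z) - (ro * A) * (indicator ?B y *\<^sub>R k y))"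
   using iB iBc by auto
  then show ?thesis by (simp add: algebra_simps)
 qed
 have "ennreal (pi * ro\<^sup>2) * ennreal \<bar>?d\<bar> = ennreal (norm (LBINT y. indicator ?B y * (ro * (Z - A * k y))))"
 proof -
  have "(pi * ro\<^sup>2) * \<bar>?d\<bar> = \<bar>(pi * ro\<^sup>2) * ?d\<bar>"
   by (subst abs_mult) (simp only: abs_of_pos[OF P])
  then show ?thesis
   unfolding 3[symmetric] real_norm_def using P by (simp only: ennreal_mult[symmetric] abs_ge_zero less_imp_le)
 qed
 also have "... <= (NN y. ennreal (norm (indicator ?B y * (ro * (Z - A * k y)))))"
  by (rule integral_norm_bound_ennreal[OF int3])
 also have "... <= (NN y. ennreal M * (ennreal (20 / ro) * (indicator ?B y * L1 (%x. k x - k y) ?B) + indicator ?B y * (ennreal 10 * gradL1 g ?B)))"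
 proof (rule nn_integral_mono)
  fix y
  show "ennreal (norm (indicator ?B y * (ro * (Z - A * k y)))) <= ennreal M * (ennreal (20 / ro) * (indicator ?B y * L1 (%x. k x - k y) ?B) + indicator ?B y * (ennreal 10 * gradL1 g ?B))"
   using 2[of y] by (cases "y \<in> ?B") (auto simp del: ennreal_numeral)
 qed
 also have "... = ennreal M * (ennreal (20 / ro) * (NN y. indicator ?B y * L1 (%x. k x - k y) ?B) + ennreal (pi * ro\<^sup>2) * (ennreal 10 * gradL1 g ?B))"
  unfolding L1_def by (simp add: nn_integral_cmult nn_integral_add nn_integral_multc mB)
 also have "(NN y. indicator ?B y * L1 (%x. k x - k y) ?B) = osc k ?B ?B"
  unfolding osc_def L1_def by (simp add: nn_integral_cmult[symmetric] abs_minus_commute)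
 also have "ennreal M * (ennreal (20 / ro) * osc k ?B ?B + ennreal (pi * ro\<^sup>2) * (ennreal 10 * gradL1 g ?B))
   <= ennreal M * (ennreal (20 / ro) * (ennreal (2 * ro * measure lborel (ball (0::real\<times>real) (2 * ro))) * gradL1 g ?B) + ennreal (pi * ro\<^sup>2) * (ennreal 10 * gradL1 g ?B))"
  by (intro mult_left_mono add_mono osc_ball[OF k]) auto
 also have "... = (ennreal M * (ennreal (20 / ro) * ennreal (2 * ro * measure lborel (ball (0::real\<times>real) (2 * ro))) + ennreal (pi * ro\<^sup>2) * ennreal 10)) * gradL1 g ?B"
  by (simp only: distrib_left distrib_right mult.assoc)
 also have "ennreal M * (ennreal (20 / ro) * ennreal (2 * ro * measure lborel (ball (0::real\<times>real) (2 * ro))) + ennreal (pi * ro\<^sup>2) * ennreal 10)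
   = ennreal (M * (20 / ro * (2 * ro * (pi * (2 * ro)\<^sup>2)) + pi * ro\<^sup>2 * 10))"
  using M ro measure_disc[of "2 * ro" 0]
  by (simp add: ennreal_mult[symmetric] ennreal_plus[symmetric] del: ennreal_plus ennreal_numeral)
 \<comment> \<open>Here 160 = 20 * 2 * 4 comes from the oscillation over the disc and 10 from the
   gradient term of the trace bound.\<close>
 also have "M * (20 / ro * (2 * ro * (pi * (2 * ro)\<^sup>2)) + pi * ro\<^sup>2 * 10) = (pi * ro\<^sup>2) * (170 * M)"
  using ro by (simp add: field_simps power2_eq_square)
 finally have 4: "ennreal (pi * ro\<^sup>2) * ennreal \<bar>?d\<bar> <= ennreal (pi * ro\<^sup>2) * (ennreal (170 * M) * gradL1 g ?B)"
  using P M by (simp add: ennreal_mult mult.assoc)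
 have "ennreal \<bar>?d\<bar> = ennreal (1 / (pi * ro\<^sup>2)) * (ennreal (pi * ro\<^sup>2) * ennreal \<bar>?d\<bar>)"
  using P ro by (simp add: mult.assoc[symmetric] ennreal_mult[symmetric])
 also have "... <= ennreal (1 / (pi * ro\<^sup>2)) * (ennreal (pi * ro\<^sup>2) * (ennreal (170 * M) * gradL1 g ?B))"
  by (intro mult_left_mono 4) auto
 also have "... = ennreal (170 * M) * gradL1 g ?B"
  using P ro by (simp add: mult.assoc[symmetric] ennreal_mult[symmetric])
 finally show ?thesis unfolding Z_def A_def K_def .
qed

section \<open>Coordinates along a cylinder\<close>

lemma point_nth [simp]: "point i t y $ i = t"
 using exhaust_3[of i] by (auto simp: point_def)

lemma rest_point [simp]: "rest i (point i t y) = y"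
 using exhaust_3[of i] by (auto simp: point_def rest_def)

lemma point_rest [simp]: "point i (x $ i) (rest i x) = x"
 using exhaust_3[of i] by (auto simp: point_def rest_def vec_eq_iff forall_3)

lemma inner_point: "x \<bullet> point i t y = x $ i * t + rest i x \<bullet> y"
 using exhaust_3[of i] by (auto simp: point_def rest_def inner_vec_def sum_3 inner_prod_def)

lemma norm_point: "(norm (point i t y))\<^sup>2 = t\<^sup>2 + (norm y)\<^sup>2"
 unfolding power2_norm_eq_inner inner_point by (simp add: power2_eq_square)

lemma norm_point_0 [simp]: "norm (point i 0 y) = norm y"
 using norm_point[of i 0 y] by (simp add: power2_eq_iff_nonneg)

lemma norm_rest_le: "norm (rest i x) <= norm x"
proof (rule power2_le_imp_le)
 show "(norm (rest i x))\<^sup>2 <= (norm x)\<^sup>2"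
  using norm_point[of i "x $ i" "rest i x"] by simp
qed simp

lemma linear_point: "linear (%p. point i (fst p) (snd p))"
 using exhaust_3[of i] by (intro linearI) (auto simp: point_def vec_eq_iff forall_3)

lemma linear_rest: "linear (rest i)"
 using exhaust_3[of i] by (intro linearI) (auto simp: rest_def)

lemma continuous_on_point [continuous_intros]:
 "continuous_on S f ==> continuous_on S g ==> continuous_on S (%x. point i (f x) (g x))"
 using bounded_linear.continuous_on[OF linear_point[unfolded linear_conv_bounded_linear], of S "%x. (f x, g x)"]
 by (simp add: continuous_on_Pair)

lemma continuous_on_rest [continuous_intros]: "continuous_on S f ==> continuous_on S (%x. rest i (f x))"
 using bounded_linear.continuous_on[OF linear_rest[unfolded linear_conv_bounded_linear]] .

lemma point_diff: "point i s y - point i t z = point i (s - t) (y - z)"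
 using linear_diff[OF linear_point, of i "(s, y)" "(t, z)"] by simp

lemma point_add: "point i s y + point i t z = point i (s + t) (y + z)"
 using linear_add[OF linear_point, of i "(s, y)" "(t, z)"] by simp

lemma point_scaleR: "c *\<^sub>R point i t y = point i (c * t) (c *\<^sub>R y)"
 using linear_cmul[OF linear_point, of i c "(t, y)"] by simp

lemma point_0 [simp]: "point i 0 0 = 0"
 using linear_0[OF linear_point, of i] by simp

lemma rest_scaleR: "rest i (c *\<^sub>R x) = c *\<^sub>R rest i x"
 using linear_cmul[OF linear_rest] .

lemma abs_nth_le_norm_rest: "j \<noteq> i ==> \<bar>x $ j\<bar> <= norm (rest i x)"
proof -
 have "\<bar>a\<bar> <= norm (a, b)" "\<bar>b\<bar> <= norm (a, b)" for a b :: real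
  using norm_fst_le[of a b] norm_snd_le[of b a] by auto
 then show "j \<noteq> i ==> ?thesis"
  using exhaust_3[of i] exhaust_3[of j] by (elim disjE) (simp_all add: rest_def)
qed

lemma has_derivative_point: "((%y. point i t y) has_derivative (%d. point i 0 d)) (at y)"
proof -
 have 1: "((%p. point i (fst p) (snd p)) has_derivative (%p. point i (fst p) (snd p))) (at (t, y))"
  by (rule bounded_linear_imp_has_derivative[OF linear_point[unfolded linear_conv_bounded_linear]])
 have 2: "((%y. (t, y)) has_derivative (%d. (0, d))) (at y)"
  by (auto intro!: derivative_eq_intros)
 from has_derivative_compose[OF 2 1] show ?thesis by simp
qed

lemma C1_section:
 assumes "C1 w g" shows "C1 (%y. w (point i t y)) (%y. rest i (g (point i t y)))"
 unfolding C1_def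
proof (intro conjI allI)
 fix y
 have "(w has_derivative (%d. g (point i t y) \<bullet> d)) (at (point i t y))"
  using assms by (simp add: C1_def)
 from has_derivative_compose[OF has_derivative_point this]
 show "((%y. w (point i t y)) has_derivative (%d. rest i (g (point i t y)) \<bullet> d)) (at y)"
  by (simp add: inner_point)
next
 show "continuous_on UNIV (%y. rest i (g (point i t y)))"
  by (intro continuous_intros continuous_on_compose2[OF C1_continuous(2)[OF assms]]) auto
qed

lemma C1_axial:
 assumes "C1 w g" shows "((%t. w (point i t y)) has_real_derivative g (point i t y) $ i) (at t)"
proof -
 show ?thesis
  using C1_line[OF assms, of "point i 0 y" "point i 1 0" t]
  by (simp add: inner_point point_scaleR point_add)
qed

lemma prod_Basis_vec3: "(\<Prod>b\<in>Basis. (v :: real^3) \<bullet> b) = v $ 1 * v $ 2 * v $ 3"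
proof -
 have "(\<Prod>b\<in>Basis. v \<bullet> b) = (\<Prod>b\<in>range (%j. axis j 1). v \<bullet> b)"
  by (rule prod.cong) (auto simp: Basis_vec_def)
 also have "... = (\<Prod>j\<in>UNIV. v \<bullet> axis j 1)"
  by (subst prod.reindex) (auto simp: inj_on_def axis_eq_axis)
 also have "... = v $ 1 * v $ 2 * v $ 3"
  unfolding UNIV_3 by (simp add: inner_axis)
 finally show ?thesis .
qed

lemma point_borel [measurable]: "(%(t, y). point i t y) \<in> borel_measurable (borel \<Otimes>\<^sub>M borel)"
 unfolding borel_prod split_beta by (intro borel_measurable_continuous_onI continuous_intros)

lemma rest_borel [measurable]: "rest i \<in> borel_measurable borel"
 by (intro borel_measurable_continuous_onI continuous_on_rest continuous_on_id)

text \<open>\<open>point i\<close> only permutes coordinates, so preimages of boxes are boxes of the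
  same volume.\<close>

lemma lborel_distr_point: "distr (lborel \<Otimes>\<^sub>M lborel) borel (%(t, y). point i t y) = lborel"
proof (rule lborel_eqI[symmetric])
 fix a b :: "real^3" assume le: "\<And>c. c \<in> Basis ==> a \<bullet> c <= b \<bullet> c"
 have le': "a $ j <= b $ j" for j
  using le[of "axis j 1"] by (simp add: inner_axis axis_in_Basis_iff)
 have box2: "p \<in> box q r \<longleftrightarrow> fst q < fst p \<and> fst p < fst r \<and> snd q < snd p \<and> snd p < snd r"
  for p q r :: "real \<times> real"
  by (auto simp: box_def Basis_prod_def inner_prod_def)
 have "(%(t, y). point i t y) -` box a b = {a $ i<..<b $ i} \<times> box (rest i a) (rest i b)"
 proof -
  have "point i t y \<in> box a b \<longleftrightarrow> (t, y) \<in> {a $ i<..<b $ i} \<times> box (rest i a) (rest i b)" for t y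
   using exhaust_3[of i] by (auto simp: mem_box_cart forall_3 box2 point_def rest_def)
  then show ?thesis by auto
 qed
 then have "emeasure (distr (lborel \<Otimes>\<^sub>M lborel) borel (%(t, y). point i t y)) (box a b) =
   emeasure lborel {a $ i<..<b $ i} * emeasure lborel (box (rest i a) (rest i b))"
  by (simp add: emeasure_distr lborel.emeasure_pair_measure_Times space_pair_measure)
 also have "emeasure lborel (box (rest i a) (rest i b)) = ennreal ((fst (rest i b) - fst (rest i a)) * (snd (rest i b) - snd (rest i a)))"
  using le' by (subst emeasure_lborel_box)
   (auto simp: Basis_prod_def inner_prod_def rest_def prod.union_disjoint)
 also have "emeasure lborel {a $ i<..<b $ i} * ... = ennreal ((b $ i - a $ i) * ((fst (rest i b) - fst (rest i a)) * (snd (rest i b) - snd (rest i a))))"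
  using le' by (subst ennreal_mult) (auto simp: rest_def)
 also have "(b $ i - a $ i) * ((fst (rest i b) - fst (rest i a)) * (snd (rest i b) - snd (rest i a))) = (\<Prod>c\<in>Basis. (b - a) \<bullet> c)"
  using exhaust_3[of i] by (auto simp: prod_Basis_vec3 rest_def)
 finally show "emeasure (distr (lborel \<Otimes>\<^sub>M lborel) borel (%(t, y). point i t y)) (box a b) = ennreal (\<Prod>c\<in>Basis. (b - a) \<bullet> c)" .
qed simp

lemma nn_integral_point:
 assumes [measurable]: "k \<in> borel_measurable borel"
 shows "(NN x. k x) = (NN t. NN y. k (point i t y))"
  and "(NN x. k x) = (NN y. NN t. k (point i t y))"
proof -
 let ?p = "%(t, y). point i t y"
 have m: "(%p. k (?p p)) \<in> borel_measurable (lborel \<Otimes>\<^sub>M lborel)" by measurable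
 then have [measurable]: "(%(t, y). k (point i t y)) \<in> borel_measurable (borel \<Otimes>\<^sub>M borel)"
  by (simp add: case_prod_beta' cong: measurable_cong_sets)
 have "(NN x. k x) = (\<integral>\<^sup>+x. k x \<partial>distr (lborel \<Otimes>\<^sub>M lborel) borel ?p)"
  by (simp only: lborel_distr_point)
 also have "... = (\<integral>\<^sup>+p. k (?p p) \<partial>(lborel \<Otimes>\<^sub>M lborel))"
  by (rule nn_integral_distr) measurable
 also have "... = (NN t. NN y. k (point i t y))"
  using lborel.nn_integral_fst[OF m] by simp
 finally show 1: "(NN x. k x) = (NN t. NN y. k (point i t y))" .
 have "(NN t. NN y. k (point i t y)) = (NN y. NN t. k (point i t y))"
  by (rule lborel_pair.Fubini'[symmetric]) measurable
 with 1 show "(NN x. k x) = (NN y. NN t. k (point i t y))" by simp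
qed

lemma integral_point:
 fixes k :: "real^3 => real"
 assumes k: "integrable lborel k"
 shows integrable_point: "integrable (lborel \<Otimes>\<^sub>M lborel) (%(t, y). k (point i t y))"
  and "(LBINT x. k x) = (LBINT t. LBINT y. k (point i t y))"
  and "(LBINT x. k x) = (LBINT y. LBINT t. k (point i t y))"
  and "integrable lborel (%t. LBINT y. k (point i t y))"
  and "integrable lborel (%y. LBINT t. k (point i t y))"
  and "AE t in lborel. integrable lborel (%y. k (point i t y))"
  and "AE y in lborel. integrable lborel (%t. k (point i t y))"
proof -
 note [measurable] = borel_measurable_integrable[OF k]
 let ?p = "%(t, y). point i t y"
 have m: "?p \<in> measurable (lborel \<Otimes>\<^sub>M lborel) borel" by measurable
 have "integrable (distr (lborel \<Otimes>\<^sub>M lborel) borel ?p) k"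
  using k by (simp only: lborel_distr_point)
 then have i': "integrable (lborel \<Otimes>\<^sub>M lborel) (%p. k (?p p))"
  using integrable_distr_eq[OF m, of k] by simp
 then show i: "integrable (lborel \<Otimes>\<^sub>M lborel) (%(t, y). k (point i t y))"
  by (simp only: case_prod_beta')
 have "(LBINT x. k x) = (\<integral>x. k x \<partial>distr (lborel \<Otimes>\<^sub>M lborel) borel ?p)"
  by (simp only: lborel_distr_point)
 also have "... = (\<integral>p. k (?p p) \<partial>(lborel \<Otimes>\<^sub>M lborel))"
  by (rule integral_distr[OF m]) measurable
 finally have e: "(LBINT x. k x) = (\<integral>p. k (?p p) \<partial>(lborel \<Otimes>\<^sub>M lborel))" .
 show "(LBINT x. k x) = (LBINT t. LBINT y. k (point i t y))"
  using lborel_pair.integral_fst[OF i] e by (simp add: case_prod_beta')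
 show "(LBINT x. k x) = (LBINT y. LBINT t. k (point i t y))"
  using lborel_pair.integral_snd[OF i] e by (simp add: case_prod_beta')
 show "integrable lborel (%t. LBINT y. k (point i t y))"
  using lborel_pair.integrable_fst[OF i] .
 show "integrable lborel (%y. LBINT t. k (point i t y))"
  using lborel_pair.integrable_snd[OF i] .
 show "AE t in lborel. integrable lborel (%y. k (point i t y))"
  using lborel_pair.AE_integrable_fst[OF i] .
 show "AE y in lborel. integrable lborel (%t. k (point i t y))"
  using lborel_pair.AE_integrable_snd[OF i] .
qed

section \<open>Geometry of the thin domain\<close>

text \<open>The translation of \<open>lipschitz_boundary_local\<close> moves every nearby point of S
  along a segment in S into one common ball.\<close>

lemma lipschitz_boundary_connected_near:
 fixes S :: "'a::euclidean_space set"
 assumes S: "open S" "lipschitz_boundary S" and p: "p \<in> closure S"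
 obtains N where "open N" "p \<in> N" "\<And>x y. x \<in> S \<inter> N ==> y \<in> S \<inter> N ==> connected_component S x y"
proof (cases "p \<in> S")
 case True
 with S(1) obtain r where r: "r > 0" "ball p r \<subseteq> S" by (rule openE)
 have "connected_component S x y" if "x \<in> ball p r" "y \<in> ball p r" for x y
  using that by (rule connected_componentI[OF connected_ball r(2)])
 with r show ?thesis by (intro that[of "ball p r"]) auto
next
 case False
 then have "p \<in> frontier S" using p S(1) by (simp add: frontier_def interior_open)
 then obtain r z where rz: "r > 0" "ball (p + z) r \<subseteq> S"
  "\<And>x s. x \<in> S \<inter> ball p r ==> 0 <= s ==> s <= 1 ==> x + s *\<^sub>R z \<in> S"
  using lipschitz_boundary_local[OF S] by blast
 have c: "connected_component S x (p + z)" if x: "x \<in> S \<inter> ball p r" for x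
 proof -
  have "closed_segment x (x + z) \<subseteq> S"
  proof
   fix q assume "q \<in> closed_segment x (x + z)"
   then obtain s where s: "0 <= s" "s <= 1" "q = (1 - s) *\<^sub>R x + s *\<^sub>R (x + z)"
    by (auto simp: in_segment)
   then have "q = x + s *\<^sub>R z" by (simp add: algebra_simps)
   with rz(3)[OF x s(1,2)] show "q \<in> S" by simp
  qed
  then have "connected_component S x (x + z)"
   by (rule connected_componentI[OF connected_segment]) auto
  moreover have "x + z \<in> ball (p + z) r" using x by (simp add: dist_norm)
  then have "connected_component S (x + z) (p + z)"
   using rz(1) by (intro connected_componentI[OF connected_ball rz(2)]) simp_all
  ultimately show ?thesis by (rule connected_component_trans)
 qed
 show ?thesis
 proof (rule that[of "ball p r"])
  show "connected_component S x y" if "x \<in> S \<inter> ball p r" "y \<in> S \<inter> ball p r" for x y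
   using c[OF that(1)] connected_component_sym[OF c[OF that(2)]] by (rule connected_component_trans)
 qed (use rz(1) in auto)
qed

text \<open>\<open>e0\<close> is a fixed reference value of eps, and \<open>R\<close> bounds at once
  the node radius, the tube radii and l. The condition \<open>e0 * (2 * R + 1) <= 1\<close> makes
  the reference domain, scaled by eps/e0, reach further along the axes than 2 eps R.\<close>

locale junction =
 fixes l R e0 :: real and h :: "3 => real" and \<Xi> :: "(real^3) set"
 assumes l: "0 < l" and h: "\<And>i. 0 < h i" and hR: "\<And>i. h i <= R" and lR: "l <= R"
  and \<Xi>: "open \<Xi>" "connected \<Xi>" and \<Xi>R: "\<And>\<xi>. \<xi> \<in> \<Xi> ==> norm \<xi> <= R"
  and disc: "\<And>i. {\<xi>. \<xi> $ i = l \<and> norm (rest i \<xi>) < h i} \<subseteq> frontier \<Xi>"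
  and e0: "0 < e0" "e0 * (2 * R + 1) <= 1"
  and lip: "lipschitz_boundary (thin_domain l h \<Xi> e0)"
  and dis_node: "\<And>ep i. 0 < ep ==> ep <= e0 ==> node \<Xi> ep \<inter> cylinder l h ep i = {}"
  and dis_cyl: "\<And>ep i j. 0 < ep ==> ep <= e0 ==> i \<noteq> j ==> cylinder l h ep i \<inter> cylinder l h ep j = {}"
begin

abbreviation "Om ep \<equiv> thin_domain l h \<Xi> ep"
abbreviation "cyl ep i \<equiv> cylinder l h ep i"
text \<open>The whole domain for the reference value \<open>e0\<close>, scaled down. It contains the
  node together with the first part of each tube, up to axial coordinate eps/e0, and is similar to
  one fixed Lipschitz domain, while the node alone is not assumed to be Lipschitz. This is where the
  Poincare inequality is used.\<close>

definition "core ep = (%x. (ep / e0) *\<^sub>R x) ` Om e0"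

section \<open>Tubes, node and rescaled core\<close>

lemma R_pos: "0 < R" using l lR by simp

lemma e0_less: "0 < ep ==> ep <= e0 ==> 2 * (ep * R) < ep / e0" "0 < ep ==> ep <= e0 ==> ep / e0 <= 1"
proof -
 assume e: "0 < ep" "ep <= e0"
 have "e0 * (2 * R) < 1" using e0 by (simp add: distrib_left)
 then have "ep * (e0 * (2 * R)) < ep * 1" using e by (intro mult_strict_left_mono)
 then show "2 * (ep * R) < ep / e0" using e0 by (simp add: pos_less_divide_eq ac_simps)
 show "ep / e0 <= 1" using e e0 by simp
qed

lemma open_cyl: "open (cyl ep i)"
 unfolding cylinder_def by (intro open_Collect_conj open_Collect_less continuous_intros)

lemma open_Om: "open (Om ep)" by (simp add: thin_domain_def)

lemma cyl_subset: "cyl ep i \<subseteq> Om ep"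
 unfolding thin_domain_def
 by (rule interior_maximal[OF _ open_cyl]) (use closure_subset[of "cyl ep i"] in auto)

lemma node_open: "ep > 0 ==> open (node \<Xi> ep)"
 unfolding node_def using \<Xi>(1) open_scaling[of ep \<Xi>] by simp

lemma node_subset: "ep > 0 ==> node \<Xi> ep \<subseteq> Om ep"
 unfolding thin_domain_def
 by (rule interior_maximal[OF _ node_open]) (use closure_subset[of "node \<Xi> ep"] in auto)

lemma convex_cyl: "convex (cyl ep i)"
proof -
 have "cyl ep i = ({x. x $ i > ep * l} \<inter> {x. x $ i < 1}) \<inter> rest i -` ball 0 (ep * h i)"
  by (auto simp: cylinder_def)
 moreover have "convex {x::real^3. x $ i > ep * l}" "convex {x::real^3. x $ i < 1}"
  using convex_halfspace_gt[of "ep * l" "point i 1 0"] convex_halfspace_lt[of "point i 1 0" 1]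
  by (simp_all add: inner_commute[of "point i 1 0"] inner_point)
 ultimately show ?thesis
  using convex_linear_vimage[OF linear_rest convex_ball, of i 0 "ep * h i"] by (auto intro!: convex_Int)
qed

lemma closure_cyl: "x \<in> closure (cyl ep i) ==> ep * l <= x $ i \<and> x $ i <= 1 \<and> norm (rest i x) <= ep * h i"
proof -
 have "closed {x. ep * l <= x $ i \<and> x $ i <= 1 \<and> norm (rest i x) <= ep * h i}"
  by (intro closed_Collect_conj closed_Collect_le continuous_intros)
 then have "closure (cyl ep i) \<subseteq> {x. ep * l <= x $ i \<and> x $ i <= 1 \<and> norm (rest i x) <= ep * h i}"
  by (intro closure_minimal) (auto simp: cylinder_def)
 then show "x \<in> closure (cyl ep i) ==> ?thesis" by blast
qed

lemma closure_node: "ep > 0 ==> x \<in> closure (node \<Xi> ep) ==> norm x <= ep * R"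
proof -
 assume e: "ep > 0" and x: "x \<in> closure (node \<Xi> ep)"
 have "closure (node \<Xi> ep) \<subseteq> cball 0 (ep * R)"
  using e \<Xi>R by (intro closure_minimal) (auto simp: node_def)
 with x show ?thesis by auto
qed

lemma Om_cases:
 assumes "x \<in> Om ep"
 obtains "x \<in> closure (node \<Xi> ep)" | i where "x \<in> closure (cyl ep i)"
 using subsetD[OF interior_subset assms[unfolded thin_domain_def]] that by auto

text \<open>The source f is smooth only in a neighbourhood of the three axes; this places the whole
  domain in that neighbourhood once eps R is small.\<close>

lemma Om_near_axis:
 assumes e: "0 < ep" "ep <= e0" and x: "x \<in> Om ep"
 obtains i t where "t \<in> {0..1}" "norm (x - point i t 0) <= ep * R"
 using x
proof (cases rule: Om_cases)
 case 1
 then show ?thesis using closure_node[OF e(1) 1] by (intro that[of 0 1]) auto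
next
 case (2 i)
 have "x - point i (x $ i) 0 = point i 0 (rest i x)"
  using point_diff[of i "x $ i" "rest i x" "x $ i" 0] by simp
 then have "norm (x - point i (x $ i) 0) <= ep * h i"
  using closure_cyl[OF 2] by simp
 also have "... <= ep * R" using e hR[of i] by simp
 finally show ?thesis
  using closure_cyl[OF 2] mult_pos_pos[OF e(1) l] by (intro that[of "x $ i" i]) auto
qed

lemma bounded_Om: assumes e: "0 < ep" "ep <= e0" shows "bounded (Om ep)"
proof -
 have "norm x <= 1 + ep * R" if xin: "x \<in> Om ep" for x
 proof -
  obtain i t where it: "t \<in> {0..1}" "norm (x - point i t 0) <= ep * R"
   using Om_near_axis[OF e xin] by blast
  have "(norm (point i t 0))\<^sup>2 = t\<^sup>2" using norm_point[of i t 0] by simp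
  then have "norm (point i t 0) = \<bar>t\<bar>" by (metis abs_norm_cancel power2_eq_iff_nonneg power2_abs abs_ge_zero norm_ge_zero)
  then show ?thesis using it norm_triangle_sub[of x "point i t 0"] by auto
 qed
 then show ?thesis by (auto simp: bounded_iff)
qed

lemma core_alt: assumes e: "0 < ep" "ep <= e0"
 shows "x \<in> core ep \<longleftrightarrow> (e0 / ep) *\<^sub>R x \<in> Om e0"
proof
 assume "x \<in> core ep" then show "(e0 / ep) *\<^sub>R x \<in> Om e0" using e e0 by (auto simp: core_def)
next
 assume *: "(e0 / ep) *\<^sub>R x \<in> Om e0"
 have "x = (ep / e0) *\<^sub>R ((e0 / ep) *\<^sub>R x)" using e e0 by simp
 then show "x \<in> core ep" unfolding core_def using * by (rule image_eqI)
qed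

lemma open_core: "0 < ep ==> open (core ep)"
 unfolding core_def using e0 by (intro open_scaling open_Om) simp

lemma scaled_node: assumes e: "0 < ep" shows "(%x. (ep / e0) *\<^sub>R x) ` node \<Xi> e0 = node \<Xi> ep"
 using e e0 by (simp add: node_def image_image)

lemma scaled_cyl: assumes e: "0 < ep"
 shows "(%x. (ep / e0) *\<^sub>R x) ` cyl e0 i = {x. ep * l < x $ i \<and> x $ i < ep / e0 \<and> norm (rest i x) < ep * h i}"
proof -
 have p: "ep / e0 > 0" using e e0 by simp
 have "(e0 / ep) *\<^sub>R x \<in> cyl e0 i \<longleftrightarrow> x \<in> {x. ep * l < x $ i \<and> x $ i < ep / e0 \<and> norm (rest i x) < ep * h i}" for x
  using e e0 by (simp add: cylinder_def rest_scaleR field_simps)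
 moreover have "x \<in> (%x. (ep / e0) *\<^sub>R x) ` A \<longleftrightarrow> (e0 / ep) *\<^sub>R x \<in> A" for x and A :: "(real^3) set"
  using e e0 by (auto intro!: image_eqI[of x _ "(e0 / ep) *\<^sub>R x"])
 ultimately show ?thesis by blast
qed

lemma core_subset: assumes e: "0 < ep" "ep <= e0" shows "core ep \<subseteq> Om ep"
proof -
 let ?s = "%x::real^3. (ep / e0) *\<^sub>R x"
 have "core ep \<subseteq> ?s ` (closure (node \<Xi> e0) \<union> (\<Union>i. closure (cyl e0 i)))"
  unfolding core_def thin_domain_def by (intro image_mono interior_subset)
 also have "... = closure (?s ` node \<Xi> e0) \<union> (\<Union>i. closure (?s ` cyl e0 i))"
  by (simp only: image_Un image_UN closure_scaleR)
 also have "... \<subseteq> closure (node \<Xi> ep) \<union> (\<Union>i. closure (cyl ep i))"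
  unfolding scaled_node[OF e(1)] scaled_cyl[OF e(1)]
  using e0_less(2)[OF e] by (intro Un_mono UN_mono closure_mono) (auto simp: cylinder_def)
 finally show ?thesis
  unfolding thin_domain_def by (intro interior_maximal open_core e)
qed

text \<open>The interior of a union of closures does not split into pieces, so membership cannot be
  checked piece by piece. Instead the open set \<open>Om ep\<close> intersected with the ball of
  radius eps/e0 is shown to lie in the scaled closed union, hence in its interior; the point itself
  has norm at most eps R.\<close>

lemma node_in_core:
 assumes e: "0 < ep" "ep <= e0" and x: "x \<in> Om ep" "x \<in> closure (node \<Xi> ep)"
 shows "x \<in> core ep"
proof -
 let ?s = "%x::real^3. (ep / e0) *\<^sub>R x"
 let ?O = "Om ep \<inter> ball 0 (ep / e0)"
 have "ep * R >= 0" using e R_pos by simp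
 then have nx: "x \<in> ?O" using x closure_node[OF e(1) x(2)] e0_less(1)[OF e] by auto
 have oO: "open ?O" by (intro open_Int open_Om open_ball)
 have "?O \<subseteq> ?s ` (closure (node \<Xi> e0) \<union> (\<Union>i. closure (cyl e0 i)))"
 proof
  fix z assume z: "z \<in> ?O"
  then have "z \<in> Om ep" by simp
  then show "z \<in> ?s ` (closure (node \<Xi> e0) \<union> (\<Union>i. closure (cyl e0 i)))"
  proof (cases rule: Om_cases)
   case 1
   then have "z \<in> ?s ` closure (node \<Xi> e0)" by (simp only: closure_scaleR scaled_node[OF e(1)])
   then show ?thesis by blast
  next
   case (2 i)
   have "z \<in> closure (cyl ep i \<inter> ball 0 (ep / e0))"
    using open_Int_closure_subset[OF open_ball, of 0 "ep / e0" "cyl ep i"] 2 z by (auto simp: Int_commute)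
   also have "... \<subseteq> closure (?s ` cyl e0 i)"
   proof (rule closure_mono, rule subsetI)
    fix y assume y: "y \<in> cyl ep i \<inter> ball 0 (ep / e0)"
    then have "y $ i < ep / e0" using component_le_norm_cart[of y i] by auto
    with y show "y \<in> ?s ` cyl e0 i" unfolding scaled_cyl[OF e(1)] by (auto simp: cylinder_def)
   qed
   finally have "z \<in> ?s ` closure (cyl e0 i)" by (simp only: closure_scaleR)
   then show ?thesis by blast
  qed
 qed
 then have "(%x. (e0 / ep) *\<^sub>R x) ` ?O \<subseteq> closure (node \<Xi> e0) \<union> (\<Union>i. closure (cyl e0 i))"
  using e e0 by fastforce
 moreover have "open ((%x. (e0 / ep) *\<^sub>R x) ` ?O)"
  using e e0 by (intro open_scaling oO) auto
 ultimately have "(%x. (e0 / ep) *\<^sub>R x) ` ?O \<subseteq> Om e0"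
  unfolding thin_domain_def[of l h \<Xi> e0] by (intro interior_maximal)
 with nx show ?thesis using core_alt[OF e] by blast
qed

lemma cyl_in_core:
 assumes e: "0 < ep" "ep <= e0" and x: "x \<in> cyl ep i" "x $ i < ep / e0"
 shows "x \<in> core ep"
proof -
 have "x \<in> (%x. (ep / e0) *\<^sub>R x) ` cyl e0 i"
  unfolding scaled_cyl[OF e(1)] using x by (auto simp: cylinder_def)
 then show ?thesis using cyl_subset[of e0 i] by (auto simp: core_def)
qed

text \<open>The points of \<open>Om ep\<close> outside the open tubes lie in the closed node or on
  tube boundaries, and the boundary of a convex set is a null set.\<close>

lemma AE_Om_decomp:
 assumes e: "0 < ep" "ep <= e0"
 shows "AE x in lborel. x \<in> Om ep --> (\<exists>i. x \<in> cyl ep i) \<or> (x \<in> core ep \<and> (\<forall>i. \<bar>x $ i\<bar> <= ep * R))"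
proof -
 have "AE x in lborel. x \<notin> frontier (cyl ep i)" for i
 proof -
  have "frontier (cyl ep i) \<in> null_sets lebesgue"
   using negligible_convex_frontier[OF convex_cyl] negligible_iff_null_sets by blast
  moreover have "frontier (cyl ep i) \<in> sets borel" by simp
  ultimately have "frontier (cyl ep i) \<in> null_sets lborel"
   by (simp add: null_sets_def)
  then show ?thesis by (rule AE_not_in)
 qed
 then have "AE x in lborel. \<forall>i. x \<notin> frontier (cyl ep i)" by (intro AE_finite_allI[where S = UNIV, simplified]) auto
 then show ?thesis
 proof eventually_elim
  case (elim x)
  show ?case
  proof (intro impI)
   assume x: "x \<in> Om ep"
   then show "(\<exists>i. x \<in> cyl ep i) \<or> (x \<in> core ep \<and> (\<forall>i. \<bar>x $ i\<bar> <= ep * R))"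
   proof (cases rule: Om_cases)
    case 1
    then show ?thesis
     using node_in_core[OF e x 1] closure_node[OF e(1) 1] component_le_norm_cart[of x] by (meson order_trans)
   next
    case (2 i)
    then have "x \<in> cyl ep i" using elim by (auto simp: frontier_def interior_open[OF open_cyl])
    then show ?thesis by blast
   qed
  qed
 qed
qed

lemma cyl_other:
 assumes e: "0 < ep" and x: "x \<in> cyl ep j" and "i \<noteq> j"
 shows "\<bar>x $ i\<bar> <= ep * R"
proof -
 have "\<bar>x $ i\<bar> <= norm (rest j x)" using assms(3) by (rule abs_nth_le_norm_rest)
 also have "... <= ep * h j" using x by (simp add: cylinder_def)
 also have "... <= ep * R" using e hR by (intro mult_left_mono) auto
 finally show ?thesis .
qed

text \<open>Node and tube are disjoint open sets, so connectedness has to come from the interior of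
  the union of their closures. The centre of the contact disc lies in the closure of both pieces and
  so of \<open>Om e0\<close>, and there the Lipschitz chart joins nearby points of the node to
  nearby points of the tube.\<close>

lemma connected_Om: "connected (Om e0)"
proof -
 let ?c = "connected_component (Om e0)"
 obtain \<xi>0 where \<xi>0: "\<xi>0 \<in> \<Xi>"
 proof -
  have "point 1 l 0 \<in> frontier \<Xi>" using disc[of 1] h[of 1] by auto
  then have "\<Xi> \<noteq> {}" by auto
  then show ?thesis using that by blast
 qed
 define x0 where "x0 = e0 *\<^sub>R \<xi>0"
 have x0: "x0 \<in> node \<Xi> e0" unfolding x0_def node_def using \<xi>0 by (rule imageI)
 have "connected (node \<Xi> e0)"
  unfolding node_def by (intro connected_continuous_image continuous_intros \<Xi>)
 then have cn: "?c x0 x" if "x \<in> node \<Xi> e0" for x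
  using x0 that by (intro connected_componentI[OF _ node_subset[OF e0(1)]])
 have cc: "?c x y" if "x \<in> cyl e0 i" "y \<in> cyl e0 i" for x y i
  using that by (intro connected_componentI[OF convex_connected[OF convex_cyl] cyl_subset])
 have link: "?c x0 x" if x: "x \<in> cyl e0 i" for x i
 proof -
  define p where "p = point i (e0 * l) 0"
  have pn: "p \<in> closure (node \<Xi> e0)"
  proof -
   have "point i l 0 \<in> frontier \<Xi>" using disc[of i] h[of i] by auto
   then have "e0 *\<^sub>R point i l 0 \<in> (%x. e0 *\<^sub>R x) ` closure \<Xi>" by (auto simp: frontier_def)
   then show ?thesis unfolding node_def p_def closure_scaleR point_scaleR by simp
  qed
  have pc: "p \<in> closure (cyl e0 i)"
  proof -
   \<comment> \<open>Points on the axis of the tube that tend to the centre of the contact disc; n +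
     2 keeps them away from the end x_i = 1.\<close>
   define q where "q n = point i (e0 * l + (1 - e0 * l) / real (n + 2)) 0" for n :: nat
   have "q \<longlonglongrightarrow> point i (e0 * l + 0) 0"
    unfolding q_def
   proof (rule continuous_on_tendsto_compose[of UNIV "%t. point i t 0"])
    have "(%n. (1 - e0 * l) / real (n + 2)) \<longlonglongrightarrow> 0" by real_asymp
    then show "(%n. e0 * l + (1 - e0 * l) / real (n + 2)) \<longlonglongrightarrow> e0 * l + 0" by (intro tendsto_intros)
   qed (auto intro!: continuous_intros)
   then have "q \<longlonglongrightarrow> p" by (simp add: p_def)
   moreover have "q n \<in> cyl e0 i" for n
   proof -
    have "e0 * l <= e0 * R" using e0 lR by simp
    moreover have "e0 * (2 * R + 1) = 2 * (e0 * R) + e0" by (simp add: algebra_simps)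
    ultimately have "e0 * l < 1" using e0 mult_pos_pos[OF e0(1) R_pos] by linarith
    then have "0 < (1 - e0 * l) / real (n + 2)" "(1 - e0 * l) / real (n + 2) < 1 - e0 * l"
    proof -
     assume "e0 * l < 1"
     then have d: "0 < 1 - e0 * l" by simp
     then show "0 < (1 - e0 * l) / real (n + 2)" by simp
     have "(1 - e0 * l) / real (n + 2) < (1 - e0 * l) / 1"
      using d by (intro divide_strict_left_mono) auto
     then show "(1 - e0 * l) / real (n + 2) < 1 - e0 * l" by simp
    qed
    then show ?thesis using e0 h[of i] by (auto simp: cylinder_def q_def)
   qed
   ultimately show ?thesis unfolding closure_sequential by blast
  qed
  have "p \<in> closure (Om e0)"
   using pc closure_mono[OF cyl_subset] by (rule rev_subsetD)
  then obtain N where N: "open N" "p \<in> N" "\<And>x y. x \<in> Om e0 \<inter> N ==> y \<in> Om e0 \<inter> N ==> ?c x y"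
   using lipschitz_boundary_connected_near[OF open_Om lip] by blast
  obtain a where a: "a \<in> node \<Xi> e0 \<inter> N"
   using pn N(1,2) open_Int_closure_eq_empty[OF N(1), of "node \<Xi> e0"] by (auto simp: Int_commute)
  obtain b where b: "b \<in> cyl e0 i \<inter> N"
   using pc N(1,2) open_Int_closure_eq_empty[OF N(1), of "cyl e0 i"] by (auto simp: Int_commute)
  have "?c a b" by (rule N(3)) (use a b node_subset[OF e0(1)] cyl_subset[of e0 i] in auto)
  then have "?c x0 b" using cn[of a] a connected_component_trans by fast
  moreover have "?c b x" using cc[of b i x] b x by simp
  ultimately show ?thesis by (rule connected_component_trans)
 qed
 have all: "?c x0 x" if x: "x \<in> Om e0" for x
 proof -
  from open_Om x obtain r where r: "r > 0" "ball x r \<subseteq> Om e0" by (rule openE)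
  have "\<exists>y\<in>ball x r. ?c x0 y"
   using x
  proof (cases rule: Om_cases)
   case 1
   then obtain y where "y \<in> node \<Xi> e0" "dist y x < r" using r(1) unfolding closure_approachable by blast
   then show ?thesis using cn by (intro bexI[of _ y]) (auto simp: dist_commute)
  next
   case (2 i)
   then obtain y where "y \<in> cyl e0 i" "dist y x < r" using r(1) unfolding closure_approachable by blast
   then show ?thesis using link by (intro bexI[of _ y]) (auto simp: dist_commute)
  qed
  then obtain y where y: "y \<in> ball x r" "?c x0 y" by blast
  have "?c y x" using r(1) y(1) by (intro connected_componentI[OF connected_ball r(2)]) simp_all
  with y(2) show ?thesis by (rule connected_component_trans)
 qed
 show ?thesis
  unfolding connected_iff_connected_component
  using all by (intro ballI) (rule connected_component_trans[OF connected_component_sym])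
qed

lemma Om_nonempty: "Om e0 \<noteq> {}"
proof -
 have "\<Xi> \<noteq> {}" using disc[of 1] h[of 1] point_nth[of 1 l 0] rest_point[of 1 l 0] by fastforce
 then have "node \<Xi> e0 \<noteq> {}" by (simp add: node_def)
 then show ?thesis using node_subset[OF e0(1)] by blast
qed

section \<open>Scaling of integrals and of the Poincare inequality to the core\<close>

lemma nn_integral_core:
 assumes e: "0 < ep" "ep <= e0" and [measurable]: "k \<in> borel_measurable borel"
 shows "(NN x. indicator (core ep) x * k x) =
  ennreal ((ep / e0) ^ 3) * (NN x. indicator (Om e0) x * k ((ep / e0) *\<^sub>R x))"
proof -
 let ?s = "ep / e0"
 have s: "?s > 0" using e e0 by simp
 have [measurable]: "core ep \<in> sets borel" using open_core[OF e(1)] by simp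
 have "(lborel :: (real^3) measure) = density (distr lborel borel (%x. 0 + ?s *\<^sub>R x)) (%_. ennreal (\<bar>?s\<bar> ^ DIM(real^3)))"
  by (rule lborel_affine) (rule less_imp_neq[OF s, symmetric])
 also have "\<bar>?s\<bar> ^ DIM(real^3) = ?s ^ 3" unfolding abs_of_pos[OF s] by simp
 finally have "(lborel :: (real^3) measure) = density (distr lborel borel (%x. ?s *\<^sub>R x)) (%_. ennreal (?s ^ 3))"
  by (simp only: add_0)
 then have "(NN x. indicator (core ep) x * k x) =
   (\<integral>\<^sup>+x. indicator (core ep) x * k x \<partial>density (distr lborel borel (%x. ?s *\<^sub>R x)) (%_. ennreal (?s ^ 3)))"
  by (rule arg_cong)
 also have "... = (NN x. ennreal (?s ^ 3) * (indicator (core ep) (?s *\<^sub>R x) * k (?s *\<^sub>R x)))"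
  by (simp add: nn_integral_density nn_integral_distr)
 also have "... = (NN x. ennreal (?s ^ 3) * (indicator (Om e0) x * k (?s *\<^sub>R x)))"
  using core_alt[OF e] e e0 by (intro nn_integral_cong) (simp add: indicator_def)
 also have "... = ennreal (?s ^ 3) * (NN x. indicator (Om e0) x * k (?s *\<^sub>R x))"
  using open_Om[of e0] by (intro nn_integral_cmult) (auto intro!: borel_measurable_times_ennreal)
 finally show ?thesis .
qed

lemma C1_scale:
 fixes g :: "'b::euclidean_space => 'b"
 assumes "C1 w g" shows "C1 (%x. w (s *\<^sub>R x)) (%x. s *\<^sub>R g (s *\<^sub>R x))"
 unfolding C1_def
proof (intro conjI allI)
 fix x :: 'b
 have "((%x. s *\<^sub>R x) has_derivative (%x. s *\<^sub>R x)) (at x)" by (auto intro!: derivative_eq_intros)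
 moreover have "(w has_derivative (%d. g (s *\<^sub>R x) \<bullet> d)) (at (s *\<^sub>R x))" using assms unfolding C1_def by blast
 ultimately have "((%x. w (s *\<^sub>R x)) has_derivative (%d. g (s *\<^sub>R x) \<bullet> (s *\<^sub>R d))) (at x)"
  by (rule has_derivative_compose)
 then show "((%x. w (s *\<^sub>R x)) has_derivative (%d. s *\<^sub>R g (s *\<^sub>R x) \<bullet> d)) (at x)" by simp
qed (intro continuous_intros continuous_on_compose2[OF C1_continuous(2)[OF assms]], auto)

text \<open>Both sides scale with the volume factor (eps/e0)^3, and the gradient of the rescaled
  function contributes one more factor eps/e0. Replacing C by C + 1 makes the constant
  positive.\<close>

lemma poincare_core:
 obtains C where "C > 0" "\<And>W g ep. C1 W g ==> 0 < ep ==> ep <= e0 ==> \<exists>c.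
  (NN x. indicator (core ep) x * ennreal \<bar>W x - c\<bar>) <= ennreal (C * ep) * gradL1 g (core ep)"
proof -
 obtain C where C: "C >= 0" "\<And>W (g :: real^3 => real^3). C1 W g ==> \<exists>c.
  (NN x. indicator (Om e0) x * ennreal \<bar>W x - c\<bar>) <= ennreal C * gradL1 g (Om e0)"
  using poincare_lipschitz_domain[OF open_Om bounded_Om[OF e0(1) order_refl] connected_Om lip Om_nonempty] by blast
 show ?thesis
 proof (rule that[of "(C + 1) / e0"])
  show "(C + 1) / e0 > 0" using C e0 by simp
  fix W :: "real^3 => real" and g ep assume W: "C1 W g" and e: "0 < ep" "ep <= e0"
  have [measurable]: "W \<in> borel_measurable borel" "g \<in> borel_measurable borel" using C1_borel[OF W] by auto
  let ?s = "ep / e0"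
  have s: "?s > 0" using e e0 by simp
  have [measurable]: "Om e0 \<in> sets borel" using open_Om by simp
  obtain c where c: "(NN x. indicator (Om e0) x * ennreal \<bar>W (?s *\<^sub>R x) - c\<bar>) <= ennreal C * gradL1 (%x. ?s *\<^sub>R g (?s *\<^sub>R x)) (Om e0)"
   using C(2)[OF C1_scale[OF W, of ?s]] by blast
  have "gradL1 (%x. ?s *\<^sub>R g (?s *\<^sub>R x)) (Om e0) = (NN x. ennreal ?s * (indicator (Om e0) x * ennreal (norm (g (?s *\<^sub>R x)))))"
  proof -
   have "norm (?s *\<^sub>R v) = ?s * norm v" for v :: "real^3"
    by (simp only: norm_scaleR abs_of_pos[OF s])
   then have "ennreal (norm (?s *\<^sub>R v)) = ennreal ?s * ennreal (norm v)" for v :: "real^3"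
    using s by (simp only: ennreal_mult[OF less_imp_le norm_ge_zero])
   then show ?thesis unfolding gradL1_def by (simp only: mult.left_commute)
  qed
  also have "... = ennreal ?s * (NN x. indicator (Om e0) x * ennreal (norm (g (?s *\<^sub>R x))))"
   by (rule nn_integral_cmult) measurable
  finally have G: "gradL1 (%x. ?s *\<^sub>R g (?s *\<^sub>R x)) (Om e0) = ennreal ?s * (NN x. indicator (Om e0) x * ennreal (norm (g (?s *\<^sub>R x))))" .
  have "(NN x. indicator (core ep) x * ennreal \<bar>W x - c\<bar>) <= ennreal (?s ^ 3) * (ennreal C * (ennreal ?s * (NN x. indicator (Om e0) x * ennreal (norm (g (?s *\<^sub>R x))))))"
   unfolding G[symmetric] by (subst nn_integral_core[OF e]) (auto intro!: mult_left_mono c)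
  also have "... = ennreal (C * ?s) * gradL1 g (core ep)"
  proof -
   have Cs: "ennreal (C * ?s) = ennreal C * ennreal ?s" using C s by (intro ennreal_mult) auto
   have "gradL1 g (core ep) = ennreal (?s ^ 3) * (NN x. indicator (Om e0) x * ennreal (norm (g (?s *\<^sub>R x))))"
    unfolding gradL1_def by (rule nn_integral_core[OF e]) measurable
   then show ?thesis unfolding Cs by (simp only: ac_simps)
  qed
  also have "... <= ennreal ((C + 1) / e0 * ep) * gradL1 g (core ep)"
   using C e e0 by (intro mult_right_mono ennreal_leI) (auto simp: field_simps)
  finally show "\<exists>c. (NN x. indicator (core ep) x * ennreal \<bar>W x - c\<bar>) <= ennreal ((C + 1) / e0 * ep) * gradL1 g (core ep)" by blast
 qed
qed

lemma measure_core:
 assumes e: "0 < ep" "ep <= e0"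
 shows "measure lborel (core ep) = measure lborel (Om e0) / e0 ^ 3 * ep ^ 3" "emeasure lborel (core ep) = ennreal (measure lborel (core ep))"
proof -
 have f: "emeasure lborel (Om e0) = ennreal (measure lborel (Om e0))"
  using emeasure_bounded_finite[OF bounded_Om[OF e0(1) order_refl]] by (intro emeasure_eq_ennreal_measure) auto
 have "emeasure lborel (core ep) = ennreal ((ep / e0) ^ 3) * emeasure lborel (Om e0)"
  using nn_integral_core[OF e, of "%_. 1"] open_core[OF e(1)] open_Om[of e0] by simp
 then have *: "emeasure lborel (core ep) = ennreal (measure lborel (Om e0) / e0 ^ 3 * ep ^ 3)"
  using e e0 unfolding f by (simp add: ennreal_mult[symmetric] power_divide)
 then show 1: "measure lborel (core ep) = measure lborel (Om e0) / e0 ^ 3 * ep ^ 3"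
  using e e0 by (simp add: measure_def)
 show "emeasure lborel (core ep) = ennreal (measure lborel (core ep))" using * 1 by simp
qed

end

section \<open>Surface measures\<close>

lemma polar_measurable:
 "r >= 0 ==> polar r \<in> measurable (restrict_space lborel {0..<2 * pi}) (restrict_space borel (sphere 0 r))"
 by (intro measurable_restrict_space2 measurable_restrict_space1) (auto simp: norm_polar)

lemma circle_measure_alt:
 assumes "r > 0"
 shows "circle_measure r = density (distr (restrict_space lborel {0..<2 * pi}) (restrict_space borel (sphere 0 r)) (polar r)) (%_. ennreal r)"
 unfolding circle_measure_def polar_def[symmetric]
 by (rule measure_eqI) (auto simp: emeasure_density_const)

lemma sets_circle [measurable_cong]: "sets (circle_measure r) = sets (restrict_space borel (sphere 0 r))"
 by (simp add: circle_measure_def)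

lemma space_circle: "space (circle_measure r) = sphere 0 r"
 using sets_eq_imp_space_eq[OF sets_circle[of r]] by (simp add: space_restrict_space)

lemma nn_integral_circle:
 assumes r: "r > 0" and k: "k \<in> borel_measurable (restrict_space borel (sphere 0 r))"
 shows "(\<integral>\<^sup>+y. k y \<partial>circle_measure r) = (NN th. indicator {0..<2 * pi} th * (ennreal r * k (polar r th)))"
proof -
 have "(\<integral>\<^sup>+y. k y \<partial>circle_measure r) = (\<integral>\<^sup>+th. ennreal r * k (polar r th) \<partial>restrict_space lborel {0..<2 * pi})"
  unfolding circle_measure_alt[OF r] using k r polar_measurable[of r]
  by (subst nn_integral_density) (auto simp: nn_integral_distr)
 also have "... = (NN th. indicator {0..<2 * pi} th * (ennreal r * k (polar r th)))"
  by (subst nn_integral_restrict_space) (auto simp: mult.commute)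
 finally show ?thesis .
qed

lemma integral_circle:
 fixes k :: "real \<times> real => real"
 assumes r: "r > 0" and k: "k \<in> borel_measurable (restrict_space borel (sphere 0 r))"
 shows "(\<integral>y. k y \<partial>circle_measure r) = r * (LBINT th. indicator {0..<2 * pi} th * k (polar r th))"
proof -
 have "(\<integral>y. k y \<partial>circle_measure r) = (\<integral>th. r * k (polar r th) \<partial>restrict_space lborel {0..<2 * pi})"
  unfolding circle_measure_alt[OF r] using k r polar_measurable[of r]
  by (subst integral_density) (auto simp: integral_distr)
 also have "... = r * (LBINT th. indicator {0..<2 * pi} th * k (polar r th))"
  by (simp add: integral_restrict_space)
 finally show ?thesis .
qed

lemma finite_measure_circle: "r > 0 ==> finite_measure (circle_measure r)"
 using nn_integral_circle[of r "%_. 1"]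
 by (intro finite_measureI) (simp add: nn_integral_multc ennreal_mult_less_top less_top[symmetric] ennreal_mult_eq_top_iff)

lemma point_borel_section: "k \<in> borel_measurable borel ==> (%y. k (point i t y)) \<in> borel_measurable borel"
 by (rule measurable_compose[of "point i t" borel borel])
   (auto intro!: borel_measurable_continuous_onI continuous_intros)

lemma point_borel_axial: "k \<in> borel_measurable borel ==> (%t. k (point i t y)) \<in> borel_measurable borel"
 by (rule measurable_compose[of "%t. point i t y" borel borel])
   (auto intro!: borel_measurable_continuous_onI continuous_intros)

lemma norm_point_axis: "norm (point i t 0) = \<bar>t\<bar>"
proof -
 have "norm (point i t 0) = sqrt ((norm (point i t 0))\<^sup>2)" by simp
 then show ?thesis unfolding norm_point by simp
qed

lemma bounded_Ioo_real: "bounded {a<..<b::real}"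
 using bounded_box[of a b] by simp

section \<open>Traces on the lateral surface and on the end disc of one tube\<close>

context
 fixes l ep :: real and h :: "3 => real" and i :: 3
 assumes l: "l > 0" and ep: "ep > 0" and h: "h i > 0"
begin

lemma rh: "ep * h i > 0" using ep h by simp

lemma lateral_point:
 assumes t: "t \<in> {ep * l<..<1}" and y: "y \<in> sphere 0 (ep * h i)"
 shows "point i t y \<in> lateral_surface l h ep i"
proof -
 let ?C = "cylinder l h ep i"
 have "open ?C"
  unfolding cylinder_def by (intro open_Collect_conj open_Collect_less continuous_intros)
 moreover have "point i t y \<notin> ?C" using y by (simp add: cylinder_def)
 moreover have "point i t y \<in> closure ?C"
 proof -
  define q where "q n = point i t ((1 - 1 / real (n + 2)) *\<^sub>R y)" for n :: nat
  have "q \<longlonglongrightarrow> point i t ((1 - 0) *\<^sub>R y)"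
   unfolding q_def
  proof (rule continuous_on_tendsto_compose[of UNIV "%s. point i t ((1 - s) *\<^sub>R y)"])
   show "(%n. 1 / real (n + 2)) \<longlonglongrightarrow> 0" by real_asymp
  qed (auto intro!: continuous_intros)
  then have "q \<longlonglongrightarrow> point i t y" by simp
  moreover have "q n \<in> ?C" for n
  proof -
   have "(1 - 1 / real (n + 2)) * norm y < 1 * norm y"
    using y rh by (intro mult_strict_right_mono) auto
   then show ?thesis using t y by (auto simp: q_def cylinder_def)
  qed
  ultimately show ?thesis unfolding closure_sequential by blast
 qed
 ultimately show ?thesis
  using t by (simp add: lateral_surface_def frontier_def interior_open)
qed

lemma lateral_map:
 "(%(t, y). point i t y) \<in> measurable (restrict_space lborel {ep * l<..<1} \<Otimes>\<^sub>M circle_measure (ep * h i))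
   (restrict_space borel (lateral_surface l h ep i))"
proof (rule measurable_restrict_space2)
 let ?P = "restrict_space lborel {ep * l<..<1} \<Otimes>\<^sub>M circle_measure (ep * h i)"
 show "(%(t, y). point i t y) \<in> space ?P \<rightarrow> lateral_surface l h ep i"
  using lateral_point by (auto simp: space_pair_measure space_circle space_restrict_space)
 have 1: "fst \<in> measurable ?P borel"
  by (rule measurable_compose[OF measurable_fst]) (auto intro: measurable_restrict_space1)
 have 2: "snd \<in> measurable ?P borel"
 proof (rule measurable_compose[OF measurable_snd])
  have "(%x. x) \<in> measurable (restrict_space borel (sphere 0 (ep * h i))) borel"
   by (rule measurable_restrict_space1) simp
  then show "(%x. x) \<in> measurable (circle_measure (ep * h i)) borel"
   using measurable_cong_sets[OF sets_circle refl] by blast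
 qed
 have "(%p. (fst p, snd p)) \<in> measurable ?P (borel \<Otimes>\<^sub>M borel)"
  using 1 2 by (rule measurable_Pair)
 from measurable_compose[OF this point_borel]
 show "(%(t, y). point i t y) \<in> measurable ?P borel" by (simp add: case_prod_beta')
qed

lemma sections_borel:
 assumes k: "k \<in> borel_measurable (restrict_space borel (lateral_surface l h ep i))" and t: "t \<in> {ep * l<..<1}"
 shows "(%y. k (point i t y)) \<in> borel_measurable (restrict_space borel (sphere 0 (ep * h i)))"
proof (rule measurable_compose[OF _ k])
 show "point i t \<in> measurable (restrict_space borel (sphere 0 (ep * h i))) (restrict_space borel (lateral_surface l h ep i))"
 proof (intro measurable_restrict_space2 measurable_restrict_space1)
  show "point i t \<in> borel_measurable borel"
   by (intro borel_measurable_continuous_onI continuous_intros)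
 qed (use lateral_point[OF t] in auto)
qed

lemma nn_integral_lateral:
 assumes k: "k \<in> borel_measurable (restrict_space borel (lateral_surface l h ep i))"
 shows "(\<integral>\<^sup>+x. k x \<partial>lateral_measure l h ep i) = (NN t. indicator {ep * l<..<1} t *
   (NN th. indicator {0..<2 * pi} th * (ennreal (ep * h i) * k (point i t (polar (ep * h i) th)))))"
proof -
 interpret finite_measure "circle_measure (ep * h i)" using rh by (rule finite_measure_circle)
 let ?P = "restrict_space lborel {ep * l<..<1} \<Otimes>\<^sub>M circle_measure (ep * h i)"
 have "(\<integral>\<^sup>+x. k x \<partial>lateral_measure l h ep i) = (\<integral>\<^sup>+p. k (case p of (t, y) => point i t y) \<partial>?P)"
  unfolding lateral_measure_def using k by (intro nn_integral_distr[OF lateral_map]) simp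
 also have "... = (\<integral>\<^sup>+t. \<integral>\<^sup>+y. k (point i t y) \<partial>circle_measure (ep * h i) \<partial>restrict_space lborel {ep * l<..<1})"
  using nn_integral_fst[OF measurable_compose[OF lateral_map k]] by simp
 also have "... = (NN t. (\<integral>\<^sup>+y. k (point i t y) \<partial>circle_measure (ep * h i)) * indicator {ep * l<..<1} t)"
  by (rule nn_integral_restrict_space) simp
 also have "... = (NN t. indicator {ep * l<..<1} t *
   (NN th. indicator {0..<2 * pi} th * (ennreal (ep * h i) * k (point i t (polar (ep * h i) th)))))"
 proof (rule nn_integral_cong)
  fix t :: real
  show "(\<integral>\<^sup>+y. k (point i t y) \<partial>circle_measure (ep * h i)) * indicator {ep * l<..<1} t = indicator {ep * l<..<1} t *
   (NN th. indicator {0..<2 * pi} th * (ennreal (ep * h i) * k (point i t (polar (ep * h i) th))))"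
   using nn_integral_circle[OF rh sections_borel[OF k], of t] by (cases "t \<in> {ep * l<..<1}") auto
 qed
 finally show ?thesis .
qed

lemma finite_measure_lateral: "finite_measure (lateral_measure l h ep i)"
proof (rule finite_measureI)
 have s: "space (lateral_measure l h ep i) \<in> sets (lateral_measure l h ep i)" by (rule sets.top)
 have "emeasure (lateral_measure l h ep i) (space (lateral_measure l h ep i)) = (\<integral>\<^sup>+x. 1 \<partial>lateral_measure l h ep i)"
  by simp
 also have "... = (NN t. indicator {ep * l<..<1} t * (ennreal (ep * h i) * emeasure lborel {0..<2*pi}))"
 proof -
  have "(NN th. indicator {0..<2 * pi} th * (ennreal (ep * h i) * 1)) = emeasure lborel {0..<2*pi} * (ennreal (ep * h i) * 1)"
   by (subst nn_integral_multc) auto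
  then show ?thesis by (subst nn_integral_lateral) (simp_all add: mult.commute)
 qed
 also have "... < \<infinity>"
  using emeasure_bounded_finite[OF bounded_Ioo_real[of "ep * l" 1]]
  by (subst nn_integral_multc) (auto simp: ennreal_mult_less_top)
 finally show "emeasure (lateral_measure l h ep i) (space (lateral_measure l h ep i)) \<noteq> \<infinity>" by simp
qed

lemma integral_lateral:
 fixes k :: "real^3 => real"
 assumes k: "integrable (lateral_measure l h ep i) k"
 shows "(\<integral>x. k x \<partial>lateral_measure l h ep i) = (LBINT t. indicator {ep * l<..<1} t *
   (ep * h i * (LBINT th. indicator {0..<2 * pi} th * k (point i t (polar (ep * h i) th)))))"
proof -
 let ?I = "restrict_space lborel {ep * l<..<1}"
 let ?c = "circle_measure (ep * h i)"
 interpret c: finite_measure ?c using rh by (rule finite_measure_circle)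
 interpret I: finite_measure ?I
  using emeasure_bounded_finite[OF bounded_Ioo_real[of "ep * l" 1]]
  by (intro finite_measureI) (simp add: emeasure_restrict_space space_restrict_space)
 interpret pair_sigma_finite ?I ?c ..
 let ?P = "?I \<Otimes>\<^sub>M ?c"
 have km: "k \<in> borel_measurable (restrict_space borel (lateral_surface l h ep i))"
  using borel_measurable_integrable[OF k] unfolding lateral_measure_def by simp
 have ki: "integrable ?P (%p. k (case p of (t, y) => point i t y))"
  using k unfolding lateral_measure_def by (subst (asm) integrable_distr_eq[OF lateral_map km])
 have "(\<integral>x. k x \<partial>lateral_measure l h ep i) = (\<integral>p. k (case p of (t, y) => point i t y) \<partial>?P)"
  unfolding lateral_measure_def by (rule integral_distr[OF lateral_map km])
 also have "... = (\<integral>t. \<integral>y. k (point i t y) \<partial>?c \<partial>?I)"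
  using integral_fst'[OF ki] by simp
 also have "... = (LBINT t. indicator {ep * l<..<1} t *\<^sub>R (\<integral>y. k (point i t y) \<partial>?c))"
  by (rule integral_restrict_space) simp
 also have "... = (LBINT t. indicator {ep * l<..<1} t *
   (ep * h i * (LBINT th. indicator {0..<2 * pi} th * k (point i t (polar (ep * h i) th)))))"
 proof (rule Bochner_Integration.integral_cong[OF refl])
  fix t :: real
  show "indicator {ep * l<..<1} t *\<^sub>R (\<integral>y. k (point i t y) \<partial>?c) = indicator {ep * l<..<1} t *
   (ep * h i * (LBINT th. indicator {0..<2 * pi} th * k (point i t (polar (ep * h i) th))))"
   using integral_circle[OF rh sections_borel[OF km], of t] by (cases "t \<in> {ep * l<..<1}") auto
 qed
 finally show ?thesis .
qed

lemma nn_integral_cylinder: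
 assumes [measurable]: "k \<in> borel_measurable borel"
 shows "(NN x. indicator (cylinder l h ep i) x * k x) = (NN t. indicator {ep * l<..<1} t *
   (NN y. indicator (ball 0 (ep * h i)) y * k (point i t y)))"
  and "(NN x. indicator (cylinder l h ep i) x * k x) = (NN y. indicator (ball 0 (ep * h i)) y *
   (NN t. indicator {ep * l<..<1} t * k (point i t y)))"
proof -
 have [measurable]: "cylinder l h ep i \<in> sets borel"
  unfolding cylinder_def by (intro borel_open open_Collect_conj open_Collect_less continuous_intros)
 have [measurable]: "ball (0 :: real \<times> real) (ep * h i) \<in> sets borel" by simp
 have m1[measurable]: "(%y. k (point i t y)) \<in> borel_measurable borel" for t
  using assms by (rule point_borel_section)
 have m2[measurable]: "(%t. k (point i t y)) \<in> borel_measurable borel" for y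
  using assms by (rule point_borel_axial)
 have km: "(%x. indicator (cylinder l h ep i) x * k x) \<in> borel_measurable borel" by measurable
 have e: "indicator (cylinder l h ep i) (point i t y) * k (point i t y) =
   indicator {ep * l<..<1} t * (indicator (ball 0 (ep * h i)) y * k (point i t y))" for t y
  by (auto simp: indicator_def cylinder_def)
 have e': "indicator (cylinder l h ep i) (point i t y) * k (point i t y) =
   indicator (ball 0 (ep * h i)) y * (indicator {ep * l<..<1} t * k (point i t y))" for t y
  by (auto simp: indicator_def cylinder_def)
 show "(NN x. indicator (cylinder l h ep i) x * k x) = (NN t. indicator {ep * l<..<1} t *
   (NN y. indicator (ball 0 (ep * h i)) y * k (point i t y)))"
  unfolding nn_integral_point(1)[OF km, of i] e
  by (intro nn_integral_cong nn_integral_cmult) measurable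
 show "(NN x. indicator (cylinder l h ep i) x * k x) = (NN y. indicator (ball 0 (ep * h i)) y *
   (NN t. indicator {ep * l<..<1} t * k (point i t y)))"
  unfolding nn_integral_point(2)[OF km, of i] e'
  by (intro nn_integral_cong nn_integral_cmult) measurable
qed

text \<open>On each section the circle trace bound is applied to v^2, whose gradient 2 v grad v is
  bounded by v^2 + |grad v|^2; integration along the axis follows.\<close>

lemma lateral_trace:
 assumes v: "C1 v g"
 shows "(\<integral>\<^sup>+x. ennreal ((v x)\<^sup>2) \<partial>lateral_measure l h ep i) <=
   ennreal (20 / (ep * h i) + 10) * (NN x. indicator (cylinder l h ep i) x * ennreal ((v x)\<^sup>2 + (norm (g x))\<^sup>2))"
proof -
 have [measurable]: "v \<in> borel_measurable borel" "g \<in> borel_measurable borel" using C1_borel[OF v] by auto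
 let ?r = "ep * h i"
 let ?C = "ennreal (20 / ?r + 10)"
 have km: "(%x. ennreal ((v x)\<^sup>2)) \<in> borel_measurable (restrict_space borel (lateral_surface l h ep i))"
  by (intro measurable_restrict_space1) measurable
 have sec: "(NN th. indicator {0..<2 * pi} th * (ennreal ?r * ennreal ((v (point i t (polar ?r th)))\<^sup>2)))
   <= ?C * (NN y. indicator (ball 0 ?r) y * ennreal ((v (point i t y))\<^sup>2 + (norm (g (point i t y)))\<^sup>2))" for t
 proof -
  have c1: "C1 (%y. v (point i t y)) (%y. rest i (g (point i t y)))" using v by (rule C1_section)
  let ?k = "%y. v (point i t y) * v (point i t y)"
  let ?g = "%y. v (point i t y) *\<^sub>R rest i (g (point i t y)) + v (point i t y) *\<^sub>R rest i (g (point i t y))"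
  have c2: "C1 ?k ?g" by (rule C1_mult[OF c1 c1])
  have [measurable]: "(%y. v (point i t y)) \<in> borel_measurable borel" "(%y. g (point i t y)) \<in> borel_measurable borel"
   by (rule point_borel_section, measurable)+
  have [measurable]: "ball (0::real\<times>real) ?r \<in> sets borel" by simp
  have "(NN th. indicator {0..<2 * pi} th * (ennreal ?r * ennreal ((v (point i t (polar ?r th)))\<^sup>2)))
    = ennreal ?r * (NN th. indicator {0..<2 * pi} th * ennreal \<bar>?k (polar ?r th)\<bar>)"
   by (subst nn_integral_cmult[symmetric]) (auto simp: power2_eq_square ac_simps intro!: measurable_compose[OF polar_borel])
  also have "... <= ennreal (20 / ?r) * L1 ?k (ball 0 ?r) + ennreal 10 * gradL1 ?g (ball 0 ?r)"
   by (rule trace_circle[OF c2 rh])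
  also have "... <= ennreal (20 / ?r) * (NN y. indicator (ball 0 ?r) y * ennreal ((v (point i t y))\<^sup>2 + (norm (g (point i t y)))\<^sup>2))
    + ennreal 10 * (NN y. indicator (ball 0 ?r) y * ennreal ((v (point i t y))\<^sup>2 + (norm (g (point i t y)))\<^sup>2))"
   unfolding L1_def gradL1_def
  proof (intro add_mono mult_left_mono nn_integral_mono ennreal_leI)
   fix y
   show "\<bar>?k y\<bar> <= (v (point i t y))\<^sup>2 + (norm (g (point i t y)))\<^sup>2"
    by (simp add: power2_eq_square)
   have "norm (?g y) = 2 * \<bar>v (point i t y)\<bar> * norm (rest i (g (point i t y)))"
    by (simp add: scaleR_2[symmetric] mult.assoc abs_mult del: scaleR_2)
   also have "... <= 2 * \<bar>v (point i t y)\<bar> * norm (g (point i t y))"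
    by (intro mult_left_mono norm_rest_le) auto
   also have "... <= (v (point i t y))\<^sup>2 + (norm (g (point i t y)))\<^sup>2"
    using sum_squares_bound[of "\<bar>v (point i t y)\<bar>" "norm (g (point i t y))"] by simp
   finally show "norm (?g y) <= (v (point i t y))\<^sup>2 + (norm (g (point i t y)))\<^sup>2" .
  qed auto
  also have "... = ?C * (NN y. indicator (ball 0 ?r) y * ennreal ((v (point i t y))\<^sup>2 + (norm (g (point i t y)))\<^sup>2))"
   using rh by (simp add: distrib_right[symmetric] ennreal_plus[symmetric] del: ennreal_plus ennreal_numeral)
  finally show ?thesis .
 qed
 have m3: "(%x. ennreal ((v x)\<^sup>2 + (norm (g x))\<^sup>2)) \<in> borel_measurable borel" by measurable
 have [measurable]: "(%x. indicator {ep * l<..<1} x * (NN y. indicator (ball 0 ?r) y * ennreal ((v (point i x y))\<^sup>2 + (norm (g (point i x y)))\<^sup>2))) \<in> borel_measurable borel"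
 proof -
  have 1: "(%p. v (point i (fst p) (snd p))) \<in> borel_measurable (borel \<Otimes>\<^sub>M borel)"
   "(%p. g (point i (fst p) (snd p))) \<in> borel_measurable (borel \<Otimes>\<^sub>M borel)"
   using measurable_compose[OF point_borel, of v borel i] measurable_compose[OF point_borel, of g borel i]
   by (simp_all add: case_prod_beta')
  have [measurable]: "ball (0::real\<times>real) ?r \<in> sets borel" by simp
  have "(%(x, y). indicator (ball 0 ?r) y * ennreal ((v (point i x y))\<^sup>2 + (norm (g (point i x y)))\<^sup>2)) \<in> borel_measurable (borel \<Otimes>\<^sub>M lborel)"
   using 1 by (simp add: case_prod_beta' measurable_cong_sets[OF sets_pair_measure_cong[OF refl sets_lborel] refl])
  then show ?thesis by measurable
 qed
 have "(\<integral>\<^sup>+x. ennreal ((v x)\<^sup>2) \<partial>lateral_measure l h ep i) <= (NN t. indicator {ep * l<..<1} t *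
   (?C * (NN y. indicator (ball 0 ?r) y * ennreal ((v (point i t y))\<^sup>2 + (norm (g (point i t y)))\<^sup>2))))"
  unfolding nn_integral_lateral[OF km] by (intro nn_integral_mono mult_left_mono sec) auto
 also have "... = (NN t. ?C * (indicator {ep * l<..<1} t *
   (NN y. indicator (ball 0 ?r) y * ennreal ((v (point i t y))\<^sup>2 + (norm (g (point i t y)))\<^sup>2))))"
  by (simp only: mult.left_commute)
 also have "... = ?C * (NN t. indicator {ep * l<..<1} t *
   (NN y. indicator (ball 0 ?r) y * ennreal ((v (point i t y))\<^sup>2 + (norm (g (point i t y)))\<^sup>2)))"
  by (rule nn_integral_cmult) measurable
 finally show ?thesis unfolding nn_integral_cylinder(1)[OF m3] .
qed

text \<open>Along each axial line v^2 at the end is at most v^2 at t plus the integral of |2 v grad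
  v|. Averaging over t in an interval of length d = 1 - eps l gives d v^2 <= Q + d Q <= 2 Q, where Q
  integrates v^2 + |grad v|^2 along the line.\<close>

lemma end_trace:
 assumes v: "C1 v g" and epl: "ep * l < 1"
 shows "(NN y. indicator (ball 0 (ep * h i)) y * ennreal ((v (point i 1 y))\<^sup>2)) <=
   ennreal (2 / (1 - ep * l)) * (NN x. indicator (cylinder l h ep i) x * ennreal ((v x)\<^sup>2 + (norm (g x))\<^sup>2))"
proof -
 have [measurable]: "v \<in> borel_measurable borel" "g \<in> borel_measurable borel" using C1_borel[OF v] by auto
 let ?I = "{ep * l<..<1}"
 let ?q = "%x. (v x)\<^sup>2 + (norm (g x))\<^sup>2"
 define d where "d = 1 - ep * l"
 have d: "0 < d" "d <= 1" using epl l ep by (auto simp: d_def)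
 have m2: "(%t. ennreal (?q (point i t y))) \<in> borel_measurable borel" "(%t. ennreal ((v (point i t y))\<^sup>2)) \<in> borel_measurable borel" for y
  by (rule point_borel_axial, measurable)+
 have line: "ennreal ((v (point i 1 y))\<^sup>2) <= ennreal (2 / d) * (NN t. indicator ?I t * ennreal (?q (point i t y)))" for y
 proof -
  let ?Q = "NN s. indicator ?I s * ennreal (?q (point i s y))"
  have le: "ennreal ((v (point i 1 y))\<^sup>2) <= ennreal ((v (point i t y))\<^sup>2) + ?Q" if t: "t \<in> ?I" for t
  proof -
   have p: "point i 0 y + s *\<^sub>R point i 1 0 = point i s y" for s by (simp add: point_scaleR point_add)
   have nz: "norm (point i 1 0) = 1" by (simp add: norm_point_axis)
   let ?v2 = "%x. v x * v x" and ?g2 = "%x. v x *\<^sub>R g x + v x *\<^sub>R g x"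
   have "ennreal \<bar>?v2 (point i 1 y) - ?v2 (point i t y)\<bar> <= (NN s. indicator {t..1} s * ennreal (norm (point i 1 0) * norm (?g2 (point i s y))))"
    using C1_segment_bound[OF C1_mult[OF v v], of t 1 "point i 0 y" "point i 1 0"] t unfolding p by auto
   also have "... <= ?Q"
   proof (rule nn_integral_mono_AE)
    show "AE s in lborel. indicator {t..1} s * ennreal (norm (point i 1 0) * norm (?g2 (point i s y))) <= indicator ?I s * ennreal (?q (point i s y))"
     using AE_lborel_singleton[of 1]
    proof eventually_elim
     case (elim s)
     have "norm (?g2 (point i s y)) = 2 * \<bar>v (point i s y)\<bar> * norm (g (point i s y))"
      by (simp add: scaleR_2[symmetric] mult.assoc abs_mult del: scaleR_2)
     also have "... <= ?q (point i s y)"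
      using sum_squares_bound[of "\<bar>v (point i s y)\<bar>" "norm (g (point i s y))"] by simp
     finally have X: "ennreal (norm (point i 1 0) * norm (?g2 (point i s y))) <= ennreal (?q (point i s y))"
      unfolding nz mult_1 by (rule ennreal_leI)
     have "indicator {t..1} s <= (indicator ?I s :: ennreal)" using elim t by (auto simp: indicator_def)
     then show ?case by (rule mult_mono[OF _ X]) simp_all
    qed
   qed
   finally have *: "ennreal \<bar>?v2 (point i 1 y) - ?v2 (point i t y)\<bar> <= ?Q" .
   have "ennreal ((v (point i 1 y))\<^sup>2) <= ennreal ((v (point i t y))\<^sup>2) + ennreal \<bar>?v2 (point i 1 y) - ?v2 (point i t y)\<bar>"
    by (auto simp: ennreal_plus[symmetric] power2_eq_square simp del: ennreal_plus intro!: ennreal_leI)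
   also have "... <= ennreal ((v (point i t y))\<^sup>2) + ?Q" by (intro add_left_mono *)
   finally show ?thesis .
  qed
  have "ennreal d * ennreal ((v (point i 1 y))\<^sup>2) = (NN t. indicator ?I t * ennreal ((v (point i 1 y))\<^sup>2))"
   using d by (simp add: nn_integral_multc d_def)
  also have "... <= (NN t. indicator ?I t * ennreal ((v (point i t y))\<^sup>2) + indicator ?I t * ?Q)"
  proof (rule nn_integral_mono)
   fix t show "indicator ?I t * ennreal ((v (point i 1 y))\<^sup>2) <= indicator ?I t * ennreal ((v (point i t y))\<^sup>2) + indicator ?I t * ?Q"
    using le[of t] by (cases "t \<in> ?I") auto
  qed
  also have "... = (NN t. indicator ?I t * ennreal ((v (point i t y))\<^sup>2)) + ennreal d * ?Q"
   using d m2 by (simp add: nn_integral_add nn_integral_multc d_def)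
  also have "... <= ?Q + 1 * ?Q"
   using d by (intro add_mono mult_right_mono nn_integral_mono) (auto simp: indicator_def intro!: ennreal_leI)
  also have "... = ennreal 2 * ?Q" by (simp add: mult_2)
  finally have *: "ennreal d * ennreal ((v (point i 1 y))\<^sup>2) <= ennreal 2 * ?Q" .
  have "ennreal ((v (point i 1 y))\<^sup>2) = ennreal (1 / d) * (ennreal d * ennreal ((v (point i 1 y))\<^sup>2))"
   using d by (simp add: mult.assoc[symmetric] ennreal_mult[symmetric])
  also have "... <= ennreal (1 / d) * (ennreal 2 * ?Q)" by (intro mult_left_mono *) auto
  also have "... = ennreal (2 / d) * ?Q"
   using d by (simp add: mult.assoc[symmetric] ennreal_mult[symmetric] del: ennreal_numeral)
  finally show ?thesis .
 qed
 have m3: "(%x. ennreal (?q x)) \<in> borel_measurable borel" by measurable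
 have m4: "(%y. NN t. indicator ?I t * ennreal (?q (point i t y))) \<in> borel_measurable borel"
 proof -
  have 1: "(%p. ennreal (?q (point i (fst p) (snd p)))) \<in> borel_measurable (borel \<Otimes>\<^sub>M borel)"
   using measurable_compose[OF point_borel m3, of i] by (simp add: case_prod_beta')
  have "(%p. (snd p, fst p)) \<in> measurable (borel \<Otimes>\<^sub>M lborel) (borel \<Otimes>\<^sub>M borel)" by measurable
  from measurable_compose[OF this 1]
  have "(%(y, t). indicator ?I t * ennreal (?q (point i t y))) \<in> borel_measurable (borel \<Otimes>\<^sub>M lborel)"
   by (simp add: case_prod_beta')
  then show ?thesis by measurable
 qed
 have "(NN y. indicator (ball 0 (ep * h i)) y * ennreal ((v (point i 1 y))\<^sup>2)) <=
   (NN y. indicator (ball 0 (ep * h i)) y * (ennreal (2 / d) * (NN t. indicator ?I t * ennreal (?q (point i t y)))))"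
  by (intro nn_integral_mono mult_left_mono line) auto
 also have "... = ennreal (2 / d) * (NN y. indicator (ball 0 (ep * h i)) y * (NN t. indicator ?I t * ennreal (?q (point i t y))))"
 proof -
  have [measurable]: "ball (0::real\<times>real) (ep * h i) \<in> sets borel" by simp
  note m4[measurable]
  show ?thesis by (subst mult.left_commute, rule nn_integral_cmult) measurable
 qed
 finally show ?thesis unfolding nn_integral_cylinder(2)[OF m3] by (simp add: d_def)
qed

end

section \<open>Completeness of \<open>L\<^sup>2\<close>\<close>

text \<open>Along a subsequence the squared distances of consecutive terms are at most 16^-k, so the
  weighted sum of 4^k |a_k|^2 is finite almost everywhere; eventually |a_k| <= 2^-k and the
  subsequence converges pointwise. Fatou's lemma transfers the Cauchy bound to the limit.\<close>

lemma L2_complete: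
 fixes w :: "nat => 'a => real"
 assumes w: "\<And>n. in_L2 M (w n)"
  and cauchy: "\<And>e. e > 0 ==> \<exists>N. \<forall>m\<ge>N. \<forall>n\<ge>N. (\<integral>x. (w m x - w n x)\<^sup>2 \<partial>M) < e"
 obtains g where "in_L2 M g" "(%n. \<integral>x. (w n x - g x)\<^sup>2 \<partial>M) \<longlonglongrightarrow> 0"
proof -
 have [measurable]: "w n \<in> borel_measurable M" for n using w by (simp add: in_L2_def)
 have i2: "integrable M (%x. (w m x - w n x)\<^sup>2)" for m n
  using in_L2_diff[OF w w, of m n] by (simp add: in_L2_def)
 have nn: "(\<integral>\<^sup>+x. ennreal ((w m x - w n x)\<^sup>2) \<partial>M) = ennreal (\<integral>x. (w m x - w n x)\<^sup>2 \<partial>M)" for m n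
  by (rule nn_integral_eq_integral[OF i2]) simp
 have "\<exists>N. \<forall>m\<ge>N. \<forall>n\<ge>N. (\<integral>x. (w m x - w n x)\<^sup>2 \<partial>M) < (1 / 16) ^ k" for k
  by (rule cauchy) simp
 then obtain N where N: "\<And>k m n. m >= N k ==> n >= N k ==> (\<integral>x. (w m x - w n x)\<^sup>2 \<partial>M) < (1 / 16) ^ k"
  by metis
 \<comment> \<open>Summing the thresholds makes \<open>r\<close> increasing with \<open>r k\<close>
   at least \<open>N k\<close>, and adding k sends it to infinity.\<close>
 define r where "r k = (\<Sum>j\<le>k. N j) + k" for k
 have r_ge: "N k <= r k" for k unfolding r_def by (simp add: member_le_sum trans_le_add1)
 have r_mono: "r k <= r (Suc k)" for k by (simp add: r_def)
 have r_id: "k <= r k" for k by (simp add: r_def)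
 define a where "a k x = w (r (Suc k)) x - w (r k) x" for k x
 have [measurable]: "a k \<in> borel_measurable M" for k unfolding a_def by measurable
 have a_le: "(\<integral>\<^sup>+x. ennreal ((a k x)\<^sup>2) \<partial>M) <= ennreal ((1 / 16) ^ k)" for k
  unfolding a_def nn using N[of k "r (Suc k)" "r k"] r_ge[of k] r_mono[of k] by (intro ennreal_leI) auto
 have "(\<integral>\<^sup>+x. (\<Sum>k. ennreal (4 ^ k * (a k x)\<^sup>2)) \<partial>M) = (\<Sum>k. \<integral>\<^sup>+x. ennreal (4 ^ k * (a k x)\<^sup>2) \<partial>M)"
  by (rule nn_integral_suminf) measurable
 also have "... = (\<Sum>k. ennreal (4 ^ k) * (\<integral>\<^sup>+x. ennreal ((a k x)\<^sup>2) \<partial>M))"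
  by (intro suminf_cong) (simp add: ennreal_mult nn_integral_cmult)
 also have "... <= (\<Sum>k. ennreal (4 ^ k) * ennreal ((1 / 16) ^ k))"
  by (intro suminf_le mult_left_mono a_le) auto
 also have "... = (\<Sum>k. ennreal ((1 / 4) ^ k))"
  by (intro suminf_cong) (simp add: ennreal_mult[symmetric] power_mult_distrib[symmetric])
 also have "... = ennreal (\<Sum>k. (1 / 4) ^ k)"
  by (intro suminf_ennreal2 summable_geometric) auto
 also have "... < \<infinity>" by simp
 finally have "AE x in M. (\<Sum>k. ennreal (4 ^ k * (a k x)\<^sup>2)) \<noteq> \<infinity>"
  by (intro nn_integral_PInf_AE) auto
 then have conv: "AE x in M. convergent (%k. w (r k) x)"
 proof eventually_elim
  case (elim x)
  then have "summable (%k. 4 ^ k * (a k x)\<^sup>2)"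
   by (intro summable_suminf_not_top) auto
  then have "(%k. 4 ^ k * (a k x)\<^sup>2) \<longlonglongrightarrow> 0" by (rule summable_LIMSEQ_zero)
  then have "eventually (%k. 4 ^ k * (a k x)\<^sup>2 < 1) sequentially"
   by (rule order_tendstoD) simp
  then have ev: "eventually (%k. norm (a k x) <= (1 / 2) ^ k) sequentially"
  proof eventually_elim
   case (elim k)
   have "(2 ^ k * a k x)\<^sup>2 <= 1\<^sup>2"
    using elim by (simp add: power_mult_distrib power_mult[symmetric] mult.commute[of k 2] power_mult)
   then have "\<bar>2 ^ k * a k x\<bar> <= 1" using abs_le_square_iff[of "2 ^ k * a k x" 1] by simp
   then show ?case by (simp add: abs_mult power_one_over field_simps)
  qed
  have "summable (%k. a k x)"
   by (rule summable_comparison_test_ev[OF ev]) (simp add: summable_geometric)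
  then have "convergent (%n. \<Sum>k<n. a k x)" by (simp add: summable_iff_convergent)
  moreover have "(\<Sum>k<n. a k x) = w (r n) x - w (r 0) x" for n
   unfolding a_def by (rule sum_lessThan_telescope)
  ultimately have "convergent (%n. w (r n) x - w (r 0) x)" by simp
  then have "convergent (%n. (w (r n) x - w (r 0) x) + w (r 0) x)"
   by (intro convergent_add convergent_const)
  then show ?case by simp
 qed
 define g where "g x = lim (%k. w (r k) x)" for x
 have [measurable]: "g \<in> borel_measurable M" unfolding g_def by measurable
 have bound: "(\<integral>\<^sup>+x. ennreal ((w n x - g x)\<^sup>2) \<partial>M) <= ennreal ((1 / 16) ^ k)" if n: "n >= N k" for n k
 proof -
  have "(\<integral>\<^sup>+x. ennreal ((w n x - g x)\<^sup>2) \<partial>M) = (\<integral>\<^sup>+x. liminf (%j. ennreal ((w n x - w (r j) x)\<^sup>2)) \<partial>M)"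
  proof (rule nn_integral_cong_AE)
   show "AE x in M. ennreal ((w n x - g x)\<^sup>2) = liminf (%j. ennreal ((w n x - w (r j) x)\<^sup>2))"
    using conv
   proof eventually_elim
    case (elim x)
    then have "(%j. w (r j) x) \<longlonglongrightarrow> g x" by (simp add: g_def convergent_LIMSEQ_iff)
    then have "(%j. ennreal ((w n x - w (r j) x)\<^sup>2)) \<longlonglongrightarrow> ennreal ((w n x - g x)\<^sup>2)"
     by (intro tendsto_intros)
    then show ?case by (rule lim_imp_Liminf[OF trivial_limit_sequentially, symmetric])
   qed
  qed
  also have "... <= liminf (%j. \<integral>\<^sup>+x. ennreal ((w n x - w (r j) x)\<^sup>2) \<partial>M)"
   by (rule nn_integral_liminf) measurable
  also have "... <= ennreal ((1 / 16) ^ k)"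
  proof (rule Liminf_le)
   show "eventually (%j. (\<integral>\<^sup>+x. ennreal ((w n x - w (r j) x)\<^sup>2) \<partial>M) <= ennreal ((1 / 16) ^ k)) sequentially"
    using eventually_ge_at_top[of "N k"]
   proof eventually_elim
    case (elim j)
    then show ?case unfolding nn using N[of k n "r j"] n r_id[of j] by (intro ennreal_leI) auto
   qed
  qed simp
  finally show ?thesis .
 qed
 have ig: "in_L2 M (%x. w (N k) x - g x)" for k
  using bound[of k "N k"] by (auto simp: in_L2_def integrable_iff_bounded intro: le_less_trans)
 have "in_L2 M (%x. w (N 0) x - (w (N 0) x - g x))"
  by (intro in_L2_diff w ig)
 then have gL: "in_L2 M g" by simp
 have "(%n. \<integral>x. (w n x - g x)\<^sup>2 \<partial>M) \<longlonglongrightarrow> 0"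
 proof (rule LIMSEQ_I)
  fix e :: real assume e: "e > 0"
  obtain k where k: "(1 / 16) ^ k < e" using real_arch_pow_inv[OF e, of "1/16"] by auto
  have "norm ((\<integral>x. (w n x - g x)\<^sup>2 \<partial>M) - 0) < e" if n: "n >= N k" for n
  proof -
   have i: "integrable M (%x. (w n x - g x)\<^sup>2)" using in_L2_diff[OF w gL] by (simp add: in_L2_def)
   have "ennreal (\<integral>x. (w n x - g x)\<^sup>2 \<partial>M) <= ennreal ((1 / 16) ^ k)"
    using bound[OF n] nn_integral_eq_integral[OF i] by simp
   then have "(\<integral>x. (w n x - g x)\<^sup>2 \<partial>M) <= (1 / 16) ^ k" by (subst (asm) ennreal_le_iff) auto
   then show ?thesis using k by simp
  qed
  then show "\<exists>N. \<forall>n\<ge>N. norm ((\<integral>x. (w n x - g x)\<^sup>2 \<partial>M) - 0) < e" by blast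
 qed
 with gL show ?thesis by (rule that)
qed

section \<open>From the weak formulation to test functions of class \<open>C\<^sup>1\<close>\<close>

lemma (in finite_measure) integral_abs_le_L2:
 fixes k :: "'a => real"
 assumes k: "in_L2 M k"
 shows "integrable M k" "(\<integral>x. \<bar>k x\<bar> \<partial>M)\<^sup>2 <= measure M (space M) * (\<integral>x. (k x)\<^sup>2 \<partial>M)"
proof -
 have [measurable]: "k \<in> borel_measurable M" and k2: "integrable M (%x. (k x)\<^sup>2)"
  using k by (auto simp: in_L2_def)
 show i: "integrable M k" by (rule square_integrable_imp_integrable) (use k2 in auto)
 have "ennreal ((\<integral>x. \<bar>k x\<bar> \<partial>M)\<^sup>2) = (\<integral>\<^sup>+x. ennreal \<bar>k x\<bar> * 1 \<partial>M)\<^sup>2"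
  using nn_integral_eq_integral[of M "%x. \<bar>k x\<bar>"] i by (simp add: ennreal_power)
 also have "... <= (\<integral>\<^sup>+x. (ennreal \<bar>k x\<bar>)\<^sup>2 \<partial>M) * (\<integral>\<^sup>+x. 1\<^sup>2 \<partial>M)"
  by (rule Cauchy_Schwarz_nn_integral) measurable
 also have "(\<integral>\<^sup>+x. (ennreal \<bar>k x\<bar>)\<^sup>2 \<partial>M) = ennreal (\<integral>x. (k x)\<^sup>2 \<partial>M)"
  using nn_integral_eq_integral[OF k2] by (simp add: ennreal_power)
 also have "(\<integral>\<^sup>+x. 1\<^sup>2 \<partial>M) = ennreal (measure M (space M))"
  by (simp add: emeasure_eq_measure)
 finally show "(\<integral>x. \<bar>k x\<bar> \<partial>M)\<^sup>2 <= measure M (space M) * (\<integral>x. (k x)\<^sup>2 \<partial>M)"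
  by (simp add: ennreal_mult[symmetric] mult.commute)
qed

lemma (in finite_measure) L2_imp_L1_tendsto:
 fixes k :: "nat => 'a => real"
 assumes k: "\<And>n. in_L2 M (k n)" and lim: "(%n. \<integral>x. (k n x)\<^sup>2 \<partial>M) \<longlonglongrightarrow> 0"
 shows "(%n. \<integral>x. \<bar>k n x\<bar> \<partial>M) \<longlonglongrightarrow> 0"
proof -
 have "(%n. sqrt (measure M (space M) * (\<integral>x. (k n x)\<^sup>2 \<partial>M))) \<longlonglongrightarrow> sqrt (measure M (space M) * 0)"
  by (intro tendsto_intros lim)
 then have *: "(%n. sqrt (measure M (space M) * (\<integral>x. (k n x)\<^sup>2 \<partial>M))) \<longlonglongrightarrow> 0" by simp
 show ?thesis
 proof (rule tendsto_sandwich[OF _ _ tendsto_const *])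
  show "eventually (%n. 0 <= (\<integral>x. \<bar>k n x\<bar> \<partial>M)) sequentially" by simp
  show "eventually (%n. (\<integral>x. \<bar>k n x\<bar> \<partial>M) <= sqrt (measure M (space M) * (\<integral>x. (k n x)\<^sup>2 \<partial>M))) sequentially"
   using integral_abs_le_L2(2)[OF k] by (intro always_eventually allI real_le_rsqrt)
 qed
qed

lemma (in finite_measure) L2_tendsto_integral:
 fixes w :: "nat => 'a => real"
 assumes w: "\<And>n. in_L2 M (w n)" and u: "in_L2 M u" and lim: "(%n. \<integral>x. (w n x - u x)\<^sup>2 \<partial>M) \<longlonglongrightarrow> 0"
  and b[measurable]: "b \<in> borel_measurable M" and B: "\<And>x. x \<in> space M ==> \<bar>b x\<bar> <= B"
 shows "(%n. \<integral>x. b x * w n x \<partial>M) \<longlonglongrightarrow> (\<integral>x. b x * u x \<partial>M)"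
proof -
 have ib: "integrable M (%x. b x * k x)" if k: "in_L2 M k" for k
 proof (rule Bochner_Integration.integrable_bound)
  show "integrable M (%x. B * k x)" using integral_abs_le_L2(1)[OF k] by simp
  show "(%x. b x * k x) \<in> borel_measurable M" using k by (auto simp: in_L2_def)
  show "AE x in M. norm (b x * k x) <= norm (B * k x)"
   using B by (intro AE_I2) (fastforce simp: abs_mult intro: mult_right_mono)
 qed
 have d: "in_L2 M (%x. w n x - u x)" for n by (rule in_L2_diff[OF w u])
 have "(%n. B * (\<integral>x. \<bar>w n x - u x\<bar> \<partial>M)) \<longlonglongrightarrow> B * 0"
  by (intro tendsto_intros L2_imp_L1_tendsto d lim)
 then have *: "(%n. B * (\<integral>x. \<bar>w n x - u x\<bar> \<partial>M)) \<longlonglongrightarrow> 0" by simp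
 have "(%n. (\<integral>x. b x * w n x \<partial>M) - (\<integral>x. b x * u x \<partial>M)) \<longlonglongrightarrow> 0"
 proof (rule Lim_null_comparison[OF _ *], intro always_eventually allI)
  fix n
  have "(\<integral>x. b x * w n x \<partial>M) - (\<integral>x. b x * u x \<partial>M) = (\<integral>x. b x * (w n x - u x) \<partial>M)"
   using ib[OF w] ib[OF u] by (simp add: right_diff_distrib)
  also have "norm ... <= (\<integral>x. norm (b x * (w n x - u x)) \<partial>M)"
   by (rule integral_norm_bound)
  also have "... <= (\<integral>x. B * \<bar>w n x - u x\<bar> \<partial>M)"
  proof (rule integral_mono)
   show "integrable M (%x. norm (b x * (w n x - u x)))" using ib[OF d] by (rule integrable_norm)
   show "integrable M (%x. B * \<bar>w n x - u x\<bar>)" using integral_abs_le_L2(1)[OF d] by simp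
  qed (use B in \<open>auto simp: abs_mult intro: mult_right_mono\<close>)
  finally show "norm ((\<integral>x. b x * w n x \<partial>M) - (\<integral>x. b x * u x \<partial>M)) <= B * (\<integral>x. \<bar>w n x - u x\<bar> \<partial>M)" by simp
 qed
 then show ?thesis by (simp add: LIM_zero_iff)
qed

lemma integral_lebesgue_on_open:
 fixes q q' :: "'a::euclidean_space => real"
 assumes S: "open S" and q': "q' \<in> borel_measurable borel" and eq: "AE x in lborel. x \<in> S --> q x = q' x"
 shows "(\<integral>x. q x \<partial>lebesgue_on S) = (LBINT x. indicator S x * q' x)"
  and "integrable (lebesgue_on S) q \<longleftrightarrow> integrable lborel (%x. indicator S x * q' x)"
proof -
 have SL: "S \<in> sets lebesgue" and [measurable]: "S \<in> sets borel" using S by auto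
 have m: "(%x. indicator S x * q' x) \<in> borel_measurable borel" using q' by measurable
 have ae: "AE x in lborel. indicator S x * q' x = (if x \<in> S then q x else 0)"
  using eq by eventually_elim auto
 show "(\<integral>x. q x \<partial>lebesgue_on S) = (LBINT x. indicator S x * q' x)"
  "integrable (lebesgue_on S) q \<longleftrightarrow> integrable lborel (%x. indicator S x * q' x)"
  using integral_lebesgue_on_borel_rep[OF SL m ae] by simp_all
qed

lemma in_L2_square_diff: 
 fixes a b :: "'a => 'b::euclidean_space"
 assumes "in_L2 M a" "in_L2 M b"
 shows "(\<integral>x. (norm (a x - b x))\<^sup>2 \<partial>M) <= 2 * (\<integral>x. (norm (a x))\<^sup>2 \<partial>M) + 2 * (\<integral>x. (norm (b x))\<^sup>2 \<partial>M)"
proof -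
 have i: "integrable M (%x. (norm (a x))\<^sup>2)" "integrable M (%x. (norm (b x))\<^sup>2)"
  using assms by (auto simp: in_L2_def)
 have "(\<integral>x. (norm (a x - b x))\<^sup>2 \<partial>M) <= (\<integral>x. 2 * (norm (a x))\<^sup>2 + 2 * (norm (b x))\<^sup>2 \<partial>M)"
 proof (rule integral_mono)
  show "integrable M (%x. (norm (a x - b x))\<^sup>2)" using in_L2_diff[OF assms] by (simp add: in_L2_def)
  show "integrable M (%x. 2 * (norm (a x))\<^sup>2 + 2 * (norm (b x))\<^sup>2)" using i by simp
  fix x
  have "(norm (a x - b x))\<^sup>2 <= (norm (a x) + norm (b x))\<^sup>2"
   by (intro power_mono norm_triangle_ineq4) simp
  also have "... <= 2 * (norm (a x))\<^sup>2 + 2 * (norm (b x))\<^sup>2"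
   using sum_squares_bound[of "norm (a x)" "norm (b x)"] by (simp add: power2_sum)
  finally show "(norm (a x - b x))\<^sup>2 <= 2 * (norm (a x))\<^sup>2 + 2 * (norm (b x))\<^sup>2" .
 qed
 also have "... = 2 * (\<integral>x. (norm (a x))\<^sup>2 \<partial>M) + 2 * (\<integral>x. (norm (b x))\<^sup>2 \<partial>M)"
  using i by simp
 finally show ?thesis .
qed

text \<open>What the estimates use of the data: the bounds \<open>F0\<close> and \<open>M0\<close>,
  and \<open>F1\<close>, which measures how far f deviates from its axis values across a section of
  size eps.\<close>

locale junction_data = junction l R e0 h \<Xi> for l R e0 h \<Xi> +
 fixes f :: "real^3 => real" and \<phi> :: "3 => real => real \<times> real => real" and F0 F1 M0 :: real
 assumes f_cont: "\<And>ep. 0 < ep ==> ep <= e0 ==> continuous_on (Om ep) f"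
  and F0: "\<And>ep x. 0 < ep ==> ep <= e0 ==> x \<in> Om ep ==> \<bar>f x\<bar> <= F0"
  and F1: "\<And>ep x i. 0 < ep ==> ep <= e0 ==> x \<in> cyl ep i ==> \<bar>f x - f (point i (x $ i) 0)\<bar> <= F1 * ep"
  and f_axis: "\<And>i. continuous_on {0..1} (%t. f (point i t 0))"
   "\<And>i t. t \<in> {0..1} ==> \<bar>f (point i t 0)\<bar> <= F0"
  and \<phi>_cont: "\<And>i. continuous_on ({0..1} \<times> sphere 0 (h i)) (%(t, y). \<phi> i t y)"
  and M0: "\<And>i t y. t \<in> {0..1} ==> y \<in> sphere 0 (h i) ==> \<bar>\<phi> i t y\<bar> <= M0"
begin

text \<open>The lateral integral as an iterated integral in the axial and angular variables.
  Rescaling by 1/eps puts the second argument of \<open>\<phi>\<close> on the fixed circle of radius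
  \<open>h i\<close>.\<close>

definition lat :: "real => 3 => (real^3 => real) => real" where
 "lat ep i v = (LBINT t. indicator {ep * l<..<1} t * (ep * h i * (LBINT th. indicator {0..<2 * pi} th *
   (\<phi> i t (polar (h i) th) * v (point i t (polar (ep * h i) th))))))"

text \<open>The right-hand side of the weak formulation with v as its own lateral trace, as is
  legitimate for C1 functions.\<close>

definition load :: "real => (real^3 => real) => real" where
 "load ep v = (LBINT x. indicator (Om ep) x * (f x * v x)) - ep * (\<Sum>i\<in>UNIV. lat ep i v)"

section \<open>The weak formulation for a fixed eps, reduced to C1 functions\<close>

context
 fixes ep :: real
 assumes e: "0 < ep" "ep <= e0"
begin

lemma el: "ep * l < 1"
proof -
 have "ep * l <= e0 * R" using e l lR by (intro mult_mono) auto
 moreover have "e0 * (2 * R + 1) = 2 * (e0 * R) + e0" by (simp add: algebra_simps)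
 ultimately show ?thesis using e0 mult_pos_pos[OF e0(1) R_pos] by linarith
qed

abbreviation "Mo \<equiv> lebesgue_on (Om ep)"
abbreviation "La i \<equiv> lateral_measure l h ep i"

lemma finite_Mo: "finite_measure Mo"
 by (intro finite_measure_lebesgue_on lmeasurable_open open_Om bounded_Om[OF e])

lemma in_L2_Mo: "continuous_on UNIV w ==> in_L2 Mo (w :: real^3 => 'b::euclidean_space)"
 using open_Om by (intro in_L2_continuous bounded_Om[OF e]) auto

lemma nn_cyl_le:
 assumes v: "C1 v g"
 shows "(NN x. indicator (cyl ep i) x * ennreal ((v x)\<^sup>2 + (norm (g x))\<^sup>2))
  <= ennreal ((\<integral>x. (v x)\<^sup>2 \<partial>Mo) + (\<integral>x. (norm (g x))\<^sup>2 \<partial>Mo))"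
proof -
 let ?q = "%x. (v x)\<^sup>2 + (norm (g x))\<^sup>2"
 have [measurable]: "v \<in> borel_measurable borel" "g \<in> borel_measurable borel" using C1_borel[OF v] by auto
 have i: "integrable Mo (%x. (v x)\<^sup>2)" "integrable Mo (%x. (norm (g x))\<^sup>2)"
  using in_L2_Mo[OF C1_continuous(1)[OF v]] in_L2_Mo[OF C1_continuous(2)[OF v]] by (auto simp: in_L2_def)
 then have iq: "integrable Mo ?q" by simp
 have c: "integrable lborel (%x. indicator (Om ep) x * ?q x)" "(\<integral>x. ?q x \<partial>Mo) = (LBINT x. indicator (Om ep) x * ?q x)"
  using integral_lebesgue_on_open[where q = ?q and q' = ?q, OF open_Om, of ep] iq by auto
 have "(NN x. indicator (cyl ep i) x * ennreal (?q x)) <= (NN x. ennreal (indicator (Om ep) x * ?q x))"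
  using cyl_subset[of ep i] by (intro nn_integral_mono) (auto simp: indicator_def)
 also have "... = ennreal (\<integral>x. ?q x \<partial>Mo)"
  unfolding c(2) by (rule nn_integral_eq_integral[OF c(1)]) auto
 finally show ?thesis using i by simp
qed

lemma lateral_trace_real:
 assumes v: "C1 v g"
 shows "in_L2 (La i) v" "(\<integral>x. (v x)\<^sup>2 \<partial>La i) <= (20 / (ep * h i) + 10) * ((\<integral>x. (v x)\<^sup>2 \<partial>Mo) + (\<integral>x. (norm (g x))\<^sup>2 \<partial>Mo))"
proof -
 let ?C = "20 / (ep * h i) + 10"
 let ?D = "(\<integral>x. (v x)\<^sup>2 \<partial>Mo) + (\<integral>x. (norm (g x))\<^sup>2 \<partial>Mo)"
 have C: "?C >= 0" using e h[of i] by (intro add_nonneg_nonneg divide_nonneg_nonneg) simp_all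
 have [measurable]: "v \<in> borel_measurable borel" using C1_borel[OF v] by auto
 have vm: "v \<in> borel_measurable (La i)"
  unfolding lateral_measure_def measurable_distr_eq1 by (intro measurable_restrict_space1) measurable
 have "(\<integral>\<^sup>+x. ennreal ((v x)\<^sup>2) \<partial>La i) <= ennreal ?C * ennreal ?D"
  using lateral_trace[where i = i, OF l e(1) h v] nn_cyl_le[OF v, of i]
  by (meson mult_left_mono order_trans zero_le)
 also have "... = ennreal (?C * ?D)" using C by (intro ennreal_mult[symmetric]) auto
 finally have le: "(\<integral>\<^sup>+x. ennreal ((v x)\<^sup>2) \<partial>La i) <= ennreal (?C * ?D)" .
 have i: "integrable (La i) (%x. (v x)\<^sup>2)"
  using vm le by (intro integrableI_bounded) (auto intro: le_less_trans)
 then show "in_L2 (La i) v" using vm by (simp add: in_L2_def)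
 have "ennreal (\<integral>x. (v x)\<^sup>2 \<partial>La i) <= ennreal (?C * ?D)"
  using le nn_integral_eq_integral[OF i] by simp
 moreover have "?C * ?D >= 0" by (rule mult_nonneg_nonneg[OF C]) simp
 ultimately show "(\<integral>x. (v x)\<^sup>2 \<partial>La i) <= ?C * ?D" by (simp only: ennreal_le_iff)
qed

lemma end_trace_real:
 assumes v: "C1 v g"
 shows "integrable lborel (%y. indicator (ball 0 (ep * h i)) y * (v (point i 1 y))\<^sup>2)"
  "(LBINT y. indicator (ball 0 (ep * h i)) y * (v (point i 1 y))\<^sup>2) <= 2 / (1 - ep * l) * ((\<integral>x. (v x)\<^sup>2 \<partial>Mo) + (\<integral>x. (norm (g x))\<^sup>2 \<partial>Mo))"
proof -
 let ?C = "2 / (1 - ep * l)"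
 let ?D = "(\<integral>x. (v x)\<^sup>2 \<partial>Mo) + (\<integral>x. (norm (g x))\<^sup>2 \<partial>Mo)"
 let ?k = "%y. indicator (ball 0 (ep * h i)) y * (v (point i 1 y))\<^sup>2"
 have C: "?C >= 0" using el by simp
 have vb: "v \<in> borel_measurable borel" using C1_borel[OF v] by auto
 have [measurable]: "(%y. v (point i 1 y)) \<in> borel_measurable borel" using vb by (rule point_borel_section)
 have [measurable]: "ball (0::real\<times>real) (ep * h i) \<in> sets borel" by simp
 have "(NN y. ennreal (?k y)) = (NN y. indicator (ball 0 (ep * h i)) y * ennreal ((v (point i 1 y))\<^sup>2))"
  by (intro nn_integral_cong) (auto simp: indicator_def)
 also have "... <= ennreal ?C * ennreal ?D"
  using end_trace[where i = i, OF l e(1) h v el] nn_cyl_le[OF v, of i]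
  by (meson mult_left_mono order_trans zero_le)
 also have "... = ennreal (?C * ?D)" using C by (intro ennreal_mult[symmetric]) auto
 finally have le: "(NN y. ennreal (?k y)) <= ennreal (?C * ?D)" .
 show i: "integrable lborel ?k"
  using le by (intro integrableI_bounded) (auto intro: le_less_trans simp: abs_mult)
 have "ennreal (LBINT y. ?k y) <= ennreal (?C * ?D)"
  using le nn_integral_eq_integral[OF i] by simp
 moreover have "?C * ?D >= 0" by (rule mult_nonneg_nonneg[OF C]) simp
 ultimately show "(LBINT y. ?k y) <= ?C * ?D" by (simp only: ennreal_le_iff)
qed

lemma cross_map: "point i 1 \<in> measurable (restrict_space lborel (ball 0 (ep * h i))) (restrict_space borel (cross_section h ep i 1))"
proof (rule measurable_restrict_space2)
 show "point i 1 \<in> space (restrict_space lborel (ball 0 (ep * h i))) \<rightarrow> cross_section h ep i 1"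
  by (auto simp: space_restrict_space cross_section_def)
 show "point i 1 \<in> measurable (restrict_space lborel (ball 0 (ep * h i))) borel"
  by (intro measurable_restrict_space1) (simp add: borel_measurable_continuous_onI continuous_intros)
qed

lemma integral_cross:
 fixes k :: "real^3 => real"
 assumes k: "k \<in> borel_measurable borel"
 shows "(\<integral>x. k x \<partial>cross_section_measure h ep i 1) = (LBINT y. indicator (ball 0 (ep * h i)) y * k (point i 1 y))"
  and "integrable (cross_section_measure h ep i 1) k \<longleftrightarrow> integrable lborel (%y. indicator (ball 0 (ep * h i)) y * k (point i 1 y))"
proof -
 have km: "k \<in> borel_measurable (restrict_space borel (cross_section h ep i 1))"
  using k by (rule measurable_restrict_space1)
 show "(\<integral>x. k x \<partial>cross_section_measure h ep i 1) = (LBINT y. indicator (ball 0 (ep * h i)) y * k (point i 1 y))"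
  unfolding cross_section_measure_def integral_distr[OF cross_map km]
  by (subst integral_restrict_space) auto
 show "integrable (cross_section_measure h ep i 1) k \<longleftrightarrow> integrable lborel (%y. indicator (ball 0 (ep * h i)) y * k (point i 1 y))"
  unfolding cross_section_measure_def integrable_distr_eq[OF cross_map km]
  by (subst integrable_restrict_space) auto
qed

text \<open>Lets the constant sequence v, v, ... witness that a C1 function is its own trace. As
  \<open>weak_grad\<close> is a choice, even the norm of the zero function has to go through
  uniqueness of weak gradients.\<close>

lemma H1_norm_zero: "H1_norm (Om ep) (%x. 0) = 0"
proof -
 have z: "C1 (%x::real^3. 0) (%x. 0)" by (simp add: C1_def)
 have "(\<integral>x. (norm (weak_grad (Om ep) (%x. 0) x))\<^sup>2 \<partial>Mo) = (\<integral>x. 0 \<partial>Mo)"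
 proof (rule integral_cong_AE)
  have "has_weak_grad (Om ep) (%x. 0) (weak_grad (Om ep) (%x. 0))"
   by (intro in_H1_weak_grad C1_in_H1(1)[OF open_Om bounded_Om[OF e] z])
  then show "(%x. (norm (weak_grad (Om ep) (%x. 0) x))\<^sup>2) \<in> borel_measurable Mo"
   by (auto simp: has_weak_grad_def in_L2_def)
  show "AE x in Mo. (norm (weak_grad (Om ep) (%x. 0) x))\<^sup>2 = 0"
   using C1_in_H1(2)[OF open_Om bounded_Om[OF e] z] by eventually_elim simp
 qed simp
 then show ?thesis by (simp add: H1_norm_def)
qed

lemma C1_trace_lateral: 
 assumes v: "C1 v g" shows "has_trace (Om ep) (La i) v v"
 unfolding has_trace_def
 using C1_imp_C_k[OF v] C1_in_H1(1)[OF open_Om bounded_Om[OF e] v] lateral_trace_real(1)[OF v]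
 by (intro conjI exI[of _ "%n. v"] allI) (simp_all add: H1_norm_zero)

lemma C1_trace_end:
 assumes v: "C1 v g" and zero: "\<And>y. norm y < ep * h i ==> v (point i 1 y) = 0"
 shows "has_trace (Om ep) (cross_section_measure h ep i 1) v (%_. 0)"
proof -
 have vb: "v \<in> borel_measurable borel" "(%x. (v x)\<^sup>2) \<in> borel_measurable borel" using C1_borel[OF v] by auto
 have z: "indicator (ball 0 (ep * h i)) y * (v (point i 1 y))\<^sup>2 = 0" for y
  using zero[of y] by (simp add: indicator_def)
 have "integrable (cross_section_measure h ep i 1) (%x. (v x)\<^sup>2)"
  unfolding integral_cross(2)[OF vb(2)] z by simp
 moreover have "v \<in> borel_measurable (cross_section_measure h ep i 1)"
  unfolding cross_section_measure_def measurable_distr_eq1 by (rule measurable_restrict_space1[OF vb(1)])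
 ultimately have "in_L2 (cross_section_measure h ep i 1) v" by (simp add: in_L2_def)
 moreover have "(\<integral>x. (v x)\<^sup>2 \<partial>cross_section_measure h ep i 1) = 0"
  unfolding integral_cross(1)[OF vb(2)] z by simp
 moreover have "in_L2 (cross_section_measure h ep i 1) (%_. 0 :: real)" by (simp add: in_L2_def)
 ultimately show ?thesis
  unfolding has_trace_def
  using C1_imp_C_k[OF v] C1_in_H1(1)[OF open_Om bounded_Om[OF e] v]
  by (intro conjI exI[of _ "%n. v"] allI) (simp_all add: H1_norm_zero)
qed

text \<open>On the lateral surface the rescaled transversal variable lies on the circle of radius
  \<open>h i\<close>, where \<open>\<phi>\<close> is known to be continuous and bounded.\<close>

lemma \<phi>_lateral: "(%x. \<phi> i (x $ i) (rest i x /\<^sub>R ep)) \<in> borel_measurable (La i)"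
  "x \<in> lateral_surface l h ep i ==> \<bar>\<phi> i (x $ i) (rest i x /\<^sub>R ep)\<bar> <= M0"
proof -
 have m: "(x $ i, rest i x /\<^sub>R ep) \<in> {0..1} \<times> sphere 0 (h i)" if x: "x \<in> lateral_surface l h ep i" for x
 proof -
  have t: "ep * l < x $ i" "x $ i < 1" "x \<in> frontier (cyl ep i)" using x by (auto simp: lateral_surface_def)
  then have "x \<notin> cyl ep i" by (simp add: frontier_def interior_open[OF open_cyl])
  then have "norm (rest i x) >= ep * h i" using t by (simp add: cylinder_def)
  moreover have "norm (rest i x) <= ep * h i" using closure_cyl[of x ep i] t by (simp add: frontier_def)
  ultimately have "norm (rest i x) = ep * h i" by simp
  moreover have "0 < ep * l" using e l by simp
  ultimately show ?thesis using t e by (simp add: field_simps)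
 qed
 have "continuous_on (lateral_surface l h ep i) (%x. case (x $ i, rest i x /\<^sub>R ep) of (t, y) => \<phi> i t y)"
  by (rule continuous_on_compose2[OF \<phi>_cont]) (use m in \<open>auto intro!: continuous_intros\<close>)
 then have "continuous_on (lateral_surface l h ep i) (%x. \<phi> i (x $ i) (rest i x /\<^sub>R ep))" by simp
 then show "(%x. \<phi> i (x $ i) (rest i x /\<^sub>R ep)) \<in> borel_measurable (La i)"
  unfolding lateral_measure_def measurable_distr_eq1 by (rule borel_measurable_continuous_on_restrict)
 show "x \<in> lateral_surface l h ep i ==> \<bar>\<phi> i (x $ i) (rest i x /\<^sub>R ep)\<bar> <= M0"
  using m[of x] M0[of "x $ i" "rest i x /\<^sub>R ep" i] by auto
qed

lemma lat_eq:
 assumes v: "C1 v g"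
 shows "(\<integral>x. \<phi> i (x $ i) (rest i x /\<^sub>R ep) * v x \<partial>La i) = lat ep i v"
proof -
 interpret finite_measure "La i" by (rule finite_measure_lateral[OF l e(1) h])
 have sp: "space (La i) = lateral_surface l h ep i" by (simp add: lateral_measure_def space_restrict_space)
 have i: "integrable (La i) (%x. \<phi> i (x $ i) (rest i x /\<^sub>R ep) * v x)"
 proof (rule Bochner_Integration.integrable_bound)
  show "integrable (La i) (%x. M0 * v x)" using integral_abs_le_L2(1)[OF lateral_trace_real(1)[OF v]] by simp
  show "(%x. \<phi> i (x $ i) (rest i x /\<^sub>R ep) * v x) \<in> borel_measurable (La i)"
   using \<phi>_lateral(1) lateral_trace_real(1)[OF v, of i] by (auto simp: in_L2_def)
  show "AE x in La i. norm (\<phi> i (x $ i) (rest i x /\<^sub>R ep) * v x) <= norm (M0 * v x)"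
  proof (rule AE_I2)
   fix x assume "x \<in> space (La i)"
   then have "\<bar>\<phi> i (x $ i) (rest i x /\<^sub>R ep)\<bar> <= \<bar>M0\<bar>" using \<phi>_lateral(2)[of x i] sp by auto
   then show "norm (\<phi> i (x $ i) (rest i x /\<^sub>R ep) * v x) <= norm (M0 * v x)"
    by (simp add: abs_mult mult_right_mono)
  qed
 qed
 have p: "polar (ep * h i) th /\<^sub>R ep = polar (h i) th" for th using e by (simp add: polar_def)
 show ?thesis
  unfolding integral_lateral[OF l e(1) h i] lat_def by (simp add: p)
qed

text \<open>The traces on the three end discs come with three unrelated approximating sequences. All
  of them converge to u in H1, so one of them can be kept for all discs. Its lateral traces are
  Cauchy in L2 and give u a lateral trace, which makes u itself an admissible test function; this is
  how the energy of u becomes the limit of \<open>load\<close> along the sequence. \<open>U\<close>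
  and \<open>H\<close> are Borel representatives of u and of its weak gradient.\<close>

lemma core_data:
 assumes u: "weak_solution l h \<Xi> f \<phi> ep u"
 obtains U H w g where
  "U \<in> borel_measurable borel" "H \<in> borel_measurable borel"
  "AE x in lborel. x \<in> Om ep --> u x = U x"
  "integrable lborel (%x. indicator (Om ep) x * (U x)\<^sup>2)" "integrable lborel (%x. indicator (Om ep) x * (norm (H x))\<^sup>2)"
  "\<And>n. C1 (w n) (g n)"
  "(%n. LBINT x. indicator (Om ep) x * (w n x - U x)\<^sup>2) \<longlonglongrightarrow> 0"
  "(%n. LBINT x. indicator (Om ep) x * (norm (g n x - H x))\<^sup>2) \<longlonglongrightarrow> 0"
  "\<And>i. (%n. LBINT y. indicator (ball 0 (ep * h i)) y * (w n (point i 1 y))\<^sup>2) \<longlonglongrightarrow> 0"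
  "\<And>v k. C1 v k ==> (\<And>i y. norm y < ep * h i ==> v (point i 1 y) = 0) ==>
    (LBINT x. indicator (Om ep) x * (H x \<bullet> k x)) = load ep v"
  "(%n. load ep (w n)) \<longlonglongrightarrow> (LBINT x. indicator (Om ep) x * (norm (H x))\<^sup>2)"
proof -
 interpret Mo: finite_measure Mo by (rule finite_Mo)
 let ?S = "%i. cross_section_measure h ep i 1"
 define G where "G = weak_grad (Om ep) u"
 have uH: "in_H1 (Om ep) u" and uT: "\<And>i. has_trace (Om ep) (?S i) u (%_. 0)"
  and uW: "\<And>v g. in_H1 (Om ep) v ==> (\<And>i. has_trace (Om ep) (?S i) v (%_. 0)) ==>
   (\<And>i. has_trace (Om ep) (La i) v (g i)) ==>
   (\<integral>x. G x \<bullet> weak_grad (Om ep) v x \<partial>Mo) = (\<integral>x. f x * v x \<partial>Mo) -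
     ep * (\<Sum>i\<in>UNIV. \<integral>x. \<phi> i (x $ i) (rest i x /\<^sub>R ep) * g i x \<partial>La i)"
  using u unfolding weak_solution_def Let_def G_def by auto
 have uL: "in_L2 Mo u" using uH by (simp add: in_H1_def)
 have uG: "has_weak_grad (Om ep) u G" unfolding G_def by (rule in_H1_weak_grad[OF uH])
 then have GL: "in_L2 Mo G" by (simp add: has_weak_grad_def)
 have "\<forall>i. \<exists>w::nat => real^3 => real. (\<forall>n. C_k 1 UNIV (w n) \<and> in_H1 (Om ep) (w n) \<and> in_L2 (?S i) (w n)) \<and>
    (%n. H1_norm (Om ep) (%x. w n x - u x)) \<longlonglongrightarrow> 0 \<and>
    (%n. \<integral>x. (w n x - 0)\<^sup>2 \<partial>?S i) \<longlonglongrightarrow> 0"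
  using uT unfolding has_trace_def by blast
 from choice[OF this] obtain W where W0: "\<forall>i. (\<forall>n. C_k 1 UNIV (W i n :: real^3 => real) \<and> in_H1 (Om ep) (W i n) \<and> in_L2 (?S i) (W i n)) \<and>
    (%n. H1_norm (Om ep) (%x. W i n x - u x)) \<longlonglongrightarrow> 0 \<and>
    (%n. \<integral>x. (W i n x - 0)\<^sup>2 \<partial>?S i) \<longlonglongrightarrow> 0" by blast
 have W: "\<And>i n. C_k 1 UNIV (W i n :: real^3 => real)"
  "\<And>i. (%n. H1_norm (Om ep) (%x. W i n x - u x)) \<longlonglongrightarrow> 0" "\<And>i. (%n. \<integral>x. (W i n x)\<^sup>2 \<partial>?S i) \<longlonglongrightarrow> 0"
  using W0 by simp_all
 define Gr where "Gr i n = (%x. \<Sum>b\<in>Basis. frechet_derivative (W i n) (at x) b *\<^sub>R b)" for i n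
 have C: "C1 (W i n) (Gr i n)" for i n unfolding Gr_def by (rule C_k_imp_C1[OF W(1)])
 have WL: "in_L2 Mo (W i n)" "in_L2 Mo (Gr i n)" for i n
  by (rule in_L2_Mo, rule C1_continuous[OF C])+
 have conv: "(%n. \<integral>x. (W i n x - u x)\<^sup>2 \<partial>Mo) \<longlonglongrightarrow> 0" "(%n. \<integral>x. (norm (Gr i n x - G x))\<^sup>2 \<partial>Mo) \<longlonglongrightarrow> 0" for i
 proof -
  let ?a = "%n. \<integral>x. (W i n x - u x)\<^sup>2 \<partial>Mo" and ?b = "%n. \<integral>x. (norm (Gr i n x - G x))\<^sup>2 \<partial>Mo"
  have eq: "(H1_norm (Om ep) (%x. W i n x - u x))\<^sup>2 = ?a n + ?b n" for n
  proof -
   have d: "has_weak_grad (Om ep) (%x. W i n x - u x) (%x. Gr i n x - G x)"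
    by (intro has_weak_grad_diff open_Om bounded_Om[OF e] WL uL uG C1_has_weak_grad C)
   then have "in_H1 (Om ep) (%x. W i n x - u x)"
    unfolding in_H1_def using in_L2_diff[OF WL(1) uL] by blast
   then have d': "has_weak_grad (Om ep) (%x. W i n x - u x) (weak_grad (Om ep) (%x. W i n x - u x))"
    by (rule in_H1_weak_grad)
   have "(\<integral>x. (norm (weak_grad (Om ep) (%x. W i n x - u x) x))\<^sup>2 \<partial>Mo) = ?b n"
   proof (rule integral_cong_AE)
    show "AE x in Mo. (norm (weak_grad (Om ep) (%x. W i n x - u x) x))\<^sup>2 = (norm (Gr i n x - G x))\<^sup>2"
     using has_weak_grad_unique[OF open_Om bounded_Om[OF e] d' d] by eventually_elim simp
   qed (use d d' in \<open>auto simp: has_weak_grad_def in_L2_def\<close>)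
   then show ?thesis by (simp add: H1_norm_def)
  qed
  have lim: "(%n. ?a n + ?b n) \<longlonglongrightarrow> 0"
   using tendsto_power[OF W(2)[of i], of 2] by (simp add: eq)
  show "?a \<longlonglongrightarrow> 0" "?b \<longlonglongrightarrow> 0"
   by (rule tendsto_sandwich[OF _ _ tendsto_const lim]; simp)+
 qed
 \<comment> \<open>Sequence 1 against sequence i: both tend to u in H1, hence their difference tends
   to zero.\<close>
 have cauchy: "(%n. (\<integral>x. (W 1 n x - W i n x)\<^sup>2 \<partial>Mo) + (\<integral>x. (norm (Gr 1 n x - Gr i n x))\<^sup>2 \<partial>Mo)) \<longlonglongrightarrow> 0" for i
 proof -
  let ?bd = "%n. (2 * (\<integral>x. (norm (W 1 n x - u x))\<^sup>2 \<partial>Mo) + 2 * (\<integral>x. (norm (W i n x - u x))\<^sup>2 \<partial>Mo)) +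
   (2 * (\<integral>x. (norm (Gr 1 n x - G x))\<^sup>2 \<partial>Mo) + 2 * (\<integral>x. (norm (Gr i n x - G x))\<^sup>2 \<partial>Mo))"
  have "?bd \<longlonglongrightarrow> (2 * 0 + 2 * 0) + (2 * 0 + 2 * 0)"
   using conv by (intro tendsto_intros) simp_all
  then have l0: "?bd \<longlonglongrightarrow> 0" by simp
  show ?thesis
  proof (rule tendsto_sandwich[OF _ _ tendsto_const l0]; intro always_eventually allI)
   fix n
   show "0 <= (\<integral>x. (W 1 n x - W i n x)\<^sup>2 \<partial>Mo) + (\<integral>x. (norm (Gr 1 n x - Gr i n x))\<^sup>2 \<partial>Mo)" by simp
   show "(\<integral>x. (W 1 n x - W i n x)\<^sup>2 \<partial>Mo) + (\<integral>x. (norm (Gr 1 n x - Gr i n x))\<^sup>2 \<partial>Mo) <= ?bd n"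
    using in_L2_square_diff[OF in_L2_diff[OF WL(1) uL] in_L2_diff[OF WL(1) uL], of 1 n i n]
     in_L2_square_diff[OF in_L2_diff[OF WL(2) GL] in_L2_diff[OF WL(2) GL], of 1 n i n] by simp
  qed
 qed
 \<comment> \<open>Sequence i vanishes on disc i in the limit, and the trace bound on the end disc
   carries this over to sequence 1.\<close>
 have ends: "(%n. LBINT y. indicator (ball 0 (ep * h i)) y * (W 1 n (point i 1 y))\<^sup>2) \<longlonglongrightarrow> 0" for i
 proof -
  let ?E = "%v. LBINT y. indicator (ball 0 (ep * h i)) y * (v (point i 1 y))\<^sup>2"
  let ?D = "%n. (\<integral>x. (W 1 n x - W i n x)\<^sup>2 \<partial>Mo) + (\<integral>x. (norm (Gr 1 n x - Gr i n x))\<^sup>2 \<partial>Mo)"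
  have sq: "(%x. (W i n x)\<^sup>2) \<in> borel_measurable borel" for n using C1_borel(1)[OF C] by measurable
  have Ei: "(%n. ?E (W i n)) \<longlonglongrightarrow> 0"
   using W(3)[of i] integral_cross(1)[OF sq] by simp
  have "(%n. 2 * ?E (W i n) + 2 * (2 / (1 - ep * l) * ?D n)) \<longlonglongrightarrow> 2 * 0 + 2 * (2 / (1 - ep * l) * 0)"
   by (intro tendsto_intros Ei cauchy)
  then have l0: "(%n. 2 * ?E (W i n) + 2 * (2 / (1 - ep * l) * ?D n)) \<longlonglongrightarrow> 0" by simp
  show ?thesis
  proof (rule tendsto_sandwich[OF _ _ tendsto_const l0]; intro always_eventually allI)
   fix n
   show "0 <= ?E (W 1 n)" by simp
   have c: "C1 (%x. W 1 n x - W i n x) (%x. Gr 1 n x - Gr i n x)" by (intro C1_diff C)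
   have "?E (W 1 n) <= (LBINT y. 2 * (indicator (ball 0 (ep * h i)) y * (W i n (point i 1 y))\<^sup>2) +
     2 * (indicator (ball 0 (ep * h i)) y * (W 1 n (point i 1 y) - W i n (point i 1 y))\<^sup>2))"
   proof (rule integral_mono)
    show "integrable lborel (%y. indicator (ball 0 (ep * h i)) y * (W 1 n (point i 1 y))\<^sup>2)"
     by (rule end_trace_real(1)[OF C])
    show "integrable lborel (%y. 2 * (indicator (ball 0 (ep * h i)) y * (W i n (point i 1 y))\<^sup>2) +
     2 * (indicator (ball 0 (ep * h i)) y * (W 1 n (point i 1 y) - W i n (point i 1 y))\<^sup>2))"
     using end_trace_real(1)[OF C, of i i n] end_trace_real(1)[OF c, of i] by simp
    fix y
    have "a\<^sup>2 <= 2 * b\<^sup>2 + 2 * (a - b)\<^sup>2" for a b :: real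
     using zero_le_power2[of "a - 2 * b"] by (simp add: power2_eq_square algebra_simps)
    then show "indicator (ball 0 (ep * h i)) y * (W 1 n (point i 1 y))\<^sup>2 <= 2 * (indicator (ball 0 (ep * h i)) y * (W i n (point i 1 y))\<^sup>2) +
     2 * (indicator (ball 0 (ep * h i)) y * (W 1 n (point i 1 y) - W i n (point i 1 y))\<^sup>2)"
     by (simp add: indicator_def)
   qed
   also have "... = 2 * ?E (W i n) + 2 * ?E (%x. W 1 n x - W i n x)"
    using end_trace_real(1)[OF C, of i i n] end_trace_real(1)[OF c, of i] by simp
   also have "... <= 2 * ?E (W i n) + 2 * (2 / (1 - ep * l) * ?D n)"
    using end_trace_real(2)[OF c, of i] by (intro add_left_mono mult_left_mono) auto
   finally show "?E (W 1 n) <= 2 * ?E (W i n) + 2 * (2 / (1 - ep * l) * ?D n)" .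
  qed
 qed
 \<comment> \<open>The lateral trace bound with constant \<open>?C\<close> turns H1 convergence into
   a Cauchy property on each lateral surface.\<close>
 have lateral: "\<exists>\<gamma>. in_L2 (La i) \<gamma> \<and> (%n. \<integral>x. (W 1 n x - \<gamma> x)\<^sup>2 \<partial>La i) \<longlonglongrightarrow> 0" for i
 proof -
  let ?C = "20 / (ep * h i) + 10"
  have Cp: "?C > 0" using e h[of i] by (simp add: add_pos_pos)
  have gen: "c * (2 * x + 2 * y) < c * (2 * q + 2 * q)" if "x < q" "y < q" "0 < c" for c x y q :: real
   using that by (intro mult_strict_left_mono) linarith+
  have "\<exists>N. \<forall>m\<ge>N. \<forall>n\<ge>N. (\<integral>x. (W 1 m x - W 1 n x)\<^sup>2 \<partial>La i) < s" if s: "s > 0" for s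
  proof -
   let ?z = "%n. (\<integral>x. (norm (W 1 n x - u x))\<^sup>2 \<partial>Mo) + (\<integral>x. (norm (Gr 1 n x - G x))\<^sup>2 \<partial>Mo)"
   have "?z \<longlonglongrightarrow> 0 + 0" using conv[of 1] by (intro tendsto_intros) simp_all
   then have "eventually (%n. ?z n < s / (4 * ?C)) sequentially"
    using s Cp by (intro order_tendstoD(2)[of _ 0]) simp_all
   then obtain N where N: "\<And>n. n >= N ==> ?z n < s / (4 * ?C)" by (auto simp: eventually_sequentially)
   have "(\<integral>x. (W 1 m x - W 1 n x)\<^sup>2 \<partial>La i) < s" if mn: "m >= N" "n >= N" for m n
   proof -
    have "(\<integral>x. (W 1 m x - W 1 n x)\<^sup>2 \<partial>La i) <= ?C * ((\<integral>x. (W 1 m x - W 1 n x)\<^sup>2 \<partial>Mo) + (\<integral>x. (norm (Gr 1 m x - Gr 1 n x))\<^sup>2 \<partial>Mo))"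
     by (rule lateral_trace_real(2)[OF C1_diff[OF C C]])
    also have "... <= ?C * (2 * ?z m + 2 * ?z n)"
     using Cp in_L2_square_diff[OF in_L2_diff[OF WL(1) uL] in_L2_diff[OF WL(1) uL], of 1 m 1 n]
     in_L2_square_diff[OF in_L2_diff[OF WL(2) GL] in_L2_diff[OF WL(2) GL], of 1 m 1 n] 
     by (intro mult_left_mono) simp_all
    also have "... < ?C * (2 * (s / (4 * ?C)) + 2 * (s / (4 * ?C)))"
     by (rule gen[OF N[OF mn(1)] N[OF mn(2)] Cp])
    also have "... = s"
    proof -
     have "c * (2 * (s / (4 * c)) + 2 * (s / (4 * c))) = s" if "c > 0" for c :: real
      using that by (simp add: field_simps)
     from this[OF Cp] show ?thesis .
    qed
    finally show ?thesis .
   qed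
   then show ?thesis by blast
  qed
  from L2_complete[OF lateral_trace_real(1)[OF C] this]
  obtain \<gamma> where "in_L2 (La i) \<gamma>" "(%n. \<integral>x. (W 1 n x - \<gamma> x)\<^sup>2 \<partial>La i) \<longlonglongrightarrow> 0" .
  then show ?thesis by (intro exI conjI)
 qed
 then have "\<forall>i. \<exists>\<gamma>. in_L2 (La i) \<gamma> \<and> (%n. \<integral>x. (W 1 n x - \<gamma> x)\<^sup>2 \<partial>La i) \<longlonglongrightarrow> 0" ..
 from choice[OF this] obtain \<gamma> where \<gamma>0: "\<forall>i. in_L2 (La i) (\<gamma> i) \<and> (%n. \<integral>x. (W 1 n x - \<gamma> i x)\<^sup>2 \<partial>La i) \<longlonglongrightarrow> 0" ..
 have \<gamma>: "\<And>i. in_L2 (La i) (\<gamma> i)" "\<And>i. (%n. \<integral>x. (W 1 n x - \<gamma> i x)\<^sup>2 \<partial>La i) \<longlonglongrightarrow> 0"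
  using \<gamma>0 by simp_all
 have traceu: "has_trace (Om ep) (La i) u (\<gamma> i)" for i
  unfolding has_trace_def
  using \<gamma> W(1,2)[of 1] C1_in_H1(1)[OF open_Om bounded_Om[OF e] C] lateral_trace_real(1)[OF C]
  by (intro conjI exI[of _ "W 1"] allI)
 \<comment> \<open>The weak formulation tested with u itself.\<close>
 have en: "(\<integral>x. G x \<bullet> G x \<partial>Mo) = (\<integral>x. f x * u x \<partial>Mo) -
     ep * (\<Sum>i\<in>UNIV. \<integral>x. \<phi> i (x $ i) (rest i x /\<^sub>R ep) * \<gamma> i x \<partial>La i)"
  using uW[OF uH uT traceu] by (simp add: G_def)
 have fm: "f \<in> borel_measurable Mo"
  using f_cont[OF e] open_Om by (intro continuous_imp_measurable_on_sets_lebesgue) auto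
 have "(%x. indicator (Om ep) x *\<^sub>R f x) \<in> borel_measurable borel"
  using borel_measurable_continuous_on_indicator[OF _ f_cont[OF e]] open_Om by auto
 then have fb: "(%x. indicator (Om ep) x * f x) \<in> borel_measurable borel" by simp
 have loadM: "load ep v = (\<integral>x. f x * v x \<partial>Mo) - ep * (\<Sum>i\<in>UNIV. \<integral>x. \<phi> i (x $ i) (rest i x /\<^sub>R ep) * v x \<partial>La i)"
  if v: "C1 v k" for v k
 proof -
  have "(\<integral>x. f x * v x \<partial>Mo) = (LBINT x. indicator (Om ep) x * ((indicator (Om ep) x * f x) * v x))"
   by (rule integral_lebesgue_on_open(1)[OF open_Om]) (use fb C1_borel(1)[OF v] in auto)
  also have "... = (LBINT x. indicator (Om ep) x * (f x * v x))"
   by (intro Bochner_Integration.integral_cong) (auto simp: indicator_def)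
  finally show ?thesis unfolding load_def lat_eq[OF v] by simp
 qed
 have limload: "(%n. load ep (W 1 n)) \<longlonglongrightarrow> (\<integral>x. G x \<bullet> G x \<partial>Mo)"
  unfolding en loadM[OF C]
 proof (intro tendsto_intros)
  show "(%n. \<integral>x. f x * W 1 n x \<partial>Mo) \<longlonglongrightarrow> (\<integral>x. f x * u x \<partial>Mo)"
   by (rule Mo.L2_tendsto_integral[OF WL(1) uL conv(1) fm, of F0]) (use F0[OF e] in simp)
  show "(%n. \<integral>x. \<phi> i (x $ i) (rest i x /\<^sub>R ep) * W 1 n x \<partial>La i) \<longlonglongrightarrow> (\<integral>x. \<phi> i (x $ i) (rest i x /\<^sub>R ep) * \<gamma> i x \<partial>La i)" for i
  proof -
   interpret L: finite_measure "La i" by (rule finite_measure_lateral[OF l e(1) h])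
   show ?thesis
    by (rule L.L2_tendsto_integral[OF lateral_trace_real(1)[OF C] \<gamma> \<phi>_lateral(1), of M0])
      (use \<phi>_lateral(2)[of _ i] in \<open>simp add: lateral_measure_def space_restrict_space\<close>)
  qed
 qed
 have test: "(\<integral>x. G x \<bullet> k x \<partial>Mo) = load ep v"
  if v: "C1 v k" and z: "\<And>i y. norm y < ep * h i ==> v (point i 1 y) = 0" for v k
 proof -
  have vH: "in_H1 (Om ep) v" "AE x in Mo. weak_grad (Om ep) v x = k x"
   using C1_in_H1[OF open_Om bounded_Om[OF e] v] by auto
  have "(\<integral>x. G x \<bullet> k x \<partial>Mo) = (\<integral>x. G x \<bullet> weak_grad (Om ep) v x \<partial>Mo)"
  proof (rule integral_cong_AE)
   show "AE x in Mo. G x \<bullet> k x = G x \<bullet> weak_grad (Om ep) v x" using vH(2) by eventually_elim simp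
   show "(%x. G x \<bullet> k x) \<in> borel_measurable Mo"
    using GL in_L2_Mo[OF C1_continuous(2)[OF v]] by (auto simp: in_L2_def)
   show "(%x. G x \<bullet> weak_grad (Om ep) v x) \<in> borel_measurable Mo"
    using GL in_H1_weak_grad[OF vH(1)] by (auto simp: in_L2_def has_weak_grad_def)
  qed
  also have "... = load ep v"
   unfolding loadM[OF v] by (rule uW[OF vH(1) C1_trace_end[OF v z] C1_trace_lateral[OF v]])
  finally show ?thesis .
 qed
 have OL: "Om ep \<in> sets lebesgue" and OB[measurable]: "Om ep \<in> sets borel" using open_Om by auto
 have um: "u \<in> borel_measurable Mo" using uL by (simp add: in_L2_def)
 from integrable_lebesgue_on_borel_rep[OF OL um]
 obtain U where U[measurable]: "U \<in> borel_measurable borel" and Uae: "AE x in lborel. U x = (if x \<in> Om ep then u x else 0)" .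
 \<comment> \<open>The Borel representative of the gradient is chosen component by
   component.\<close>
 have "\<forall>b. \<exists>K. K \<in> borel_measurable borel \<and> (AE x in lborel. K x = (if x \<in> Om ep then G x \<bullet> b else 0))"
 proof
  fix b :: "real^3"
  have "(%x. G x \<bullet> b) \<in> borel_measurable Mo" using GL by (auto simp: in_L2_def)
  from integrable_lebesgue_on_borel_rep[OF OL this]
  obtain K where "K \<in> borel_measurable borel" "AE x in lborel. K x = (if x \<in> Om ep then G x \<bullet> b else 0)" .
  then show "\<exists>K. K \<in> borel_measurable borel \<and> (AE x in lborel. K x = (if x \<in> Om ep then G x \<bullet> b else 0))"
   by (intro exI conjI)
 qed
 from choice[OF this] obtain K where K0: "\<forall>b. K b \<in> borel_measurable borel \<and> (AE x in lborel. K b x = (if x \<in> Om ep then G x \<bullet> b else 0))" ..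
 have K: "\<And>b. K b \<in> borel_measurable borel" "\<And>b. AE x in lborel. K b x = (if x \<in> Om ep then G x \<bullet> b else 0)"
  using K0 by simp_all
 define H where "H x = (\<Sum>b\<in>Basis. K b x *\<^sub>R b)" for x
 have [measurable]: "H \<in> borel_measurable borel" unfolding H_def using K(1) by measurable
 have "AE x in lborel. \<forall>b\<in>Basis. K b x = (if x \<in> Om ep then G x \<bullet> b else 0)"
  by (intro AE_finite_allI K) auto
 then have Hae: "AE x in lborel. x \<in> Om ep --> G x = H x"
  by eventually_elim (simp add: H_def euclidean_representation)
 have Uae': "AE x in lborel. x \<in> Om ep --> u x = U x" using Uae by eventually_elim simp
 have [measurable]: "W 1 n \<in> borel_measurable borel" "Gr 1 n \<in> borel_measurable borel" for n
  using C1_borel[OF C] by auto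
 show ?thesis
 proof (rule that[of U H "W 1" "Gr 1"])
  show "AE x in lborel. x \<in> Om ep --> u x = U x" by (rule Uae')
  have "integrable Mo (%x. (u x)\<^sup>2)" "integrable Mo (%x. (norm (G x))\<^sup>2)"
   using uL GL by (auto simp: in_L2_def)
  moreover have "AE x in lborel. x \<in> Om ep --> (u x)\<^sup>2 = (U x)\<^sup>2" using Uae' by eventually_elim simp
  moreover have "AE x in lborel. x \<in> Om ep --> (norm (G x))\<^sup>2 = (norm (H x))\<^sup>2" using Hae by eventually_elim simp
  ultimately show "integrable lborel (%x. indicator (Om ep) x * (U x)\<^sup>2)" "integrable lborel (%x. indicator (Om ep) x * (norm (H x))\<^sup>2)"
   using integral_lebesgue_on_open(2)[where q' = "%x. (U x)\<^sup>2" and q = "%x. (u x)\<^sup>2", OF open_Om, of ep]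
    integral_lebesgue_on_open(2)[where q' = "%x. (norm (H x))\<^sup>2" and q = "%x. (norm (G x))\<^sup>2", OF open_Om, of ep] by simp_all
  show "C1 (W 1 n) (Gr 1 n)" for n by (rule C)
  have "(\<integral>x. (W 1 n x - u x)\<^sup>2 \<partial>Mo) = (LBINT x. indicator (Om ep) x * (W 1 n x - U x)\<^sup>2)" for n
   by (rule integral_lebesgue_on_open(1)[OF open_Om]) (measurable, use Uae' in \<open>eventually_elim, simp\<close>)
  then show "(%n. LBINT x. indicator (Om ep) x * (W 1 n x - U x)\<^sup>2) \<longlonglongrightarrow> 0" using conv(1)[of 1] by simp
  have "(\<integral>x. (norm (Gr 1 n x - G x))\<^sup>2 \<partial>Mo) = (LBINT x. indicator (Om ep) x * (norm (Gr 1 n x - H x))\<^sup>2)" for n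
   by (rule integral_lebesgue_on_open(1)[OF open_Om]) (measurable, use Hae in \<open>eventually_elim, simp\<close>)
  then show "(%n. LBINT x. indicator (Om ep) x * (norm (Gr 1 n x - H x))\<^sup>2) \<longlonglongrightarrow> 0" using conv(2)[of 1] by simp
  show "(%n. LBINT y. indicator (ball 0 (ep * h i)) y * (W 1 n (point i 1 y))\<^sup>2) \<longlonglongrightarrow> 0" for i by (rule ends)
  show "(LBINT x. indicator (Om ep) x * (H x \<bullet> k x)) = load ep v"
   if v: "C1 v k" and z: "\<And>i y. norm y < ep * h i ==> v (point i 1 y) = 0" for v k
  proof -
   have [measurable]: "k \<in> borel_measurable borel" using C1_borel[OF v] by auto
   have "(\<integral>x. G x \<bullet> k x \<partial>Mo) = (LBINT x. indicator (Om ep) x * (H x \<bullet> k x))"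
    by (rule integral_lebesgue_on_open(1)[OF open_Om]) (measurable, use Hae in \<open>eventually_elim, simp\<close>)
   then show ?thesis using test[OF v z] by simp
  qed
  have "(\<integral>x. G x \<bullet> G x \<partial>Mo) = (LBINT x. indicator (Om ep) x * (norm (H x))\<^sup>2)"
   by (rule integral_lebesgue_on_open(1)[OF open_Om])
     (measurable, use Hae in \<open>eventually_elim, simp add: power2_norm_eq_inner\<close>)
  then show "(%n. load ep (W 1 n)) \<longlonglongrightarrow> (LBINT x. indicator (Om ep) x * (norm (H x))\<^sup>2)"
   using limload by simp
 qed measurable
qed

end

end

section \<open>Integrals over sets and one-dimensional tools\<close>

definition intg :: "'a::euclidean_space set => ('a => real) => bool" where
 "intg S q \<longleftrightarrow> integrable lborel (%x. indicator S x * q x)"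

definition Int_on :: "'a::euclidean_space set => ('a => real) => real" where
 "Int_on S q = (LBINT x. indicator S x * q x)"

lemma intg_add: "intg S p ==> intg S q ==> intg S (%x. p x + q x)"
 by (simp add: intg_def distrib_left)

lemma intg_diff: "intg S p ==> intg S q ==> intg S (%x. p x - q x)"
 by (simp add: intg_def right_diff_distrib)

lemma intg_cmult: "intg S q ==> intg S (%x. c * q x)"
 using integrable_mult_right[of c lborel "%x. indicator S x * q x"] by (auto simp: intg_def mult.left_commute)

lemma indicator_times_abs: "indicator S x * \<bar>q x\<bar> = \<bar>indicator S x * q x :: real\<bar>"
 by (simp add: abs_mult)

lemma intg_abs: "intg S q ==> intg S (%x. \<bar>q x\<bar>)"
 unfolding intg_def indicator_times_abs by (rule integrable_abs)

lemma Int_on_add: "intg S p ==> intg S q ==> Int_on S (%x. p x + q x) = Int_on S p + Int_on S q"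
 by (simp add: intg_def Int_on_def distrib_left)

lemma Int_on_diff: "intg S p ==> intg S q ==> Int_on S (%x. p x - q x) = Int_on S p - Int_on S q"
 by (simp add: intg_def Int_on_def right_diff_distrib)

lemma Int_on_cmult: "Int_on S (%x. c * q x) = c * Int_on S q"
 unfolding Int_on_def by (simp add: mult.left_commute[of _ c])

lemma Int_on_mono: "intg S p ==> intg S q ==> (\<And>x. x \<in> S ==> p x <= q x) ==> Int_on S p <= Int_on S q"
 unfolding intg_def Int_on_def by (rule integral_mono) (auto simp: indicator_def)

lemma Int_on_bound:
 assumes "intg S p" "intg S q" "\<And>x. x \<in> S ==> \<bar>p x\<bar> <= q x"
 shows "\<bar>Int_on S p\<bar> <= Int_on S q"
proof -
 have "\<bar>Int_on S p\<bar> <= (LBINT x. \<bar>indicator S x * p x\<bar>)"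
  unfolding Int_on_def by (rule integral_abs_bound)
 also have "... = Int_on S (%x. \<bar>p x\<bar>)" by (simp add: Int_on_def abs_mult)
 also have "... <= Int_on S q" using assms by (intro Int_on_mono intg_abs) auto
 finally show ?thesis .
qed

lemma Int_on_nonneg: "(\<And>x. x \<in> S ==> 0 <= q x) ==> 0 <= Int_on S q"
 unfolding Int_on_def by (rule integral_nonneg_AE) (auto simp: indicator_def)

lemma intg_subset: "intg T q ==> S \<subseteq> T ==> S \<in> sets borel ==> intg S q"
proof -
 assume T: "intg T q" "S \<subseteq> T" "S \<in> sets borel"
 then have "integrable lborel (%x. indicator S x *\<^sub>R (indicator T x * q x))"
  unfolding intg_def by (intro integrable_mult_indicator) auto
 moreover have "indicator S x *\<^sub>R (indicator T x * q x) = indicator S x * q x" for x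
  using T(2) by (auto simp: indicator_def)
 ultimately show "intg S q" by (simp only: intg_def)
qed

lemma Int_on_subset:
 assumes "intg T q" "S \<subseteq> T" "S \<in> sets borel" "\<And>x. x \<in> T ==> 0 <= q x"
 shows "Int_on S q <= Int_on T q"
 using assms intg_subset[OF assms(1-3)] unfolding intg_def Int_on_def
 by (intro integral_mono) (auto simp: indicator_def)

lemma intg_continuous_on_compact:
 assumes "compact T" "continuous_on T q" "S \<subseteq> T" "S \<in> sets borel"
 shows "intg S q"
 using borel_integrable_compact[OF assms(1,2)] intg_subset[OF _ assms(3,4)] by (simp add: intg_def)

lemma intg_continuous:
 assumes "bounded S" "S \<in> sets borel" "continuous_on UNIV q"
 shows "intg S q"
 by (rule intg_continuous_on_compact[of "closure S", OF _ continuous_on_subset[OF assms(3)]])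
   (use assms closure_subset in \<open>auto simp: compact_closure\<close>)

lemma intg_continuous_on_open:
 fixes q :: "'a::euclidean_space => real"
 assumes "open T" "bounded T" "continuous_on T q" "\<And>x. x \<in> T ==> \<bar>q x\<bar> <= B"
 shows "intg T q"
proof -
 have "(%x. indicator T x *\<^sub>R q x) \<in> borel_measurable borel"
  using borel_measurable_continuous_on_indicator[OF _ assms(3)] assms(1) by auto
 then have "integrable lborel (%x. indicator T x *\<^sub>R (indicator T x *\<^sub>R q x))"
  using assms emeasure_bounded_finite[OF assms(2)]
  by (intro integrableI_bounded_set_indicator[where B = B]) auto
 then show ?thesis by (simp add: intg_def mult.assoc[symmetric] indicator_times_eq_if if_distrib cong: if_cong)
qed

lemma Int_on_const: "S \<in> sets borel ==> Int_on S (%x. c) = c * measure lborel S"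
 unfolding Int_on_def by simp

lemma nn_Int_on:
 assumes "intg S q" "\<And>x. x \<in> S ==> 0 <= q x"
 shows "(NN x. indicator S x * ennreal (q x)) = ennreal (Int_on S q)"
proof -
 have "(NN x. indicator S x * ennreal (q x)) = (NN x. ennreal (indicator S x * q x))"
  by (intro nn_integral_cong) (auto simp: indicator_def)
 also have "... = ennreal (Int_on S q)"
  unfolding Int_on_def by (rule nn_integral_eq_integral) (use assms in \<open>auto simp: intg_def indicator_def\<close>)
 finally show ?thesis .
qed

section \<open>One-dimensional calculus and a C1 step function\<close>

lemma ftc_Ioo:
 fixes P q :: "real => real"
 assumes ab: "a <= b" and P: "continuous_on {a..b} P" and q: "continuous_on {a..b} q"
  and d: "\<And>t. t \<in> {a<..<b} ==> (P has_real_derivative q t) (at t)"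
 shows "intg {a<..<b} q" "Int_on {a<..<b} q = P b - P a"
proof -
 show i: "intg {a<..<b} q"
  by (rule intg_continuous_on_compact[of "{a..b}"]) (use q in auto)
 have si: "set_integrable lborel {a<..<b} q" using i by (simp add: intg_def set_integrable_def)
 have "(q has_integral (P b - P a)) {a..b}"
  using d by (intro fundamental_theorem_of_calculus_interior ab P)
   (simp add: has_real_derivative_iff_has_vector_derivative)
 then have "(q has_integral (P b - P a)) {a<..<b}"
  by (simp add: has_integral_Icc_iff_Ioo)
 moreover have "Int_on {a<..<b} q = integral {a<..<b} q"
  using set_borel_integral_eq_integral(2)[OF si] by (simp add: Int_on_def set_lebesgue_integral_def)
 ultimately show "Int_on {a<..<b} q = P b - P a" by (simp add: integral_unique)
qed

lemma has_derivative_pos_sq: "((%x::real. (max 0 x)\<^sup>2) has_real_derivative 2 * max 0 x) (at x)"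
proof -
 consider "x > 0" | "x < 0" | "x = 0" by linarith
 then show ?thesis
 proof cases
  case 1
  have "((%x::real. x\<^sup>2) has_real_derivative 2 * max 0 x) (at x)"
   using 1 by (auto intro!: derivative_eq_intros)
  then show ?thesis
   by (rule has_field_derivative_transform_within[where d = x]) (use 1 in \<open>auto simp: dist_real_def\<close>)
 next
  case 2
  have "((%x::real. 0) has_real_derivative 2 * max 0 x) (at x)"
   using 2 by (auto intro!: derivative_eq_intros)
  then show ?thesis
   by (rule has_field_derivative_transform_within[where d = "- x"]) (use 2 in \<open>auto simp: dist_real_def\<close>)
 next
  case 3
  have "((%h::real. (max 0 h)\<^sup>2 / h) \<longlongrightarrow> 0) (at 0)"
  proof (rule Lim_null_comparison[where g = "%h. \<bar>h\<bar>"])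
   have "norm ((max 0 h)\<^sup>2 / h) <= \<bar>h\<bar>" for h :: real
    by (cases "h > 0") (auto simp: max_def power2_eq_square)
   then show "\<forall>\<^sub>F h in at 0. norm ((max 0 h)\<^sup>2 / h) <= \<bar>h::real\<bar>" by simp
   show "((%h::real. \<bar>h\<bar>) \<longlongrightarrow> 0) (at 0)" by (rule tendsto_rabs_zero) (rule tendsto_ident_at)
  qed
  then show ?thesis using 3 by (simp add: DERIV_def)
 qed
qed

text \<open>A piecewise quadratic C1 transition from 0 to 1 on [0, 1]; its derivative is the hat
  function with peak 2 at 1/2.\<close>

definition step :: "real => real" where
 "step x = 2 * ((max 0 x)\<^sup>2 - 2 * (max 0 (x - 1/2))\<^sup>2 + (max 0 (x - 1))\<^sup>2)"

definition step' :: "real => real" where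
 "step' x = 4 * (max 0 x - 2 * max 0 (x - 1/2) + max 0 (x - 1))"

lemma step_deriv: "(step has_real_derivative step' x) (at x)"
proof -
 have s: "((%x. (max 0 (x - c))\<^sup>2) has_real_derivative 2 * max 0 (x - c)) (at x)" for c :: real
 proof -
  have "((%x. x - c) has_real_derivative 1) (at x)" by (auto intro!: derivative_eq_intros)
  from DERIV_chain2[where f = "%x. (max 0 x)\<^sup>2", OF has_derivative_pos_sq this] show ?thesis by simp
 qed
 have "((%x. 2 * ((max 0 x)\<^sup>2 - 2 * (max 0 (x - 1/2))\<^sup>2 + (max 0 (x - 1))\<^sup>2)) has_real_derivative
   2 * (2 * max 0 x - 2 * (2 * max 0 (x - 1/2)) + 2 * max 0 (x - 1))) (at x)"
  by (intro DERIV_cmult DERIV_add DERIV_diff has_derivative_pos_sq s)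
 moreover have "2 * (2 * max 0 x - 2 * (2 * max 0 (x - 1/2)) + 2 * max 0 (x - 1)) = step' x"
  by (simp add: step'_def)
 ultimately show ?thesis unfolding step_def[abs_def] by simp
qed

lemma step_simps: "x <= 0 ==> step x = 0" "x >= 1 ==> step x = 1" "x <= 0 ==> step' x = 0" "x >= 1 ==> step' x = 0"
 by (auto simp: step_def step'_def max_def power2_eq_square algebra_simps)

lemma step'_bounds: "0 <= step' x" "step' x <= 2"
 by (auto simp: step'_def max_def)

lemma continuous_step: "continuous_on S step" "continuous_on S step'"
proof -
 show "continuous_on S step"
  using step_deriv DERIV_isCont by (blast intro: continuous_at_imp_continuous_on)
 show "continuous_on S step'"
  unfolding step'_def[abs_def] by (intro continuous_intros)
qed

lemma step_mono: "x <= y ==> step x <= step y"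
 by (rule DERIV_nonneg_imp_nondecreasing[of x y step]) (use step_deriv step'_bounds in blast)+

lemma step_bounds: "0 <= step x" "step x <= 1"
 using step_mono[of "min x 0" x] step_mono[of x "max x 1"] step_simps(1)[of "min x 0"] step_simps(2)[of "max x 1"]
 by auto

lemma continuous_on_angular_integral:
 fixes q :: "real => real => real"
 assumes q: "continuous_on ({a..b} \<times> {0..2 * pi}) (%(t, th). q t th)"
 shows "continuous_on {a..b} (%t. Int_on {0..<2 * pi} (q t))"
proof -
 have "continuous_on {a..b} (%t. integral (cbox 0 (2 * pi)) (q t))"
  by (rule integral_continuous_on_param) (use q in simp)
 moreover have "Int_on {0..<2 * pi} (q t) = integral (cbox 0 (2 * pi)) (q t)" if t: "t \<in> {a..b}" for t
 proof -
  have c: "continuous_on {0..2 * pi} (q t)"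
  proof -
   have "continuous_on {0..2 * pi} (%th. case (t, th) of (t, th) => q t th)"
    by (rule continuous_on_compose2[OF q continuous_on_Pair[OF continuous_on_const continuous_on_id]]) (use t in auto)
   then show ?thesis by simp
  qed
  have si: "set_integrable lborel {0..2 * pi} (q t)" by (rule borel_integrable_atLeastAtMost'[OF c])
  have "Int_on {0..<2 * pi} (q t) = (LBINT th. indicator {0..2 * pi} th * q t th)"
   unfolding Int_on_def
  proof (rule integral_cong_AE)
   have b: "(%th. indicator {0..2*pi} th *\<^sub>R q t th) \<in> borel_measurable borel"
    using si by (auto simp: set_integrable_def)
   then show "(%th. indicator {0..2*pi} th * q t th) \<in> borel_measurable lborel" by simp
   have "(%th. indicator {0..<2*pi} th * (indicator {0..2*pi} th *\<^sub>R q t th)) \<in> borel_measurable borel"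
    using b by measurable
   also have "(%th. indicator {0..<2*pi} th * (indicator {0..2*pi} th *\<^sub>R q t th)) = (%th. indicator {0..<2*pi} th * q t th)"
    by (auto simp: indicator_def)
   finally show "(%th. indicator {0..<2*pi} th * q t th) \<in> borel_measurable lborel" by simp
   show "AE th in lborel. indicator {0..<2 * pi} th * q t th = indicator {0..2 * pi} th * q t th"
    using AE_lborel_singleton[of "2 * pi"] by eventually_elim (auto simp: indicator_def)
  qed
  also have "... = integral {0..2 * pi} (q t)"
   using set_borel_integral_eq_integral(2)[OF si] by (simp add: set_lebesgue_integral_def)
  finally show ?thesis by simp
 qed
 ultimately show ?thesis by (rule continuous_on_eq[OF _ sym])
qed

lemma circle_mean_real:
 assumes k: "C1 k g" and ro: "ro > 0" and a: "continuous_on UNIV a" "\<And>th. th \<in> {0..<2 * pi} ==> \<bar>a th\<bar> <= M"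
 shows "\<bar>ro * Int_on {0..<2 * pi} (%th. a th * k (polar ro th))
   - ro * Int_on {0..<2 * pi} a / (pi * ro\<^sup>2) * Int_on (ball 0 ro) k\<bar> <= 170 * M * Int_on (ball 0 ro) (%y. norm (g y))"
proof -
 have M: "M >= 0" using a(2)[of 0] by (simp add: order_trans[OF abs_ge_zero])
 have "gradL1 g (ball 0 ro) = ennreal (Int_on (ball 0 ro) (%y. norm (g y)))"
  unfolding gradL1_def
  by (intro nn_Int_on intg_continuous continuous_intros C1_continuous(2)[OF k]) auto
 then have "ennreal \<bar>ro * Int_on {0..<2 * pi} (%th. a th * k (polar ro th))
   - ro * Int_on {0..<2 * pi} a / (pi * ro\<^sup>2) * Int_on (ball 0 ro) k\<bar> <= ennreal (170 * M * Int_on (ball 0 ro) (%y. norm (g y)))"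
  using circle_mean[OF k ro a] M by (simp add: Int_on_def ennreal_mult)
 moreover have "0 <= Int_on (ball 0 ro) (%y. norm (g y))" by (rule Int_on_nonneg) simp
 ultimately show ?thesis using M by (simp add: ennreal_le_iff)
qed

lemma mvt_bound:
 fixes P :: "real => real"
 assumes ab: "a <= b" and P: "continuous_on {a..b} P" and d: "\<And>t. t \<in> {a<..<b} ==> (P has_real_derivative q t) (at t)"
  and B: "\<And>t. t \<in> {a<..<b} ==> \<bar>q t\<bar> <= B"
 shows "\<bar>P b - P a\<bar> <= B * (b - a)"
proof (cases "a = b")
 case False
 then have "a < b" using ab by simp
 moreover have "P differentiable (at t)" if "a < t" "t < b" for t
  using d[of t] that real_differentiable_def by auto
 ultimately obtain l z where z: "a < z" "z < b" "(P has_real_derivative l) (at z)" "P b - P a = (b - a) * l"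
  using MVT[of a b P] P by blast
 have "l = q z" using DERIV_unique[OF z(3) d] z by simp
 with z \<open>a < b\<close> have *: "a < z" "z < b" "P b - P a = (b - a) * q z" by auto
 note z = *
 have "\<bar>P b - P a\<bar> = (b - a) * \<bar>q z\<bar>" using \<open>a < b\<close> z(3) by (simp add: abs_mult)
 also have "... <= (b - a) * B" using B[of z] z \<open>a < b\<close> by (intro mult_left_mono) auto
 finally show ?thesis by (simp add: mult.commute)
qed simp

lemma Int_on_cylinder:
 fixes q :: "real^3 => real"
 assumes q: "intg (cylinder l h ep i) q"
 shows "Int_on (cylinder l h ep i) q = Int_on {ep * l<..<1} (%t. Int_on (ball 0 (ep * h i)) (%y. q (point i t y)))"
  and "Int_on (cylinder l h ep i) q = Int_on (ball 0 (ep * h i)) (%y. Int_on {ep * l<..<1} (%t. q (point i t y)))"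
  and "intg {ep * l<..<1} (%t. Int_on (ball 0 (ep * h i)) (%y. q (point i t y)))"
  and "intg (ball 0 (ep * h i)) (%y. Int_on {ep * l<..<1} (%t. q (point i t y)))"
  and "AE t in lborel. t \<in> {ep * l<..<1} --> intg (ball 0 (ep * h i)) (%y. q (point i t y))"
proof -
 let ?I = "{ep * l<..<1}" and ?B = "ball (0::real\<times>real) (ep * h i)"
 have e1: "indicator (cylinder l h ep i) (point i t y) * q (point i t y) = indicator ?I t * (indicator ?B y * q (point i t y))" for t y
  by (auto simp: indicator_def cylinder_def)
 have e2: "indicator ?I t * (indicator ?B y * q (point i t y)) = indicator ?B y * (indicator ?I t * q (point i t y))" for t y
  by (rule mult.left_commute)
 note P = integral_point[OF q[unfolded intg_def], of i, unfolded e1]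
 show "Int_on (cylinder l h ep i) q = Int_on ?I (%t. Int_on ?B (%y. q (point i t y)))"
  using P(2) by (simp add: Int_on_def)
 show "Int_on (cylinder l h ep i) q = Int_on ?B (%y. Int_on ?I (%t. q (point i t y)))"
  using P(3) by (simp add: Int_on_def e2)
 show "intg ?I (%t. Int_on ?B (%y. q (point i t y)))"
  using P(4) by (simp add: intg_def Int_on_def)
 show "intg ?B (%y. Int_on ?I (%t. q (point i t y)))"
  using P(5) by (simp add: intg_def Int_on_def e2)
 show "AE t in lborel. t \<in> ?I --> intg ?B (%y. q (point i t y))"
  using P(6) by eventually_elim (auto simp: intg_def)
qed

section \<open>The energy estimate\<close>

context junction_data
begin

definition phibar :: "3 => real => real" where
 "phibar i t = h i * Int_on {0..<2 * pi} (%th. \<phi> i t (polar (h i) th))"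

text \<open>The limit equation solved for the second derivative of the profile on edge i.\<close>

definition rhs :: "3 => real => real" where
 "rhs i t = phibar i t / (pi * (h i)\<^sup>2) - f (point i t 0)"

lemma \<phi>_polar_cont: "continuous_on ({0..1} \<times> S) (%(t, th). \<phi> i t (polar (h i) th))"
proof -
 have "continuous_on ({0..1} \<times> S) (%p. case (fst p, polar (h i) (snd p)) of (t, y) => \<phi> i t y)"
  by (rule continuous_on_compose2[OF \<phi>_cont])
    (use h[of i] in \<open>auto intro!: continuous_intros continuous_on_compose2[OF continuous_polar] simp: norm_polar\<close>)
 then show ?thesis by (simp add: case_prod_beta')
qed

lemma \<phi>_polar_cont1: "t \<in> {0..1} ==> continuous_on S (%th. \<phi> i t (polar (h i) th))"
proof -
 assume t: "t \<in> {0..1}"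
 have "continuous_on S (%th. case (t, th) of (t, th) => \<phi> i t (polar (h i) th))"
  by (rule continuous_on_compose2[OF \<phi>_polar_cont continuous_on_Pair[OF continuous_on_const continuous_on_id], of _ S]) (use t in auto)
 then show ?thesis by simp
qed

lemma \<phi>_polar_bound: "t \<in> {0..1} ==> \<bar>\<phi> i t (polar (h i) th)\<bar> <= M0"
 using M0[of t "polar (h i) th" i] h[of i] by (simp add: norm_polar)

lemma phibar_cont: "continuous_on {0..1} (phibar i)"
 unfolding phibar_def[abs_def]
 by (intro continuous_intros continuous_on_angular_integral \<phi>_polar_cont)

lemma rhs_cont: "continuous_on {0..1} (rhs i)"
 unfolding rhs_def[abs_def] using h[of i]
 by (intro continuous_intros phibar_cont f_axis) auto

end

text \<open>\<open>D\<close> is the derivative of \<open>\<omega>\<close>, \<open>w0\<close> the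
  common value at the vertex, and \<open>CP\<close> the constant of the scaled Poincare inequality
  on the core. Kirchhoff's law appears divided by pi.\<close>

locale junction_limit = junction_data l R e0 h \<Xi> f \<phi> F0 F1 M0 for l R e0 h \<Xi> f \<phi> F0 F1 M0 +
 fixes \<omega> D :: "3 => real => real" and w0 D0 B0 CP :: real
 assumes D_cont: "\<And>i. continuous_on {0..1} (D i)"
  and \<omega>_deriv: "\<And>i t. t \<in> {0..1} ==> (\<omega> i has_real_derivative D i t) (at t within {0..1})"
  and D_deriv: "\<And>i t. t \<in> {0<..<1} ==> (D i has_real_derivative rhs i t) (at t)"
  and \<omega>1: "\<And>i. \<omega> i 1 = 0" and \<omega>0: "\<And>i. \<omega> i 0 = w0"
  and kirchhoff: "(\<Sum>i\<in>UNIV. (h i)\<^sup>2 * D i 0) = 0"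
  and D0: "\<And>i t. t \<in> {0..1} ==> \<bar>D i t\<bar> <= D0"
  and B0: "\<And>i t. t \<in> {0..1} ==> \<bar>rhs i t\<bar> <= B0"
  and CP: "CP > 0" "\<And>W g ep. C1 W g ==> 0 < ep ==> ep <= e0 ==> \<exists>c.
   (NN x. indicator (core ep) x * ennreal \<bar>W x - c\<bar>) <= ennreal (CP * ep) * gradL1 g (core ep)"
begin

lemma \<omega>_cont: "continuous_on {0..1} (\<omega> i)"
 unfolding continuous_on_eq_continuous_within using DERIV_continuous[OF \<omega>_deriv] by blast

lemma \<omega>_deriv_at: "t \<in> {0<..<1} ==> (\<omega> i has_real_derivative D i t) (at t)"
 using \<omega>_deriv[of t i] by (simp add: at_within_Icc_at)

lemma pos0: "F0 >= 0" "M0 >= 0" "D0 >= 0" "B0 >= 0"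
 using f_axis(2)[of 0 1] \<phi>_polar_bound[of 0 1 0] D0[of 0 1] B0[of 0 1] by auto

lemma D_near: "t \<in> {0..1} ==> \<bar>D i t - D i 0\<bar> <= B0 * t"
 using mvt_bound[of 0 t "D i" "rhs i" B0] D_deriv B0 continuous_on_subset[OF D_cont, of "{0..t}" i] by auto

lemma \<omega>_near: "t \<in> {0..1} ==> \<bar>\<omega> i t - w0\<bar> <= D0 * t"
 using mvt_bound[of 0 t "\<omega> i" "D i" D0] \<omega>_deriv_at D0 continuous_on_subset[OF \<omega>_cont, of "{0..t}" i] \<omega>0 by auto

end

locale junction_eps = junction_limit +
 fixes ep :: real
 assumes e: "0 < ep" "ep <= e0"
begin

text \<open>The cut-off acts on a <= x_i <= 2 a. In a tube all transversal coordinates are at most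
  a, so a function of x_j that is constant for x_j <= a does not vary in the other tubes:
  corrections for different edges can be added without interaction. The whole transition zone lies
  in the core since 2 a < eps/e0.\<close>

definition a :: real where "a = ep * R"
definition cut :: "real => real" where "cut t = step ((t - a) / a)"
definition cut' :: "real => real" where "cut' t = step' ((t - a) / a) / a"
definition near :: "3 => (real^3) set" where "near i = {x \<in> cyl ep i. x $ i < 2 * a}"
definition zeta' :: "3 => real => real" where "zeta' i t = cut' t * (\<omega> i t - w0) + cut t * D i t"
abbreviation "Ii \<equiv> {ep * l<..<1}"
abbreviation "Bi i \<equiv> ball (0 :: real \<times> real) (ep * h i)"

section \<open>Cut-off functions at scale eps and integrability on the tubes\<close>

lemma a_pos: "a > 0" using e R_pos by (simp add: a_def)
lemma a_small: "2 * a < ep / e0" "2 * a <= 1" using e0_less[OF e] by (auto simp: a_def)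
lemma la: "0 < ep * l" "ep * l <= a" using e l lR by (auto simp: a_def)
lemma Ii_sub: "t \<in> Ii ==> t \<in> {0<..<1}" "t \<in> Ii ==> t \<in> {0..1}" using la by auto

lemma cut_deriv: "(cut has_real_derivative cut' t) (at t)"
proof -
 have "((%t. (t - a) / a) has_real_derivative 1 / a) (at t)"
  using a_pos by (auto intro!: derivative_eq_intros)
 from DERIV_chain2[OF step_deriv this] show ?thesis
  unfolding cut_def[abs_def] cut'_def by simp
qed

lemma cut_simps: "t <= a ==> cut t = 0" "t >= 2 * a ==> cut t = 1" "t <= a ==> cut' t = 0" "t >= 2 * a ==> cut' t = 0"
 using a_pos by (auto simp: cut_def cut'_def step_simps pos_le_divide_eq divide_le_0_iff)

lemma cut_bounds: "0 <= cut t" "cut t <= 1" "0 <= cut' t" "cut' t <= 2 / a"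
 using step_bounds step'_bounds a_pos by (auto simp: cut_def cut'_def intro: divide_right_mono)

lemma cut_cont: "continuous_on S cut" "continuous_on S cut'"
 unfolding cut_def[abs_def] cut'_def[abs_def] using a_pos
 by (intro continuous_intros continuous_on_compose2[OF continuous_step(1)[of UNIV]] continuous_on_compose2[OF continuous_step(2)[of UNIV]]; auto)+

lemma cyl_borel [measurable]: "cyl ep i \<in> sets borel" using open_cyl by simp
lemma near_borel [measurable]: "near i \<in> sets borel"
proof -
 have "open {x :: real^3. x $ i < 2 * a}" by (intro open_Collect_less continuous_intros)
 then have "near i = cyl ep i \<inter> {x. x $ i < 2 * a}" "{x :: real^3. x $ i < 2 * a} \<in> sets borel" by (auto simp: near_def)
 then show ?thesis by simp
qed
lemma core_borel [measurable]: "core ep \<in> sets borel" using open_core[OF e(1)] by simp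
lemma Om_borel [measurable]: "Om ep \<in> sets borel" using open_Om by simp
lemma bounded_sub: "bounded (cyl ep i)" "bounded (core ep)" "bounded (near i)"
 using bounded_Om[OF e] cyl_subset core_subset[OF e] bounded_subset by (auto simp: near_def intro: bounded_subset)

lemma near_core: "near i \<subseteq> core ep"
 using cyl_in_core[OF e] a_small(1) by (auto simp: near_def)

lemma near_cyl: "near i \<subseteq> cyl ep i" by (auto simp: near_def)

lemma intg_cyl:
 assumes g: "continuous_on {0..1} g" and q: "continuous_on UNIV q"
 shows "intg (cyl ep i) (%x. g (x $ i) * q x)"
proof -
 let ?K = "(%p. point i (fst p) (snd p)) ` ({0..1} \<times> cball 0 (ep * h i))"
 have K: "compact ?K"
  by (intro compact_continuous_image continuous_intros compact_Times compact_cball) auto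
 show ?thesis
 proof (rule intg_continuous_on_compact[OF K])
  have "continuous_on ?K (%x. g (x $ i))"
   by (rule continuous_on_compose2[OF g]) (auto intro!: continuous_intros)
  then show "continuous_on ?K (%x. g (x $ i) * q x)"
   by (intro continuous_intros continuous_on_subset[OF q]) auto
  show "cyl ep i \<subseteq> ?K"
  proof
   fix x assume "x \<in> cyl ep i"
   then show "x \<in> ?K" using la
    by (intro image_eqI[of x _ "(x $ i, rest i x)"]) (auto simp: cylinder_def)
  qed
 qed simp
qed

lemma Int_on_near: "(\<And>x. x \<in> cyl ep i ==> x $ i >= 2 * a ==> q x = 0) ==> Int_on (cyl ep i) q = Int_on (near i) q"
 unfolding Int_on_def by (intro Bochner_Integration.integral_cong) (auto simp: near_def indicator_def)

lemma intg_f: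
 assumes q: "continuous_on UNIV q"
 shows "intg (Om ep) (%x. f x * q x)"
proof -
 obtain B where B: "B > 0" "\<And>x. x \<in> Om ep ==> norm (q x) <= B"
  using bounded_continuous_bound[OF bounded_Om[OF e] q] by blast
 show ?thesis
 proof (rule intg_continuous_on_open[OF open_Om bounded_Om[OF e]])
  show "continuous_on (Om ep) (%x. f x * q x)"
   by (intro continuous_intros f_cont[OF e] continuous_on_subset[OF q]) auto
  show "\<bar>f x * q x\<bar> <= F0 * B" if "x \<in> Om ep" for x
   unfolding abs_mult using F0[OF e that] B(2)[OF that] pos0 by (intro mult_mono) auto
 qed
qed

lemma continuous_line: "continuous_on UNIV q ==> continuous_on S (%t. q (point i t y))"
 by (rule continuous_on_compose2[of UNIV q]) (auto intro!: continuous_intros)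

lemma continuous_section: "continuous_on UNIV q ==> continuous_on S (%y. q (point i t y))"
 by (rule continuous_on_compose2[of UNIV q]) (auto intro!: continuous_intros)

lemma lat_Int: "lat ep i v = Int_on Ii (%t. ep * h i * Int_on {0..<2 * pi} (%th. \<phi> i t (polar (h i) th) * v (point i t (polar (ep * h i) th))))"
 by (simp add: lat_def Int_on_def)

lemma intg_lat:
 assumes z: "continuous_on UNIV z"
 shows "intg Ii (%t. ep * h i * Int_on {0..<2 * pi} (%th. \<phi> i t (polar (h i) th) * z (point i t (polar (ep * h i) th))))"
proof (rule intg_continuous_on_compact[of "{0..1}"])
 have "continuous_on ({0..1} \<times> {0..2*pi}) (%p. z (point i (fst p) (polar (ep * h i) (snd p))))"
  by (rule continuous_on_compose2[OF z]) (auto intro!: continuous_intros continuous_on_compose2[OF continuous_polar])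
 then have "continuous_on ({0..1} \<times> {0..2*pi}) (%(t, th). \<phi> i t (polar (h i) th) * z (point i t (polar (ep * h i) th)))"
  using \<phi>_polar_cont[of "{0..2*pi}" i] by (auto simp: case_prod_beta' intro!: continuous_intros)
 then show "continuous_on {0..1} (%t. ep * h i * Int_on {0..<2 * pi} (%th. \<phi> i t (polar (h i) th) * z (point i t (polar (ep * h i) th))))"
  by (intro continuous_intros continuous_on_angular_integral)
qed (use Ii_sub in auto)

text \<open>\<open>circle_mean_real\<close> on each section, integrated along the axis: the flux
  through a circle acts like the volume density \<open>phibar\<close> divided by pi h^2, up to the
  gradient of z. No power of eps remains in the density, since eps times the circle radius eps h is
  divided by the section area pi (eps h)^2.\<close>

lemma lat_bound:
 assumes z: "C1 z k"
 shows "\<bar>ep * lat ep i z - Int_on (cyl ep i) (%x. phibar i (x $ i) / (pi * (h i)\<^sup>2) * z x)\<bar>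
  <= 170 * M0 * ep * Int_on (cyl ep i) (%x. norm (k x))"
proof -
 let ?r = "ep * h i"
 have r: "?r > 0" using e h by simp
 let ?L = "%t. ?r * Int_on {0..<2 * pi} (%th. \<phi> i t (polar (h i) th) * z (point i t (polar ?r th)))"
 let ?Z = "%t. Int_on (Bi i) (%y. z (point i t y))"
 let ?K = "%t. Int_on (Bi i) (%y. norm (k (point i t y)))"
 let ?c = "%t. phibar i t / (pi * (h i)\<^sup>2)"
 have cz: "continuous_on UNIV z" and ck: "continuous_on UNIV k" using C1_continuous[OF z] by auto
 have cn: "continuous_on UNIV (%x. norm (k x))" by (intro continuous_intros ck)
 have cc: "continuous_on {0..1} ?c" using h[of i] by (intro continuous_intros phibar_cont) auto
 have pw: "\<bar>ep * ?L t - ?c t * ?Z t\<bar> <= 170 * M0 * ep * ?K t" if t: "t \<in> Ii" for t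
 proof -
  have "\<bar>?r * Int_on {0..<2 * pi} (%th. \<phi> i t (polar (h i) th) * z (point i t (polar ?r th)))
   - ?r * Int_on {0..<2 * pi} (%th. \<phi> i t (polar (h i) th)) / (pi * ?r\<^sup>2) * ?Z t\<bar> <= 170 * M0 * Int_on (Bi i) (%y. norm (rest i (k (point i t y))))"
   by (rule circle_mean_real[OF C1_section[OF z] r \<phi>_polar_cont1 \<phi>_polar_bound]) (use Ii_sub(2)[OF t] in auto)
  also have "... <= 170 * M0 * ?K t"
   using pos0 by (intro mult_left_mono Int_on_mono intg_continuous continuous_intros continuous_section[OF ck] norm_rest_le) auto
  finally have F: "ep * \<bar>?L t - ?r * Int_on {0..<2 * pi} (%th. \<phi> i t (polar (h i) th)) / (pi * ?r\<^sup>2) * ?Z t\<bar> <= ep * (170 * M0 * ?K t)"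
   using e by (intro mult_left_mono) auto
  have G: "ep * \<bar>?L t - ?r * Int_on {0..<2 * pi} (%th. \<phi> i t (polar (h i) th)) / (pi * ?r\<^sup>2) * ?Z t\<bar>
    = \<bar>ep * ?L t - ep * (?r * Int_on {0..<2 * pi} (%th. \<phi> i t (polar (h i) th)) / (pi * ?r\<^sup>2)) * ?Z t\<bar>"
   using e by (subst abs_of_pos[OF e(1), symmetric], subst abs_mult[symmetric]) (simp add: right_diff_distrib mult.assoc)
  have H: "ep * (?r * Int_on {0..<2 * pi} (%th. \<phi> i t (polar (h i) th)) / (pi * ?r\<^sup>2)) = ?c t"
   using e h[of i] by (simp add: phibar_def power2_eq_square field_simps)
  show ?thesis using F unfolding G H by (simp only: mult.assoc mult.commute mult.left_commute)
 qed
 have iL: "intg Ii ?L" by (rule intg_lat[OF cz])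
 have izc: "intg (cyl ep i) (%x. ?c (x $ i) * z x)" by (rule intg_cyl[OF cc cz])
 have ik: "intg (cyl ep i) (%x. norm (k x))" by (rule intg_continuous[OF bounded_sub(1) _ cn]) simp
 have iZ: "intg Ii (%t. ?c t * ?Z t)"
  using Int_on_cylinder(3)[OF izc] by (simp only: Int_on_cmult point_nth)
 have 1: "ep * lat ep i z - Int_on (cyl ep i) (%x. ?c (x $ i) * z x) = Int_on Ii (%t. ep * ?L t - ?c t * ?Z t)"
  unfolding Int_on_cylinder(1)[OF izc] point_nth Int_on_cmult lat_Int Int_on_diff[OF intg_cmult[OF iL] iZ]
  by (simp only: Int_on_cmult)
 have 2: "\<bar>Int_on Ii (%t. ep * ?L t - ?c t * ?Z t)\<bar> <= Int_on Ii (%t. 170 * M0 * ep * ?K t)"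
  using intg_diff[OF intg_cmult[OF iL, of ep] iZ] intg_cmult[OF Int_on_cylinder(3)[OF ik]] pw
  by (rule Int_on_bound)
 show ?thesis
  unfolding 1 Int_on_cylinder(1)[OF ik] by (rule order_trans[OF 2]) (simp only: Int_on_cmult order_refl)
qed

text \<open>The derivative of cut D z is integrated along each axial line. At the lower end x_i =
  eps l the cut-off vanishes, so only the end disc contributes.\<close>

lemma by_parts:
 assumes z: "C1 z k"
 shows "Int_on (cyl ep i) (%x. (cut (x $ i) * D i (x $ i)) * k x $ i) + Int_on (cyl ep i) (%x. (cut' (x $ i) * D i (x $ i) + cut (x $ i) * rhs i (x $ i)) * z x)
  = D i 1 * Int_on (Bi i) (%y. z (point i 1 y))"
proof -
 have cz: "continuous_on UNIV z" and ck: "continuous_on UNIV (%x. k x $ i)" using C1_continuous[OF z] by (auto intro!: continuous_intros)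
 let ?p = "%t. cut t * D i t" and ?q = "%t. cut' t * D i t + cut t * rhs i t"
 have cp: "continuous_on {0..1} ?p" and cq: "continuous_on {0..1} ?q"
  by (intro continuous_intros cut_cont D_cont rhs_cont)+
 have i1: "intg (cyl ep i) (%x. ?p (x $ i) * k x $ i)" and i2: "intg (cyl ep i) (%x. ?q (x $ i) * z x)"
  by (rule intg_cyl[OF cp ck], rule intg_cyl[OF cq cz])
 have line: "Int_on Ii (%t. ?p t * k (point i t y) $ i + ?q t * z (point i t y)) = D i 1 * z (point i 1 y)" for y
 proof -
  have "Int_on Ii (%t. ?p t * k (point i t y) $ i + ?q t * z (point i t y)) = ?p 1 * z (point i 1 y) - ?p (ep * l) * z (point i (ep * l) y)"
  proof (rule ftc_Ioo(2))
   have sub: "{ep * l..1} \<subseteq> {0..1}" using la by auto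
   show "ep * l <= 1" using el[OF e] by simp
   show "continuous_on {ep * l..1} (%t. ?p t * z (point i t y))"
    by (intro continuous_intros continuous_on_subset[OF cp sub] continuous_line[OF cz] cut_cont continuous_on_subset[OF D_cont sub])
   show "continuous_on {ep * l..1} (%t. ?p t * k (point i t y) $ i + ?q t * z (point i t y))"
    by (intro continuous_intros continuous_line[OF cz] continuous_line[OF ck] cut_cont continuous_on_subset[OF D_cont sub] continuous_on_subset[OF rhs_cont sub])
   fix t assume t: "t \<in> Ii"
   show "((%t. ?p t * z (point i t y)) has_real_derivative ?p t * k (point i t y) $ i + ?q t * z (point i t y)) (at t)"
    using Ii_sub(1)[OF t]
    by (auto intro!: derivative_eq_intros cut_deriv D_deriv C1_axial[OF z] simp: algebra_simps)
  qed
  then show ?thesis using cut_simps(1)[OF la(2)] cut_simps(2)[OF a_small(2)] by simp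
 qed
 have "Int_on (cyl ep i) (%x. ?p (x $ i) * k x $ i) + Int_on (cyl ep i) (%x. ?q (x $ i) * z x) =
   Int_on (cyl ep i) (%x. ?p (x $ i) * k x $ i + ?q (x $ i) * z x)"
  by (rule Int_on_add[OF i1 i2, symmetric])
 also have "... = Int_on (Bi i) (%y. D i 1 * z (point i 1 y))"
  using Int_on_cylinder(2)[OF intg_add[OF i1 i2]] line by simp
 also have "... = D i 1 * Int_on (Bi i) (%y. z (point i 1 y))" by (rule Int_on_cmult)
 finally show ?thesis .
qed

text \<open>The profile solves the limit equation, so after integration by parts only six errors
  remain: f against its axis value (T1), the equation switched off where the cut-off is below 1
  (T2), the derivative of the cut-off times \<omega> - w0 (T3), the end disc (T4), D against D(0) in
  the transition zone (T5) and the lateral flux (T6). The term with D(0) is kept apart: it is not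
  small on one tube and cancels only in the sum over the edges.\<close>

lemma cyl_bound:
 assumes z: "C1 z k"
 shows "\<bar>Int_on (cyl ep i) (%x. f x * z x) - Int_on (cyl ep i) (%x. zeta' i (x $ i) * k x $ i) - ep * lat ep i z
   - D i 0 * Int_on (cyl ep i) (%x. cut' (x $ i) * z x)\<bar>
  <= F1 * ep * Int_on (cyl ep i) (%x. \<bar>z x\<bar>) + 170 * M0 * ep * Int_on (cyl ep i) (%x. norm (k x))
   + 5 * B0 * Int_on (near i) (%x. \<bar>z x\<bar>) + 4 * D0 * Int_on (near i) (%x. norm (k x)) + D0 * Int_on (Bi i) (%y. \<bar>z (point i 1 y)\<bar>)"
proof -
 let ?C = "cyl ep i"
 have cz: "continuous_on UNIV z" and ck: "continuous_on UNIV (%x. k x $ i)" and ckn: "continuous_on UNIV (%x. norm (k x))"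
  and czn: "continuous_on UNIV (%x. \<bar>z x\<bar>)"
  using C1_continuous[OF z] by (auto intro!: continuous_intros)
 have fax: "continuous_on {0..1} (%t. f (point i t 0))" by (rule f_axis)
 have cph: "continuous_on {0..1} (%t. phibar i t / (pi * (h i)\<^sup>2))" using h[of i] by (intro continuous_intros phibar_cont) auto
 have ifz: "intg ?C (%x. f x * z x)" by (rule intg_subset[OF intg_f[OF cz] cyl_subset]) simp
 have iax: "intg ?C (%x. f (point i (x $ i) 0) * z x)" by (rule intg_cyl[OF fax cz])
 have iph: "intg ?C (%x. phibar i (x $ i) / (pi * (h i)\<^sup>2) * z x)" by (rule intg_cyl[OF cph cz])
 have ig1: "intg ?C (%x. (cut' (x $ i) * (\<omega> i (x $ i) - w0)) * k x $ i)"
  by (rule intg_cyl[OF _ ck]) (intro continuous_intros cut_cont \<omega>_cont)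
 have ig2: "intg ?C (%x. (cut (x $ i) * D i (x $ i)) * k x $ i)"
  by (rule intg_cyl[OF _ ck]) (intro continuous_intros cut_cont D_cont)
 have ig3: "intg ?C (%x. (cut' (x $ i) * D i (x $ i)) * z x)" "intg ?C (%x. (cut (x $ i) * rhs i (x $ i)) * z x)"
  "intg ?C (%x. cut' (x $ i) * z x)" "intg ?C (%x. ((1 - cut (x $ i)) * rhs i (x $ i)) * z x)"
  "intg ?C (%x. (cut' (x $ i) * (D i (x $ i) - D i 0)) * z x)"
  by (rule intg_cyl[OF _ cz], intro continuous_intros cut_cont D_cont rhs_cont)+
 have izn: "intg ?C (%x. \<bar>z x\<bar>)" "intg (near i) (%x. \<bar>z x\<bar>)" "intg (near i) (%x. norm (k x))"
  by (rule intg_continuous[OF bounded_sub(1) _ czn], simp, rule intg_continuous[OF bounded_sub(3) _ czn], simp,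
    rule intg_continuous[OF bounded_sub(3) _ ckn], simp)
 have xs: "x $ i \<in> {0..1}" "0 <= x $ i" if "x \<in> ?C" for x using that Ii_sub(2)[of "x $ i"] by (auto simp: cylinder_def)
 define T1 where "T1 = Int_on ?C (%x. f x * z x - f (point i (x $ i) 0) * z x)"
 define T2 where "T2 = Int_on ?C (%x. ((1 - cut (x $ i)) * rhs i (x $ i)) * z x)"
 define T3 where "T3 = Int_on ?C (%x. (cut' (x $ i) * (\<omega> i (x $ i) - w0)) * k x $ i)"
 define T4 where "T4 = D i 1 * Int_on (Bi i) (%y. z (point i 1 y))"
 define T5 where "T5 = Int_on ?C (%x. (cut' (x $ i) * (D i (x $ i) - D i 0)) * z x)"
 define T6 where "T6 = ep * lat ep i z - Int_on ?C (%x. phibar i (x $ i) / (pi * (h i)\<^sup>2) * z x)"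
 have e1: "Int_on ?C (%x. zeta' i (x $ i) * k x $ i) = T3 + Int_on ?C (%x. (cut (x $ i) * D i (x $ i)) * k x $ i)"
  unfolding T3_def Int_on_add[OF ig1 ig2, symmetric] by (simp add: zeta'_def distrib_right)
 have e2: "Int_on ?C (%x. (cut (x $ i) * D i (x $ i)) * k x $ i) = T4 - Int_on ?C (%x. (cut' (x $ i) * D i (x $ i)) * z x) - Int_on ?C (%x. (cut (x $ i) * rhs i (x $ i)) * z x)"
  using by_parts[OF z, of i] Int_on_add[OF ig3(1,2)] by (simp add: T4_def distrib_right)
 have e3: "T5 = Int_on ?C (%x. (cut' (x $ i) * D i (x $ i)) * z x) - D i 0 * Int_on ?C (%x. cut' (x $ i) * z x)"
  unfolding T5_def Int_on_cmult[symmetric] Int_on_diff[OF ig3(1) intg_cmult[OF ig3(3)], symmetric]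
  by (simp add: algebra_simps)
 have e4: "T1 - T2 = Int_on ?C (%x. f x * z x) + Int_on ?C (%x. (cut (x $ i) * rhs i (x $ i)) * z x) - Int_on ?C (%x. phibar i (x $ i) / (pi * (h i)\<^sup>2) * z x)"
  unfolding T1_def T2_def Int_on_diff[OF intg_diff[OF ifz iax] ig3(4), symmetric]
   Int_on_add[OF ifz ig3(2), symmetric] Int_on_diff[OF intg_add[OF ifz ig3(2)] iph, symmetric]
  by (simp add: rhs_def algebra_simps add_divide_distrib diff_divide_distrib)
 have main: "Int_on ?C (%x. f x * z x) - Int_on ?C (%x. zeta' i (x $ i) * k x $ i) - ep * lat ep i z
   - D i 0 * Int_on ?C (%x. cut' (x $ i) * z x) = (T1 - T2) - T3 - T4 + T5 - T6"
  using e1 e2 e3 e4 T6_def by simp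
 have b1: "\<bar>T1\<bar> <= F1 * ep * Int_on ?C (%x. \<bar>z x\<bar>)"
  unfolding T1_def Int_on_cmult[symmetric]
 proof (rule Int_on_bound[OF intg_diff[OF ifz iax] intg_cmult[OF izn(1)]])
  fix x assume "x \<in> ?C"
  then show "\<bar>f x * z x - f (point i (x $ i) 0) * z x\<bar> <= F1 * ep * \<bar>z x\<bar>"
   unfolding left_diff_distrib[symmetric] abs_mult by (intro mult_right_mono F1[OF e]) auto
 qed
 have b2: "\<bar>T2\<bar> <= B0 * Int_on (near i) (%x. \<bar>z x\<bar>)"
 proof -
  have "T2 = Int_on (near i) (%x. ((1 - cut (x $ i)) * rhs i (x $ i)) * z x)"
   unfolding T2_def by (rule Int_on_near) (simp add: cut_simps)
  also have "\<bar>...\<bar> <= Int_on (near i) (%x. B0 * \<bar>z x\<bar>)"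
  proof (rule Int_on_bound[OF intg_subset[OF ig3(4) near_cyl near_borel] intg_cmult[OF izn(2)]])
   fix x assume "x \<in> near i"
   then have "x $ i \<in> {0..1}" using near_cyl xs by blast
   then have "\<bar>1 - cut (x $ i)\<bar> * \<bar>rhs i (x $ i)\<bar> <= 1 * B0"
    using cut_bounds B0 by (intro mult_mono) auto
   then show "\<bar>((1 - cut (x $ i)) * rhs i (x $ i)) * z x\<bar> <= B0 * \<bar>z x\<bar>"
    unfolding abs_mult by (intro mult_right_mono) auto
  qed
  finally show ?thesis by (simp add: Int_on_cmult)
 qed
 \<comment> \<open>The slope 2/a of the cut-off against the width 2 a of the zone, where \<omega> -
   w0 and D - D(0) grow at most linearly.\<close>
 have aa: "2 / a * (X * (2 * a)) = 4 * X" for X using a_pos by (simp add: field_simps)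
 have b3: "\<bar>T3\<bar> <= 4 * D0 * Int_on (near i) (%x. norm (k x))"
 proof -
  have "T3 = Int_on (near i) (%x. (cut' (x $ i) * (\<omega> i (x $ i) - w0)) * k x $ i)"
   unfolding T3_def by (rule Int_on_near) (simp add: cut_simps)
  also have "\<bar>...\<bar> <= Int_on (near i) (%x. (4 * D0) * norm (k x))"
  proof (rule Int_on_bound[OF intg_subset[OF ig1 near_cyl near_borel] intg_cmult[OF izn(3)]])
   fix x assume x: "x \<in> near i"
   then have x1: "x $ i \<in> {0..1}" using near_cyl xs by blast
   have "\<bar>\<omega> i (x $ i) - w0\<bar> <= D0 * (2 * a)"
    using \<omega>_near[OF x1, of i] x pos0 mult_left_mono[of "x $ i" "2 * a" D0] by (auto simp: near_def)
   then have "\<bar>cut' (x $ i)\<bar> * \<bar>\<omega> i (x $ i) - w0\<bar> <= 2 / a * (D0 * (2 * a))"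
    using cut_bounds a_pos by (intro mult_mono) auto
   then show "\<bar>(cut' (x $ i) * (\<omega> i (x $ i) - w0)) * k x $ i\<bar> <= (4 * D0) * norm (k x)"
    unfolding abs_mult aa using component_le_norm_cart[of "k x" i] pos0 by - (rule mult_mono, auto)
  qed
  finally show ?thesis by (simp add: Int_on_cmult)
 qed
 have b4: "\<bar>T4\<bar> <= D0 * Int_on (Bi i) (%y. \<bar>z (point i 1 y)\<bar>)"
  unfolding T4_def abs_mult
 proof (rule mult_mono)
  show "\<bar>D i 1\<bar> <= D0" using D0[of 1 i] by simp
  show "\<bar>Int_on (Bi i) (%y. z (point i 1 y))\<bar> <= Int_on (Bi i) (%y. \<bar>z (point i 1 y)\<bar>)"
   by (rule Int_on_bound; (intro intg_continuous continuous_intros continuous_section[OF cz])?) auto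
 qed (use pos0 in auto)
 have b5: "\<bar>T5\<bar> <= 4 * B0 * Int_on (near i) (%x. \<bar>z x\<bar>)"
 proof -
  have "T5 = Int_on (near i) (%x. (cut' (x $ i) * (D i (x $ i) - D i 0)) * z x)"
   unfolding T5_def by (rule Int_on_near) (simp add: cut_simps)
  also have "\<bar>...\<bar> <= Int_on (near i) (%x. (4 * B0) * \<bar>z x\<bar>)"
  proof (rule Int_on_bound[OF intg_subset[OF ig3(5) near_cyl near_borel] intg_cmult[OF izn(2)]])
   fix x assume x: "x \<in> near i"
   then have x1: "x $ i \<in> {0..1}" using near_cyl xs by blast
   have "\<bar>D i (x $ i) - D i 0\<bar> <= B0 * (2 * a)"
    using D_near[OF x1, of i] x pos0 mult_left_mono[of "x $ i" "2 * a" B0] by (auto simp: near_def)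
   then have "\<bar>cut' (x $ i)\<bar> * \<bar>D i (x $ i) - D i 0\<bar> <= 2 / a * (B0 * (2 * a))"
    using cut_bounds a_pos by (intro mult_mono) auto
   then show "\<bar>(cut' (x $ i) * (D i (x $ i) - D i 0)) * z x\<bar> <= (4 * B0) * \<bar>z x\<bar>"
    unfolding abs_mult aa by (intro mult_right_mono) auto
  qed
  finally show ?thesis by (simp add: Int_on_cmult)
 qed
 have b6: "\<bar>T6\<bar> <= 170 * M0 * ep * Int_on ?C (%x. norm (k x))"
  unfolding T6_def by (rule lat_bound[OF z])
 show ?thesis
  unfolding main using b1 b2 b3 b4 b5 b6 by (simp add: abs_le_iff)
qed

end

lemma intg_bounded_by:
 assumes "intg S r" "q \<in> borel_measurable borel" "S \<in> sets borel" "\<And>x. x \<in> S ==> \<bar>q x\<bar> <= r x"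
 shows "intg S q"
 unfolding intg_def
proof (rule Bochner_Integration.integrable_bound[OF assms(1)[unfolded intg_def]])
 show "(%x. indicator S x * q x) \<in> borel_measurable lborel" using assms(2,3) by measurable
 show "AE x in lborel. norm (indicator S x * q x :: real) <= norm (indicator S x * r x)"
  using assms(4) by (intro AE_I2) (force simp: indicator_def)
qed

lemma Int_on_tendsto:
 assumes q: "\<And>n. intg S (q n)" "intg S p" and r: "\<And>n. intg S (r n)" "(%n. Int_on S (r n)) \<longlonglongrightarrow> 0"
  and le: "\<And>n x. x \<in> S ==> \<bar>q n x - p x\<bar> <= B * r n x"
 shows "(%n. Int_on S (q n)) \<longlonglongrightarrow> Int_on S p"
proof -
 have "(%n. Int_on S (q n) - Int_on S p) \<longlonglongrightarrow> 0"
 proof (rule Lim_null_comparison)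
  show "\<forall>\<^sub>F n in sequentially. norm (Int_on S (q n) - Int_on S p) <= B * Int_on S (r n)"
  proof (intro always_eventually allI)
   fix n
   show "norm (Int_on S (q n) - Int_on S p) <= B * Int_on S (r n)"
    unfolding Int_on_diff[OF q(1) q(2), symmetric] Int_on_cmult[symmetric] real_norm_def
    by (rule Int_on_bound[OF intg_diff[OF q] intg_cmult[OF r(1)] le])
  qed
  show "(%n. B * Int_on S (r n)) \<longlonglongrightarrow> 0" using tendsto_mult_right_zero[OF r(2)] .
 qed
 then show ?thesis by (simp add: LIM_zero_iff)
qed

lemma L1_of_L2:
 fixes q :: "nat => 'a::euclidean_space => real"
 assumes S: "bounded S" "S \<in> sets borel" and q: "\<And>n. q n \<in> borel_measurable borel" "\<And>n. intg S (%x. (q n x)\<^sup>2)"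
 shows "intg S (q n)"
  and "(%n. Int_on S (%x. (q n x)\<^sup>2)) \<longlonglongrightarrow> 0 ==> (%n. Int_on S (%x. \<bar>q n x\<bar>)) \<longlonglongrightarrow> 0"
proof -
 let ?M = "restrict_space lborel S"
 have [measurable]: "S \<in> sets borel" by fact
 interpret M: finite_measure ?M
  using emeasure_bounded_finite[OF S(1)] S(2) by (intro finite_measureI) (simp add: emeasure_restrict_space space_restrict_space)
 have e: "integrable ?M k \<longleftrightarrow> intg S k" "(\<integral>x. k x \<partial>?M) = Int_on S k" for k :: "'a => real"
  using S(2) by (simp_all add: integrable_restrict_space integral_restrict_space intg_def Int_on_def)
 have L: "in_L2 ?M (q n)" for n
  unfolding in_L2_def using q by (auto simp: e intro: measurable_restrict_space1)
 show "intg S (q n)" using M.integral_abs_le_L2(1)[OF L[of n]] by (simp add: e)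
 show "(%n. Int_on S (%x. \<bar>q n x\<bar>)) \<longlonglongrightarrow> 0" if "(%n. Int_on S (%x. (q n x)\<^sup>2)) \<longlonglongrightarrow> 0"
  using M.L2_imp_L1_tendsto[OF L] that by (simp add: e)
qed

text \<open>Supplies C1 functions on the whole line from prescribed continuous derivatives, as the
  test functions have to be defined on all of space. Both functions vanish left of a > 0, so
  integrating from 0 raises no question for negative arguments.\<close>

lemma antiderivative_on_reals:
 fixes \<kappa> :: "real => real"
 assumes c: "continuous_on UNIV \<kappa>" and z: "\<And>t. t <= a ==> \<kappa> t = 0" and a: "a > 0"
 obtains \<eta> where "\<And>t. (\<eta> has_real_derivative \<kappa> t) (at t)" "\<And>t. t <= a ==> \<eta> t = 0"
proof -
 define \<eta> where "\<eta> t = integral {0..t} \<kappa>" for t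
 have 0: "\<eta> t = 0" if "t <= a" for t
 proof -
  have "integral {0..t} \<kappa> = integral {0..t} (%_. 0)"
   using that z by (intro Henstock_Kurzweil_Integration.integral_cong) auto
  then show ?thesis by (simp add: \<eta>_def)
 qed
 have "(\<eta> has_real_derivative \<kappa> t) (at t)" for t
 proof (cases "t < a")
  case True
  have "((%_. 0) has_real_derivative 0) (at t)" by simp
  then have "(\<eta> has_real_derivative 0) (at t)"
   by (rule has_field_derivative_transform_within_open[of _ _ _ "{..<a}"]) (use True 0 in auto)
  then show ?thesis using z True by simp
 next
  case False
  have "(\<eta> has_real_derivative \<kappa> t) (at t within {0..t+1})"
   unfolding \<eta>_def[abs_def] using False a
   by (intro integral_has_real_derivative continuous_on_subset[OF c]) auto
  then show ?thesis using False a by (simp add: at_within_Icc_at)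
 qed
 then show ?thesis using 0 that by blast
qed

text \<open>The explicit test functions of the proof have this form; restricted to a tube only the
  summand of that edge varies, because the others are constant for small arguments.\<close>

lemma C1_axial_sum:
 fixes \<eta> \<eta>' :: "3 => real => real"
 assumes d: "\<And>i t. (\<eta> i has_real_derivative \<eta>' i t) (at t)" and c: "\<And>i. continuous_on UNIV (\<eta>' i)"
 shows "C1 (%x. c + (\<Sum>i\<in>UNIV. \<eta> i (x $ i))) (%x. \<chi> i. \<eta>' i (x $ i))"
 unfolding C1_def
proof (intro conjI allI)
 fix x :: "real^3"
 have "((%x. \<eta> i (x $ i)) has_derivative (%d. \<eta>' i (x $ i) * d $ i)) (at x)" for i
 proof -
  have "((%x. x $ i) has_derivative (%d. d $ i)) (at x)"
   by (rule bounded_linear_imp_has_derivative[OF bounded_linear_vec_nth])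
  from has_derivative_compose[OF this d[of i "x $ i", unfolded has_field_derivative_def]]
  show ?thesis .
 qed
 then have "((%x. c + (\<Sum>i\<in>UNIV. \<eta> i (x $ i))) has_derivative (%d. 0 + (\<Sum>i\<in>UNIV. \<eta>' i (x $ i) * d $ i))) (at x)"
  by (intro has_derivative_add has_derivative_const has_derivative_sum)
 then show "((%x. c + (\<Sum>i\<in>UNIV. \<eta> i (x $ i))) has_derivative (%d. (\<chi> i. \<eta>' i (x $ i)) \<bullet> d)) (at x)"
  by (simp add: inner_vec_def)
next
 show "continuous_on UNIV (%x::real^3. \<chi> i. \<eta>' i (x $ i))"
  by (intro continuous_on_vec_lambda continuous_on_compose2[OF c] continuous_intros) auto
qed

context junction_limit
begin

text \<open>Constants independent of eps: \<open>vC\<close> is the volume of the core divided by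
  eps^3, \<open>K1\<close> serves in \<open>core_L1\<close>. In \<open>KR\<close> the coefficients
  510 = 3 * 170, 15 = 3 * 5 and 6 = 3 * 2 are sums over the three edges, and the summand 1 keeps
  \<open>KR\<close> away from zero so that it can be divided by.\<close>

definition "vC = measure lborel (Om e0) / e0 ^ 3"
definition "K1 = vC / (pi * (h 1)\<^sup>2) * (2 * CP / R + 4) + CP"
definition "KR = 1 + F0 * K1 + 3 * F1 + 510 * M0 + 15 * B0 * K1 + 15 * D0 + 6 * D0 * CP / R"

lemma F1_nonneg: "F1 >= 0"
proof -
 have "point 1 ((e0 * l + 1) / 2) 0 \<in> cyl e0 1"
  using el[OF e0(1) order_refl] e0 h by (auto simp: cylinder_def field_simps)
 from F1[OF e0(1) order_refl this] e0 show ?thesis by (simp add: zero_le_mult_iff)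
qed

lemma K_nonneg: "vC >= 0" "K1 >= 0" "KR >= 1"
proof -
 show 1: "vC >= 0" using e0 by (simp add: vC_def)
 show 2: "K1 >= 0" using 1 CP(1) R_pos by (simp add: K1_def)
 show "KR >= 1" using 2 CP(1) R_pos pos0 F1_nonneg by (simp add: KR_def)
qed

end

section \<open>Bounds for C1 functions near the node\<close>

context junction_eps
begin

text \<open>Up to a null set this part of the domain lies in the core and has all coordinates at
  most a, so axial corrections are constant on it.\<close>

definition outer :: "(real^3) set" where "outer = Om ep - (\<Union>i. cyl ep i)"

lemma outer_borel [measurable]: "outer \<in> sets borel" unfolding outer_def by auto

lemma outer_sub: "outer \<subseteq> Om ep" by (auto simp: outer_def)

lemma AE_outer: "AE x in lborel. x \<in> outer --> x \<in> core ep \<and> (\<forall>i. x $ i <= a)"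
 using AE_Om_decomp[OF e]
proof eventually_elim
 case (elim x)
 then have "x \<in> outer --> x \<in> core ep \<and> (\<forall>i. \<bar>x $ i\<bar> <= a)" by (auto simp: outer_def a_def)
 then show ?case using abs_le_D1 by blast
qed

lemma cyl_other_le: "x \<in> cyl ep j ==> i \<noteq> j ==> x $ i <= a"
 using cyl_other[OF e(1), of x j i] by (auto simp: a_def)

lemma disjoint_cyl: "disjoint_family (cyl ep)"
 using dis_cyl[OF e] by (auto simp: disjoint_family_on_def)

lemma Int_Om_split:
 assumes q: "intg (Om ep) q"
 shows "Int_on (Om ep) q = Int_on outer q + (\<Sum>i\<in>UNIV. Int_on (cyl ep i) q)"
proof -
 have i1: "integrable lborel (%x. indicator outer x * q x)" "integrable lborel (%x. indicator (cyl ep i) x * q x)" for i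
  using intg_subset[OF q outer_sub] intg_subset[OF q cyl_subset] by (auto simp: intg_def)
 have pw: "indicator (Om ep) x * q x = indicator outer x * q x + (\<Sum>i\<in>UNIV. indicator (cyl ep i) x * q x)" for x
 proof -
  have "(\<Sum>i\<in>UNIV. indicator (cyl ep i) x :: real) = indicator (\<Union>i. cyl ep i) x"
   by (rule indicator_UN_disjoint[OF finite disjoint_cyl, symmetric])
  moreover have "(indicator (Om ep) x :: real) = indicator outer x + indicator (\<Union>i. cyl ep i) x"
   using cyl_subset by (auto simp: outer_def indicator_def)
  ultimately show ?thesis by (simp add: distrib_right sum_distrib_right[symmetric])
 qed
 show ?thesis
  unfolding Int_on_def pw
  unfolding Bochner_Integration.integral_add[OF i1(1) Bochner_Integration.integrable_sum[OF i1(2)]]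
   Bochner_Integration.integral_sum[OF i1(2)] ..
qed

lemma Int_on_AE_eq:
 assumes "AE x in lborel. x \<in> S --> q x = p x" "q \<in> borel_measurable borel" "p \<in> borel_measurable borel" "S \<in> sets borel"
 shows "Int_on S q = Int_on S p"
 unfolding Int_on_def
proof (rule integral_cong_AE)
 show "AE x in lborel. indicator S x * q x = indicator S x * p x"
  using assms(1) by eventually_elim (auto simp: indicator_def)
qed (use assms in measurable)

lemma Int_outer_core:
 assumes q: "intg (Om ep) q" "\<And>x. x \<in> Om ep ==> 0 <= q x"
 shows "Int_on outer q <= Int_on (core ep) q"
 unfolding Int_on_def
proof (rule integral_mono_AE)
 show "integrable lborel (%x. indicator outer x * q x)" "integrable lborel (%x. indicator (core ep) x * q x)"
  using intg_subset[OF q(1) outer_sub] intg_subset[OF q(1) core_subset[OF e]] by (auto simp: intg_def)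
 show "AE x in lborel. indicator outer x * q x <= indicator (core ep) x * q x"
  using AE_outer
 proof eventually_elim
  case (elim x)
  then show ?case using q(2)[of x] core_subset[OF e] by (auto simp: indicator_def)
 qed
qed

lemma intg_cont: "continuous_on UNIV q ==> intg (Om ep) q" "continuous_on UNIV q ==> intg (core ep) q"
 "continuous_on UNIV q ==> intg (cyl ep i) q" "continuous_on UNIV q ==> intg (near i) q"
 using intg_continuous[of _ q] bounded_Om[OF e] bounded_sub by auto

text \<open>Measures how far z is from vanishing on the end discs. The approximations of u need not
  satisfy the boundary condition exactly; this term tends to zero along them.\<close>

definition ends :: "(real^3 => real) => real" where
 "ends z = (\<Sum>i\<in>UNIV. Int_on (Bi i) (%y. \<bar>z (point i 1 y)\<bar>))"

lemma ends_ge: "Int_on (Bi i) (%y. \<bar>z (point i 1 y)\<bar>) <= ends z" "0 <= ends z"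
proof -
 have nn: "0 <= Int_on (Bi i) (%y. \<bar>z (point i 1 y)\<bar>)" for i by (intro Int_on_nonneg) auto
 then show "Int_on (Bi i) (%y. \<bar>z (point i 1 y)\<bar>) <= ends z" "0 <= ends z"
  unfolding ends_def by (auto intro!: sum_nonneg member_le_sum)
qed

text \<open>On each axial line |z| is at most its value at the end x_i = 1 plus the integral of
  |grad z| along the line. The bound does not depend on t, so a slab of axial length b gains the
  factor b.\<close>

lemma slab_L1:
 assumes z: "C1 z k" and b: "0 < b" "b <= 1"
 shows "Int_on {x \<in> cyl ep i. x $ i < b} (%x. \<bar>z x\<bar>) <= b * (ends z + Int_on (Om ep) (%x. norm (k x)))"
proof -
 have cz: "continuous_on UNIV z" and ck: "continuous_on UNIV (%x. norm (k x))"
  and cza: "continuous_on UNIV (%x. \<bar>z x\<bar>)"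
  using C1_continuous[OF z] by (auto intro!: continuous_intros)
 let ?G = "%y. \<bar>z (point i 1 y)\<bar> + Int_on Ii (%s. norm (k (point i s y)))"
 have ik: "intg (cyl ep i) (%x. norm (k x))" by (rule intg_cont[OF ck])
 have iz: "intg (cyl ep i) (%x. indicator {..<b} (x $ i) * \<bar>z x\<bar>)"
  by (rule intg_bounded_by[OF intg_cont(3)[OF cza]]) (use C1_borel[OF z] in \<open>auto simp: indicator_def\<close>)
 have G0: "0 <= ?G y" for y by (intro add_nonneg_nonneg Int_on_nonneg) auto
 have pw: "\<bar>z (point i t y)\<bar> <= ?G y" if t: "t \<in> Ii" for t y
 proof -
  have tt: "t <= 1" "{t<..<1} \<subseteq> Ii" using t by auto
  have ii: "intg Ii (%s. norm (k (point i s y)))" by (rule intg_continuous) (auto intro: continuous_line[OF ck] bounded_Ioo_real)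
  have ck': "continuous_on UNIV (%x. k x $ i)" using C1_continuous[OF z] by (auto intro!: continuous_intros)
  have F: "intg {t<..<1} (%s. k (point i s y) $ i)" "Int_on {t<..<1} (%s. k (point i s y) $ i) = z (point i 1 y) - z (point i t y)"
   by (rule ftc_Ioo[OF tt(1) continuous_line[OF cz] continuous_line[OF ck'] C1_axial[OF z]])+
  have "\<bar>z (point i 1 y) - z (point i t y)\<bar> <= Int_on {t<..<1} (%s. norm (k (point i s y)))"
   unfolding F(2)[symmetric]
   by (rule Int_on_bound[OF F(1) intg_subset[OF ii tt(2)]]) (auto simp: component_le_norm_cart)
  also have "... <= Int_on Ii (%s. norm (k (point i s y)))"
   by (rule Int_on_subset[OF ii tt(2)]) auto
  finally show ?thesis by linarith
 qed
 have inner: "Int_on Ii (%t. indicator {..<b} t * \<bar>z (point i t y)\<bar>) <= b * ?G y" for y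
 proof -
  have "Int_on Ii (%t. indicator {..<b} t * \<bar>z (point i t y)\<bar>) = Int_on {ep * l<..<b} (%t. \<bar>z (point i t y)\<bar>)"
   unfolding Int_on_def using b by (intro Bochner_Integration.integral_cong) (auto simp: indicator_def)
  also have "... <= Int_on {ep * l<..<b} (%t. ?G y)"
  proof (rule Int_on_mono)
   show "intg {ep * l<..<b} (%t. \<bar>z (point i t y)\<bar>)"
    by (rule intg_continuous) (auto intro: continuous_line[OF cza] bounded_Ioo_real)
   show "intg {ep * l<..<b} (%t. ?G y)"
    by (rule intg_continuous) (auto intro: bounded_Ioo_real)
  qed (use pw b in auto)
  also have "... = ?G y * measure lborel {ep * l<..<b}" by (rule Int_on_const) simp
  also have "... <= ?G y * b" using la b by (intro mult_left_mono G0, cases "ep * l <= b") auto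
  finally show ?thesis by (simp add: mult.commute)
 qed
 have iE: "intg (Bi i) (%y. \<bar>z (point i 1 y)\<bar>)" by (rule intg_continuous) (auto intro: continuous_section[OF cza])
 have "Int_on {x \<in> cyl ep i. x $ i < b} (%x. \<bar>z x\<bar>) = Int_on (cyl ep i) (%x. indicator {..<b} (x $ i) * \<bar>z x\<bar>)"
  unfolding Int_on_def by (intro Bochner_Integration.integral_cong) (auto simp: indicator_def)
 also have "... = Int_on (Bi i) (%y. Int_on Ii (%t. indicator {..<b} t * \<bar>z (point i t y)\<bar>))"
  using Int_on_cylinder(2)[OF iz] by simp
 also have "... <= Int_on (Bi i) (%y. b * ?G y)"
  using Int_on_cylinder(4)[OF iz] Int_on_cylinder(4)[OF ik] inner
  by (intro Int_on_mono intg_cmult intg_add iE) auto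
 also have "... = b * (Int_on (Bi i) (%y. \<bar>z (point i 1 y)\<bar>) + Int_on (cyl ep i) (%x. norm (k x)))"
  unfolding Int_on_cmult Int_on_add[OF iE Int_on_cylinder(4)[OF ik]] Int_on_cylinder(2)[OF ik] ..
 also have "... <= b * (ends z + Int_on (Om ep) (%x. norm (k x)))"
  using b by (intro mult_left_mono add_mono ends_ge Int_on_subset intg_cont(1)[OF ck] cyl_subset) auto
 finally show ?thesis .
qed

lemma near_L1: "C1 z k ==> Int_on (near i) (%x. \<bar>z x\<bar>) <= 2 * a * (ends z + Int_on (Om ep) (%x. norm (k x)))"
 using slab_L1[of z k "2 * a" i] a_pos a_small(2) by (simp add: near_def)

lemma cyl_L1: "C1 z k ==> Int_on (cyl ep i) (%x. \<bar>z x\<bar>) <= ends z + Int_on (Om ep) (%x. norm (k x))"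
proof -
 have "{x \<in> cyl ep i. x $ i < 1} = cyl ep i" by (auto simp: cylinder_def)
 then show "C1 z k ==> ?thesis" using slab_L1[of z k 1 i] by simp
qed

lemma core_poincare:
 assumes z: "C1 z k"
 obtains c where "Int_on (core ep) (%x. \<bar>z x - c\<bar>) <= CP * ep * Int_on (core ep) (%x. norm (k x))"
proof -
 obtain c where c: "(NN x. indicator (core ep) x * ennreal \<bar>z x - c\<bar>) <= ennreal (CP * ep) * gradL1 k (core ep)"
  using CP(2)[OF z e] by (rule exE)
 have cz: "continuous_on UNIV (%x. \<bar>z x - c\<bar>)" and ck: "continuous_on UNIV (%x. norm (k x))"
  using C1_continuous[OF z] by (auto intro!: continuous_intros)
 have nn: "0 <= Int_on (core ep) (%x. norm (k x))" by (rule Int_on_nonneg) simp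
 have "ennreal (Int_on (core ep) (%x. \<bar>z x - c\<bar>)) = (NN x. indicator (core ep) x * ennreal \<bar>z x - c\<bar>)"
  using nn_Int_on[OF intg_cont(2)[OF cz]] by simp
 also note c
 also have "gradL1 k (core ep) = ennreal (Int_on (core ep) (%x. norm (k x)))"
  unfolding gradL1_def using nn_Int_on[OF intg_cont(2)[OF ck]] by simp
 also have "ennreal (CP * ep) * ... = ennreal (CP * ep * Int_on (core ep) (%x. norm (k x)))"
  using CP(1) e nn by (intro ennreal_mult[symmetric]) auto
 finally show ?thesis
  using CP(1) e nn that[of c] by (simp add: ennreal_le_iff)
qed

text \<open>The cut-off rises from 0 to 1 along the axis, so only the section area remains.\<close>

lemma cut'_total: "Int_on (cyl ep i) (%x. cut' (x $ i)) = pi * (ep * h i)\<^sup>2"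
proof -
 have c: "continuous_on UNIV (%x :: real^3. cut' (x $ i))"
  by (intro continuous_on_compose2[OF cut_cont(2)[of UNIV]] continuous_intros) auto
 have F: "Int_on Ii cut' = 1"
  using ftc_Ioo(2)[OF _ cut_cont(1) cut_cont(2) cut_deriv, of "ep * l" 1] el[OF e] cut_simps(1)[OF la(2)] cut_simps(2)[OF a_small(2)] by simp
 have "Int_on (cyl ep i) (%x. cut' (x $ i)) = Int_on Ii (%t. Int_on (Bi i) (%y. cut' t))"
  using Int_on_cylinder(1)[OF intg_cont(3)[OF c]] by simp
 also have "... = Int_on Ii (%t. (pi * (ep * h i)\<^sup>2) * cut' t)"
  using measure_disc[of "ep * h i"] e h[of i] by (simp add: Int_on_const mult.commute)
 also have "... = pi * (ep * h i)\<^sup>2" unfolding Int_on_cmult F by simp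
 finally show ?thesis .
qed

lemma cut'_weight:
 assumes z: "C1 z k"
 shows "\<bar>Int_on (cyl ep i) (%x. cut' (x $ i) * z x)\<bar> <= 2 / a * Int_on (near i) (%x. \<bar>z x\<bar>)"
proof -
 have cz: "continuous_on UNIV z" "continuous_on UNIV (%x. \<bar>z x\<bar>)" using C1_continuous[OF z] by (auto intro!: continuous_intros)
 have i: "intg (cyl ep i) (%x. cut' (x $ i) * z x)" by (rule intg_cyl[OF cut_cont(2) cz(1)])
 have "Int_on (cyl ep i) (%x. cut' (x $ i) * z x) = Int_on (near i) (%x. cut' (x $ i) * z x)"
  by (rule Int_on_near) (simp add: cut_simps)
 also have "\<bar>...\<bar> <= Int_on (near i) (%x. 2 / a * \<bar>z x\<bar>)"
 proof (rule Int_on_bound[OF intg_subset[OF i near_cyl near_borel] intg_cmult[OF intg_cont(4)[OF cz(2)]]])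
  fix x assume "x \<in> near i"
  show "\<bar>cut' (x $ i) * z x\<bar> <= 2 / a * \<bar>z x\<bar>"
   unfolding abs_mult using cut_bounds by (intro mult_right_mono) auto
 qed
 finally show ?thesis unfolding Int_on_cmult .
qed

end

lemma sum3_bound:
 fixes q :: "3 => real" shows "(\<And>i. \<bar>q i\<bar> <= B) ==> \<bar>\<Sum>i\<in>UNIV. q i\<bar> <= 3 * B"
 using sum_norm_bound[of UNIV q B] by simp

section \<open>The residual of the corrected limit profile\<close>

context junction_eps
begin

lemma eps_le_1: "ep <= 1"
proof -
 have "e0 * 1 <= e0 * (2 * R + 1)" using e0 R_pos by (intro mult_left_mono) auto
 then show ?thesis using e e0 by linarith
qed

lemma core_measure: "measure lborel (core ep) = vC * ep ^ 3"
 using measure_core(1)[OF e] by (simp add: vC_def)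

lemma C1_shift: "C1 z k ==> C1 (%x. z x - c) k"
 using C1_diff[of z k "%_. c" "%_. 0"] by (auto simp: C1_def)

text \<open>Poincare on the core controls z up to a constant c. The constant is read off in tube 1:
  c times the section area equals the integral of cut' z minus that of cut' (z - c), and the first
  is bounded through the slab estimate because the slope 2/a of the cut-off compensates the slab
  length 2 a.\<close>

lemma core_L1:
 assumes z: "C1 z k"
 shows "Int_on (core ep) (%x. \<bar>z x\<bar>) <= K1 * (ep * (ends z + Int_on (Om ep) (%x. norm (k x))))"
proof -
 define A where "A = Int_on (Om ep) (%x. norm (k x))"
 let ?S = "ends z + A"
 obtain c where c: "Int_on (core ep) (%x. \<bar>z x - c\<bar>) <= CP * ep * Int_on (core ep) (%x. norm (k x))"
  by (rule core_poincare[OF z])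
 note zc = C1_shift[OF z, of c]
 have cz: "continuous_on UNIV z" "continuous_on UNIV (%x. \<bar>z x\<bar>)" "continuous_on UNIV (%x. \<bar>z x - c\<bar>)"
  and ck: "continuous_on UNIV (%x. norm (k x))"
  using C1_continuous[OF z] by (auto intro!: continuous_intros)
 have A: "Int_on (core ep) (%x. norm (k x)) <= A"
  unfolding A_def by (rule Int_on_subset[OF intg_cont(1)[OF ck] core_subset[OF e]]) auto
 have A0: "0 <= A" "0 <= ?S" using ends_ge(2)[of z] by (auto simp: A_def intro!: Int_on_nonneg add_nonneg_nonneg)
 have c2: "Int_on (core ep) (%x. \<bar>z x - c\<bar>) <= CP * ep * A"
  by (rule order_trans[OF c mult_left_mono[OF A]]) (use CP(1) e in simp)
 have c3: "Int_on (near 1) (%x. \<bar>z x - c\<bar>) <= CP * ep * A"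
  by (rule order_trans[OF Int_on_subset[OF intg_cont(2)[OF cz(3)] near_core near_borel] c2]) auto
 let ?m = "pi * (ep * h 1)\<^sup>2"
 have m: "?m > 0" using e h[of 1] by simp
 have i: "intg (cyl ep 1) (%x. cut' (x $ 1) * z x)" "intg (cyl ep 1) (%x. cut' (x $ 1) * 1)"
  by (rule intg_cyl[OF cut_cont(2) cz(1)], rule intg_cyl[OF cut_cont(2) continuous_on_const])
 have "Int_on (cyl ep 1) (%x. cut' (x $ 1) * (z x - c)) = Int_on (cyl ep 1) (%x. cut' (x $ 1) * z x) - c * Int_on (cyl ep 1) (%x. cut' (x $ 1) * 1)"
  unfolding Int_on_cmult[symmetric] Int_on_diff[OF i(1) intg_cmult[OF i(2)], symmetric] by (simp add: algebra_simps)
 then have "c * ?m = Int_on (cyl ep 1) (%x. cut' (x $ 1) * z x) - Int_on (cyl ep 1) (%x. cut' (x $ 1) * (z x - c))"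
  using cut'_total[of 1] by simp
 then have "\<bar>c * ?m\<bar> <= 2 / a * Int_on (near 1) (%x. \<bar>z x\<bar>) + 2 / a * Int_on (near 1) (%x. \<bar>z x - c\<bar>)"
  using cut'_weight[OF z, of 1] cut'_weight[OF zc, of 1] by linarith
 also have "... <= 2 / a * (2 * a * ?S) + 2 / a * (CP * ep * A)"
  using near_L1[OF z, of 1] c3 a_pos unfolding A_def by (intro add_mono mult_left_mono) auto
 also have "... = 4 * ?S + 2 * CP / R * A" using a_pos e R_pos by (simp add: field_simps a_def)
 also have "... <= 4 * ?S + 2 * CP / R * ?S"
  using ends_ge(2)[of z] CP(1) R_pos by (intro add_left_mono mult_left_mono) auto
 finally have "\<bar>c\<bar> * ?m <= (2 * CP / R + 4) * ?S" using m by (simp add: abs_mult algebra_simps)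
 then have cb: "\<bar>c\<bar> <= (2 * CP / R + 4) * ?S / ?m" using m by (simp add: pos_le_divide_eq)
 have "Int_on (core ep) (%x. \<bar>z x\<bar>) <= Int_on (core ep) (%x. \<bar>z x - c\<bar> + \<bar>c\<bar>)"
  by (intro Int_on_mono intg_cont cz continuous_intros) auto
 also have "... = Int_on (core ep) (%x. \<bar>z x - c\<bar>) + \<bar>c\<bar> * (vC * ep ^ 3)"
  unfolding core_measure[symmetric] Int_on_const[OF core_borel, symmetric]
  by (intro Int_on_add intg_cont cz continuous_intros)
 also have "... <= CP * ep * ?S + (2 * CP / R + 4) * ?S / ?m * (vC * ep ^ 3)"
 proof (intro add_mono mult_right_mono cb)
  have "CP * ep * A <= CP * ep * ?S" using ends_ge(2)[of z] CP(1) e by (intro mult_left_mono) auto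
  then show "Int_on (core ep) (%x. \<bar>z x - c\<bar>) <= CP * ep * ?S" using c2 by linarith
 qed (use K_nonneg e in auto)
 also have "... = K1 * (ep * ?S)"
  using e h[of 1] R_pos by (simp add: K1_def power_mult_distrib power3_eq_cube power2_eq_square field_simps)
 finally show ?thesis by (simp add: A_def)
qed

lemma lat_diff:
 assumes "continuous_on UNIV v" "continuous_on UNIV z"
 shows "lat ep i (%x. v x - z x) = lat ep i v - lat ep i z"
proof -
 let ?I = "%v t. ep * h i * Int_on {0..<2 * pi} (%th. \<phi> i t (polar (h i) th) * v (point i t (polar (ep * h i) th)))"
 have c: "intg {0..<2 * pi} (%th. \<phi> i t (polar (h i) th) * v (point i t (polar (ep * h i) th)))"
  if v: "continuous_on UNIV v" and t: "t \<in> Ii" for v t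
  by (rule intg_continuous)
    (auto intro!: continuous_intros \<phi>_polar_cont1 Ii_sub(2)[OF t] continuous_on_compose2[OF v] continuous_on_compose2[OF continuous_polar])
 have eq: "?I (%x. v x - z x) t = ?I v t - ?I z t" if t: "t \<in> Ii" for t
  unfolding right_diff_distrib Int_on_diff[OF c[OF assms(1) t] c[OF assms(2) t]] ..
 have "lat ep i (%x. v x - z x) = Int_on Ii (%t. ?I v t - ?I z t)"
  unfolding lat_Int Int_on_def[of Ii] using eq by (intro Bochner_Integration.integral_cong) (auto simp: indicator_def)
 also have "... = lat ep i v - lat ep i z"
  unfolding lat_Int by (rule Int_on_diff[OF intg_lat[OF assms(1)] intg_lat[OF assms(2)]])
 finally show ?thesis .
qed

lemma load_Int: "load ep v = Int_on (Om ep) (%x. f x * v x) - ep * (\<Sum>i\<in>UNIV. lat ep i v)"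
 by (simp add: load_def Int_on_def)

lemma load_diff:
 assumes "continuous_on UNIV v" "continuous_on UNIV z"
 shows "load ep (%x. v x - z x) = load ep v - load ep z"
 unfolding load_Int lat_diff[OF assms] right_diff_distrib Int_on_diff[OF intg_f[OF assms(1)] intg_f[OF assms(2)]]
 by (simp add: sum_subtractf algebra_simps)

text \<open>The residual of the corrected limit profile as a functional on C1 functions. The parts
  of all tubes and of the node are bounded separately, except the terms with \<open>D i 0\<close>,
  which need Kirchhoff's law.\<close>

lemma load_bound:
 assumes gp: "continuous_on UNIV gp" "\<And>i x v. x \<in> cyl ep i ==> gp x \<bullet> v = zeta' i (x $ i) * v $ i" "\<And>x. (\<And>i. x $ i <= a) ==> gp x = 0"
  and z: "C1 z k"
 shows "\<bar>load ep z - Int_on (Om ep) (%x. gp x \<bullet> k x)\<bar>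
  <= KR * (ep * Int_on (Om ep) (%x. norm (k x)) + Int_on (core ep) (%x. norm (k x)) + ends z)"
proof -
 define A where "A = Int_on (Om ep) (%x. norm (k x))"
 define Ac where "Ac = Int_on (core ep) (%x. norm (k x))"
 define X where "X = ep * A + Ac + ends z"
 obtain c where c: "Int_on (core ep) (%x. \<bar>z x - c\<bar>) <= CP * ep * Ac"
  unfolding Ac_def by (rule core_poincare[OF z])
 have cz: "continuous_on UNIV z" "continuous_on UNIV (%x. \<bar>z x\<bar>)" "continuous_on UNIV (%x. \<bar>z x - c\<bar>)"
  and ck: "continuous_on UNIV k" "continuous_on UNIV (%x. norm (k x))" "continuous_on UNIV (%x. gp x \<bullet> k x)"
  using C1_continuous[OF z] gp(1) by (auto intro!: continuous_intros)
 have A0: "0 <= A" "0 <= Ac" "0 <= ends z" by (auto simp: A_def Ac_def intro!: Int_on_nonneg ends_ge)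
 have X: "ep * A <= X" "Ac <= X" "ends z <= X" "0 <= X" "ep * (ends z + A) <= X"
 proof -
  have "0 <= ep * A" "ep * ends z <= 1 * ends z"
   using A0 e mult_right_mono[OF eps_le_1 A0(3)] by auto
  then show "ep * A <= X" "Ac <= X" "ends z <= X" "0 <= X" "ep * (ends z + A) <= X"
   using A0 by (auto simp: X_def distrib_left)
 qed
 have core: "Int_on (core ep) (%x. \<bar>z x\<bar>) <= K1 * X"
  using core_L1[OF z] mult_left_mono[OF X(5) K_nonneg(2)] by (simp add: A_def)
 have near: "Int_on (near i) (%x. \<bar>z x\<bar>) <= K1 * X" for i
  by (rule order_trans[OF Int_on_subset[OF intg_cont(2)[OF cz(2)] near_core near_borel] core]) auto
 have near_k: "Int_on (near i) (%x. norm (k x)) <= X" for i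
  using Int_on_subset[OF intg_cont(2)[OF ck(2)] near_core near_borel, of i] X(2) by (simp add: Ac_def)
 have cylk: "Int_on (cyl ep i) (%x. norm (k x)) <= A" for i
  unfolding A_def by (rule Int_on_subset[OF intg_cont(1)[OF ck(2)] cyl_subset]) auto
 define Y where "Y i = Int_on (cyl ep i) (%x. cut' (x $ i) * z x)" for i
 define V where "V i = Int_on (cyl ep i) (%x. f x * z x) - Int_on (cyl ep i) (%x. zeta' i (x $ i) * k x $ i) - ep * lat ep i z - D i 0 * Y i" for i
 define KV where "KV = F1 + 170 * M0 + 5 * B0 * K1 + 5 * D0"
 have V: "\<bar>V i\<bar> <= KV * X" for i
 proof -
  have 1: "F1 * ep * Int_on (cyl ep i) (%x. \<bar>z x\<bar>) <= F1 * X"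
  proof -
   have "F1 * ep * Int_on (cyl ep i) (%x. \<bar>z x\<bar>) <= F1 * ep * (ends z + A)"
    using cyl_L1[OF z] F1_nonneg e unfolding A_def by (intro mult_left_mono) auto
   also have "... <= F1 * X" using mult_left_mono[OF X(5) F1_nonneg] by (simp add: mult.assoc)
   finally show ?thesis .
  qed
  have 2: "170 * M0 * ep * Int_on (cyl ep i) (%x. norm (k x)) <= 170 * M0 * X"
  proof -
   have "170 * M0 * (ep * Int_on (cyl ep i) (%x. norm (k x))) <= 170 * M0 * (ep * A)"
    using cylk pos0 e by (intro mult_left_mono) auto
   also have "... <= 170 * M0 * X" using X(1) pos0 by (intro mult_left_mono) auto
   finally show ?thesis by (simp add: mult.assoc)
  qed
  have 3: "5 * B0 * Int_on (near i) (%x. \<bar>z x\<bar>) <= 5 * B0 * (K1 * X)"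
   using near pos0 by (intro mult_left_mono) auto
  have 4: "4 * D0 * Int_on (near i) (%x. norm (k x)) <= 4 * D0 * X"
   using near_k pos0 by (intro mult_left_mono) auto
  have 5: "D0 * Int_on (Bi i) (%y. \<bar>z (point i 1 y)\<bar>) <= D0 * X"
   using ends_ge(1)[of i z] X(3) pos0 by (intro mult_left_mono) auto
  have "\<bar>V i\<bar> <= F1 * X + 170 * M0 * X + 5 * B0 * (K1 * X) + 4 * D0 * X + D0 * X"
   using cyl_bound[OF z, of i] 1 2 3 4 5 unfolding V_def Y_def by linarith
  also have "... = KV * X" by (simp add: KV_def algebra_simps)
  finally show ?thesis .
 qed
 have Y: "\<bar>D i 0 * (Y i - c * (pi * (ep * h i)\<^sup>2))\<bar> <= D0 * (2 * CP / R * X)" for i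
 proof -
  have i: "intg (cyl ep i) (%x. cut' (x $ i) * z x)" "intg (cyl ep i) (%x. cut' (x $ i) * 1)"
   by (rule intg_cyl[OF cut_cont(2) cz(1)], rule intg_cyl[OF cut_cont(2) continuous_on_const])
  have "Int_on (cyl ep i) (%x. cut' (x $ i) * (z x - c)) = Y i - c * Int_on (cyl ep i) (%x. cut' (x $ i) * 1)"
   unfolding Y_def Int_on_cmult[symmetric] Int_on_diff[OF i(1) intg_cmult[OF i(2)], symmetric] by (simp add: algebra_simps)
  then have "\<bar>Y i - c * (pi * (ep * h i)\<^sup>2)\<bar> <= 2 / a * Int_on (near i) (%x. \<bar>z x - c\<bar>)"
   using cut'_weight[OF C1_shift[OF z, of c], of i] cut'_total[of i] by simp
  also have "... <= 2 / a * (CP * ep * Ac)"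
   using Int_on_subset[OF intg_cont(2)[OF cz(3)] near_core near_borel, of i] c a_pos by (intro mult_left_mono) auto
  also have "... = 2 * CP / R * Ac" using a_pos e R_pos by (simp add: field_simps a_def)
  also have "... <= 2 * CP / R * X" using X(2) CP(1) R_pos by (intro mult_left_mono) auto
  finally show ?thesis unfolding abs_mult using D0[of 0 i] pos0 by (intro mult_mono) auto
 qed
 \<comment> \<open>Kirchhoff's law allows subtracting the Poincare constant c of z on the core from
   every weighted mean at once; what is left is an oscillation, small by the Poincare
   inequality.\<close>
 have kir: "(\<Sum>i\<in>UNIV. D i 0 * Y i) = (\<Sum>i\<in>UNIV. D i 0 * (Y i - c * (pi * (ep * h i)\<^sup>2)))"
 proof -
  have "(\<Sum>i\<in>UNIV. D i 0 * (c * (pi * (ep * h i)\<^sup>2))) = c * pi * ep\<^sup>2 * (\<Sum>i\<in>UNIV. (h i)\<^sup>2 * D i 0)"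
   unfolding sum_distrib_left by (intro sum.cong) (auto simp: power_mult_distrib)
  then show ?thesis using kirchhoff by (simp add: right_diff_distrib sum_subtractf)
 qed
 have ofz: "\<bar>Int_on outer (%x. f x * z x)\<bar> <= F0 * (K1 * X)"
 proof -
  have "\<bar>Int_on outer (%x. f x * z x)\<bar> <= Int_on outer (%x. F0 * \<bar>z x\<bar>)"
  proof (rule Int_on_bound[OF intg_subset[OF intg_f[OF cz(1)] outer_sub outer_borel] intg_cmult[OF intg_subset[OF intg_cont(1)[OF cz(2)] outer_sub outer_borel]]])
   fix x assume "x \<in> outer"
   then show "\<bar>f x * z x\<bar> <= F0 * \<bar>z x\<bar>"
    unfolding abs_mult using outer_sub F0[OF e] by (intro mult_right_mono) auto
  qed
  also have "... = F0 * Int_on outer (%x. \<bar>z x\<bar>)" by (rule Int_on_cmult)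
  also have "... <= F0 * (K1 * X)"
   using Int_outer_core[OF intg_cont(1)[OF cz(2)]] core pos0 by (intro mult_left_mono) auto
  finally show ?thesis .
 qed
 have ogp: "Int_on outer (%x. gp x \<bullet> k x) = 0"
 proof -
  have "Int_on outer (%x. gp x \<bullet> k x) = Int_on outer (%x. 0)"
  proof (rule Int_on_AE_eq)
   show "AE x in lborel. x \<in> outer --> gp x \<bullet> k x = 0"
    using AE_outer by eventually_elim (use gp(3) in auto)
   show "(%x. gp x \<bullet> k x) \<in> borel_measurable borel" by (rule borel_measurable_continuous_onI[OF ck(3)])
  qed auto
  then show ?thesis by (simp add: Int_on_def)
 qed
 have cgp: "Int_on (cyl ep i) (%x. gp x \<bullet> k x) = Int_on (cyl ep i) (%x. zeta' i (x $ i) * k x $ i)" for i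
  unfolding Int_on_def by (intro Bochner_Integration.integral_cong) (auto simp: indicator_def gp(2))
 have "load ep z - Int_on (Om ep) (%x. gp x \<bullet> k x) = Int_on outer (%x. f x * z x) + (\<Sum>i\<in>UNIV. V i) + (\<Sum>i\<in>UNIV. D i 0 * Y i)"
  unfolding load_Int Int_Om_split[OF intg_f[OF cz(1)]] Int_Om_split[OF intg_cont(1)[OF ck(3)]] ogp cgp
  by (simp add: V_def sum_subtractf sum_distrib_left)
 also have "\<bar>...\<bar> <= F0 * (K1 * X) + 3 * (KV * X) + 3 * (D0 * (2 * CP / R * X))"
  using ofz sum3_bound[of V, OF V] sum3_bound[of "%i. D i 0 * (Y i - c * (pi * (ep * h i)\<^sup>2))", OF Y] unfolding kir by linarith
 also have "... = (KR - 1) * X" by (simp add: KR_def KV_def algebra_simps)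
 also have "... <= KR * X" using X(4) by (intro mult_right_mono) auto
 finally show ?thesis by (simp add: X_def A_def Ac_def)
qed

text \<open>The profile is known only on [0, 1] while test functions live on the whole space. Hence
  the derivative \<open>zeta'\<close> is continued by its end values and integrated; on [0, 1] the
  result agrees with cut (\<omega> - w0), so it equals - w0 at 1 and p vanishes on the end discs.
  The gradient bound is 5 D0 = 4 D0 + D0 per edge, times three edges.\<close>

lemma corrector:
 obtains p gp where "C1 p gp" "\<And>i y. norm y < ep * h i ==> p (point i 1 y) = 0"
  "\<And>i x v. x \<in> cyl ep i ==> gp x \<bullet> v = zeta' i (x $ i) * v $ i"
  "\<And>x. (\<And>i. x $ i <= a) ==> gp x = 0" "\<And>x. norm (gp x) <= 15 * D0"
proof -
 define q where "q i t = zeta' i (max 0 (min 1 t))" for i t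
 have zc: "continuous_on {0..1} (zeta' i)" for i
  unfolding zeta'_def[abs_def] by (intro continuous_intros cut_cont \<omega>_cont D_cont)
 have qc: "continuous_on UNIV (q i)" for i
  unfolding q_def[abs_def] by (rule continuous_on_compose2[OF zc]) (auto intro!: continuous_intros)
 have q0: "q i t = 0" if "t <= a" for i t
 proof -
  have "max 0 (min 1 t) <= a" using that a_pos by auto
  then show ?thesis by (simp add: q_def zeta'_def cut_simps)
 qed
 have q1: "q i t = zeta' i t" if "t \<in> {0..1}" for i t using that by (simp add: q_def)
 have "\<exists>\<eta>. (\<forall>t. (\<eta> has_real_derivative q i t) (at t)) \<and> (\<forall>t\<le>a. \<eta> t = 0)" for i
  using antiderivative_on_reals[OF qc q0 a_pos, of i] by metis
 then obtain \<eta> where \<eta>: "\<And>i t. (\<eta> i has_real_derivative q i t) (at t)" "\<And>i t. t <= a ==> \<eta> i t = 0"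
  by metis
 have qb: "\<bar>q i t\<bar> <= 5 * D0" for i t
 proof -
  have b: "\<bar>zeta' i s\<bar> <= 5 * D0" if s: "s \<in> {0..1}" for s
  proof (cases "s <= 2 * a")
   case True
   have "\<bar>cut' s\<bar> * \<bar>\<omega> i s - w0\<bar> <= 2 / a * (D0 * (2 * a))"
    using \<omega>_near[OF s, of i] mult_left_mono[OF True pos0(3)] cut_bounds[of s] a_pos by (intro mult_mono) auto
   moreover have "\<bar>cut s\<bar> * \<bar>D i s\<bar> <= 1 * D0" using D0[OF s, of i] cut_bounds[of s] by (intro mult_mono) auto
   moreover have "2 / a * (D0 * (2 * a)) = 4 * D0" using a_pos by (simp add: field_simps)
   ultimately show ?thesis unfolding zeta'_def abs_mult[symmetric] by linarith
  next
   case False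
   then show ?thesis using D0[OF s, of i] pos0 by (simp add: zeta'_def cut_simps)
  qed
  show ?thesis unfolding q_def by (rule b) auto
 qed
 have \<eta>1: "\<eta> i 1 = - w0" for i
 proof -
  have "\<bar>(\<eta> i 1 - cut 1 * (\<omega> i 1 - w0)) - (\<eta> i 0 - cut 0 * (\<omega> i 0 - w0))\<bar> <= 0 * (1 - 0)"
  proof (rule mvt_bound[where P = "%t. \<eta> i t - cut t * (\<omega> i t - w0)" and q = "%_. 0"])
   have "continuous_on {0..1} (\<eta> i)" by (intro DERIV_continuous_on[OF DERIV_subset[OF \<eta>(1)]]) auto
   then show "continuous_on {0..1} (%t. \<eta> i t - cut t * (\<omega> i t - w0))" by (intro continuous_intros cut_cont \<omega>_cont)
   fix t :: real assume t: "t \<in> {0<..<1}"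
   then have "q i t = cut' t * (\<omega> i t - w0) + cut t * D i t" using q1[of t i] by (simp add: zeta'_def)
   then show "((%t. \<eta> i t - cut t * (\<omega> i t - w0)) has_real_derivative 0) (at t)"
    by (auto intro!: derivative_eq_intros \<eta>(1) cut_deriv \<omega>_deriv_at t)
  qed auto
  then show ?thesis using \<eta>(2)[of 0 i] a_pos a_small \<omega>1 by (simp add: cut_simps)
 qed
 show ?thesis
 proof (rule that)
  show "C1 (%x. w0 + (\<Sum>i\<in>UNIV. \<eta> i (x $ i))) (%x. \<chi> i. q i (x $ i))"
   by (rule C1_axial_sum[OF \<eta>(1) qc])
  fix i :: 3 and y :: "real \<times> real" assume y: "norm y < ep * h i"
  have "\<eta> j (point i 1 y $ j) = 0" if "j \<noteq> i" for j
  proof (rule \<eta>(2))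
   have "point i 1 y $ j <= \<bar>point i 1 y $ j\<bar>" by simp
   also have "... <= norm y" using abs_nth_le_norm_rest[OF that, of "point i 1 y"] by simp
   also have "... <= a" unfolding a_def by (rule order_trans[OF less_imp_le[OF y] mult_left_mono[OF hR]]) (use e in simp)
   finally show "point i 1 y $ j <= a" .
  qed
  then have "(\<Sum>j\<in>UNIV - {i}. \<eta> j (point i 1 y $ j)) = 0" by (intro sum.neutral) auto
  then show "w0 + (\<Sum>j\<in>UNIV. \<eta> j (point i 1 y $ j)) = 0"
   using \<eta>1[of i] by (simp add: sum.remove[of UNIV i])
 next
  fix i and x v :: "real^3" assume x: "x \<in> cyl ep i"
  have "(\<Sum>j\<in>UNIV - {i}. q j (x $ j) * v $ j) = 0"
   using q0[OF cyl_other_le[OF x]] by (intro sum.neutral) auto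
  moreover have "q i (x $ i) = zeta' i (x $ i)" using x Ii_sub(2)[of "x $ i"] by (intro q1) (auto simp: cylinder_def)
  ultimately show "(\<chi> i. q i (x $ i)) \<bullet> v = zeta' i (x $ i) * v $ i"
   by (simp add: inner_vec_def sum.remove[of UNIV i])
 next
  fix x :: "real^3" assume "\<And>i. x $ i <= a"
  then show "(\<chi> i. q i (x $ i)) = 0" using q0 by (simp add: vec_eq_iff)
 next
  fix x :: "real^3"
  have "norm (\<chi> i. q i (x $ i)) <= (\<Sum>i\<in>UNIV. \<bar>(\<chi> i. q i (x $ i)) $ i\<bar>)" by (rule norm_le_l1_cart)
  also have "... <= (\<Sum>i\<in>(UNIV :: 3 set). 5 * D0)" by (rule sum_mono) (simp add: qb)
  also have "... = 15 * D0" by simp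
  finally show "norm (\<chi> i. q i (x $ i)) <= 15 * D0" .
 qed
qed

end

context junction_limit
begin

text \<open>\<open>KQ\<close> bounds the squared energy of the error and \<open>KE\<close> the L1
  norm of the gradient on the core, both in units of eps^3.\<close>

definition "KQ = 2 * KR\<^sup>2 * (2 * vC + 3 * pi * R\<^sup>2)"
definition "KE = KQ + (1 + 15 * D0) * vC"

lemma KE_nonneg: "0 <= KQ" "0 <= KE"
 using K_nonneg pos0 by (auto simp: KQ_def KE_def)

end

text \<open>\<open>U\<close> and \<open>H\<close> stand for the solution and its gradient,
  \<open>w\<close> and \<open>g\<close> for the C1 approximations and their gradients, as delivered
  by \<open>core_data\<close>. The end values of \<open>w\<close> vanish only in the limit.\<close>

locale junction_solution = junction_eps +
 fixes U :: "real^3 => real" and H :: "real^3 => real^3" and w :: "nat => real^3 => real" and g :: "nat => real^3 => real^3"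
 assumes U_meas [measurable]: "U \<in> borel_measurable borel" and H_meas [measurable]: "H \<in> borel_measurable borel"
  and U2: "intg (Om ep) (%x. (U x)\<^sup>2)" and H2: "intg (Om ep) (%x. (norm (H x))\<^sup>2)"
  and w: "\<And>n. C1 (w n) (g n)"
  and wU2: "(%n. Int_on (Om ep) (%x. (w n x - U x)\<^sup>2)) \<longlonglongrightarrow> 0"
  and gH2: "(%n. Int_on (Om ep) (%x. (norm (g n x - H x))\<^sup>2)) \<longlonglongrightarrow> 0"
  and w_end: "\<And>i. (%n. Int_on (Bi i) (%y. (w n (point i 1 y))\<^sup>2)) \<longlonglongrightarrow> 0"
  and weak: "\<And>v k. C1 v k ==> (\<And>i y. norm y < ep * h i ==> v (point i 1 y) = 0) ==>
    Int_on (Om ep) (%x. H x \<bullet> k x) = load ep v"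
  and w_load: "(%n. load ep (w n)) \<longlonglongrightarrow> Int_on (Om ep) (%x. (norm (H x))\<^sup>2)"
begin

section \<open>Passage to the limit along the approximations and the energy bound\<close>

lemma w_meas [measurable]: "w n \<in> borel_measurable borel" "g n \<in> borel_measurable borel"
 using C1_borel[OF w[of n]] by auto

lemma bounded_Om_eps: "bounded (Om ep)" by (rule bounded_Om[OF e])

lemma intg_H: "intg (Om ep) (%x. norm (H x))"
 by (rule L1_of_L2(1)[OF bounded_Om_eps Om_borel, of "%_ x. norm (H x)"]) (use H2 in auto)

lemma intg_U: "intg (Om ep) U"
 by (rule L1_of_L2(1)[OF bounded_Om_eps Om_borel, of "%_. U"]) (use U2 in auto)

lemma gH: "intg (Om ep) (%x. norm (g n x - H x))" "(%n. Int_on (Om ep) (%x. norm (g n x - H x))) \<longlonglongrightarrow> 0"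
proof -
 have i: "intg (Om ep) (%x. (norm (g n x - H x))\<^sup>2)" for n
 proof (rule intg_bounded_by[OF intg_add[OF intg_cmult[OF intg_cont(1)] intg_cmult[OF H2]]])
  show "continuous_on UNIV (%x. (norm (g n x))\<^sup>2)" using C1_continuous[OF w[of n]] by (intro continuous_intros) auto
  fix x
  have "(norm (g n x - H x))\<^sup>2 <= (norm (g n x) + norm (H x))\<^sup>2" by (intro power_mono norm_triangle_ineq4) auto
  also have "... <= 2 * (norm (g n x))\<^sup>2 + 2 * (norm (H x))\<^sup>2"
   using sum_squares_bound[of "norm (g n x)" "norm (H x)"] by (simp add: power2_sum)
  finally show "\<bar>(norm (g n x - H x))\<^sup>2\<bar> <= 2 * (norm (g n x))\<^sup>2 + 2 * (norm (H x))\<^sup>2" by simp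
 qed auto
 show "intg (Om ep) (%x. norm (g n x - H x))"
  by (rule L1_of_L2(1)[OF bounded_Om_eps Om_borel _ i, of "%n. n"]) auto
 show "(%n. Int_on (Om ep) (%x. norm (g n x - H x))) \<longlonglongrightarrow> 0"
  using L1_of_L2(2)[OF bounded_Om_eps Om_borel _ i gH2] by simp
qed

lemma wU: "intg (Om ep) (%x. \<bar>w n x - U x\<bar>)" "(%n. Int_on (Om ep) (%x. \<bar>w n x - U x\<bar>)) \<longlonglongrightarrow> 0"
proof -
 have i: "intg (Om ep) (%x. (w n x - U x)\<^sup>2)" for n
 proof (rule intg_bounded_by[OF intg_add[OF intg_cmult[OF intg_cont(1)] intg_cmult[OF U2]]])
  show "continuous_on UNIV (%x. (w n x)\<^sup>2)" using C1_continuous[OF w[of n]] by (intro continuous_intros) auto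
  fix x
  have "(w n x - U x)\<^sup>2 <= 2 * (w n x)\<^sup>2 + 2 * (U x)\<^sup>2"
   using sum_squares_bound[of "w n x" "- U x"] by (simp add: power2_diff)
  then show "\<bar>(w n x - U x)\<^sup>2\<bar> <= 2 * (w n x)\<^sup>2 + 2 * (U x)\<^sup>2" by simp
 qed auto
 show "intg (Om ep) (%x. \<bar>w n x - U x\<bar>)"
  by (rule intg_abs, rule L1_of_L2(1)[OF bounded_Om_eps Om_borel _ i]) simp
 show "(%n. Int_on (Om ep) (%x. \<bar>w n x - U x\<bar>)) \<longlonglongrightarrow> 0"
  by (rule L1_of_L2(2)[OF bounded_Om_eps Om_borel _ i wU2]) simp
qed

lemma w_ends: "(%n. Int_on (Bi i) (%y. \<bar>w n (point i 1 y)\<bar>)) \<longlonglongrightarrow> 0"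
proof (rule L1_of_L2(2)[OF _ _ _ _ w_end])
 have c: "continuous_on UNIV (%y. w n (point i 1 y))" for n
  by (rule continuous_section[OF C1_continuous(1)[OF w]])
 show "(%y. w n (point i 1 y)) \<in> borel_measurable borel" for n by (rule borel_measurable_continuous_onI[OF c])
 show "intg (Bi i) (%y. (w n (point i 1 y))\<^sup>2)" for n by (intro intg_continuous continuous_intros c) auto
qed auto

text \<open>Three tubes of section area at most pi (eps R)^2, and a remainder in the core, whose
  volume is \<open>vC\<close> eps^3 <= \<open>vC\<close> eps^2.\<close>

lemma Om_measure: "measure lborel (Om ep) <= (vC + 3 * pi * R\<^sup>2) * ep\<^sup>2"
proof -
 have i1: "intg (Om ep) (%_. 1)" by (rule intg_cont) simp
 have m1: "measure lborel S = Int_on S (%_. 1)" if "S \<in> sets borel" for S :: "(real^3) set"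
  using Int_on_const[OF that, of 1] by simp
 have "Int_on outer (%_. 1) <= vC * ep\<^sup>2"
 proof -
  have "Int_on outer (%_. 1) <= vC * ep ^ 3"
   unfolding core_measure[symmetric] m1[OF core_borel] by (rule Int_outer_core[OF i1]) simp
  also have "... <= vC * ep\<^sup>2"
   using K_nonneg e eps_le_1 by (intro mult_left_mono power_decreasing) auto
  finally show ?thesis .
 qed
 moreover have "Int_on (cyl ep i) (%_. 1) <= pi * R\<^sup>2 * ep\<^sup>2" for i
 proof -
  have "Int_on (cyl ep i) (%_. 1) = Int_on Ii (%t. pi * (ep * h i)\<^sup>2)"
   using Int_on_cylinder(1)[OF intg_subset[OF i1 cyl_subset cyl_borel], of i] measure_disc[of "ep * h i"] e h[of i]
   by (simp add: Int_on_const)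
  also have "... = (pi * (ep * h i)\<^sup>2) * (1 - ep * l)" using el[OF e] by (simp add: Int_on_const)
  also have "... <= (pi * (ep * R)\<^sup>2) * 1"
   using la e h[of i] hR[of i] el[OF e] by (intro mult_mono power_mono) auto
  finally show ?thesis by (simp add: power_mult_distrib ac_simps)
 qed
 then have "(\<Sum>i\<in>UNIV. Int_on (cyl ep i) (%_. 1)) <= (\<Sum>i\<in>(UNIV::3 set). pi * R\<^sup>2 * ep\<^sup>2)" by (rule sum_mono)
 ultimately show ?thesis
  unfolding m1[OF Om_borel] Int_Om_split[OF i1] by (simp add: algebra_simps)
qed

text \<open>Q is the squared L2 norm of H - grad p. Expanded, it is the energy of u minus twice the
  mixed term plus the energy of p; the first is the limit of \<open>load\<close> along the
  approximations and the mixed term is \<open>load\<close> of p, so Q is the limit of the residual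
  at w - p and is bounded by KR (eps A + Ac). Young's inequality absorbs A and Ac into Q/2, and the
  remaining volume terms are of order eps^3.\<close>

lemma core_H: "Int_on (core ep) (%x. norm (H x)) <= KE * ep ^ 3"
proof -
 obtain p gp where p: "C1 p gp" and p1: "\<And>i y. norm y < ep * h i ==> p (point i 1 y) = 0"
  and gp: "\<And>i x v. x \<in> cyl ep i ==> gp x \<bullet> v = zeta' i (x $ i) * v $ i" "\<And>x. (\<And>i. x $ i <= a) ==> gp x = 0"
  and gpb: "\<And>x. norm (gp x) <= 15 * D0"
  by (rule corrector) blast
 have gpc: "continuous_on UNIV gp" by (rule C1_continuous[OF p])
 have [measurable]: "gp \<in> borel_measurable borel" by (rule borel_measurable_continuous_onI[OF gpc])
 have gc: "continuous_on UNIV (g n)" for n by (rule C1_continuous[OF w])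
 define N where "N x = norm (H x - gp x)" for x
 define Q where "Q = Int_on (Om ep) (%x. (N x)\<^sup>2)"
 define A where "A = Int_on (Om ep) N"
 define Ac where "Ac = Int_on (core ep) N"
 have cb: "core ep \<subseteq> Om ep" by (rule core_subset[OF e])
 have iHg: "intg (Om ep) (%x. H x \<bullet> gp x)"
 proof (rule intg_bounded_by[OF intg_cmult[OF intg_H]])
  fix x show "\<bar>H x \<bullet> gp x\<bar> <= (15 * D0) * norm (H x)"
   using Cauchy_Schwarz_ineq2[of "H x" "gp x"] mult_left_mono[OF gpb norm_ge_zero, of "H x" x] by (simp add: mult.commute)
 qed auto
 have igg: "intg (Om ep) (%x. (norm (gp x))\<^sup>2)" by (intro intg_cont continuous_intros gpc)
 have iN: "intg (Om ep) N"
 proof (rule intg_bounded_by[OF intg_add[OF intg_H intg_cont(1)[of "%_. 15 * D0"]]])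
  show "N \<in> borel_measurable borel" unfolding N_def[abs_def] by measurable
  fix x show "\<bar>N x\<bar> <= norm (H x) + 15 * D0"
   using norm_triangle_ineq4[of "H x" "gp x"] gpb[of x] by (simp add: N_def)
 qed auto
 have N2: "(N x)\<^sup>2 = (norm (H x))\<^sup>2 - 2 * (H x \<bullet> gp x) + (norm (gp x))\<^sup>2" for x
  by (simp add: N_def power2_norm_eq_inner inner_diff_left inner_diff_right inner_commute)
 have iN2: "intg (Om ep) (%x. (N x)\<^sup>2)"
  unfolding N2 by (intro intg_add intg_diff intg_cmult iHg igg H2)
 define HG where "HG = Int_on (Om ep) (%x. H x \<bullet> gp x)"
 define HH where "HH = Int_on (Om ep) (%x. (norm (H x))\<^sup>2)"
 define GG where "GG = Int_on (Om ep) (%x. (norm (gp x))\<^sup>2)"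
 have Q: "Q = HH - 2 * HG + GG"
  unfolding Q_def N2 HH_def HG_def GG_def Int_on_add[OF intg_diff[OF H2 intg_cmult[OF iHg]] igg]
   Int_on_diff[OF H2 intg_cmult[OF iHg]] Int_on_cmult ..
 have z: "C1 (%x. w n x - p x) (%x. g n x - gp x)" for n by (rule C1_diff[OF w p])
 have An: "(%n. Int_on (Om ep) (%x. norm (g n x - gp x))) \<longlonglongrightarrow> A"
  unfolding A_def
 proof (rule Int_on_tendsto[OF _ iN gH])
  show "intg (Om ep) (%x. norm (g n x - gp x))" for n by (intro intg_cont continuous_intros gc gpc)
  show "\<bar>norm (g n x - gp x) - N x\<bar> <= 1 * norm (g n x - H x)" for n x
   using norm_triangle_ineq3[of "g n x - gp x" "H x - gp x"] by (simp add: N_def)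
 qed
 have Acn: "(%n. Int_on (core ep) (%x. norm (g n x - gp x))) \<longlonglongrightarrow> Ac"
  unfolding Ac_def
 proof (rule Int_on_tendsto[OF _ intg_subset[OF iN cb core_borel] intg_subset[OF gH(1) cb core_borel]])
  show "intg (core ep) (%x. norm (g n x - gp x))" for n by (intro intg_cont continuous_intros gc gpc)
  show "\<bar>norm (g n x - gp x) - N x\<bar> <= 1 * norm (g n x - H x)" for n x
   using norm_triangle_ineq3[of "g n x - gp x" "H x - gp x"] by (simp add: N_def)
  show "(%n. Int_on (core ep) (%x. norm (g n x - H x))) \<longlonglongrightarrow> 0"
   by (rule tendsto_sandwich[OF _ _ tendsto_const gH(2)])
     (auto intro!: always_eventually Int_on_nonneg Int_on_subset[OF gH(1) cb core_borel])
 qed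
 have En: "(%n. ends (%x. w n x - p x)) \<longlonglongrightarrow> 0"
 proof -
  have "ends (%x. w n x - p x) = (\<Sum>i\<in>UNIV. Int_on (Bi i) (%y. \<bar>w n (point i 1 y)\<bar>))" for n
   unfolding ends_def Int_on_def
   by (intro sum.cong Bochner_Integration.integral_cong) (auto simp: indicator_def p1)
  then show ?thesis using tendsto_sum[of UNIV, OF w_ends] by simp
 qed
 have Gn: "(%n. Int_on (Om ep) (%x. gp x \<bullet> (g n x - gp x))) \<longlonglongrightarrow> HG - GG"
  unfolding HG_def GG_def Int_on_diff[OF iHg igg, symmetric]
 proof (rule Int_on_tendsto[OF _ intg_diff[OF iHg igg] gH])
  show "intg (Om ep) (%x. gp x \<bullet> (g n x - gp x))" for n by (intro intg_cont continuous_intros gc gpc)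
  fix n x
  have "gp x \<bullet> (g n x - gp x) - (H x \<bullet> gp x - (norm (gp x))\<^sup>2) = gp x \<bullet> (g n x - H x)"
   by (simp add: power2_norm_eq_inner inner_diff_right inner_commute)
  then show "\<bar>gp x \<bullet> (g n x - gp x) - (H x \<bullet> gp x - (norm (gp x))\<^sup>2)\<bar> <= (15 * D0) * norm (g n x - H x)"
   using Cauchy_Schwarz_ineq2[of "gp x" "g n x - H x"] mult_right_mono[OF gpb norm_ge_zero, of x "g n x - H x"] by simp
 qed
 have lp: "load ep p = HG" unfolding HG_def by (rule weak[OF p p1, symmetric])
 have Rn: "(%n. load ep (%x. w n x - p x) - Int_on (Om ep) (%x. gp x \<bullet> (g n x - gp x))) \<longlonglongrightarrow> (HH - HG) - (HG - GG)"
  unfolding load_diff[OF C1_continuous(1)[OF w] C1_continuous(1)[OF p]] lp HH_def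
  by (intro tendsto_diff w_load tendsto_const Gn)
 have "(HH - HG) - (HG - GG) <= KR * (ep * A + Ac + 0)"
 proof (rule LIMSEQ_le[OF Rn tendsto_mult_left[OF tendsto_add[OF tendsto_add[OF tendsto_mult_left[OF An] Acn] En]]], intro exI allI impI)
  fix n :: nat
  show "load ep (%x. w n x - p x) - Int_on (Om ep) (%x. gp x \<bullet> (g n x - gp x))
   <= KR * (ep * Int_on (Om ep) (%x. norm (g n x - gp x)) + Int_on (core ep) (%x. norm (g n x - gp x)) + ends (%x. w n x - p x))"
   using load_bound[OF gpc gp z[of n]] by (rule abs_le_D1)
 qed
 then have QR: "Q <= KR * (ep * A + Ac)" using Q by simp
 have K: "KR > 0" using K_nonneg by linarith
 \<comment> \<open>Young's inequality with weight 1/(4 KR): used for A and for Ac it costs Q/(2 KR),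
   that is Q/2 after multiplication by KR.\<close>
 have am: "c * x <= 1 / (4 * KR) * x\<^sup>2 + KR * c\<^sup>2" for c x :: real
 proof -
  have "0 <= (x / (2 * KR) - c)\<^sup>2 * KR" using K by simp
  also have "... = 1 / (4 * KR) * x\<^sup>2 + KR * c\<^sup>2 - c * x" using K by (simp add: power2_eq_square field_simps)
  finally show ?thesis by linarith
 qed
 have amI: "Int_on S (%x. c * N x) <= 1 / (4 * KR) * Q + KR * c\<^sup>2 * measure lborel S"
  if S: "S \<subseteq> Om ep" "S \<in> sets borel" for S c
 proof -
  have i: "intg S N" "intg S (%x. (N x)\<^sup>2)" "intg S (%x. KR * c\<^sup>2)"
   using intg_subset[OF iN S] intg_subset[OF iN2 S] intg_subset[OF intg_cont(1)[of "%_. KR * c\<^sup>2"] S] by auto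
  have "Int_on S (%x. c * N x) <= Int_on S (%x. 1 / (4 * KR) * (N x)\<^sup>2 + KR * c\<^sup>2)"
   by (intro Int_on_mono intg_add intg_cmult i am)
  also have "... = 1 / (4 * KR) * Int_on S (%x. (N x)\<^sup>2) + KR * c\<^sup>2 * measure lborel S"
   unfolding Int_on_add[OF intg_cmult[OF i(2)] i(3)] Int_on_cmult Int_on_const[OF S(2)] by (simp only: mult.assoc)
  also have "... <= 1 / (4 * KR) * Q + KR * c\<^sup>2 * measure lborel S"
   unfolding Q_def using K by (intro add_right_mono mult_left_mono Int_on_subset[OF iN2 S]) auto
  finally show ?thesis .
 qed
 have "ep * A <= 1 / (4 * KR) * Q + KR * ep\<^sup>2 * measure lborel (Om ep)"
  using amI[OF subset_refl Om_borel, of ep] unfolding Int_on_cmult A_def .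
 moreover have "Ac <= 1 / (4 * KR) * Q + KR * measure lborel (core ep)"
  using amI[OF cb core_borel, of 1] by (simp add: Ac_def)
 ultimately have "ep * A + Ac <= 1 / (2 * KR) * Q + KR * (ep\<^sup>2 * measure lborel (Om ep) + measure lborel (core ep))"
  by (simp add: algebra_simps)
 then have "KR * (ep * A + Ac) <= KR * (1 / (2 * KR) * Q + KR * (ep\<^sup>2 * measure lborel (Om ep) + measure lborel (core ep)))"
  using K by (intro mult_left_mono) auto
 also have "... = Q / 2 + KR\<^sup>2 * (ep\<^sup>2 * measure lborel (Om ep) + measure lborel (core ep))"
  using K by (simp add: power2_eq_square field_simps)
 finally have "Q <= 2 * KR\<^sup>2 * (ep\<^sup>2 * measure lborel (Om ep) + measure lborel (core ep))"
  using QR by simp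
 also have "... <= 2 * KR\<^sup>2 * ((vC + 3 * pi * R\<^sup>2) * ep ^ 3 + vC * ep ^ 3)"
 proof (intro mult_left_mono add_mono)
  have "ep\<^sup>2 * measure lborel (Om ep) <= ep\<^sup>2 * ((vC + 3 * pi * R\<^sup>2) * ep\<^sup>2)"
   by (intro mult_left_mono Om_measure) auto
  also have "... = (vC + 3 * pi * R\<^sup>2) * ep ^ 4" by (simp add: power_numeral_reduce power2_eq_square)
  also have "... <= (vC + 3 * pi * R\<^sup>2) * ep ^ 3"
   using K_nonneg e eps_le_1 by (intro mult_left_mono power_decreasing) auto
  finally show "ep\<^sup>2 * measure lborel (Om ep) <= (vC + 3 * pi * R\<^sup>2) * ep ^ 3" .
 qed (simp_all add: core_measure)
 also have "... = KQ * ep ^ 3" by (simp add: KQ_def algebra_simps)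
 finally have Qb: "Q <= KQ * ep ^ 3" .
 \<comment> \<open>On the core N <= N^2 + 1 loses nothing in the order: both the energy and the
   volume are bounded by multiples of eps^3.\<close>
 have "Int_on (core ep) (%x. norm (H x)) <= Int_on (core ep) (%x. (N x)\<^sup>2 + (1 + 15 * D0))"
 proof (intro Int_on_mono intg_add intg_subset[OF intg_H cb core_borel] intg_subset[OF iN2 cb core_borel] intg_cont)
  fix x
  have "0 <= N x" by (simp add: N_def)
  then have "N x <= (N x)\<^sup>2 + 1" using sum_squares_bound[of "N x" 1] by simp
  then show "norm (H x) <= (N x)\<^sup>2 + (1 + 15 * D0)"
   using norm_triangle_sub[of "H x" "gp x"] gpb[of x] by (simp add: N_def)
 qed (intro continuous_intros)+
 also have "... = Int_on (core ep) (%x. (N x)\<^sup>2) + (1 + 15 * D0) * (vC * ep ^ 3)"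
  unfolding core_measure[symmetric] Int_on_const[OF core_borel, symmetric]
  by (intro Int_on_add intg_subset[OF iN2 cb core_borel] intg_cont continuous_on_const)
 also have "... <= KQ * ep ^ 3 + (1 + 15 * D0) * (vC * ep ^ 3)"
  using Int_on_subset[OF iN2 cb core_borel] Qb unfolding Q_def by (intro add_right_mono) fastforce
 also have "... = KE * ep ^ 3" by (simp add: KE_def algebra_simps)
 finally show ?thesis .
qed

end

section \<open>The averaged problem on the edges\<close>

lemma Int_on_lebesgue_on:
 fixes q :: "'a::euclidean_space => real"
 assumes S: "open S" and q: "intg S q"
 shows "integrable (lebesgue_on S) q" "(\<integral>x. q x \<partial>lebesgue_on S) = Int_on S q"
proof -
 have m: "(%x. indicator S x * q x) \<in> borel_measurable borel"
  using borel_measurable_integrable[OF q[unfolded intg_def]] by simp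
 have ae: "AE x in lborel. x \<in> S --> q x = indicator S x * q x" by simp
 have eq: "(%x. indicator S x * (indicator S x * q x)) = (%x. indicator S x * q x :: real)"
  by (auto simp: indicator_def)
 show "integrable (lebesgue_on S) q"
  unfolding integral_lebesgue_on_open(2)[OF S m ae] eq using q by (simp add: intg_def)
 show "(\<integral>x. q x \<partial>lebesgue_on S) = Int_on S q"
  unfolding integral_lebesgue_on_open(1)[OF S m ae] eq by (simp add: Int_on_def)
qed

lemma AE_lebesgue_on_iff:
 "open S ==> (AE x in lebesgue_on S. P x) \<longleftrightarrow> (AE x in lborel. x \<in> S --> P x)"
 by (simp add: AE_restrict_space_iff AE_completion_iff)

lemma intg_mult_continuous:
 fixes c :: "'a::euclidean_space => real"
 assumes q: "intg S q" and S: "bounded S" and c: "continuous_on UNIV c"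
 shows "intg S (%x. q x * c x)"
proof -
 obtain B where B: "B > 0" "\<And>x. x \<in> S ==> norm (c x) <= B"
  using bounded_continuous_bound[OF S c] by blast
 have [measurable]: "(%x. indicator S x * q x) \<in> borel_measurable borel" "c \<in> borel_measurable borel"
  using borel_measurable_integrable[OF q[unfolded intg_def]] borel_measurable_continuous_onI[OF c] by auto
 show ?thesis
  unfolding intg_def
 proof (rule Bochner_Integration.integrable_bound[OF integrable_mult_right[OF q[unfolded intg_def], of B]])
  have "(%x. (indicator S x * q x) * c x) \<in> borel_measurable lborel" by measurable
  then show "(%x. indicator S x * (q x * c x)) \<in> borel_measurable lborel" by (simp add: mult.assoc)
  have "norm (indicator S x * (q x * c x)) <= norm (B * (indicator S x * q x))" for x
   using B mult_left_mono[OF B(2), of x "\<bar>q x\<bar>"] by (auto simp: indicator_def abs_mult mult.commute)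
  then show "AE x in lborel. norm (indicator S x * (q x * c x)) <= norm (B * (indicator S x * q x))" by simp
 qed
qed

text \<open>A multiple of a fixed hat function of integral 1 is subtracted from an arbitrary test
  function to make its integral zero; with \<kappa> the integral of q times the hat, q - \<kappa> is
  then orthogonal to all test functions. The hypothesis runs over continuous c, which will be the
  derivatives of C1 functions used for testing.\<close>

lemma du_bois_reymond:
 fixes q :: "real => real"
 assumes ab: "a < b" and q: "intg {a<..<b} q"
  and z: "\<And>c. continuous_on UNIV c ==> (\<And>t. t \<notin> {a<..<b} ==> c t = 0) ==> Int_on {a<..<b} c = 0 ==> Int_on {a<..<b} (%t. q t * c t) = 0"
 obtains \<kappa> where "AE t in lborel. t \<in> {a<..<b} --> q t = \<kappa>"
proof -
 let ?S = "{a<..<b}"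
 define \<psi>0 where "\<psi>0 t = step' ((t - a) / (b - a)) / (b - a)" for t
 have c0: "continuous_on UNIV \<psi>0"
  unfolding \<psi>0_def[abs_def] using ab
  by (intro continuous_intros continuous_on_compose2[OF continuous_step(2)[of UNIV]]) auto
 have z0: "\<psi>0 t = 0" if "t \<notin> ?S" for t
  using that ab by (cases "t <= a") (auto simp: \<psi>0_def step_simps divide_le_0_iff pos_le_divide_eq)
 have d0: "((%t. step ((t - a) / (b - a))) has_real_derivative \<psi>0 t) (at t)" for t
 proof -
  have "((%t. (t - a) / (b - a)) has_real_derivative 1 / (b - a)) (at t)"
   using ab by (auto intro!: derivative_eq_intros)
  from DERIV_chain2[OF step_deriv this] show ?thesis by (simp add: \<psi>0_def)
 qed
 have I0: "Int_on ?S \<psi>0 = 1"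
 proof -
  have "Int_on ?S \<psi>0 = step ((b - a) / (b - a)) - step ((a - a) / (b - a))"
   by (rule ftc_Ioo(2)[OF _ DERIV_continuous_on[OF DERIV_subset[OF d0]] continuous_on_subset[OF c0] d0]) (use ab in auto)
  then show ?thesis using ab by (simp add: step_simps)
 qed
 have S: "bounded ?S" "?S \<in> sets borel" by (auto intro: bounded_Ioo_real)
 define \<kappa> where "\<kappa> = Int_on ?S (%t. q t * \<psi>0 t)"
 have ik: "intg ?S (%t. q t - \<kappa>)" by (intro intg_diff q intg_continuous S) simp
 have "AE t in lebesgue_on ?S. q t - \<kappa> = 0"
 proof (rule fundamental_lemma)
  show "integrable (lebesgue_on ?S) (%t. q t - \<kappa>)" by (rule Int_on_lebesgue_on(1)[OF _ ik]) simp
  fix \<psi> :: "real => real" assume t: "test_function ?S \<psi>"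
  obtain k where k: "C1 \<psi> k" "closure {x. \<psi> x \<noteq> 0} \<subseteq> ?S" by (rule test_function_C1[OF t])
  have c: "continuous_on UNIV \<psi>" by (rule C1_continuous[OF k(1)])
  have zp: "\<psi> t = 0" if "t \<notin> ?S" for t
   using k(2) closure_subset[of "{x. \<psi> x \<noteq> 0}"] that by (metis (mono_tags) mem_Collect_eq subsetD)
  define J where "J = Int_on ?S \<psi>"
  have ip: "intg ?S \<psi>" "intg ?S \<psi>0" by (intro intg_continuous S c c0)+
  have "Int_on ?S (%t. q t * (\<psi> t - J * \<psi>0 t)) = 0"
  proof (rule z)
   show "continuous_on UNIV (%t. \<psi> t - J * \<psi>0 t)" by (intro continuous_intros c c0)
   show "Int_on ?S (%t. \<psi> t - J * \<psi>0 t) = 0"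
    unfolding Int_on_diff[OF ip(1) intg_cmult[OF ip(2)]] Int_on_cmult I0 by (simp add: J_def)
  qed (use zp z0 in auto)
  moreover have "q t * (\<psi> t - J * \<psi>0 t) = q t * \<psi> t - J * (q t * \<psi>0 t)" for t by (simp add: algebra_simps)
  ultimately have "Int_on ?S (%t. q t * \<psi> t) = J * \<kappa>"
   using Int_on_diff[OF intg_mult_continuous[OF q S(1) c] intg_cmult[OF intg_mult_continuous[OF q S(1) c0]], of J]
   by (simp add: Int_on_cmult \<kappa>_def)
  then have "Int_on ?S (%t. q t * \<psi> t - \<kappa> * \<psi> t) = 0"
   unfolding Int_on_diff[OF intg_mult_continuous[OF q S(1) c] intg_cmult[OF ip(1)]] Int_on_cmult by (simp add: J_def)
  then show "(\<integral>t. (q t - \<kappa>) * \<psi> t \<partial>lebesgue_on ?S) = 0"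
   using Int_on_lebesgue_on(2)[OF _ intg_mult_continuous[OF ik S(1) c]] by (simp add: left_diff_distrib)
 qed simp
 then have "AE t in lborel. t \<in> ?S --> q t - \<kappa> = 0" by (subst (asm) AE_lebesgue_on_iff) auto
 then have "AE t in lborel. t \<in> ?S --> q t = \<kappa>" by eventually_elim auto
 then show ?thesis by (rule that)
qed

text \<open>T is the antiderivative of - q that vanishes at 1. As q is merely integrable and
  bounded, T is Lipschitz but need not be differentiable, and the integration by parts is obtained
  from Fubini on the triangle s < t.\<close>

lemma tail_integral:
 fixes q :: "real => real"
 assumes \<alpha>: "0 <= \<alpha>" "\<alpha> < 1" and q: "intg {\<alpha><..<1} q" and B: "\<And>t. t \<in> {\<alpha><..<1} ==> \<bar>q t\<bar> <= B"
 defines "T \<equiv> %s. Int_on {\<alpha><..<1} (%t. indicator {s<..} t * q t)"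
 shows "continuous_on UNIV T" "\<bar>T s\<bar> <= B" "s >= 1 ==> T s = 0"
  and "\<And>\<eta> \<eta>'. (\<And>t. (\<eta> has_real_derivative \<eta>' t) (at t)) ==> continuous_on UNIV \<eta>' ==> \<eta> \<alpha> = 0 ==>
    Int_on {\<alpha><..<1} (%t. q t * \<eta> t) = Int_on {\<alpha><..<1} (%t. T t * \<eta>' t)"
proof -
 let ?I = "{\<alpha><..<1}"
 have qm [measurable]: "(%t. indicator ?I t * q t) \<in> borel_measurable borel"
  using borel_measurable_integrable[OF q[unfolded intg_def]] by simp
 have B0: "0 <= B" using B[of "(\<alpha> + 1) / 2"] \<alpha> by (auto intro: order_trans[OF abs_ge_zero])
 have ii: "intg ?I (%t. indicator A t * q t)" if [measurable]: "A \<in> sets borel" for A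
 proof -
  have "integrable lborel (%t. indicator A t *\<^sub>R (indicator ?I t * q t))"
   by (intro integrable_mult_indicator q[unfolded intg_def]) simp
  then show ?thesis by (simp add: intg_def mult.left_commute)
 qed
 have bnd: "\<bar>Int_on ?I (%t. indicator A t * q t)\<bar> <= B * measure lborel (?I \<inter> A)" if A: "A \<in> sets borel" for A
 proof -
  have [measurable]: "A \<in> sets borel" by fact
  have iA: "integrable lborel (indicator (?I \<inter> A) :: real => real)"
   using emeasure_bounded_finite[OF bounded_subset[OF bounded_Ioo_real[of \<alpha> 1] Int_lower1[of ?I A]]]
   by (intro integrable_real_indicator) auto
  have eq: "(indicator ?I t * (indicator A t * B) :: real) = B * indicator (?I \<inter> A) t" for t by (auto simp: indicator_def)
  have "\<bar>Int_on ?I (%t. indicator A t * q t)\<bar> <= Int_on ?I (%t. indicator A t * B)"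
  proof (rule Int_on_bound[OF ii[OF A]])
   show "intg ?I (%t. indicator A t * B)" unfolding intg_def eq by (intro integrable_mult_right iA)
  qed (use B B0 in \<open>auto simp: indicator_def\<close>)
  also have "... = B * measure lborel (?I \<inter> A)" unfolding Int_on_def eq by simp
  finally show ?thesis .
 qed
 have lip: "\<bar>T s - T s'\<bar> <= B * \<bar>s - s'\<bar>" if "s <= s'" for s s'
 proof -
  have eq: "indicator {s<..} t * q t - indicator {s'<..} t * q t = indicator {s<..s'} t * q t" for t
   using that by (auto simp: indicator_def)
  have "T s - T s' = Int_on ?I (%t. indicator {s<..s'} t * q t)"
   unfolding T_def Int_on_diff[OF ii ii, symmetric, of "{s<..}" "{s'<..}", simplified] eq ..
  also have "\<bar>...\<bar> <= B * measure lborel (?I \<inter> {s<..s'})" by (rule bnd) simp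
  also have "... <= B * measure lborel {s<..s'}"
  proof (intro mult_left_mono B0)
   show "measure lborel (?I \<inter> {s<..s'}) <= measure lborel {s<..s'}"
    using that by (intro measure_mono_fmeasurable) (auto simp: fmeasurable_def)
  qed
  also have "... = B * \<bar>s - s'\<bar>" using that by simp
  finally show ?thesis .
 qed
 have lip2: "dist (T s) (T s') <= B * dist s s'" for s s'
  using lip[of s s'] lip[of s' s] by (cases "s <= s'") (auto simp: dist_real_def abs_minus_commute)
 then have "B-lipschitz_on UNIV T" using B0 by (intro lipschitz_onI) auto
 then show cT: "continuous_on UNIV T" by (rule lipschitz_on_continuous_on)
 show "\<bar>T s\<bar> <= B" for s
 proof -
  have "\<bar>T s\<bar> <= B * measure lborel (?I \<inter> {s<..})" unfolding T_def by (rule bnd) simp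
  also have "... <= B * measure lborel ?I"
   using B0 \<alpha> by (intro mult_left_mono measure_mono_fmeasurable) (auto simp: fmeasurable_def)
  also have "... <= B * 1" using B0 \<alpha> by (intro mult_left_mono) auto
  finally show ?thesis by simp
 qed
 show "T s = 0" if "s >= 1" for s
 proof -
  have "(%t. indicator ?I t * (indicator {s<..} t * q t)) = (%t. 0)" using that by (auto simp: indicator_def)
  then show ?thesis by (simp add: T_def Int_on_def)
 qed
 fix \<eta> \<eta>' :: "real => real"
 assume d: "\<And>t. (\<eta> has_real_derivative \<eta>' t) (at t)" and c: "continuous_on UNIV \<eta>'" and z: "\<eta> \<alpha> = 0"
 have [measurable]: "\<eta>' \<in> borel_measurable borel" by (rule borel_measurable_continuous_onI[OF c])
 obtain B' where B': "B' > 0" "\<And>t. t \<in> ?I ==> norm (\<eta>' t) <= B'"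
  using bounded_continuous_bound[OF bounded_Ioo_real c] by blast
 define F where "F t s = (indicator ?I t * q t) * (indicator ?I s * \<eta>' s) * (if s < t then 1 else 0)" for t s :: real
 have iF: "integrable (lborel \<Otimes>\<^sub>M lborel) (%(t, s). F t s)"
 proof (rule integrableI_bounded_set[where A = "?I \<times> ?I" and B = "B * B'"])
  show "(%(t, s). F t s) \<in> borel_measurable (lborel \<Otimes>\<^sub>M lborel)" unfolding F_def by measurable
  show "emeasure (lborel \<Otimes>\<^sub>M lborel) (?I \<times> ?I) < \<infinity>"
   using \<alpha> by (simp add: lborel.emeasure_pair_measure_Times ennreal_mult_less_top)
  show "AE x in lborel \<Otimes>\<^sub>M lborel. x \<in> ?I \<times> ?I --> norm (case x of (t, s) => F t s) <= B * B'"
  proof (intro AE_I2 impI)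
   fix x assume "x \<in> ?I \<times> ?I"
   then obtain t s where x: "x = (t, s)" "t \<in> ?I" "s \<in> ?I" by blast
   have "\<bar>q t\<bar> * \<bar>\<eta>' s\<bar> <= B * B'" using B[OF x(2)] B'(2)[OF x(3)] B0 by (intro mult_mono) auto
   then show "norm (case x of (t, s) => F t s) <= B * B'"
    using x B0 B'(1) by (auto simp: F_def indicator_def abs_mult)
  qed
  show "AE x in lborel \<Otimes>\<^sub>M lborel. x \<notin> ?I \<times> ?I --> (case x of (t, s) => F t s) = 0"
   by (intro AE_I2) (auto simp: F_def indicator_def)
 qed simp
 have l1: "(LBINT s. F t s) = indicator ?I t * (q t * \<eta> t)" for t
 proof (cases "t \<in> ?I")
  case True
  have "F t s = q t * (indicator {\<alpha><..<t} s * \<eta>' s)" for s using True by (auto simp: F_def indicator_def)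
  moreover have "Int_on {\<alpha><..<t} \<eta>' = \<eta> t - \<eta> \<alpha>"
   by (rule ftc_Ioo(2)[OF _ DERIV_continuous_on[OF DERIV_subset[OF d]] continuous_on_subset[OF c] d]) (use True in auto)
  ultimately show ?thesis using True z by (simp add: Int_on_def)
 qed (simp add: F_def)
 have l2: "(LBINT t. F t s) = indicator ?I s * (T s * \<eta>' s)" for s
 proof -
  have "F t s = indicator ?I t * (indicator {s<..} t * q t) * (indicator ?I s * \<eta>' s)" for t by (auto simp: F_def indicator_def)
  then show ?thesis by (simp add: T_def Int_on_def)
 qed
 show "Int_on ?I (%t. q t * \<eta> t) = Int_on ?I (%t. T t * \<eta>' t)"
  unfolding Int_on_def[of ?I] l1[symmetric] l2[symmetric] by (rule lborel_pair.Fubini_integral[OF iF, symmetric])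
qed

section \<open>Section means and their one-dimensional identities\<close>

context junction_solution
begin

text \<open>\<open>m\<close> is the area of a section, \<open>P\<close> the section mean of the
  axial derivative of u, \<open>fb\<close> that of f, and \<open>df\<close> its deviation from the
  axis value, which is of order eps.\<close>

definition m :: "3 => real" where "m i = pi * (ep * h i)\<^sup>2"
definition P :: "3 => real => real" where "P i t = Int_on (Bi i) (%y. H (point i t y) $ i) / m i"
definition fb :: "3 => real => real" where "fb i t = Int_on (Bi i) (%y. f (point i t y)) / m i"
definition df :: "3 => real => real" where "df i t = fb i t - f (point i t 0)"

lemma m_pos: "m i > 0" using e h[of i] by (simp add: m_def)

lemma measure_Bi: "measure lborel (Bi i) = m i"
 using measure_disc[of "ep * h i"] e h[of i] by (simp add: m_def)

lemma intg_cyl_f: "intg (cyl ep i) f"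
 using intg_subset[OF intg_f[of "%_. 1"] cyl_subset cyl_borel] by simp

lemma intg_cyl_H: "intg (cyl ep i) (%x. H x $ i)"
proof (rule intg_bounded_by[OF intg_subset[OF intg_H cyl_subset cyl_borel]])
 have "(%x. H x \<bullet> axis i 1) \<in> borel_measurable borel" by measurable
 then show "(%x. H x $ i) \<in> borel_measurable borel" by (simp add: inner_axis)
qed (auto simp: component_le_norm_cart)

lemma intg_P: "intg Ii (P i)" and intg_fb: "intg Ii (fb i)"
 unfolding P_def[abs_def] fb_def[abs_def] divide_inverse
 using intg_cmult[OF Int_on_cylinder(3)[OF intg_cyl_H], of "inverse (m i)" i] intg_cmult[OF Int_on_cylinder(3)[OF intg_cyl_f], of "inverse (m i)" i]
 by (simp_all add: mult.commute)

lemma bounded_Ii: "bounded Ii" by (rule bounded_Ioo_real)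

lemma intg_df: "intg Ii (df i)"
 unfolding df_def[abs_def]
 by (intro intg_diff intg_fb intg_continuous_on_compact[OF compact_Icc f_axis(1)]) (use Ii_sub in auto)

lemma df_bound: "t \<in> Ii ==> \<bar>df i t\<bar> <= F1 * ep"
proof -
 assume t: "t \<in> Ii"
 have cyl: "point i t y \<in> cyl ep i" if "y \<in> Bi i" for y using that t by (simp add: cylinder_def)
 have i1: "intg (Bi i) (%y. f (point i t y))"
 proof (rule intg_continuous_on_open)
  show "continuous_on (Bi i) (%y. f (point i t y))"
  proof (rule continuous_on_compose2[OF f_cont[OF e]])
   show "point i t ` Bi i \<subseteq> Om ep" by (intro image_subsetI subsetD[OF cyl_subset cyl])
  qed (intro continuous_intros)
  show "\<bar>f (point i t y)\<bar> <= F0" if "y \<in> Bi i" for y using F0[OF e] cyl[OF that] cyl_subset by blast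
 qed auto
 have i2: "intg (Bi i) (%y. c)" for c :: real by (rule intg_continuous) auto
 have "m i * df i t = Int_on (Bi i) (%y. f (point i t y) - f (point i t 0))"
  unfolding Int_on_diff[OF i1 i2] using m_pos[of i] by (simp add: df_def fb_def Int_on_const measure_Bi right_diff_distrib)
 also have "\<bar>...\<bar> <= Int_on (Bi i) (%y. F1 * ep)"
 proof (rule Int_on_bound[OF intg_diff[OF i1 i2] i2])
  fix y assume "y \<in> Bi i"
  from F1[OF e cyl[OF this]] show "\<bar>f (point i t y) - f (point i t 0)\<bar> <= F1 * ep" by simp
 qed
 also have "... = m i * (F1 * ep)" by (simp add: Int_on_const measure_Bi)
 finally show ?thesis using m_pos[of i] by (simp add: abs_mult)
qed

lemma Int_cyl_axial:
 assumes q: "intg (cyl ep i) q" and c: "continuous_on UNIV c"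
 shows "Int_on (cyl ep i) (%x. q x * c (x $ i)) = Int_on Ii (%t. Int_on (Bi i) (%y. q (point i t y)) * c t)"
proof -
 have c3: "continuous_on UNIV (%x :: real^3. c (x $ i))"
  by (rule continuous_on_compose2[OF c]) (auto intro!: continuous_intros)
 have "intg (cyl ep i) (%x. q x * c (x $ i))" by (rule intg_mult_continuous[OF q bounded_sub(1) c3])
 from Int_on_cylinder(1)[OF this] show ?thesis
  by (simp add: Int_on_def mult.assoc[symmetric])
qed

text \<open>The test function equals \<beta> in the node and \<beta> + \<eta> i (x_i) in tube i, and
  vanishes on the end discs because \<eta> i 1 = - \<beta>. Such functions are constant on the
  sections of a tube, so volume, lateral and gradient terms become one-dimensional without error;
  subtracting the limit equation leaves \<open>df\<close>, the node and the flux of the profile at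
  x_i = eps l. The choice \<beta> = 0 isolates a single edge, \<beta> = 1 gives the balance of
  fluxes.\<close>

lemma test_identity:
 assumes d: "\<And>i t. (\<eta> i has_real_derivative \<eta>' i t) (at t)" and c: "\<And>i. continuous_on UNIV (\<eta>' i)"
  and z: "\<And>i t. t <= a ==> \<eta> i t = 0" "\<And>i t. t <= a ==> \<eta>' i t = 0" and \<eta>1: "\<And>i. \<eta> i 1 = - \<beta>"
 shows "(\<Sum>i\<in>UNIV. m i * Int_on Ii (%t. (P i t - D i t) * \<eta>' i t)) =
  \<beta> * Int_on outer f + (\<Sum>i\<in>UNIV. m i * (Int_on Ii (%t. df i t * (\<beta> + \<eta> i t)) + \<beta> * D i (ep * l)))"
proof -
 let ?v = "%x :: real^3. \<beta> + (\<Sum>i\<in>UNIV. \<eta> i (x $ i))" and ?k = "%x :: real^3. \<chi> i. \<eta>' i (x $ i)"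
 have v: "C1 ?v ?k" by (rule C1_axial_sum[OF d c])
 have c\<eta>: "continuous_on S (\<eta> i)" for i S by (intro DERIV_continuous_on[OF DERIV_subset[OF d]]) auto
 have v1: "?v (point i t y) = \<beta> + \<eta> i t" if y: "norm y <= ep * h i" for i t y
 proof -
  have "\<eta> j (point i t y $ j) = 0" if "j \<noteq> i" for j
  proof (rule z(1))
   have "point i t y $ j <= \<bar>point i t y $ j\<bar>" by simp
   also have "... <= norm y" using abs_nth_le_norm_rest[OF that, of "point i t y"] by simp
   also have "... <= a" unfolding a_def by (rule order_trans[OF y mult_left_mono[OF hR]]) (use e in simp)
   finally show "point i t y $ j <= a" .
  qed
  then have "(\<Sum>j\<in>UNIV - {i}. \<eta> j (point i t y $ j)) = 0" by (intro sum.neutral) auto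
  then show ?thesis by (simp add: sum.remove[of UNIV i])
 qed
 have W: "Int_on (Om ep) (%x. H x \<bullet> ?k x) = load ep ?v"
  by (rule weak[OF v]) (use v1 \<eta>1 in \<open>simp add: less_imp_le\<close>)
 have cv: "continuous_on UNIV ?v" and ck: "continuous_on UNIV ?k" using C1_continuous[OF v] by auto
 obtain B where B: "B > 0" "\<And>x. x \<in> Om ep ==> norm (?k x) <= B"
  using bounded_continuous_bound[OF bounded_Om_eps ck] by blast
 have mk [measurable]: "?k \<in> borel_measurable borel" by (rule borel_measurable_continuous_onI[OF ck])
 have iHk: "intg (Om ep) (%x. H x \<bullet> ?k x)"
 proof (rule intg_bounded_by[OF intg_cmult[OF intg_H]])
  show "(%x. H x \<bullet> ?k x) \<in> borel_measurable borel" by (intro borel_measurable_inner H_meas mk)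
  fix x assume "x \<in> Om ep"
  then show "\<bar>H x \<bullet> ?k x\<bar> <= B * norm (H x)"
   using Cauchy_Schwarz_ineq2[of "H x" "?k x"] mult_left_mono[OF B(2), of x "norm (H x)"] by (simp add: mult.commute)
 qed simp
 have "Int_on outer (%x. H x \<bullet> ?k x) = Int_on outer (%x. 0)"
 proof (rule Int_on_AE_eq)
  show "AE x in lborel. x \<in> outer --> H x \<bullet> ?k x = 0"
   using AE_outer
  proof eventually_elim
   case (elim x)
   then have "x \<in> outer --> ?k x = 0" using z(2) by (simp add: vec_eq_iff)
   then show ?case by (metis inner_zero_right)
  qed
  show "(%x. H x \<bullet> ?k x) \<in> borel_measurable borel" by (intro borel_measurable_inner H_meas mk)
 qed auto
 then have o1: "Int_on outer (%x. H x \<bullet> ?k x) = 0" by (simp add: Int_on_def)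
 have L: "Int_on (cyl ep i) (%x. H x \<bullet> ?k x) = m i * Int_on Ii (%t. P i t * \<eta>' i t)" for i
 proof -
  have pt: "H x \<bullet> ?k x = H x $ i * \<eta>' i (x $ i)" if x: "x \<in> cyl ep i" for x
  proof -
   have "(\<Sum>j\<in>UNIV - {i}. H x $ j * \<eta>' j (x $ j)) = 0"
    using z(2)[OF cyl_other_le[OF x]] by (intro sum.neutral) auto
   then show ?thesis by (simp add: inner_vec_def sum.remove[of UNIV i])
  qed
  have "Int_on (cyl ep i) (%x. H x \<bullet> ?k x) = Int_on (cyl ep i) (%x. H x $ i * \<eta>' i (x $ i))"
   unfolding Int_on_def using pt by (intro Bochner_Integration.integral_cong) (auto simp: indicator_def)
  also have "... = Int_on Ii (%t. m i * (P i t * \<eta>' i t))"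
   unfolding Int_cyl_axial[OF intg_cyl_H c] using m_pos[of i] by (simp add: P_def)
  finally show ?thesis by (simp add: Int_on_cmult)
 qed
 have o2: "Int_on outer (%x. f x * ?v x) = \<beta> * Int_on outer f"
  unfolding Int_on_cmult[symmetric]
 proof -
  show "Int_on outer (%x. f x * ?v x) = Int_on outer (%x. \<beta> * f x)"
   unfolding Int_on_def
  proof (rule integral_cong_AE)
   have "integrable lborel (%x. indicator outer x * (f x * ?v x))" "integrable lborel (%x. indicator outer x * (\<beta> * f x))"
    using intg_subset[OF intg_f[OF cv] outer_sub outer_borel] intg_cmult[OF intg_subset[OF intg_f[of "%_. 1"] outer_sub outer_borel], of \<beta>]
    by (auto simp: intg_def)
   then show "(%x. indicator outer x * (f x * ?v x)) \<in> borel_measurable lborel" "(%x. indicator outer x * (\<beta> * f x)) \<in> borel_measurable lborel"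
    by auto
   show "AE x in lborel. indicator outer x * (f x * ?v x) = indicator outer x * (\<beta> * f x)"
    using AE_outer by eventually_elim (auto simp: indicator_def z(1))
  qed
 qed
 have cb: "continuous_on S (%t. \<beta> + \<eta> i t)" for i S by (intro continuous_intros c\<eta>)
 have F: "Int_on (cyl ep i) (%x. f x * ?v x) = m i * Int_on Ii (%t. fb i t * (\<beta> + \<eta> i t))" for i
 proof -
  have pt: "?v x = \<beta> + \<eta> i (x $ i)" if "x \<in> cyl ep i" for x
   using v1[of "rest i x" i "x $ i"] that by (simp add: cylinder_def)
  have "Int_on (cyl ep i) (%x. f x * ?v x) = Int_on (cyl ep i) (%x. f x * (\<beta> + \<eta> i (x $ i)))"
   unfolding Int_on_def using pt by (intro Bochner_Integration.integral_cong) (auto simp: indicator_def)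
  also have "... = Int_on Ii (%t. m i * (fb i t * (\<beta> + \<eta> i t)))"
   unfolding Int_cyl_axial[OF intg_cyl_f cb] using m_pos[of i] by (simp add: fb_def)
  finally show ?thesis by (simp add: Int_on_cmult)
 qed
 have irf: "intg Ii (%t. (rhs i t + f (point i t 0)) * (\<beta> + \<eta> i t))" "intg Ii (%t. rhs i t * (\<beta> + \<eta> i t))"
  "intg Ii (%t. f (point i t 0) * (\<beta> + \<eta> i t))" "intg Ii (%t. D i t * \<eta>' i t)" for i
  by (rule intg_continuous_on_compact[of "{0..1}"];
    (intro continuous_intros cb rhs_cont f_axis D_cont continuous_on_subset[OF c])?; use Ii_sub in auto)+
 \<comment> \<open>No trace estimate enters: the test function is constant on each circle, so the
   lateral integral is exactly \<open>phibar\<close> times its value.\<close>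
 have G: "ep * lat ep i ?v = m i * Int_on Ii (%t. (rhs i t + f (point i t 0)) * (\<beta> + \<eta> i t))" for i
 proof -
  have pt: "ep * (ep * h i * Int_on {0..<2 * pi} (%th. \<phi> i t (polar (h i) th) * ?v (point i t (polar (ep * h i) th))))
   = m i * ((rhs i t + f (point i t 0)) * (\<beta> + \<eta> i t))" for t
  proof -
   have e1: "?v (point i t (polar (ep * h i) th)) = \<beta> + \<eta> i t" for th
    by (rule v1) (use e h[of i] in \<open>simp add: norm_polar\<close>)
   have e2: "Int_on {0..<2 * pi} (%th. \<phi> i t (polar (h i) th) * X) = Int_on {0..<2 * pi} (%th. \<phi> i t (polar (h i) th)) * X" for X
    using Int_on_cmult[of "{0..<2 * pi}" X] by (simp add: mult.commute)
   show ?thesis unfolding e1 e2 using h[of i] e by (simp add: rhs_def phibar_def m_def power2_eq_square field_simps)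
  qed
  have "ep * lat ep i ?v = Int_on Ii (%t. ep * (ep * h i * Int_on {0..<2 * pi} (%th. \<phi> i t (polar (h i) th) * ?v (point i t (polar (ep * h i) th)))))"
   unfolding lat_Int by (rule Int_on_cmult[symmetric])
  then show ?thesis unfolding pt by (simp only: Int_on_cmult)
 qed
 \<comment> \<open>The boundary term at 1 vanishes by the end condition; at eps l the function
   \<eta> is zero and - \<beta> D remains.\<close>
 have ibp: "Int_on Ii (%t. rhs i t * (\<beta> + \<eta> i t)) + Int_on Ii (%t. D i t * \<eta>' i t) = - \<beta> * D i (ep * l)" for i
 proof -
  have sub: "{ep * l..1} \<subseteq> {0..1}" using la by auto
  have "Int_on Ii (%t. rhs i t * (\<beta> + \<eta> i t) + D i t * \<eta>' i t) = D i 1 * (\<beta> + \<eta> i 1) - D i (ep * l) * (\<beta> + \<eta> i (ep * l))"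
  proof (rule ftc_Ioo(2))
   show "ep * l <= 1" using el[OF e] by simp
   show "continuous_on {ep * l..1} (%t. D i t * (\<beta> + \<eta> i t))" "continuous_on {ep * l..1} (%t. rhs i t * (\<beta> + \<eta> i t) + D i t * \<eta>' i t)"
    by (intro continuous_intros cb continuous_on_subset[OF D_cont sub] continuous_on_subset[OF rhs_cont sub] continuous_on_subset[OF c]; simp)+
   fix t assume "t \<in> Ii"
   note Dt = D_deriv[OF Ii_sub(1)[OF this], of i]
   show "((%t. D i t * (\<beta> + \<eta> i t)) has_real_derivative rhs i t * (\<beta> + \<eta> i t) + D i t * \<eta>' i t) (at t)"
    by (auto intro!: derivative_eq_intros Dt d simp: algebra_simps)
  qed
  then show ?thesis using Int_on_add[OF irf(2,4)] \<eta>1 z(1)[OF la(2), of i] by simp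
 qed
 have iP: "intg Ii (%t. P i t * \<eta>' i t)" for i by (rule intg_mult_continuous[OF intg_P bounded_Ii c])
 have idf: "intg Ii (%t. df i t * (\<beta> + \<eta> i t))" "intg Ii (%t. fb i t * (\<beta> + \<eta> i t))" for i
  by (intro intg_mult_continuous[OF _ bounded_Ii cb] intg_df intg_fb)+
 have split1: "Int_on Ii (%t. (P i t - D i t) * \<eta>' i t) = Int_on Ii (%t. P i t * \<eta>' i t) - Int_on Ii (%t. D i t * \<eta>' i t)" for i
  unfolding left_diff_distrib by (rule Int_on_diff[OF iP irf(4)])
 have split2: "Int_on Ii (%t. df i t * (\<beta> + \<eta> i t)) = Int_on Ii (%t. fb i t * (\<beta> + \<eta> i t)) - Int_on Ii (%t. f (point i t 0) * (\<beta> + \<eta> i t))" for i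
  unfolding df_def left_diff_distrib by (rule Int_on_diff[OF idf(2) irf(3)])
 have split3: "Int_on Ii (%t. (rhs i t + f (point i t 0)) * (\<beta> + \<eta> i t)) = Int_on Ii (%t. rhs i t * (\<beta> + \<eta> i t)) + Int_on Ii (%t. f (point i t 0) * (\<beta> + \<eta> i t))" for i
  unfolding distrib_right[of "rhs i _"] by (rule Int_on_add[OF irf(2,3)])
 define p1 where "p1 i = Int_on Ii (%t. P i t * \<eta>' i t)" for i
 define p2 where "p2 i = Int_on Ii (%t. fb i t * (\<beta> + \<eta> i t))" for i
 define p3 where "p3 i = Int_on Ii (%t. (rhs i t + f (point i t 0)) * (\<beta> + \<eta> i t))" for i
 have main: "(\<Sum>i\<in>UNIV. m i * p1 i) = \<beta> * Int_on outer f + (\<Sum>i\<in>UNIV. m i * p2 i) - (\<Sum>i\<in>UNIV. m i * p3 i)"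
  using W unfolding load_Int Int_Om_split[OF iHk] Int_Om_split[OF intg_f[OF cv]] o1 o2 L F sum_distrib_left G
  by (simp add: p1_def p2_def p3_def)
 have eq: "m i * Int_on Ii (%t. (P i t - D i t) * \<eta>' i t) = m i * p1 i - m i * p2 i + m i * p3 i + m i * (Int_on Ii (%t. df i t * (\<beta> + \<eta> i t)) + \<beta> * D i (ep * l))" for i
 proof -
  have "Int_on Ii (%t. (P i t - D i t) * \<eta>' i t) = p1 i - p2 i + p3 i + (Int_on Ii (%t. df i t * (\<beta> + \<eta> i t)) + \<beta> * D i (ep * l))"
   using split1[of i] split2[of i] split3[of i] ibp[of i] unfolding p1_def p2_def p3_def by linarith
  then show ?thesis by (simp only: distrib_left right_diff_distrib)
 qed
 show ?thesis unfolding eq sum.distrib sum_subtractf using main by linarith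
qed

end

lemma Int_on_AE_cong:
 assumes "intg S q" "intg S p" "AE x in lborel. x \<in> S --> q x = p x"
 shows "Int_on S q = Int_on S p"
 unfolding Int_on_def
proof (rule integral_cong_AE)
 show "(%x. indicator S x * q x) \<in> borel_measurable lborel" "(%x. indicator S x * p x) \<in> borel_measurable lborel"
  using borel_measurable_integrable[OF assms(1)[unfolded intg_def]] borel_measurable_integrable[OF assms(2)[unfolded intg_def]] by auto
 show "AE x in lborel. indicator S x * q x = indicator S x * p x"
  using assms(3) by eventually_elim (auto simp: indicator_def)
qed

lemma sum_single:
 fixes X :: "'a::finite => real"
 assumes "\<And>j. j \<noteq> i ==> X j = 0" shows "(\<Sum>j\<in>UNIV. X j) = X i"
 using assms by (simp add: sum.remove[of UNIV i])

section \<open>The edge equation up to constants\<close>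

context junction_solution
begin

definition T :: "3 => real => real" where "T i s = Int_on Ii (%t. indicator {s<..} t * df i t)"

lemma T_cont: "continuous_on S (T i)"
 and T_bound: "\<bar>T i s\<bar> <= F1 * ep"
 and T_ge1: "s >= 1 ==> T i s = 0"
 and T_ibp: "\<And>\<eta> \<eta>'. (\<And>t. (\<eta> has_real_derivative \<eta>' t) (at t)) ==> continuous_on UNIV \<eta>' ==> \<eta> (ep * l) = 0 ==>
    Int_on Ii (%t. df i t * \<eta> t) = Int_on Ii (%t. T i t * \<eta>' t)"
 using tail_integral[OF less_imp_le[OF la(1)] el[OF e] intg_df df_bound] continuous_on_subset[of UNIV "T i" S]
 unfolding T_def[abs_def] by auto

lemma a_Ii: "{a<..<1} \<subseteq> Ii" using la by auto

text \<open>With \<beta> = 0 and all \<eta> but one equal to zero, the identity says that P - D - T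
  is orthogonal to every continuous c on (a, 1) with integral zero; the condition on the integral is
  exactly what makes the antiderivative of c vanish at the end.\<close>

lemma du_bois_reymond_edge: "\<exists>\<kappa>. AE t in lborel. t \<in> {a<..<1} --> P i t - D i t - T i t = \<kappa>"
proof -
 have iD: "intg Ii (D i)" by (rule intg_continuous_on_compact[OF compact_Icc D_cont]) (use Ii_sub in auto)
 have iT: "intg Ii (T i)" by (rule intg_continuous[OF bounded_Ii _ T_cont]) simp
 have iq: "intg Ii (%t. P i t - D i t - T i t)" by (intro intg_diff intg_P iD iT)
 have a1: "a < 1" using a_small a_pos by simp
 obtain \<kappa> where "AE t in lborel. t \<in> {a<..<1} --> P i t - D i t - T i t = \<kappa>"
 proof (rule du_bois_reymond[OF a1 intg_subset[OF iq a_Ii]])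
  fix c :: "real => real" assume c: "continuous_on UNIV c" and z: "\<And>t. t \<notin> {a<..<1} ==> c t = 0" and I: "Int_on {a<..<1} c = 0"
  obtain \<eta> where \<eta>: "\<And>t. (\<eta> has_real_derivative c t) (at t)" "\<And>t. t <= a ==> \<eta> t = 0"
   by (rule antiderivative_on_reals[OF c z a_pos]) auto
  have "Int_on {a<..<1} c = \<eta> 1 - \<eta> a"
   by (rule ftc_Ioo(2)[OF _ DERIV_continuous_on[OF DERIV_subset[OF \<eta>(1)]] continuous_on_subset[OF c] \<eta>(1)]) (use a1 in auto)
  then have \<eta>1: "\<eta> 1 = 0" using I \<eta>(2)[of a] by simp
  define E where "E j t = (if j = i then \<eta> t else 0)" for j :: 3 and t
  define E' where "E' j t = (if j = i then c t else 0)" for j :: 3 and t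
  have "(\<Sum>j\<in>UNIV. m j * Int_on Ii (%t. (P j t - D j t) * E' j t)) =
   0 * Int_on outer f + (\<Sum>j\<in>UNIV. m j * (Int_on Ii (%t. df j t * (0 + E j t)) + 0 * D j (ep * l)))"
  proof (rule test_identity)
   fix j
   show "(E j has_real_derivative E' j t) (at t)" for t using \<eta>(1) by (cases "j = i") (simp_all add: E_def[abs_def] E'_def)
   show "continuous_on UNIV (E' j)" using c by (cases "j = i") (simp_all add: E'_def[abs_def])
   show "E j t = 0" "E' j t = 0" if "t <= a" for t using that \<eta>(2) z by (auto simp: E_def E'_def)
   show "E j 1 = - 0" using \<eta>1 by (simp add: E_def)
  qed
  moreover have "(\<Sum>j\<in>UNIV. m j * Int_on Ii (%t. (P j t - D j t) * E' j t)) = m i * Int_on Ii (%t. (P i t - D i t) * E' i t)"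
   by (rule sum_single) (simp add: E'_def Int_on_def)
  moreover have "(\<Sum>j\<in>UNIV. m j * (Int_on Ii (%t. df j t * (0 + E j t)) + 0 * D j (ep * l))) = m i * (Int_on Ii (%t. df i t * (0 + E i t)) + 0 * D i (ep * l))"
   by (rule sum_single) (simp add: E_def Int_on_def)
  ultimately have "m i * Int_on Ii (%t. (P i t - D i t) * c t) = m i * Int_on Ii (%t. df i t * \<eta> t)"
   by (simp add: E_def E'_def)
  then have 1: "Int_on Ii (%t. (P i t - D i t) * c t) = Int_on Ii (%t. df i t * \<eta> t)" using m_pos[of i] by simp
  have "Int_on Ii (%t. df i t * \<eta> t) = Int_on Ii (%t. T i t * c t)"
   by (rule T_ibp[OF \<eta>(1) c \<eta>(2)[OF la(2)]])
  then have "Int_on Ii (%t. (P i t - D i t) * c t - T i t * c t) = 0"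
   using 1 Int_on_diff[OF intg_mult_continuous[OF intg_diff[OF intg_P iD] bounded_Ii c] intg_mult_continuous[OF iT bounded_Ii c]] by simp
  moreover have "Int_on {a<..<1} (%t. (P i t - D i t - T i t) * c t) = Int_on Ii (%t. (P i t - D i t) * c t - T i t * c t)"
   unfolding Int_on_def
  proof (intro Bochner_Integration.integral_cong refl)
   fix t show "indicator {a<..<1} t * ((P i t - D i t - T i t) * c t) = indicator Ii t * ((P i t - D i t) * c t - T i t * c t)"
    using z[of t] a_Ii by (cases "t \<in> {a<..<1}") (auto simp: left_diff_distrib)
  qed
  ultimately show "Int_on {a<..<1} (%t. (P i t - D i t - T i t) * c t) = 0" by simp
 qed simp
 then show ?thesis by (rule exI)
qed

definition \<kappa> :: "3 => real" where
 "\<kappa> i = (SOME \<kappa>. AE t in lborel. t \<in> {a<..<1} --> P i t - D i t - T i t = \<kappa>)"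

lemma AE_\<kappa>: "AE t in lborel. t \<in> {a<..<1} --> P i t - D i t - T i t = \<kappa> i"
 unfolding \<kappa>_def by (rule someI_ex[OF du_bois_reymond_edge])

definition \<Theta> :: "3 => real => real" where
 "\<Theta> i = (SOME \<Theta>. (\<forall>t. (\<Theta> has_real_derivative T i t) (at t)) \<and> \<Theta> 1 = 0)"

lemma \<Theta>: "(\<Theta> i has_real_derivative T i t) (at t)" "\<Theta> i 1 = 0"
proof -
 \<comment> \<open>T vanishes right of 1 whereas \<open>antiderivative_on_reals\<close> asks for
   zero on the left, hence the reflection of t to 2 - t.\<close>
 have c: "continuous_on UNIV (%t. T i (2 - t))"
  by (rule continuous_on_compose2[OF T_cont[of UNIV]]) (auto intro!: continuous_intros)
 obtain \<eta> where \<eta>: "\<And>t. (\<eta> has_real_derivative T i (2 - t)) (at t)" "\<And>t. t <= 1 ==> \<eta> t = 0"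
  by (rule antiderivative_on_reals[OF c, of 1]) (auto simp: T_ge1)
 have "((%t. - \<eta> (2 - t)) has_real_derivative T i t) (at t)" for t
 proof -
  have "((%t. 2 - t) has_real_derivative - 1) (at t)" by (auto intro!: derivative_eq_intros)
  from DERIV_minus[OF DERIV_chain2[OF \<eta>(1) this]] show ?thesis by simp
 qed
 then have "\<exists>\<Theta>. (\<forall>t. (\<Theta> has_real_derivative T i t) (at t)) \<and> \<Theta> 1 = 0"
  using \<eta>(2)[of 1] by (intro exI[of _ "%t. - \<eta> (2 - t)"]) simp
 from someI_ex[OF this] show "(\<Theta> i has_real_derivative T i t) (at t)" "\<Theta> i 1 = 0" unfolding \<Theta>_def by auto
qed

text \<open>The error of the section mean on edge i: its derivative is \<kappa> + T, which is P - D
  almost everywhere beyond a, and it vanishes at 1. It is C1 on the whole line, which is what the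
  norm estimates use.\<close>

definition q :: "3 => real => real" where "q i t = \<Theta> i t - \<kappa> i * (1 - t)"

lemma q_deriv: "(q i has_real_derivative \<kappa> i + T i t) (at t)"
 unfolding q_def[abs_def] by (auto intro!: derivative_eq_intros \<Theta>)

lemma q1: "q i 1 = 0" by (simp add: q_def \<Theta>)

lemma \<Theta>_bound: "t \<in> {0..1} ==> \<bar>\<Theta> i t\<bar> <= F1 * ep"
proof -
 assume t: "t \<in> {0..1}"
 have "\<bar>\<Theta> i 1 - \<Theta> i t\<bar> <= F1 * ep * (1 - t)"
  by (rule mvt_bound[where q = "T i"]) (use t in \<open>auto intro!: DERIV_continuous_on[OF DERIV_subset[OF \<Theta>(1)]] \<Theta> T_bound\<close>)
 also have "... <= F1 * ep * 1" using t F1_nonneg e by (intro mult_left_mono) auto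
 finally show ?thesis by (simp add: \<Theta>)
qed

definition sm :: "3 => (real^3 => real) => real => real" where
 "sm i v t = Int_on (Bi i) (%y. v (point i t y)) / m i"

definition ro :: "nat => real" where "ro n = Int_on (Om ep) (%x. norm (g n x - H x))"
definition \<sigma> :: "3 => nat => real" where "\<sigma> i n = Int_on (Bi i) (%y. \<bar>w n (point i 1 y)\<bar>)"

lemma ro\<sigma>_lim: "ro \<longlonglongrightarrow> 0" "\<sigma> i \<longlonglongrightarrow> 0"
 unfolding ro_def[abs_def] \<sigma>_def[abs_def] by (rule gH w_ends)+

lemma wn_cont: "continuous_on UNIV (w n)" "continuous_on UNIV (g n)" "continuous_on UNIV (%x. g n x $ i)"
 using C1_continuous[OF w[of n]] by (auto intro!: continuous_intros)

text \<open>Both quantities are compared through their increments from t to 1. For the C1 functions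
  \<open>w n\<close> this increment is an integral of \<open>g n\<close>, for \<omega> + q it is an
  integral of H by the edge equation, and the two differ by at most \<open>ro\<close>; the values on
  the end disc account for \<sigma>.\<close>

lemma sm_close:
 assumes t: "t \<in> {a<..<1}"
 shows "\<bar>sm i (w n) t - (\<omega> i t + q i t)\<bar> <= (\<sigma> i n + ro n) / m i"
proof -
 have tI: "t \<in> Ii" using t a_Ii by blast
 have ind: "Int_on Ii (%s. indicator {t<..} s * k s) = Int_on {t<..<1} k" for k :: "real => real"
  unfolding Int_on_def using tI by (intro Bochner_Integration.integral_cong) (auto simp: indicator_def)
 have mJ: "(%x. indicator {t<..} (x $ i) :: real) \<in> borel_measurable (borel :: (real^3) measure)"
 proof -
  have "{x :: real^3. t < x $ i} \<in> sets borel" by (intro borel_open open_Collect_less continuous_intros)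
  moreover have "(%x :: real^3. indicator {t<..} (x $ i) :: real) = indicator {x. t < x $ i}" by (auto simp: indicator_def)
  ultimately show ?thesis by simp
 qed
 have Hi: "(%x. H x $ i) \<in> borel_measurable borel"
 proof -
  have "(%x. H x \<bullet> axis i 1) \<in> borel_measurable borel" by measurable
  then show ?thesis by (simp add: inner_axis)
 qed
 have i1: "intg (cyl ep i) (%x. indicator {t<..} (x $ i) * g n x $ i)"
  by (rule intg_bounded_by[OF intg_abs[OF intg_cont(3)[OF wn_cont(3)[of n i]]] borel_measurable_times[OF mJ borel_measurable_continuous_onI[OF wn_cont(3)]]])
    (auto simp: indicator_def)
 have i2: "intg (cyl ep i) (%x. indicator {t<..} (x $ i) * H x $ i)"
  by (rule intg_bounded_by[OF intg_abs[OF intg_cyl_H] borel_measurable_times[OF mJ Hi]]) (auto simp: indicator_def)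
 have A1: "Int_on (cyl ep i) (%x. indicator {t<..} (x $ i) * g n x $ i) = m i * (sm i (w n) 1 - sm i (w n) t)"
 proof -
  have "Int_on {t<..<1} (%s. g n (point i s y) $ i) = w n (point i 1 y) - w n (point i t y)" for y
   by (rule ftc_Ioo(2)[OF _ continuous_line[OF wn_cont(1)] continuous_line[OF wn_cont(3)] C1_axial[OF w]]) (use t in auto)
  then have "Int_on (cyl ep i) (%x. indicator {t<..} (x $ i) * g n x $ i) = Int_on (Bi i) (%y. w n (point i 1 y) - w n (point i t y))"
   using Int_on_cylinder(2)[OF i1] by (simp add: ind)
  also have "... = Int_on (Bi i) (%y. w n (point i 1 y)) - Int_on (Bi i) (%y. w n (point i t y))"
   by (intro Int_on_diff intg_continuous continuous_section wn_cont) auto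
  finally show ?thesis using m_pos[of i] by (simp add: sm_def right_diff_distrib)
 qed
 have A2: "Int_on (cyl ep i) (%x. indicator {t<..} (x $ i) * H x $ i) = - m i * (\<omega> i t + q i t)"
 proof -
  have sub: "{t<..<1} \<subseteq> Ii" "{t..1} \<subseteq> {0..1}" using tI la by auto
  have cD: "continuous_on {t..1} (%s. D i s + (\<kappa> i + T i s))"
   by (intro continuous_intros T_cont continuous_on_subset[OF D_cont sub(2)])
  have F: "intg {t<..<1} (%s. D i s + (\<kappa> i + T i s))" "Int_on {t<..<1} (%s. D i s + (\<kappa> i + T i s)) = (\<omega> i 1 + q i 1) - (\<omega> i t + q i t)"
  proof -
   have c: "continuous_on {t..1} (%s. \<omega> i s + q i s)"
    by (intro continuous_intros continuous_on_subset[OF \<omega>_cont sub(2)] DERIV_continuous_on[OF DERIV_subset[OF q_deriv]]) auto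
   have d: "((%s. \<omega> i s + q i s) has_real_derivative D i s + (\<kappa> i + T i s)) (at s)" if "s \<in> {t<..<1}" for s
    using that sub Ii_sub by (intro DERIV_add \<omega>_deriv_at q_deriv) auto
   show "intg {t<..<1} (%s. D i s + (\<kappa> i + T i s))" "Int_on {t<..<1} (%s. D i s + (\<kappa> i + T i s)) = (\<omega> i 1 + q i 1) - (\<omega> i t + q i t)"
    using ftc_Ioo[OF _ c cD d] t by auto
  qed
  have "Int_on (cyl ep i) (%x. indicator {t<..} (x $ i) * H x $ i) = Int_on Ii (%s. indicator {t<..} s * (m i * P i s))"
   using Int_on_cylinder(1)[OF i2] m_pos[of i] by (simp add: P_def Int_on_cmult)
  also have "... = m i * Int_on {t<..<1} (P i)" unfolding ind Int_on_cmult ..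
  also have "Int_on {t<..<1} (P i) = Int_on {t<..<1} (%s. D i s + (\<kappa> i + T i s))"
  proof (rule Int_on_AE_cong[OF intg_subset[OF intg_P sub(1)] F(1)])
   show "AE s in lborel. s \<in> {t<..<1} --> P i s = D i s + (\<kappa> i + T i s)"
    using AE_\<kappa>[of i] by eventually_elim (use t in auto)
  qed simp
  finally show ?thesis unfolding F(2) using \<omega>1 q1 by (simp add: algebra_simps)
 qed
 have "\<bar>Int_on (cyl ep i) (%x. indicator {t<..} (x $ i) * g n x $ i) - Int_on (cyl ep i) (%x. indicator {t<..} (x $ i) * H x $ i)\<bar> <= Int_on (cyl ep i) (%x. norm (g n x - H x))"
  unfolding Int_on_diff[OF i1 i2, symmetric]
 proof (rule Int_on_bound[OF intg_diff[OF i1 i2] intg_subset[OF gH(1) cyl_subset cyl_borel]])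
  fix x
  show "\<bar>indicator {t<..} (x $ i) * g n x $ i - indicator {t<..} (x $ i) * H x $ i\<bar> <= norm (g n x - H x)"
   using component_le_norm_cart[of "g n x - H x" i] by (auto simp: indicator_def)
 qed
 also have "... <= ro n" unfolding ro_def by (rule Int_on_subset[OF gH(1) cyl_subset cyl_borel]) auto
 finally have 1: "\<bar>m i * (sm i (w n) 1 - sm i (w n) t) + m i * (\<omega> i t + q i t)\<bar> <= ro n" unfolding A1 A2 by simp
 have 2: "\<bar>m i * sm i (w n) 1\<bar> <= \<sigma> i n"
 proof -
  have "\<bar>Int_on (Bi i) (%y. w n (point i 1 y))\<bar> <= \<sigma> i n"
   unfolding \<sigma>_def by (intro Int_on_bound intg_continuous continuous_intros continuous_section wn_cont) auto
  then show ?thesis using m_pos[of i] by (simp add: sm_def)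
 qed
 have "\<bar>m i * (sm i (w n) t - (\<omega> i t + q i t))\<bar> <= \<sigma> i n + ro n"
  using 1 2 by (simp add: right_diff_distrib distrib_left abs_le_iff)
 then show ?thesis using m_pos[of i] by (simp add: abs_mult pos_le_divide_eq mult.commute)
qed

text \<open>U is determined only up to null sets and has no values on individual sections, so the
  identity is obtained in L1 of (a, 1), as the limit of the bounds for \<open>w n\<close>.\<close>

lemma AE_sm: "AE t in lborel. t \<in> {a<..<1} --> sm i U t = \<omega> i t + q i t"
proof -
 let ?S = "{a<..<1}"
 let ?Y = "%t. sm i U t - (\<omega> i t + q i t)"
 have iUc: "intg (cyl ep i) U" by (rule intg_subset[OF intg_U cyl_subset]) simp
 have iU: "intg Ii (sm i U)"
  unfolding sm_def[abs_def] divide_inverse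
  using intg_cmult[OF Int_on_cylinder(3)[OF iUc], of "inverse (m i)"] by (simp add: mult.commute)
 have cR: "continuous_on {0..1} (%t. \<omega> i t + q i t)"
  by (intro continuous_intros \<omega>_cont DERIV_continuous_on[OF DERIV_subset[OF q_deriv]]) auto
 have iR: "intg Ii (%t. \<omega> i t + q i t)"
  by (rule intg_continuous_on_compact[OF compact_Icc cR]) (use Ii_sub in auto)
 have iY: "intg ?S (%t. \<bar>?Y t\<bar>)" by (rule intg_subset[OF intg_abs[OF intg_diff[OF iU iR]] a_Ii]) simp
 have bound: "Int_on ?S (%t. \<bar>?Y t\<bar>) <= Int_on (Om ep) (%x. \<bar>w n x - U x\<bar>) / m i + (\<sigma> i n + ro n) / m i" for n
 proof -
  let ?d = "%t. Int_on (Bi i) (%y. \<bar>w n (point i t y) - U (point i t y)\<bar>)"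
  have iwU: "intg (cyl ep i) (%x. \<bar>w n x - U x\<bar>)" by (rule intg_subset[OF wU(1) cyl_subset]) simp
  have id: "intg Ii (%t. inverse (m i) * ?d t)" by (rule intg_cmult[OF Int_on_cylinder(3)[OF iwU]])
  have s0: "0 <= (\<sigma> i n + ro n) / m i"
   by (rule divide_nonneg_pos[OF _ m_pos]) (auto simp: \<sigma>_def ro_def intro!: add_nonneg_nonneg Int_on_nonneg)
  have ic: "intg ?S (%t. (\<sigma> i n + ro n) / m i)" by (rule intg_continuous) (auto intro: bounded_Ioo_real)
  have "Int_on ?S (%t. \<bar>?Y t\<bar>) <= Int_on ?S (%t. inverse (m i) * ?d t + (\<sigma> i n + ro n) / m i)"
   unfolding Int_on_def
  proof (rule integral_mono_AE)
   show "integrable lborel (%t. indicator ?S t * \<bar>?Y t\<bar>)" using iY by (simp add: intg_def)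
   show "integrable lborel (%t. indicator ?S t * (inverse (m i) * (LBINT y. indicator (Bi i) y * \<bar>w n (point i t y) - U (point i t y)\<bar>) + (\<sigma> i n + ro n) / m i))"
    using intg_add[OF intg_subset[OF id a_Ii] ic] by (simp add: intg_def Int_on_def)
   show "AE t in lborel. indicator ?S t * \<bar>?Y t\<bar> <= indicator ?S t * (inverse (m i) * (LBINT y. indicator (Bi i) y * \<bar>w n (point i t y) - U (point i t y)\<bar>) + (\<sigma> i n + ro n) / m i)"
    using Int_on_cylinder(5)[OF iUc]
   proof eventually_elim
    case (elim t)
    show ?case
    proof (cases "t \<in> ?S")
     case True
     then have iUt: "intg (Bi i) (%y. U (point i t y))" using elim a_Ii by blast
     have iwt: "intg (Bi i) (%y. w n (point i t y))" by (intro intg_continuous continuous_section wn_cont) auto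
     have "\<bar>Int_on (Bi i) (%y. w n (point i t y)) - Int_on (Bi i) (%y. U (point i t y))\<bar> <= ?d t"
      unfolding Int_on_diff[OF iwt iUt, symmetric]
      by (rule Int_on_bound[OF intg_diff[OF iwt iUt] intg_abs[OF intg_diff[OF iwt iUt]]]) simp
     then have "\<bar>sm i (w n) t - sm i U t\<bar> <= ?d t / m i"
      unfolding sm_def diff_divide_distrib[symmetric] using m_pos[of i] by (simp add: abs_divide divide_right_mono)
     then have "\<bar>sm i (w n) t - sm i U t\<bar> <= inverse (m i) * ?d t" by (simp only: divide_inverse mult.commute)
     then have "\<bar>?Y t\<bar> <= inverse (m i) * ?d t + (\<sigma> i n + ro n) / m i"
      using sm_close[OF True, of i n] by linarith
     then show ?thesis using True by (simp add: Int_on_def)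
    qed simp
   qed
  qed
  also have "... = Int_on ?S (%t. inverse (m i) * ?d t) + Int_on ?S (%t. (\<sigma> i n + ro n) / m i)"
   by (rule Int_on_add[OF intg_subset[OF id a_Ii] ic]) simp
  also have "... <= Int_on Ii (%t. inverse (m i) * ?d t) + (\<sigma> i n + ro n) / m i"
  proof (rule add_mono)
   show "Int_on ?S (%t. inverse (m i) * ?d t) <= Int_on Ii (%t. inverse (m i) * ?d t)"
    using m_pos[of i] by (intro Int_on_subset[OF id a_Ii] mult_nonneg_nonneg Int_on_nonneg) (auto intro: less_imp_le)
   have "Int_on ?S (%t. (\<sigma> i n + ro n) / m i) = (\<sigma> i n + ro n) / m i * (1 - a)"
    using a_small a_pos by (simp add: Int_on_const)
   also have "... <= (\<sigma> i n + ro n) / m i * 1" using s0 a_pos by (intro mult_left_mono) auto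
   finally show "Int_on ?S (%t. (\<sigma> i n + ro n) / m i) <= (\<sigma> i n + ro n) / m i" by simp
  qed
  also have "Int_on Ii (%t. inverse (m i) * ?d t) = inverse (m i) * Int_on (cyl ep i) (%x. \<bar>w n x - U x\<bar>)"
   unfolding Int_on_cylinder(1)[OF iwU] Int_on_cmult ..
  also have "... <= Int_on (Om ep) (%x. \<bar>w n x - U x\<bar>) / m i"
   unfolding divide_inverse mult.commute[of _ "inverse (m i)"]
   using m_pos[of i] by (intro mult_left_mono Int_on_subset[OF wU(1) cyl_subset cyl_borel]) auto
  finally show ?thesis by simp
 qed
 have "Int_on ?S (%t. \<bar>?Y t\<bar>) <= 0 / m i + (0 + 0) / m i"
  by (rule LIMSEQ_le_const[OF tendsto_add[OF tendsto_divide[OF wU(2) tendsto_const] tendsto_divide[OF tendsto_add[OF ro\<sigma>_lim(2) ro\<sigma>_lim(1)] tendsto_const]]])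
    (use bound m_pos[of i] in auto)
 then have le: "Int_on ?S (%t. \<bar>?Y t\<bar>) <= 0" by simp
 have "0 <= Int_on ?S (%t. \<bar>?Y t\<bar>)" by (rule Int_on_nonneg) simp
 from antisym[OF le this] have "(LBINT t. indicator ?S t * \<bar>?Y t\<bar>) = 0" by (simp only: Int_on_def)
 then have "AE t in lborel. indicator ?S t * \<bar>?Y t\<bar> = 0"
  using integral_nonneg_eq_0_iff_AE[OF iY[unfolded intg_def]] by simp
 then show ?thesis by eventually_elim (auto simp: indicator_def)
qed

end

context junction_limit
begin

text \<open>Constants of the edge analysis: \<open>Kd\<close> for differences of the \<kappa>,
  \<open>Kf\<close> for their weighted sum, \<open>K\<kappa>\<close> for each of them.\<close>

definition "Hs = (\<Sum>i\<in>UNIV. 1 / (pi * (h i)\<^sup>2))"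
definition "Kd = 8 * CP * KE * Hs / R + 8 * (D0 / e0 + F1)"
definition "Kf = F0 * vC / pi + 3 * (R\<^sup>2 * (F1 + B0 * R))"
definition "K\<kappa> = (Kf + 3 * (R\<^sup>2 * Kd)) / (\<Sum>i\<in>UNIV. (h i)\<^sup>2)"

lemma Hs: "1 / (pi * (h i)\<^sup>2) <= Hs" "0 <= Hs"
 unfolding Hs_def by (auto intro!: member_le_sum sum_nonneg)

end

section \<open>Size of the constants on the edges\<close>

context junction_solution
begin

text \<open>The slabs a < x_i < b lie in the core, and their length is comparable to eps.\<close>

definition b :: real where "b = ep / e0"

lemma b: "2 * a < b" "b <= 1"
 using a_small e0_less(2)[OF e] by (auto simp: b_def)

text \<open>One Poincare constant c of the core serves all three edges. On the slabs a < x_i < b,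
  which lie in the core, the L1 distance of \<open>w n\<close> from c is at most CP eps times a
  gradient norm of order eps^3, up to terms that vanish as n grows; dividing by the section area
  leaves eps^2.\<close>

lemma slab_mean:
 obtains c where "\<And>i. \<bar>Int_on {a<..<b} (%t. \<omega> i t + q i t) - (b - a) * c\<bar>
   <= (\<sigma> i n + ro n) / m i + CP * ep * (KE * ep ^ 3 + ro n) / m i"
proof -
 let ?J = "{a<..<b}"
 obtain c where c: "Int_on (core ep) (%x. \<bar>w n x - c\<bar>) <= CP * ep * Int_on (core ep) (%x. norm (g n x))"
  by (rule core_poincare[OF w])
 have cb: "core ep \<subseteq> Om ep" by (rule core_subset[OF e])
 have Gn: "Int_on (core ep) (%x. norm (g n x)) <= KE * ep ^ 3 + ro n"
 proof -
  have i: "intg (core ep) (%x. norm (H x))" "intg (core ep) (%x. norm (g n x - H x))"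
   using intg_subset[OF intg_H cb] intg_subset[OF gH(1) cb] by auto
  have "Int_on (core ep) (%x. norm (g n x)) <= Int_on (core ep) (%x. norm (H x) + norm (g n x - H x))"
  proof (rule Int_on_mono[OF _ intg_add[OF i]])
   show "intg (core ep) (%x. norm (g n x))" by (intro intg_cont continuous_intros wn_cont)
   show "norm (g n x) <= norm (H x) + norm (g n x - H x)" for x by (rule norm_triangle_sub)
  qed
  also have "... <= KE * ep ^ 3 + ro n"
   unfolding Int_on_add[OF i] ro_def by (intro add_mono core_H Int_on_subset[OF gH(1) cb]) auto
  finally show ?thesis .
 qed
 have cz: "continuous_on UNIV (%x. w n x - c)" "continuous_on UNIV (%x. \<bar>w n x - c\<bar>)" by (intro continuous_intros wn_cont)+
 show ?thesis
 proof (rule that)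
  fix i
  let ?slab = "{x \<in> cyl ep i. a < x $ i \<and> x $ i < b}"
  have JI: "?J \<subseteq> Ii" using la b by auto
  have "open {x :: real^3. a < x $ i}" "open {x :: real^3. x $ i < b}"
   by (intro open_Collect_less continuous_intros)+
  then have "open (cyl ep i \<inter> ({x. a < x $ i} \<inter> {x. x $ i < b}))" by (intro open_Int open_cyl)
  moreover have "?slab = cyl ep i \<inter> ({x. a < x $ i} \<inter> {x. x $ i < b})" by auto
  ultimately have sb: "?slab \<in> sets borel" by simp
  have sc: "?slab \<subseteq> core ep" using cyl_in_core[OF e] by (auto simp: b_def)
  have isl: "intg ?slab (%x. w n x - c)" by (rule intg_subset[OF intg_cont(2)[OF cz(1)] sc sb])
  have ic: "intg (cyl ep i) (%x. indicator ?J (x $ i) * (w n x - c))"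
  proof -
   have "integrable lborel (%x. indicator ?slab x * (w n x - c))" using isl by (simp add: intg_def)
   moreover have "(%x. indicator ?slab x * (w n x - c)) = (%x. indicator (cyl ep i) x * (indicator ?J (x $ i) * (w n x - c)))"
    by (auto simp: indicator_def)
   ultimately show ?thesis by (simp add: intg_def)
  qed
  have iw: "intg ?J (sm i (w n))"
  proof -
   have "intg Ii (sm i (w n))"
    unfolding sm_def[abs_def] divide_inverse
    using intg_cmult[OF Int_on_cylinder(3)[OF intg_cont(3)[OF wn_cont(1)[of n], of i]], of "inverse (m i)"] by (simp add: mult.commute)
   then show ?thesis by (rule intg_subset[OF _ JI]) simp
  qed
  have iJ: "intg ?J (%t. k)" for k :: real by (rule intg_continuous) (auto intro: bounded_Ioo_real)
  have mJ: "measure lborel ?J = b - a" using b a_pos by simp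
  have ine: "Int_on (Bi i) (%y. w n (point i t y) - c) = m i * (sm i (w n) t - c)" for t
  proof -
   have "Int_on (Bi i) (%y. w n (point i t y) - c) = Int_on (Bi i) (%y. w n (point i t y)) - Int_on (Bi i) (%y. c)"
    by (intro Int_on_diff intg_continuous continuous_section wn_cont) auto
   then show ?thesis using m_pos[of i] by (simp add: sm_def Int_on_const measure_Bi right_diff_distrib)
  qed
  have "Int_on ?slab (%x. w n x - c) = Int_on (cyl ep i) (%x. indicator ?J (x $ i) * (w n x - c))"
   unfolding Int_on_def by (intro Bochner_Integration.integral_cong) (auto simp: indicator_def)
  also have "... = Int_on Ii (%t. indicator ?J t * (m i * (sm i (w n) t - c)))"
   unfolding Int_on_cylinder(1)[OF ic] point_nth Int_on_cmult ine ..
  also have "... = Int_on ?J (%t. m i * (sm i (w n) t - c))"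
   unfolding Int_on_def using JI by (intro Bochner_Integration.integral_cong) (auto simp: indicator_def)
  also have "... = m i * (Int_on ?J (sm i (w n)) - c * (b - a))"
   unfolding Int_on_cmult Int_on_diff[OF iw iJ] mJ[symmetric] by (simp add: Int_on_const)
  finally have s1: "Int_on ?slab (%x. w n x - c) = m i * (Int_on ?J (sm i (w n)) - c * (b - a))" .
  have "\<bar>Int_on ?slab (%x. w n x - c)\<bar> <= Int_on ?slab (%x. \<bar>w n x - c\<bar>)"
   by (rule Int_on_bound[OF isl intg_abs[OF isl]]) simp
  also have "... <= Int_on (core ep) (%x. \<bar>w n x - c\<bar>)"
   by (rule Int_on_subset[OF intg_cont(2)[OF cz(2)] sc sb]) simp
  also have "... <= CP * ep * (KE * ep ^ 3 + ro n)"
   by (rule order_trans[OF c mult_left_mono[OF Gn]]) (use CP(1) e in simp)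
  finally have 1: "\<bar>Int_on ?J (sm i (w n)) - c * (b - a)\<bar> <= CP * ep * (KE * ep ^ 3 + ro n) / m i"
   unfolding s1 using m_pos[of i] by (simp add: abs_mult pos_le_divide_eq mult.commute)
  have cR: "continuous_on {0..1} (%t. \<omega> i t + q i t)"
   by (intro continuous_intros \<omega>_cont DERIV_continuous_on[OF DERIV_subset[OF q_deriv]]) auto
  have iR: "intg ?J (%t. \<omega> i t + q i t)"
   by (rule intg_continuous_on_compact[OF compact_Icc cR]) (use b a_pos in auto)
  have s0: "0 <= (\<sigma> i n + ro n) / m i"
   by (rule divide_nonneg_pos[OF _ m_pos]) (auto simp: \<sigma>_def ro_def intro!: add_nonneg_nonneg Int_on_nonneg)
  have "\<bar>Int_on ?J (sm i (w n)) - Int_on ?J (%t. \<omega> i t + q i t)\<bar> <= Int_on ?J (%t. (\<sigma> i n + ro n) / m i)"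
   unfolding Int_on_diff[OF iw iR, symmetric]
   by (rule Int_on_bound[OF intg_diff[OF iw iR] iJ sm_close]) (use b in auto)
  also have "... = (\<sigma> i n + ro n) / m i * (b - a)" by (simp add: Int_on_const mJ)
  also have "... <= (\<sigma> i n + ro n) / m i * 1" using s0 b a_pos by (intro mult_left_mono) auto
  finally show "\<bar>Int_on ?J (%t. \<omega> i t + q i t) - (b - a) * c\<bar> <= (\<sigma> i n + ro n) / m i + CP * ep * (KE * ep ^ 3 + ro n) / m i"
   using 1 by (simp add: mult.commute[of c])
 qed
qed

text \<open>The common constant c drops out of the difference of two edges. The integral of \<omega>
  + q over the slab is the common w0 part minus \<kappa> times the integral N of 1 - t, up to O(eps
  L) for a slab of length L; as N >= L/4 and L >= eps R, division by L gives the rate eps.\<close>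

lemma \<kappa>_diff: "\<bar>\<kappa> i - \<kappa> j\<bar> <= Kd * ep"
proof -
 let ?J = "{a<..<b}"
 define L where "L = b - a"
 have L: "L > 0" "ep * R <= L" using b a_pos by (auto simp: L_def a_def[symmetric])
 define I where "I i = Int_on ?J (%t. \<omega> i t + q i t)" for i
 let ?X = "%i n. (\<sigma> i n + ro n) / m i + CP * ep * (KE * ep ^ 3 + ro n) / m i"
 have Xlim: "?X i \<longlonglongrightarrow> (0 + 0) / m i + CP * ep * (KE * ep ^ 3 + 0) / m i" for i
  using m_pos[of i] by (intro tendsto_intros ro\<sigma>_lim) auto
 have "\<bar>I i - I j\<bar> <= ((0 + 0) / m i + CP * ep * (KE * ep ^ 3 + 0) / m i) + ((0 + 0) / m j + CP * ep * (KE * ep ^ 3 + 0) / m j)"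
 proof (rule LIMSEQ_le_const[OF tendsto_add[OF Xlim Xlim]], intro exI allI impI)
  fix n :: nat
  obtain c where c: "\<And>i. \<bar>I i - (b - a) * c\<bar> <= ?X i n" unfolding I_def by (rule slab_mean[of n]) blast
  show "\<bar>I i - I j\<bar> <= ?X i n + ?X j n" using c[of i] c[of j] by linarith
 qed
 also have "... = CP * KE * ep\<^sup>2 * (1 / (pi * (h i)\<^sup>2)) + CP * KE * ep\<^sup>2 * (1 / (pi * (h j)\<^sup>2))"
  using e h[of i] h[of j] by (simp add: m_def power_mult_distrib power2_eq_square power3_eq_cube field_simps)
 also have "... <= CP * KE * ep\<^sup>2 * Hs + CP * KE * ep\<^sup>2 * Hs"
  using CP(1) KE_nonneg by (intro add_mono mult_left_mono Hs) auto
 also have "... = 2 * CP * KE * Hs / R * (ep * (ep * R))" using R_pos by (simp add: power2_eq_square field_simps)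
 also have "... <= 2 * CP * KE * Hs / R * (ep * L)"
  using CP(1) KE_nonneg Hs(2) R_pos e L by (intro mult_left_mono divide_nonneg_nonneg mult_nonneg_nonneg) auto
 finally have 1: "\<bar>I i - I j\<bar> <= 2 * CP * KE * Hs / R * (ep * L)" .
 define Z where "Z i = Int_on ?J (%t. (\<omega> i t - w0) + \<Theta> i t)" for i
 define N where "N = Int_on ?J (%t. 1 - t)"
 have JI: "?J \<subseteq> {0..1}" using a_pos b by auto
 have iz: "intg ?J (%t. (\<omega> i t - w0) + \<Theta> i t)" for i
  by (rule intg_continuous_on_compact[OF compact_Icc _ JI])
    (auto intro!: continuous_intros \<omega>_cont DERIV_continuous_on[OF DERIV_subset[OF \<Theta>(1)]])
 have iN: "intg ?J (%t. 1 - t)" and i1: "intg ?J (%t. k)" for k :: real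
  by (rule intg_continuous; auto intro!: bounded_Ioo_real continuous_intros)+
 have I: "I i = Z i + Int_on ?J (%_. w0) - \<kappa> i * N" for i
  unfolding I_def Z_def N_def Int_on_cmult[symmetric] Int_on_add[OF iz i1, symmetric]
   Int_on_diff[OF intg_add[OF iz i1] intg_cmult[OF iN], symmetric]
  by (simp add: q_def algebra_simps)
 have Z: "\<bar>Z i\<bar> <= (D0 / e0 + F1) * (ep * L)" for i
 proof -
  have "\<bar>Z i\<bar> <= Int_on ?J (%t. D0 * b + F1 * ep)"
   unfolding Z_def
  proof (rule Int_on_bound[OF iz i1])
   fix t assume t: "t \<in> ?J"
   then have "t \<in> {0..1}" using JI by blast
   moreover have "D0 * t <= D0 * b" using t pos0 by (intro mult_left_mono) auto
   ultimately show "\<bar>\<omega> i t - w0 + \<Theta> i t\<bar> <= D0 * b + F1 * ep"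
    using \<omega>_near[of t i] \<Theta>_bound[of t i] by linarith
  qed
  also have "... = (D0 / e0 + F1) * (ep * L)"
  proof -
   have "measure lborel ?J = L" using b a_pos by (simp add: L_def)
   then have "Int_on ?J (%t. D0 * b + F1 * ep) = (D0 * b + F1 * ep) * L" by (simp add: Int_on_const)
   then show ?thesis using e0 by (simp add: b_def algebra_simps)
  qed
  finally show ?thesis .
 qed
 \<comment> \<open>The inequalities 2 a < b <= 1 give (a + b)/2 <= 3/4.\<close>
 have N: "L / 4 <= N"
 proof -
  have "N = (b - b\<^sup>2 / 2) - (a - a\<^sup>2 / 2)"
   unfolding N_def using b a_pos
   by (intro ftc_Ioo(2)[where P = "%t. t - t\<^sup>2 / 2"]) (auto intro!: continuous_intros derivative_eq_intros)
  also have "... = L * (1 - (a + b) / 2)" by (simp add: L_def power2_eq_square field_simps)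
  finally have "N = L * (1 - (a + b) / 2)" .
  moreover have "L * (1 / 4) <= L * (1 - (a + b) / 2)" using b L by (intro mult_left_mono) auto
  ultimately show ?thesis by simp
 qed
 have "\<bar>\<kappa> i - \<kappa> j\<bar> * (L / 4) <= \<bar>\<kappa> i - \<kappa> j\<bar> * N" by (intro mult_left_mono N) simp
 also have "... = \<bar>(\<kappa> i - \<kappa> j) * N\<bar>" using N L by (simp add: abs_mult)
 also have "(\<kappa> i - \<kappa> j) * N = (Z i - Z j) - (I i - I j)" using I[of i] I[of j] by (simp add: algebra_simps)
 also have "\<bar>...\<bar> <= 2 * ((D0 / e0 + F1) * (ep * L)) + 2 * CP * KE * Hs / R * (ep * L)"
  using Z[of i] Z[of j] 1 by linarith
 also have "... = Kd * ep * (L / 4)" by (simp add: Kd_def algebra_simps)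
 finally show ?thesis using L by simp
qed

text \<open>The test function falls from 1 to 0 between x_i = 1/4 and x_i = 3/4 in every tube; a <=
  1/4 makes it admissible for \<open>test_identity\<close>. Its derivative has integral -1 on each
  edge and thus picks out \<kappa>. Kirchhoff's law removes the sum of the D(0), and what remains is
  the source on the node, \<open>df\<close> and D(eps l) - D(0), all small.\<close>

lemma flux:
 assumes a4: "a <= 1 / 4"
 shows "\<bar>\<Sum>i\<in>UNIV. (h i)\<^sup>2 * \<kappa> i\<bar> <= Kf * ep"
proof -
 define \<eta> where "\<eta> t = - step (2 * t - 1 / 2)" for t
 define \<eta>' where "\<eta>' t = - 2 * step' (2 * t - 1 / 2)" for t
 have d: "(\<eta> has_real_derivative \<eta>' t) (at t)" for t
 proof -
  have "((%t. 2 * t - 1 / 2) has_real_derivative 2) (at t)" by (auto intro!: derivative_eq_intros)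
  from DERIV_minus[OF DERIV_chain2[OF step_deriv this]] show ?thesis by (simp add: \<eta>_def[abs_def] \<eta>'_def mult.commute)
 qed
 have c: "continuous_on UNIV \<eta>'"
  unfolding \<eta>'_def[abs_def] by (intro continuous_intros continuous_on_compose2[OF continuous_step(2)[of UNIV]]) auto
 have z: "\<eta> t = 0" "\<eta>' t = 0" if "t <= a" for t using that a4 by (auto simp: \<eta>_def \<eta>'_def step_simps)
 have \<eta>1: "\<eta> 1 = - 1" by (simp add: \<eta>_def step_simps)
 have TI: "(\<Sum>i\<in>UNIV. m i * Int_on Ii (%t. (P i t - D i t) * \<eta>' t)) =
  1 * Int_on outer f + (\<Sum>i\<in>UNIV. m i * (Int_on Ii (%t. df i t * (1 + \<eta> t)) + 1 * D i (ep * l)))"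
  by (rule test_identity[where \<eta> = "%_. \<eta>" and \<eta>' = "%_. \<eta>'"]) (use d c z \<eta>1 in auto)
 have c\<eta>: "continuous_on UNIV \<eta>" by (intro DERIV_continuous_on[OF DERIV_subset[OF d]]) auto
 have iT: "intg Ii (%t. T i t * \<eta>' t)" for i by (intro intg_continuous continuous_intros T_cont c) auto
 have i\<eta>: "intg Ii \<eta>'" by (rule intg_continuous[OF _ _ c]) (auto intro: bounded_Ioo_real)
 have idf: "intg Ii (%t. df i t * \<eta> t)" for i by (rule intg_mult_continuous[OF intg_df bounded_Ii c\<eta>])
 have I\<eta>: "Int_on Ii \<eta>' = - 1"
  using ftc_Ioo(2)[OF _ continuous_on_subset[OF c\<eta>] continuous_on_subset[OF c] d, of "ep * l" 1] el[OF e] \<eta>1 z(1)[OF la(2)] by simp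
 have L: "Int_on Ii (%t. (P i t - D i t) * \<eta>' t) = - \<kappa> i + Int_on Ii (%t. T i t * \<eta>' t)" for i
 proof -
  have iD: "intg Ii (D i)" by (rule intg_continuous_on_compact[OF compact_Icc D_cont]) (use Ii_sub in auto)
  have "Int_on Ii (%t. (P i t - D i t) * \<eta>' t) = Int_on Ii (%t. \<kappa> i * \<eta>' t + T i t * \<eta>' t)"
  proof (rule Int_on_AE_cong[OF intg_mult_continuous[OF intg_diff[OF intg_P iD] bounded_Ii c] intg_add[OF intg_cmult[OF i\<eta>] iT]])
   show "AE t in lborel. t \<in> Ii --> (P i t - D i t) * \<eta>' t = \<kappa> i * \<eta>' t + T i t * \<eta>' t"
    using AE_\<kappa>[of i]
   proof eventually_elim
    case (elim t)
    show ?case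
    proof (cases "t <= a")
     case False
     show ?thesis
     proof
      assume "t \<in> Ii"
      then have "P i t - D i t = \<kappa> i + T i t" using elim False by auto
      then show "(P i t - D i t) * \<eta>' t = \<kappa> i * \<eta>' t + T i t * \<eta>' t" by (simp add: distrib_right)
     qed
    qed (simp add: z)
   qed
  qed
  then show ?thesis unfolding Int_on_add[OF intg_cmult[OF i\<eta>] iT] Int_on_cmult I\<eta> by simp
 qed
 have Rr: "Int_on Ii (%t. df i t * (1 + \<eta> t)) = Int_on Ii (df i) + Int_on Ii (%t. T i t * \<eta>' t)" for i
 proof -
  have "Int_on Ii (%t. df i t * (1 + \<eta> t)) = Int_on Ii (df i) + Int_on Ii (%t. df i t * \<eta> t)"
   unfolding distrib_left mult_1_right by (rule Int_on_add[OF intg_df idf])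
  then show ?thesis using T_ibp[OF d c z(1)[OF la(2)]] by simp
 qed
 define tt where "tt i = Int_on Ii (%t. T i t * \<eta>' t)" for i
 have K0: "(\<Sum>i\<in>UNIV. m i * D i 0) = 0"
 proof -
  have "(\<Sum>i\<in>UNIV. m i * D i 0) = pi * ep\<^sup>2 * (\<Sum>i\<in>UNIV. (h i)\<^sup>2 * D i 0)"
   unfolding sum_distrib_left by (intro sum.cong) (auto simp: m_def power_mult_distrib)
  then show ?thesis using kirchhoff by simp
 qed
 define V where "V i = m i * (Int_on Ii (df i) + (D i (ep * l) - D i 0))" for i
 have "(\<Sum>i\<in>UNIV. m i * (- \<kappa> i + tt i)) = Int_on outer f + (\<Sum>i\<in>UNIV. m i * (Int_on Ii (df i) + tt i + D i (ep * l)))"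
  using TI unfolding L Rr tt_def by simp
 then have main: "(\<Sum>i\<in>UNIV. m i * \<kappa> i) = - Int_on outer f - (\<Sum>i\<in>UNIV. V i)"
  using K0 by (simp add: V_def distrib_left right_diff_distrib sum.distrib sum_subtractf sum_negf)
 have V: "\<bar>V i\<bar> <= pi * ep\<^sup>2 * (R\<^sup>2 * ((F1 + B0 * R) * ep))" for i
 proof -
  have "\<bar>Int_on Ii (df i)\<bar> <= Int_on Ii (%t. F1 * ep)"
   by (rule Int_on_bound[OF intg_df intg_continuous[OF bounded_Ii] df_bound]) auto
  also have "... = F1 * ep * (1 - ep * l)" using el[OF e] by (simp add: Int_on_const)
  also have "... <= F1 * ep * 1" using F1_nonneg e la by (intro mult_left_mono) auto
  finally have 1: "\<bar>Int_on Ii (df i)\<bar> <= F1 * ep" by simp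
  have "\<bar>D i (ep * l) - D i 0\<bar> <= B0 * (ep * l)" using el[OF e] la by (intro D_near) auto
  also have "... <= B0 * (ep * R)" using pos0 e lR by (intro mult_left_mono) auto
  finally have "\<bar>Int_on Ii (df i) + (D i (ep * l) - D i 0)\<bar> <= (F1 + B0 * R) * ep"
   using 1 by (simp add: algebra_simps)
  moreover have "\<bar>m i\<bar> <= pi * ep\<^sup>2 * R\<^sup>2"
   using h[of i] hR[of i] by (auto simp: m_def power_mult_distrib intro!: mult_left_mono power_mono)
  ultimately have "\<bar>V i\<bar> <= (pi * ep\<^sup>2 * R\<^sup>2) * ((F1 + B0 * R) * ep)"
   unfolding V_def abs_mult by (intro mult_mono) auto
  then show ?thesis by (simp add: mult.assoc)
 qed
 have ofb: "\<bar>Int_on outer f\<bar> <= F0 * vC * ep ^ 3"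
 proof -
  have i: "intg outer f" using intg_subset[OF intg_f[of "%_. 1"] outer_sub outer_borel] by simp
  have i0: "intg (Om ep) (%_. F0)" by (rule intg_cont) simp
  have "\<bar>Int_on outer f\<bar> <= Int_on outer (%_. F0)"
   using F0[OF e] outer_sub by (intro Int_on_bound[OF i intg_subset[OF i0 outer_sub outer_borel]]) auto
  also have "... <= Int_on (core ep) (%_. F0)" by (rule Int_outer_core[OF i0]) (use pos0 in auto)
  also have "... = F0 * vC * ep ^ 3" using core_measure by (simp add: Int_on_const)
  finally show ?thesis .
 qed
 have S: "(\<Sum>i\<in>UNIV. m i * \<kappa> i) = pi * ep\<^sup>2 * (\<Sum>i\<in>UNIV. (h i)\<^sup>2 * \<kappa> i)"
  unfolding sum_distrib_left by (intro sum.cong) (auto simp: m_def power_mult_distrib)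
 have "pi * ep\<^sup>2 * \<bar>\<Sum>i\<in>UNIV. (h i)\<^sup>2 * \<kappa> i\<bar> = \<bar>\<Sum>i\<in>UNIV. m i * \<kappa> i\<bar>"
  unfolding S by (simp add: abs_mult)
 also have "... <= F0 * vC * ep ^ 3 + 3 * (pi * ep\<^sup>2 * (R\<^sup>2 * ((F1 + B0 * R) * ep)))"
  unfolding main using ofb sum3_bound[of V, OF V] by linarith
 also have "... = pi * ep\<^sup>2 * (Kf * ep)"
  by (simp add: Kf_def power2_eq_square power3_eq_cube field_simps)
 finally show ?thesis using e by simp
qed

text \<open>One \<kappa> times the sum of all h^2 is the weighted sum of the \<kappa> plus weighted
  differences, both of order eps.\<close>

lemma \<kappa>_bound:
 assumes a4: "a <= 1 / 4" shows "\<bar>\<kappa> i\<bar> <= K\<kappa> * ep"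
proof -
 have S: "(\<Sum>i\<in>UNIV. (h i)\<^sup>2) > 0" by (intro sum_pos zero_less_power h) auto
 have Kd: "Kd >= 0" using order_trans[OF abs_ge_zero \<kappa>_diff[of i i]] e by (simp add: zero_le_mult_iff)
 have t: "\<bar>(h j)\<^sup>2 * (\<kappa> i - \<kappa> j)\<bar> <= R\<^sup>2 * (Kd * ep)" for j
  unfolding abs_mult using hR[of j] h[of j] \<kappa>_diff by (intro mult_mono) (auto intro!: power_mono)
 have "\<kappa> i * (\<Sum>j\<in>UNIV. (h j)\<^sup>2) = (\<Sum>j\<in>UNIV. (h j)\<^sup>2 * \<kappa> j) + (\<Sum>j\<in>UNIV. (h j)\<^sup>2 * (\<kappa> i - \<kappa> j))"
  unfolding sum_distrib_left sum.distrib[symmetric] by (intro sum.cong) (auto simp: algebra_simps)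
 then have "\<bar>\<kappa> i * (\<Sum>j\<in>UNIV. (h j)\<^sup>2)\<bar> <= Kf * ep + 3 * (R\<^sup>2 * (Kd * ep))"
  using flux[OF a4] sum3_bound[of "%j. (h j)\<^sup>2 * (\<kappa> i - \<kappa> j)", OF t] by linarith
 then have "\<bar>\<kappa> i\<bar> * (\<Sum>j\<in>UNIV. (h j)\<^sup>2) <= (Kf + 3 * (R\<^sup>2 * Kd)) * ep"
  using S by (simp add: abs_mult algebra_simps)
 then show ?thesis using S by (simp add: K\<kappa>_def pos_le_divide_eq)
qed

lemma q_bounds:
 assumes a4: "a <= 1 / 4" and t: "t \<in> {0..1}"
 shows "\<bar>q i t\<bar> <= (K\<kappa> + F1) * ep" "\<bar>\<kappa> i + T i t\<bar> <= (K\<kappa> + F1) * ep"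
proof -
 have "\<bar>\<kappa> i * (1 - t)\<bar> <= (K\<kappa> * ep) * 1"
  unfolding abs_mult using \<kappa>_bound[OF a4, of i] t by (intro mult_mono) auto
 then show "\<bar>q i t\<bar> <= (K\<kappa> + F1) * ep"
  using \<Theta>_bound[OF t, of i] unfolding q_def distrib_right by linarith
 show "\<bar>\<kappa> i + T i t\<bar> <= (K\<kappa> + F1) * ep"
  using \<kappa>_bound[OF a4, of i] T_bound[of i t] unfolding distrib_right by linarith
qed

end

section \<open>Passage to the norms and constants of the theorem\<close>

lemma AE_point:
 assumes "AE x in lborel. P (x :: real^3)"
 shows "AE t in lborel. AE y in lborel. P (point i t y)"
proof -
 have "AE x in distr (lborel \<Otimes>\<^sub>M lborel) borel (%(t, y). point i t y). P x"
  using assms by (simp only: lborel_distr_point)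
 moreover have "(%(t, y). point i t y) \<in> lborel \<Otimes>\<^sub>M lborel \<rightarrow>\<^sub>M borel"
 proof -
  have "(%p. point i (fst p) (snd p)) \<in> borel \<rightarrow>\<^sub>M borel"
   by (intro borel_measurable_continuous_onI continuous_intros)
  then show ?thesis by (simp add: lborel_prod case_prod_beta')
 qed
 ultimately have "AE p in lborel \<Otimes>\<^sub>M lborel. P (case p of (t, y) => point i t y)" by (rule AE_distrD[rotated])
 from lborel_pair.AE_pair[OF this] show ?thesis by simp
qed

text \<open>Weak derivatives see only almost-everywhere classes, so v inherits the classical
  derivative of q. On a set of measure at most 1 both parts of the squared norm are at most B^2, and
  sqrt 2 B <= 2 B.\<close>

lemma H1_of_AE_eq:
 fixes v q q' :: "real => real"
 assumes S: "open S" "bounded S" "measure lborel S <= 1"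
  and d: "\<And>t. (q has_real_derivative q' t) (at t)" "continuous_on UNIV q'"
  and eq: "AE t in lborel. t \<in> S --> v t = q t"
  and B: "\<And>t. t \<in> S ==> \<bar>q t\<bar> <= B" "\<And>t. t \<in> S ==> \<bar>q' t\<bar> <= B" "0 <= B"
 shows "in_H1 S v" "H1_norm S v <= 2 * B"
proof -
 have C: "C1 q q'" using d by (simp add: C1_def has_field_derivative_def)
 have cq: "continuous_on UNIV q" by (rule C1_continuous[OF C])
 have [measurable]: "q \<in> borel_measurable borel" "q' \<in> borel_measurable borel" using C1_borel[OF C] by auto
 have Sb: "S \<in> sets borel" using S by simp
 have ic: "intg S k" if "continuous_on UNIV k" for k :: "real => real" by (rule intg_continuous[OF S(2) Sb that])
 have "integrable (lebesgue_on S) v"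
  using integral_lebesgue_on_open(2)[OF S(1) _ eq] ic[OF cq] by (simp add: intg_def)
 then have vm: "v \<in> borel_measurable (lebesgue_on S)" by (rule borel_measurable_integrable)
 have eq2: "AE t in lborel. t \<in> S --> (v t)\<^sup>2 = (q t)\<^sup>2" using eq by eventually_elim auto
 have v2: "integrable (lebesgue_on S) (%t. (v t)\<^sup>2)" "(\<integral>t. (v t)\<^sup>2 \<partial>lebesgue_on S) = Int_on S (%t. (q t)\<^sup>2)"
 proof -
  have c: "continuous_on UNIV (%t. (q t)\<^sup>2)" by (intro continuous_intros cq)
  show "integrable (lebesgue_on S) (%t. (v t)\<^sup>2)" "(\<integral>t. (v t)\<^sup>2 \<partial>lebesgue_on S) = Int_on S (%t. (q t)\<^sup>2)"
   using integral_lebesgue_on_open[OF S(1) _ eq2] ic[OF c] by (simp_all add: intg_def Int_on_def)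
 qed
 have L2: "in_L2 (lebesgue_on S) v" using vm v2 by (simp add: in_L2_def)
 have wq: "has_weak_grad S q q'" by (rule C1_has_weak_grad[OF S(1,2) C])
 have wv: "has_weak_grad S v q'"
  unfolding has_weak_grad_def
 proof (intro conjI allI impI ballI)
  show "in_L2 (lebesgue_on S) q'" using wq by (simp add: has_weak_grad_def)
  fix \<psi> :: "real => real" and b :: real assume t: "test_function S \<psi>" and b: "b \<in> Basis"
  obtain k where k: "C1 \<psi> k" by (rule test_function_imp_C1[OF t])
  have [measurable]: "k \<in> borel_measurable borel" by (rule C1_borel[OF k])
  let ?d = "%x. frechet_derivative \<psi> (at x) b"
  have e1: "AE t in lborel. t \<in> S --> v t * ?d t = q t * (k t \<bullet> b)" "AE t in lborel. t \<in> S --> q t * ?d t = q t * (k t \<bullet> b)"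
   using eq by (auto simp: C1_frechet[OF k])
  have "(%t. q t * (k t \<bullet> b)) \<in> borel_measurable borel" by measurable
  then have "(\<integral>x. v x * ?d x \<partial>lebesgue_on S) = (\<integral>x. q x * ?d x \<partial>lebesgue_on S)"
   using integral_lebesgue_on_open(1)[OF S(1) _ e1(1)] integral_lebesgue_on_open(1)[OF S(1) _ e1(2)] by simp
  also have "... = - (\<integral>x. (q' x \<bullet> b) * \<psi> x \<partial>lebesgue_on S)" using wq t b by (simp add: has_weak_grad_def)
  finally show "(\<integral>x. v x * ?d x \<partial>lebesgue_on S) = - (\<integral>x. (q' x \<bullet> b) * \<psi> x \<partial>lebesgue_on S)" .
 qed
 show H: "in_H1 S v" using L2 wv by (auto simp: in_H1_def)
 have "AE t in lebesgue_on S. weak_grad S v t = q' t"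
  by (rule has_weak_grad_unique[OF S(1,2) in_H1_weak_grad[OF H] wv])
 then have "AE t in lborel. t \<in> S --> weak_grad S v t = q' t" using S by (simp add: AE_lebesgue_on_iff)
 then have "AE t in lborel. t \<in> S --> (norm (weak_grad S v t))\<^sup>2 = (q' t)\<^sup>2" by eventually_elim auto
 then have g2: "(\<integral>t. (norm (weak_grad S v t))\<^sup>2 \<partial>lebesgue_on S) = Int_on S (%t. (q' t)\<^sup>2)"
  using integral_lebesgue_on_open(1)[OF S(1)] by (simp add: Int_on_def)
 have le: "Int_on S (%t. (k t)\<^sup>2) <= B\<^sup>2" if k: "continuous_on UNIV k" "\<And>t. t \<in> S ==> \<bar>k t\<bar> <= B" for k :: "real => real"
 proof -
  have "Int_on S (%t. (k t)\<^sup>2) <= Int_on S (%t. B\<^sup>2)"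
   using k by (intro Int_on_mono ic continuous_intros) (auto intro: abs_le_square_iff[THEN iffD1] simp: abs_le_square_iff[symmetric] B(3))
  also have "... = B\<^sup>2 * measure lborel S" by (rule Int_on_const[OF Sb])
  also have "... <= B\<^sup>2 * 1" using S by (intro mult_left_mono) auto
  finally show ?thesis by simp
 qed
 have "H1_norm S v <= sqrt (B\<^sup>2 + B\<^sup>2)"
  unfolding H1_norm_def v2(2) g2 by (intro real_sqrt_le_mono add_mono le cq d(2) B)
 also have "... <= sqrt ((2 * B)\<^sup>2)" by (intro real_sqrt_le_mono) (simp add: power_mult_distrib)
 also have "... = 2 * B" by (subst real_sqrt_abs) (use B(3) in simp)
 finally show "H1_norm S v <= 2 * B" .
qed

lemma uniform_bound_compact:
 fixes k :: "'i::finite => 'a::topological_space => real"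
 assumes "\<And>i. compact (S i)" "\<And>i. continuous_on (S i) (k i)"
 obtains M where "\<And>i x. x \<in> S i ==> \<bar>k i x\<bar> <= M"
proof -
 have "\<exists>M. \<forall>x\<in>S i. \<bar>k i x\<bar> <= M" for i
  using compact_imp_bounded[OF compact_continuous_image[OF assms(2) assms(1)], of i] by (auto simp: bounded_iff)
 then obtain M where M: "\<And>i x. x \<in> S i ==> \<bar>k i x\<bar> <= M i" by metis
 show ?thesis
 proof (rule that)
  fix i x assume "x \<in> S i"
  then have "\<bar>k i x\<bar> <= \<bar>M i\<bar>" using M[of x i] by linarith
  also have "... <= (\<Sum>i\<in>UNIV. \<bar>M i\<bar>)" by (rule member_le_sum) auto
  finally show "\<bar>k i x\<bar> <= (\<Sum>i\<in>UNIV. \<bar>M i\<bar>)" .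
 qed
qed

text \<open>A closed \<delta>-neighbourhood N of A is compact and lies in U, so the derivatives are
  bounded on it. The mean value inequality is applied on the ball about p, which is convex and
  contained in N, since U itself need not be convex.\<close>

lemma lipschitz_near_compact:
 fixes f :: "'a::euclidean_space => real"
 assumes U: "open U" and f: "C_k 1 U f" and A: "compact A" "A \<subseteq> U"
 obtains \<delta> F L where "\<delta> > 0" "L >= 0" "\<And>p x. p \<in> A ==> norm (x - p) <= \<delta> ==> x \<in> U \<and> \<bar>f x\<bar> <= F \<and> \<bar>f x - f p\<bar> <= L * norm (x - p)"
proof -
 obtain \<delta> where \<delta>: "\<delta> > 0" "(\<Union>x\<in>A. cball x \<delta>) \<subseteq> U"
  by (rule compact_subset_open_imp_cball_epsilon_subset[OF A(1) U A(2)])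
 define N where "N = {x + y |x y. x \<in> A \<and> y \<in> cball 0 \<delta>}"
 have N: "compact N" unfolding N_def by (rule compact_sums[OF A(1) compact_cball])
 have NI: "x \<in> N" if "p \<in> A" "norm (x - p) <= \<delta>" for x p
  unfolding N_def using that by (intro CollectI exI[of _ p] exI[of _ "x - p"]) auto
 have NU: "N \<subseteq> U"
 proof
  fix x assume "x \<in> N"
  then obtain p y where "x = p + y" "p \<in> A" "norm y <= \<delta>" unfolding N_def by auto
  then have "x \<in> (\<Union>x\<in>A. cball x \<delta>)" by (intro UN_I[of p]) (auto simp: dist_norm)
  then show "x \<in> U" using \<delta>(2) by blast
 qed
 have df: "f differentiable (at x)" if "x \<in> U" for x using f that by simp
 have dc: "continuous_on U (%x. frechet_derivative f (at x) b)" if "b \<in> Basis" for b using f that by simp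
 have fc: "continuous_on U f"
  using df U by (auto simp: continuous_on_eq_continuous_at intro: differentiable_imp_continuous_within)
 define G where "G x = (\<Sum>b\<in>Basis. \<bar>frechet_derivative f (at x) b\<bar>)" for x
 have "continuous_on N G" unfolding G_def[abs_def] by (intro continuous_intros continuous_on_subset[OF dc NU])
 then obtain L where L: "\<And>x. x \<in> N ==> \<bar>G x\<bar> <= L"
  using uniform_bound_compact[of "%_::unit. N" "%_. G", OF N] by metis
 obtain F where F: "\<And>x. x \<in> N ==> \<bar>f x\<bar> <= F"
  using uniform_bound_compact[of "%_::unit. N" "%_. f", OF N continuous_on_subset[OF fc NU]] by metis
 show ?thesis
 proof (rule that[of \<delta> "max 0 L" F])
  fix p x assume p: "p \<in> A" and x: "norm (x - p) <= \<delta>"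
  have cN: "cball p \<delta> \<subseteq> N" using NI[OF p] by (auto simp: dist_norm norm_minus_commute)
  have "norm (f x - f p) <= max 0 L * norm (x - p)"
  proof (rule differentiable_bound[OF convex_cball[of p \<delta>]])
   fix y assume y: "y \<in> cball p \<delta>"
   then have yN: "y \<in> N" "y \<in> U" using cN NU by auto
   let ?f' = "frechet_derivative f (at y)"
   have d: "(f has_derivative ?f') (at y)" using df[OF yN(2)] by (simp add: frechet_derivative_works)
   then show "(f has_derivative ?f') (at y within cball p \<delta>)" by (rule has_derivative_at_withinI)
   show "onorm ?f' <= max 0 L"
   proof (rule onorm_le)
    fix v
    interpret bounded_linear ?f' by (rule has_derivative_bounded_linear[OF d])
    have "?f' v = ?f' (\<Sum>b\<in>Basis. (v \<bullet> b) *\<^sub>R b)" by (simp add: euclidean_representation)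
    also have "... = (\<Sum>b\<in>Basis. (v \<bullet> b) * ?f' b)" by (simp add: sum scaleR)
    also have "norm ... <= (\<Sum>b\<in>Basis. norm v * \<bar>?f' b\<bar>)"
     by (rule sum_norm_le) (auto simp: abs_mult intro!: mult_right_mono Basis_le_norm)
    also have "... = norm v * G y" by (simp add: G_def sum_distrib_left)
    also have "... <= norm v * max 0 L" using L[OF yN(1)] by (intro mult_left_mono) auto
    finally show "norm (?f' v) <= max 0 L * norm v" by (simp add: mult.commute)
   qed
  qed (use \<delta>(1) x in \<open>auto simp: dist_norm norm_minus_commute\<close>)
  then show "x \<in> U \<and> \<bar>f x\<bar> <= F \<and> \<bar>f x - f p\<bar> <= max 0 L * norm (x - p)"
   using NI[OF p x] NU F by auto
 qed (use \<delta>(1) in auto)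
qed

context junction_limit
begin

text \<open>Besides feeding the data of \<open>core_data\<close> into the edge analysis, this
  identifies the mean of the Borel representative with \<open>section_mean\<close> of u, which is
  possible on almost every section.\<close>

lemma estimate:
 assumes e: "0 < ep" "ep <= e0" and u: "weak_solution l h \<Xi> f \<phi> ep u" and a4: "ep * R <= 1 / 4"
 obtains q q' where "\<And>i t. (q i has_real_derivative q' i t) (at t)" "\<And>i. continuous_on UNIV (q' i)"
  "\<And>i t. t \<in> {0..1} ==> \<bar>q i t\<bar> <= (K\<kappa> + F1) * ep" "\<And>i t. t \<in> {0..1} ==> \<bar>q' i t\<bar> <= (K\<kappa> + F1) * ep"
  "\<And>i. AE t in lborel. t \<in> {ep * R<..<1} --> section_mean h ep i u t = \<omega> i t + q i t"
proof (rule core_data[OF e u])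
 fix U H w g
 assume UH:
  "U \<in> borel_measurable borel" "H \<in> borel_measurable borel"
  "AE x in lborel. x \<in> Om ep --> u x = U x"
  "integrable lborel (%x. indicator (Om ep) x * (U x)\<^sup>2)" "integrable lborel (%x. indicator (Om ep) x * (norm (H x))\<^sup>2)"
  "\<And>n. C1 (w n) (g n)"
  "(%n. LBINT x. indicator (Om ep) x * (w n x - U x)\<^sup>2) \<longlonglongrightarrow> 0"
  "(%n. LBINT x. indicator (Om ep) x * (norm (g n x - H x))\<^sup>2) \<longlonglongrightarrow> 0"
  "\<And>i. (%n. LBINT y. indicator (ball 0 (ep * h i)) y * (w n (point i 1 y))\<^sup>2) \<longlonglongrightarrow> 0"
  "\<And>v k. C1 v k ==> (\<And>i y. norm y < ep * h i ==> v (point i 1 y) = 0) ==>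
    (LBINT x. indicator (Om ep) x * (H x \<bullet> k x)) = load ep v"
  "(%n. load ep (w n)) \<longlonglongrightarrow> (LBINT x. indicator (Om ep) x * (norm (H x))\<^sup>2)"
 interpret S: junction_solution l R e0 h \<Xi> f \<phi> F0 F1 M0 \<omega> D w0 D0 B0 CP ep U H w g
  by unfold_locales (use e UH in \<open>simp_all only: intg_def Int_on_def\<close>)
 have aR: "S.a = ep * R" by (simp add: S.a_def)
 show ?thesis
 proof (rule that[of S.q "%i t. S.\<kappa> i + S.T i t"])
  fix i
  show "(S.q i has_real_derivative S.\<kappa> i + S.T i t) (at t)" for t by (rule S.q_deriv)
  show "continuous_on UNIV (%t. S.\<kappa> i + S.T i t)" by (intro continuous_intros S.T_cont)
  show "\<bar>S.q i t\<bar> <= (K\<kappa> + F1) * ep" "\<bar>S.\<kappa> i + S.T i t\<bar> <= (K\<kappa> + F1) * ep" if "t \<in> {0..1}" for t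
   using S.q_bounds[OF _ that] a4 by (auto simp: aR)
  show "AE t in lborel. t \<in> {ep * R<..<1} --> section_mean h ep i u t = \<omega> i t + S.q i t"
   using S.AE_sm[of i] AE_point[OF UH(3), of i]
  proof eventually_elim
   case (elim t)
   show ?case
   proof
    assume t: "t \<in> {ep * R<..<1}"
    have cyl: "point i t y \<in> Om ep" if "y \<in> ball 0 (ep * h i)" for y
     using that t S.a_Ii by (intro subsetD[OF cyl_subset[of ep i]]) (auto simp: cylinder_def aR)
    have "(\<integral>y. u (point i t y) \<partial>lebesgue_on (ball 0 (ep * h i))) = Int_on (ball 0 (ep * h i)) (%y. U (point i t y))"
     unfolding Int_on_def
    proof (rule integral_lebesgue_on_open(1))
     show "AE y in lborel. y \<in> ball 0 (ep * h i) --> u (point i t y) = U (point i t y)"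
      using elim(2) by eventually_elim (use cyl in blast)
    qed (simp_all add: point_borel_section[OF UH(1)])
    then have "section_mean h ep i u t = S.sm i U t"
     by (simp add: section_mean_def S.sm_def S.m_def power_mult_distrib mult.assoc)
    then show "section_mean h ep i u t = \<omega> i t + S.q i t" using elim(1) t by (simp add: aR)
   qed
  qed
 qed
qed

end

theorem corollary4p2:
  fixes l \<alpha> :: real and h :: "3 \<Rightarrow> real" and \<Xi> U :: "(real^3) set"
    and f :: "real^3 \<Rightarrow> real" and \<phi> :: "3 \<Rightarrow> real \<Rightarrow> real \<times> real \<Rightarrow> real"
    and V :: "3 \<Rightarrow> (real \<times> real \<times> real) set"
    and u :: "real \<Rightarrow> real^3 \<Rightarrow> real" and \<omega> :: "3 \<Rightarrow> real \<Rightarrow> real"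
  assumes l: "0 < l" "l < 1 / 3"
    and h: "\<And>i. h i > 0"
    and \<alpha>: "2 / 3 < \<alpha>" "\<alpha> < 1"
    and \<Xi>: "open \<Xi>" "connected \<Xi>" "bounded \<Xi>"
      "\<And>i. {\<xi>. \<xi> $ i = l \<and> norm (rest i \<xi>) < h i} \<subseteq> frontier \<Xi>"
    and disjoint: "\<forall>\<^sub>F \<epsilon> in at_right 0.
      (\<forall>i. node \<Xi> \<epsilon> \<inter> cylinder l h \<epsilon> i = {}) \<and>
      (\<forall>i j. i \<noteq> j \<longrightarrow> cylinder l h \<epsilon> i \<inter> cylinder l h \<epsilon> j = {})"
    and Lipschitz: "\<forall>\<^sub>F \<epsilon> in at_right 0. lipschitz_boundary (thin_domain l h \<Xi> \<epsilon>)"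
    and f: "open U" "\<And>i t. t \<in> {0..1} \<Longrightarrow> point i t 0 \<in> U" "smooth_fun_on U f"
    and \<phi>: "\<And>i. open (V i)" "\<And>i. {0..1} \<times> sphere 0 (h i) \<subseteq> V i"
      "\<And>i. smooth_fun_on (V i) (\<lambda>(t, y). \<phi> i t y)"
    and u: "\<forall>\<^sub>F \<epsilon> in at_right 0. weak_solution l h \<Xi> f \<phi> \<epsilon> (u \<epsilon>)"
    and \<omega>: "limit_solution h f \<phi> \<omega>"
  shows "\<exists>C2 > 0. \<exists>C3 > 0. \<forall>\<^sub>F \<epsilon> in at_right 0. \<forall>i.
    (let I = {3 * l * \<epsilon> powr \<alpha> <..< 1}; E = section_mean h \<epsilon> i (u \<epsilon>) in
      in_H1 I (\<lambda>t. E t - \<omega> i t) \<and>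
      H1_norm I (\<lambda>t. E t - \<omega> i t) \<le> C2 * \<epsilon> \<and>
      (\<exists>e. continuous_on (closure I) e \<and> (AE t in lebesgue_on I. e t = E t) \<and>
           (\<forall>t \<in> closure I. \<bar>e t - \<omega> i t\<bar> \<le> C3 * \<epsilon>)))"
proof -
 from \<omega> obtain D D2 where lim:
  "(\<forall>i. continuous_on {0..1} (D i) \<and>
    (\<forall>t\<in>{0..1}. (\<omega> i has_real_derivative D i t) (at t within {0..1})) \<and>
    (\<forall>t\<in>{0<..<1}. (D i has_real_derivative D2 i t) (at t) \<and>
     - pi * (h i)\<^sup>2 * D2 i t = pi * (h i)\<^sup>2 * f (point i t 0) - (\<integral>y. \<phi> i t y \<partial>circle_measure (h i))) \<and>
    \<omega> i 1 = 0) \<and>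
   \<omega> 1 0 = \<omega> 2 0 \<and> \<omega> 2 0 = \<omega> 3 0 \<and> (\<Sum>i\<in>UNIV. pi * (h i)\<^sup>2 * D i 0) = 0"
  unfolding limit_solution_def by (elim exE) (rule that)
 note lim1 = spec[OF conjunct1[OF lim]]
 note D_cont = conjunct1[OF lim1]
  and \<omega>_deriv = bspec[OF conjunct1[OF conjunct2[OF lim1]]]
  and D2 = bspec[OF conjunct1[OF conjunct2[OF conjunct2[OF lim1]]], THEN conjunct1]
   bspec[OF conjunct1[OF conjunct2[OF conjunct2[OF lim1]]], THEN conjunct2]
  and \<omega>1 = conjunct2[OF conjunct2[OF conjunct2[OF lim1]]]
 have \<omega>0: "\<omega> 1 0 = \<omega> 2 0" "\<omega> 2 0 = \<omega> 3 0" and kir: "(\<Sum>i\<in>UNIV. pi * (h i)\<^sup>2 * D i 0) = 0"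
  using conjunct2[OF lim] by simp_all
 obtain R0 where R0: "R0 > 0" "\<And>\<xi>. \<xi> \<in> \<Xi> ==> norm \<xi> <= R0" using \<Xi>(3) by (auto simp: bounded_pos)
 \<comment> \<open>One radius for everything: it dominates the node, l and all
   \<open>h i\<close>.\<close>
 define R where "R = R0 + l + (\<Sum>i\<in>UNIV. h i)"
 have hs: "h i <= (\<Sum>i\<in>UNIV. h i)" for i using h by (intro member_le_sum) (auto intro: less_imp_le)
 then have hR: "h i <= R" for i using R0 l by (simp add: R_def add_increasing)
 have S0: "0 <= (\<Sum>i\<in>UNIV. h i)" using h by (intro sum_nonneg) (auto intro: less_imp_le)
 have R: "l <= R" "R0 <= R" "R > 0" using R0 l S0 by (auto simp: R_def)
 \<comment> \<open>The three axis segments, near which f is known to be smooth.\<close>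
 define A where "A = (\<Union>i. (%t. point i t 0) ` {0..1 :: real})"
 have A: "compact A" unfolding A_def by (intro compact_UN compact_continuous_image continuous_intros) auto
 have AI: "point i t 0 \<in> A" if "t \<in> {0..1}" for i t unfolding A_def by (rule UN_I[OF UNIV_I[of i] imageI[OF that]])
 have AU: "A \<subseteq> U" using f(2) by (auto simp: A_def)
 have Ck: "C_k 1 U f" using f(3) by (simp add: smooth_fun_on_def)
 obtain \<delta> F0 L where \<delta>: "\<delta> > 0" "L >= 0"
  and fN: "\<And>p x. p \<in> A ==> norm (x - p) <= \<delta> ==> x \<in> U \<and> \<bar>f x\<bar> <= F0 \<and> \<bar>f x - f p\<bar> <= L * norm (x - p)"
  by (rule lipschitz_near_compact[OF f(1) Ck A AU]) blast
 have fU: "continuous_on U f" using f(3) by (auto simp: smooth_fun_on_def dest: spec[of _ 0])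
 have \<phi>c: "continuous_on ({0..1} \<times> sphere 0 (h i)) (%(t, y). \<phi> i t y)" for i
 proof (rule continuous_on_subset[OF _ \<phi>(2)])
  show "continuous_on (V i) (%(t, y). \<phi> i t y)" using \<phi>(3)[of i] unfolding smooth_fun_on_def by (metis C_k.simps(1))
 qed
 have \<phi>k: "compact ({0..1 :: real} \<times> sphere (0 :: real \<times> real) (h i))" for i by (intro compact_Times compact_Icc compact_sphere)
 have "\<exists>M0. \<forall>i p. p \<in> {0..1} \<times> sphere 0 (h i) --> \<bar>case p of (t, y) => \<phi> i t y\<bar> <= M0"
 proof (rule uniform_bound_compact[where S = "%i. {0..1} \<times> sphere 0 (h i)" and k = "%i p. case p of (t, y) => \<phi> i t y", OF \<phi>k \<phi>c])
  fix M assume M: "\<And>i p. p \<in> {0..1} \<times> sphere 0 (h i) ==> \<bar>case p of (t, y) => \<phi> i t y\<bar> <= M"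
  show ?thesis by (intro exI[of _ M] allI impI M)
 qed
 then obtain M0 where M0: "\<forall>i p. p \<in> {0..1} \<times> sphere 0 (h i) --> \<bar>case p of (t, y) => \<phi> i t y\<bar> <= M0" ..
 from eventually_conj[OF disjoint Lipschitz] obtain e1 where e1': "e1 > 0 \<and> (\<forall>ep>0. ep < e1 -->
   ((\<forall>i. node \<Xi> ep \<inter> cylinder l h ep i = {}) \<and> (\<forall>i j. i \<noteq> j --> cylinder l h ep i \<inter> cylinder l h ep j = {})) \<and>
   lipschitz_boundary (thin_domain l h \<Xi> ep))"
  unfolding eventually_at_right_field by (rule exE)
 note e1 = conjunct1[OF e1'] mp[OF mp[OF spec[OF conjunct2[OF e1']]]]
 \<comment> \<open>Three demands: strictly below \<open>e1\<close>, so that the geometric conditions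
   hold; e0 (2 R + 1) <= 1/4, which also gives a <= 1/4; e0 R <= \<delta>, so that the domain stays
   where f is controlled.\<close>
 define e0 where "e0 = min (e1 / 2) (min (1 / (4 * (2 * R + 1))) (\<delta> / R))"
 have e0: "e0 > 0" "e0 < e1" "e0 * (2 * R + 1) <= 1 / 4" "e0 * R <= \<delta>"
 proof -
  show "e0 > 0" "e0 < e1" using e1 R \<delta> by (auto simp: e0_def)
  have "e0 <= 1 / (4 * (2 * R + 1))" "e0 <= \<delta> / R" by (auto simp: e0_def)
  then show "e0 * (2 * R + 1) <= 1 / 4" "e0 * R <= \<delta>" using R by (simp_all add: pos_le_divide_eq field_simps)
 qed
 interpret J: junction l R e0 h \<Xi>
 proof
  show "0 < l" "\<And>i. 0 < h i" "\<And>i. h i <= R" "l <= R" "open \<Xi>" "connected \<Xi>" using l h hR R \<Xi> by auto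
  show "norm \<xi> <= R" if "\<xi> \<in> \<Xi>" for \<xi> using R0(2)[OF that] R by linarith
  show "{\<xi>. \<xi> $ i = l \<and> norm (rest i \<xi>) < h i} \<subseteq> frontier \<Xi>" for i by (rule \<Xi>(4))
  show "0 < e0" "e0 * (2 * R + 1) <= 1" using e0 by auto
  show "lipschitz_boundary (thin_domain l h \<Xi> e0)" by (rule conjunct2[OF e1(2)[OF e0(1,2)]])
  fix ep :: real and i j :: 3 assume e: "0 < ep" "ep <= e0"
  then have "ep < e1" using e0 by linarith
  note E = e1(2)[OF e(1) this]
  show "node \<Xi> ep \<inter> cylinder l h ep i = {}" by (rule spec[OF conjunct1[OF conjunct1[OF E]]])
  show "cylinder l h ep i \<inter> cylinder l h ep j = {}" if "i \<noteq> j"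
   by (rule mp[OF spec[OF spec[OF conjunct2[OF conjunct1[OF E]]]] that])
 qed
 have eR: "ep * R <= \<delta>" if "0 < ep" "ep <= e0" for ep
  using mult_right_mono[OF that(2), of R] R e0 by linarith
 have Om: "x \<in> U \<and> \<bar>f x\<bar> <= F0" if e: "0 < ep" "ep <= e0" and x: "x \<in> J.Om ep" for ep x
 proof -
  obtain i t where t: "t \<in> {0..1}" "norm (x - point i t 0) <= ep * R" by (rule J.Om_near_axis[OF e x])
  have "norm (x - point i t 0) <= \<delta>" using t(2) eR[OF e] by linarith
  from fN[OF AI[OF t(1)] this] show ?thesis by blast
 qed
 interpret JD: junction_data l R e0 h \<Xi> f \<phi> F0 "L * R" M0
 proof
  fix ep :: real assume e: "0 < ep" "ep <= e0"
  show "continuous_on (J.Om ep) f" by (rule continuous_on_subset[OF fU]) (use Om[OF e] in blast)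
  show "\<bar>f x\<bar> <= F0" if "x \<in> J.Om ep" for x using Om[OF e that] by blast
  fix x i assume x: "x \<in> J.cyl ep i"
  have "ep * l < x $ i" "x $ i < 1" using x by (auto simp: cylinder_def)
  with mult_pos_pos[OF e(1) l(1)] have t: "x $ i \<in> {0..1}" unfolding atLeastAtMost_iff by linarith
  have "x - point i (x $ i) 0 = point i 0 (rest i x)"
   using point_diff[of i "x $ i" "rest i x" "x $ i" 0] by simp
  moreover have "norm (point i 0 (rest i x)) = norm (rest i x)"
   using norm_point[of i 0 "rest i x"] by (simp add: power2_eq_iff_nonneg)
  ultimately have n: "norm (x - point i (x $ i) 0) <= ep * h i" using x by (simp add: cylinder_def)
  also have "... <= R * ep" using mult_left_mono[OF hR[of i], of ep] e by (simp add: mult.commute)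
  finally have n: "norm (x - point i (x $ i) 0) <= R * ep" .
  then have "norm (x - point i (x $ i) 0) <= \<delta>" using eR[OF e] by (simp add: mult.commute)
  from fN[OF AI[OF t] this] have "\<bar>f x - f (point i (x $ i) 0)\<bar> <= L * norm (x - point i (x $ i) 0)" by blast
  also have "... <= L * (R * ep)" by (rule mult_left_mono[OF n \<delta>(2)])
  finally show "\<bar>f x - f (point i (x $ i) 0)\<bar> <= L * R * ep" by (simp add: mult.assoc)
 next
  fix i
  show "continuous_on {0..1} (%t. f (point i t 0))"
   by (rule continuous_on_compose2[OF fU]) (use f(2) in \<open>auto intro!: continuous_intros\<close>)
  show "\<bar>f (point i t 0)\<bar> <= F0" if "t \<in> {0..1}" for t using fN[OF AI[OF that, of i], of "point i t 0"] \<delta> by simp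
  show "continuous_on ({0..1} \<times> sphere 0 (h i)) (%(t, y). \<phi> i t y)" by (rule \<phi>c)
  show "\<bar>\<phi> i t y\<bar> <= M0" if "t \<in> {0..1}" "y \<in> sphere 0 (h i)" for t y using M0[rule_format, of "(t, y)" i] that by simp
 qed
 have rhs: "D2 i t = JD.rhs i t" if t: "t \<in> {0<..<1}" for i t
 proof -
  have "continuous_on (sphere 0 (h i)) (%y. case (t, y) of (t, y) => \<phi> i t y)"
   by (rule continuous_on_compose2[OF \<phi>c[of i] continuous_on_Pair[OF continuous_on_const continuous_on_id]]) (use t in auto)
  then have "\<phi> i t \<in> borel_measurable (restrict_space borel (sphere 0 (h i)))"
   by (intro borel_measurable_continuous_on_restrict) simp
  from integral_circle[OF h[of i] this] have "(\<integral>y. \<phi> i t y \<partial>circle_measure (h i)) = JD.phibar i t"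
   by (simp add: JD.phibar_def Int_on_def)
  then have "- pi * (h i)\<^sup>2 * D2 i t = pi * (h i)\<^sup>2 * f (point i t 0) - JD.phibar i t" using D2(2)[OF t, of i] by simp
  then show ?thesis using h[of i] by (simp add: JD.rhs_def field_simps)
 qed
 obtain D0 where D0: "\<And>i t. t \<in> {0..1} ==> \<bar>D i t\<bar> <= D0"
  using uniform_bound_compact[of "%_. {0..1}" D, OF compact_Icc D_cont] by metis
 obtain B0 where B0: "\<And>i t. t \<in> {0..1} ==> \<bar>JD.rhs i t\<bar> <= B0"
  using uniform_bound_compact[of "%_. {0..1}" JD.rhs, OF compact_Icc JD.rhs_cont] by metis
 have "\<exists>CP. CP > 0 \<and> (\<forall>W g ep. C1 W g --> 0 < ep --> ep <= e0 --> (\<exists>c.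
   (NN x. indicator (J.core ep) x * ennreal \<bar>W x - c\<bar>) <= ennreal (CP * ep) * gradL1 g (J.core ep)))"
 proof (rule J.poincare_core)
  fix C assume C: "C > 0" "\<And>W g ep. C1 W g ==> 0 < ep ==> ep <= e0 ==> \<exists>c.
   (NN x. indicator (J.core ep) x * ennreal \<bar>W x - c\<bar>) <= ennreal (C * ep) * gradL1 g (J.core ep)"
  show ?thesis by (intro exI[of _ C] conjI allI impI C)
 qed
 then obtain CP where CP': "CP > 0 \<and> (\<forall>W g ep. C1 W g --> 0 < ep --> ep <= e0 --> (\<exists>c.
   (NN x. indicator (J.core ep) x * ennreal \<bar>W x - c\<bar>) <= ennreal (CP * ep) * gradL1 g (J.core ep)))" ..
 note CP = conjunct1[OF CP'] conjunct2[OF CP', rule_format]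
 interpret JL: junction_limit l R e0 h \<Xi> f \<phi> F0 "L * R" M0 \<omega> D "\<omega> 1 0" D0 B0 CP
 proof
  show "(D i has_real_derivative JD.rhs i t) (at t)" if "t \<in> {0<..<1}" for i t using D2(1)[OF that] rhs[OF that] by simp
  show "\<omega> i 0 = \<omega> 1 0" for i using exhaust_3[of i] \<omega>0 by auto
  have "pi * (\<Sum>i\<in>UNIV. (h i)\<^sup>2 * D i 0) = 0" using kir by (simp add: sum_distrib_left mult.assoc)
  then show "(\<Sum>i\<in>UNIV. (h i)\<^sup>2 * D i 0) = 0" by simp
 qed (fact D_cont \<omega>_deriv \<omega>1 D0 B0 CP)+
 \<comment> \<open>The absolute value and the summand 1 make K positive.\<close>
 define K where "K = \<bar>JL.K\<kappa> + L * R\<bar> + 1"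
 have K: "K > 0" by (simp add: K_def)
 \<comment> \<open>Here \<alpha> < 1 enters: eps R <= 3 l eps^\<alpha> holds once eps^(1 - \<alpha>)
   <= 3 l / R, so the interval lies in the region (a, 1) where the section mean is
   identified.\<close>
 have ev: "\<forall>\<^sub>F ep in at_right 0. ep * R <= 3 * l * ep powr \<alpha> \<and> 0 < ep \<and> ep <= e0 \<and> weak_solution l h \<Xi> f \<phi> ep (u ep)"
 proof (intro eventually_conj u)
  show pos: "\<forall>\<^sub>F ep in at_right 0. (0::real) < ep" by (simp add: eventually_at_right_less)
  show "\<forall>\<^sub>F ep in at_right 0. ep <= e0" using e0(1) unfolding eventually_at_right_field by (intro exI[of _ e0]) auto
  have "((%ep::real. ep powr (1 - \<alpha>)) \<longlongrightarrow> 0) (at_right 0)" using \<alpha> by real_asymp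
  then have "\<forall>\<^sub>F ep in at_right 0. ep powr (1 - \<alpha>) < 3 * l / R" by (rule order_tendstoD(2)) (use l R in simp)
  then show "\<forall>\<^sub>F ep in at_right 0. ep * R <= 3 * l * ep powr \<alpha>"
   using pos
  proof eventually_elim
   case (elim ep)
   have "ep powr (1 - \<alpha>) * ep powr \<alpha> <= 3 * l / R * ep powr \<alpha>" using elim by (intro mult_right_mono) auto
   moreover have "ep powr (1 - \<alpha>) * ep powr \<alpha> = ep" using elim by (simp add: powr_add[symmetric])
   ultimately show ?case using R by (simp add: pos_le_divide_eq)
  qed
 qed
 have main: "\<forall>\<^sub>F ep in at_right 0. \<forall>i.
  (let I = {3 * l * ep powr \<alpha> <..< 1}; E = section_mean h ep i (u ep) in
   in_H1 I (%t. E t - \<omega> i t) \<and>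
   H1_norm I (%t. E t - \<omega> i t) <= (2 * K) * ep \<and>
   (\<exists>e. continuous_on (closure I) e \<and> (AE t in lebesgue_on I. e t = E t) \<and>
      (\<forall>t \<in> closure I. \<bar>e t - \<omega> i t\<bar> <= K * ep)))"
  using ev
 proof eventually_elim
  case (elim ep)
  then have e: "0 < ep" "ep <= e0" and w: "weak_solution l h \<Xi> f \<phi> ep (u ep)" and c: "ep * R <= 3 * l * ep powr \<alpha>" by auto
  have a4: "ep * R <= 1 / 4"
  proof -
   have "ep * R <= e0 * R" using e R by (intro mult_right_mono) auto
   also have "... <= e0 * (2 * R + 1)" using e0 R by (intro mult_left_mono) auto
   finally show ?thesis using e0 by linarith
  qed
  show ?case
  proof (rule JL.estimate[OF e w a4])
  fix q q' :: "3 => real => real"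
  assume q: "\<And>i t. (q i has_real_derivative q' i t) (at t)" "\<And>i. continuous_on UNIV (q' i)"
   and qb: "\<And>i t. t \<in> {0..1} ==> \<bar>q i t\<bar> <= (JL.K\<kappa> + L * R) * ep" "\<And>i t. t \<in> {0..1} ==> \<bar>q' i t\<bar> <= (JL.K\<kappa> + L * R) * ep"
   and qE: "\<And>i. AE t in lborel. t \<in> {ep * R<..<1} --> section_mean h ep i (u ep) t = \<omega> i t + q i t"
  have Ke: "(JL.K\<kappa> + L * R) * ep <= K * ep" using e by (intro mult_right_mono) (auto simp: K_def)
  define I where "I = {3 * l * ep powr \<alpha> <..< 1}"
  have p: "0 <= 3 * l * ep powr \<alpha>" using l by simp
  have I: "open I" "bounded I" "I \<subseteq> {0..1}" "measure lborel I <= 1" "I \<subseteq> {ep * R<..<1}"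
  proof -
   show "measure lborel I <= 1" using p by (cases "3 * l * ep powr \<alpha> <= 1") (auto simp: I_def)
   show "I \<subseteq> {0..1}" using p by (auto simp: I_def)
  qed (use c in \<open>auto simp: I_def bounded_Ioo_real\<close>)
  have cI: "closure I \<subseteq> {0..1}" by (rule closure_minimal[OF I(3)]) simp
  show ?case
   unfolding Let_def I_def[symmetric]
  proof (intro allI conjI)
   fix i
   let ?E = "section_mean h ep i (u ep)"
   have eq: "AE t in lborel. t \<in> I --> ?E t - \<omega> i t = q i t"
    using qE[of i] by eventually_elim (use I(5) in auto)
   have b: "\<bar>q i t\<bar> <= K * ep" "\<bar>q' i t\<bar> <= K * ep" if "t \<in> {0..1}" for t
    using qb[OF that, of i] Ke by linarith+
   have bI: "\<bar>q i t\<bar> <= K * ep" "\<bar>q' i t\<bar> <= K * ep" if "t \<in> I" for t using b I(3) that by blast+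
   have K0: "0 <= K * ep" using K e by simp
   note H = H1_of_AE_eq[OF I(1,2,4) q(1)[of i] q(2)[of i] eq bI K0]
   show "in_H1 I (%t. ?E t - \<omega> i t)" by (rule H(1))
   show "H1_norm I (%t. ?E t - \<omega> i t) <= (2 * K) * ep" using H(2) by simp
   \<comment> \<open>The continuous representative is \<omega> + q; the bound reaches the closed
     interval because q is bounded on all of [0, 1].\<close>
   show "\<exists>e. continuous_on (closure I) e \<and> (AE t in lebesgue_on I. e t = ?E t) \<and> (\<forall>t\<in>closure I. \<bar>e t - \<omega> i t\<bar> <= K * ep)"
   proof (intro exI conjI ballI)
    have "continuous_on {0..1} (%t. \<omega> i t + q i t)"
     by (intro continuous_intros JL.\<omega>_cont DERIV_continuous_on[OF DERIV_subset[OF q(1)]]) auto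
    then show "continuous_on (closure I) (%t. \<omega> i t + q i t)" by (rule continuous_on_subset[OF _ cI])
    have "AE t in lborel. t \<in> I --> \<omega> i t + q i t = ?E t" using eq by eventually_elim auto
    then show "AE t in lebesgue_on I. \<omega> i t + q i t = ?E t" by (simp add: AE_lebesgue_on_iff[OF I(1)])
    show "\<bar>\<omega> i t + q i t - \<omega> i t\<bar> <= K * ep" if "t \<in> closure I" for t using b(1)[of t] cI that by auto
   qed
  qed
  qed
 qed
 show ?thesis
  using K main by (intro exI[of _ "2 * K"] exI[of _ K] conjI) simp_all
qed

end
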